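(* Let $(X^{(d)})_{d\in\mathbb{N}}$ be random vectors, $X^{(d)}$ taking values in $\mathbb{R}^d\subset\ell^2$, and for each $d$ let $(X^{(d)}_i)_{i\in\mathbb{N}}$ be independent copies of $X^{(d)}$. Put $S^{(d)}_0=0$, $S^{(d)}_k=X^{(d)}_1+\cdots+X^{(d)}_k$, and $\Theta^{(d)}_i=X_i^{(d)}/\|X_i^{(d)}\|_2$. Let $n=n(d)$ be positive integers with $n(d)\to\infty$ as $d\to\infty$. Assume that there exist positive constants $(a(k))_{k\in\mathbb{N}}$ and a measure $\nu$ on $(0,\infty]$ with $\int_{(0,\infty)}\min(1,x)\,\nu(\mathrm{d}x)<\infty$ and $\nu(\{\infty\})=0$ such that the following hold. (a) As $d\to\infty$, $n\,\mathbb{P}\{(a(n))^{-1}\|X^{(d)}\|_2^2\in\cdot\}\to\nu(\cdot)$ vaguely on $(0,\infty]$, and $$\lim_{s\to0+}\limsup_{d\to\infty}\frac{n}{a(n)}\mathbb{E}\left(\|X^{(d)}\|_2^2\,\mathbf 1_{\{\|X^{(d)}\|_2^2\le s a(n)\}}\right)=0.$$ (b) For all fixed $s>0$ and $\varepsilon>0$, $$\lim_{d\to\infty}\mathbb{P}\left\{\left|\langle\Theta^{(d)}_1,\Theta^{(d)}_2\rangle_2\right|>\varepsilon\;\Big|\;\|X_1^{(d)}\|_2^2\ge s a(n),\ \|X_2^{(d)}\|_2^2\ge s a(n)\right\}=0.$$ (c) $$\lim_{s\to0+}\limsup_{d\to\infty}\frac{n}{\sqrt{a(n)}}\left\|\mathbb{E}\left(X^{(d)}\mathbf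 1_{\{\|X^{(d)}\|_2^2\le s a(n)\}}\right)\right\|_2=0.$$ Fix $T>0$ and let $\mathcal{M}^{(d)}_{\lfloor nT\rfloor}=\{S^{(d)}_k/\sqrt{a(n)}:\ k=0,1,\ldots,\lfloor nT\rfloor\}$. Then, as $d\to\infty$, $$[\mathcal{M}^{(d)}_{\lfloor nT\rfloor}]\Longrightarrow[\mathcal{R}_\nu(T)]$$ in distribution as random elements of the metric space $(\mathbb{H},d_\sim)$ (i.e. the laws converge weakly as probability measures on $(\mathbb{H},d_\sim)$), where $\mathcal{R}_\nu(T)$ is the range on $[0,T]$ of a crinkled subordinator with Lévy measure $\nu$.
   Context: $\ell^2$ is the real Hilbert space of square-summable sequences with norm $\|\cdot\|_2$, inner product $\langle\cdot,\cdot\rangle_2$, and standard orthonormal basis $(e_k)_{k\in\mathbb{N}}$; $\mathbb{R}^d$ is identified with the linear span of $e_1,\ldots,e_d$. Vague convergence on $(0,\infty]$ means convergence of integrals of continuous functions with compact support in $(0,\infty]$ (compact sets being contained in some $[\delta,\infty]$, $\delta>0$). A conditional probability given an event of probability zero is taken to be $0$. Crinkled subordinator: let $\mathcal{P}=\sum_k\delta_{(x_k,y_k)}$ be a Poisson random measure on $[0,\infty)\times(0,\infty]$ with intensity measure Lebesgue $\times\,\nu$, with atoms enumerated (measurably) by indices $k\in\mathbb{N}$. The crinkled subordinator with Lévy measure $\nu$ is the $\ell^2$-valued process $\mathcal{C}_\nu(t)=\sum_{k:\,x_k\le t}e_k\sqrt{y_k}$, $t\ge0$. Its range on $[0,T]$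 is $\mathcal{R}_\nu(T)$, the closure in $\ell^2$ of $\{\mathcal{C}_\nu(t):0\le t\le T\}$; it is a.s. compact. The measure $\nu$ may be finite. Hausdorff distance up to isometry: let $\mathcal{K}(\ell^2)$ be the collection of non-empty compact subsets of $\ell^2$. Call $K_1,K_2\in\mathcal{K}(\ell^2)$ equivalent, $K_1\sim K_2$, if there is a distance-preserving bijection $K_1\to K_2$; $[K]$ denotes the equivalence class of $K$ and $\mathbb{H}=\mathcal{K}(\ell^2)/\sim$. The metric $d_\sim$ on $\mathbb{H}$ is $d_\sim([K_1],[K_2])=\inf\{d_H(K_1',K_2'):K_1'\in[K_1],K_2'\in[K_2]\}$, where $d_H$ is the Hausdorff distance in $\ell^2$. *)

theory Defs
  imports "HOL-Probability.Probability"
begin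

section \<open>The Hilbert space of square-summable sequences\<close>

typedef ell2 = "{f :: nat \<Rightarrow> real. summable (\<lambda>k. (f k)\<^sup>2)}"
  morphisms coord Abs_ell2
  by (rule exI[of _ "\<lambda>_. 0"]) simp

setup_lifting type_definition_ell2

lemma summable_coord_sq: "summable (\<lambda>k. (coord u k)\<^sup>2)"
  using coord[of u] by simp

lemma summable_mult_of_sq:
  fixes f g :: "nat \<Rightarrow> real"
  assumes "summable (\<lambda>k. (f k)\<^sup>2)" "summable (\<lambda>k. (g k)\<^sup>2)"
  shows "summable (\<lambda>k. f k * g k)"
proof (rule summable_comparison_test')
  show "summable (\<lambda>k. (f k)\<^sup>2 + (g k)\<^sup>2)" using assms by (rule summable_add)
  fix k :: nat
  have "0 \<le> (\<bar>f k\<bar> - \<bar>g k\<bar>)\<^sup>2" by simp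
  then have "2 * (\<bar>f k\<bar> * \<bar>g k\<bar>) \<le> (f k)\<^sup>2 + (g k)\<^sup>2"
    by (simp add: power2_diff)
  moreover have "0 \<le> \<bar>f k\<bar> * \<bar>g k\<bar>" by simp
  ultimately have "\<bar>f k\<bar> * \<bar>g k\<bar> \<le> (f k)\<^sup>2 + (g k)\<^sup>2" by linarith
  then show "norm (f k * g k) \<le> (f k)\<^sup>2 + (g k)\<^sup>2" by (simp add: abs_mult)
qed

lemma summable_sq_add:
  fixes f g :: "nat \<Rightarrow> real"
  assumes "summable (\<lambda>k. (f k)\<^sup>2)" "summable (\<lambda>k. (g k)\<^sup>2)"
  shows "summable (\<lambda>k. (f k + g k)\<^sup>2)"
proof -
  have "summable (\<lambda>k. (f k)\<^sup>2 + (g k)\<^sup>2 + 2 * (f k * g k))"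
    using assms by (intro summable_add summable_mult summable_mult_of_sq)
  then show ?thesis by (simp add: power2_sum mult.assoc)
qed

instantiation ell2 :: real_vector
begin

lift_definition zero_ell2 :: ell2 is "\<lambda>_. 0" by simp
lift_definition uminus_ell2 :: "ell2 \<Rightarrow> ell2" is "\<lambda>f k. - f k" by simp
lift_definition plus_ell2 :: "ell2 \<Rightarrow> ell2 \<Rightarrow> ell2" is "\<lambda>f g k. f k + g k"
  by (rule summable_sq_add)
lift_definition minus_ell2 :: "ell2 \<Rightarrow> ell2 \<Rightarrow> ell2" is "\<lambda>f g k. f k - g k"
  using summable_sq_add[of _ "\<lambda>k. - g k" for g] by simp
lift_definition scaleR_ell2 :: "real \<Rightarrow> ell2 \<Rightarrow> ell2" is "\<lambda>r f k. r * f k"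
  by (simp add: power_mult_distrib summable_mult)

instance
  by standard (transfer, simp add: fun_eq_iff algebra_simps)+

end

instantiation ell2 :: real_inner
begin

definition inner_ell2 :: "ell2 \<Rightarrow> ell2 \<Rightarrow> real"
  where "inner_ell2 u v = (\<Sum>k. coord u k * coord v k)"

definition norm_ell2 :: "ell2 \<Rightarrow> real"
  where "norm_ell2 u = sqrt (inner u u)"

definition sgn_ell2 :: "ell2 \<Rightarrow> ell2"
  where "sgn_ell2 u = u /\<^sub>R norm u"

definition dist_ell2 :: "ell2 \<Rightarrow> ell2 \<Rightarrow> real"
  where "dist_ell2 u v = norm (u - v)"

definition uniformity_ell2 :: "(ell2 \<times> ell2) filter"
  where "uniformity_ell2 = (INF e\<in>{0 <..}. principal {(u, v). dist u v < e})"

definition open_ell2 :: "ell2 set \<Rightarrow> bool"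
  where "open_ell2 U = (\<forall>u\<in>U. \<forall>\<^sub>F (u', v) in uniformity. u' = u \<longrightarrow> v \<in> U)"

lemma summable_coord_mult: "summable (\<lambda>k. coord u k * coord v k)"
  by (rule summable_mult_of_sq[OF summable_coord_sq summable_coord_sq])

instance
proof
  fix u v w :: ell2 and r :: real
  show "inner u v = inner v u"
    by (simp add: inner_ell2_def mult.commute)
  show "inner (u + v) w = inner u w + inner v w"
    by (simp add: inner_ell2_def plus_ell2.rep_eq distrib_right suminf_add summable_coord_mult)
  show "inner (r *\<^sub>R u) v = r * inner u v"
    by (simp add: inner_ell2_def scaleR_ell2.rep_eq mult.assoc suminf_mult summable_coord_mult)
  show "0 \<le> inner u u"
    unfolding inner_ell2_def by (rule suminf_nonneg[OF summable_coord_mult]) simp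
  show "inner u u = 0 \<longleftrightarrow> u = 0"
    unfolding inner_ell2_def
    by (subst suminf_eq_zero_iff[OF summable_coord_mult])
      (auto simp: coord_inject[symmetric] zero_ell2.rep_eq fun_eq_iff)
qed (simp_all add: norm_ell2_def sgn_ell2_def dist_ell2_def uniformity_ell2_def open_ell2_def)

end

lemma norm_ell2_sq: "(norm u)\<^sup>2 = (\<Sum>k. (coord u k)\<^sup>2)"
  unfolding power2_norm_eq_inner inner_ell2_def by (simp add: power2_eq_square)

lemma sum_coord_sq_le: "(\<Sum>k<m. (coord u k)\<^sup>2) \<le> (norm u)\<^sup>2"
  unfolding norm_ell2_sq by (rule sum_le_suminf[OF summable_coord_sq]) auto

lemma abs_coord_le: "\<bar>coord u k\<bar> \<le> norm u"
proof -
  have "(coord u k)\<^sup>2 \<le> (\<Sum>j<Suc k. (coord u j)\<^sup>2)"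
    by (simp add: sum_nonneg)
  also have "\<dots> \<le> (norm u)\<^sup>2" by (rule sum_coord_sq_le)
  finally have "\<bar>coord u k\<bar>\<^sup>2 \<le> (norm u)\<^sup>2" by simp
  then show ?thesis by (rule power2_le_imp_le) simp
qed

lemma ell2_of_partial_sums:
  assumes "\<And>m. (\<Sum>k<m. (f k)\<^sup>2) \<le> r\<^sup>2" and "0 \<le> r"
  shows "summable (\<lambda>k. (f k)\<^sup>2)" and "norm (Abs_ell2 f) \<le> r"
proof -
  show s: "summable (\<lambda>k. (f k)\<^sup>2)"
    by (rule summableI_nonneg_bounded[where x = "r\<^sup>2"]) (use assms in auto)
  then have "coord (Abs_ell2 f) = f" by (simp add: Abs_ell2_inverse)
  then have "(norm (Abs_ell2 f))\<^sup>2 \<le> r\<^sup>2"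
    unfolding norm_ell2_sq using s assms by (auto intro: suminf_le_const)
  then show "norm (Abs_ell2 f) \<le> r" using \<open>0 \<le> r\<close> by (rule power2_le_imp_le)
qed

instance ell2 :: complete_space
proof
  fix X :: "nat \<Rightarrow> ell2"
  assume X: "Cauchy X"
  have "Cauchy (\<lambda>n. coord (X n) k)" for k
  proof (rule CauchyI)
    fix e :: real assume "0 < e"
    then obtain N where N: "\<forall>m\<ge>N. \<forall>n\<ge>N. norm (X m - X n) < e"
      using X by (auto dest: CauchyD)
    have "norm (coord (X m) k - coord (X n) k) \<le> norm (X m - X n)" for m n
      using abs_coord_le[of "X m - X n" k] by (simp add: minus_ell2.rep_eq)
    then show "\<exists>M. \<forall>m\<ge>M. \<forall>n\<ge>M. norm (coord (X m) k - coord (X n) k) < e"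
      using N by (meson le_less_trans)
  qed
  then have "\<forall>k. \<exists>l. (\<lambda>n. coord (X n) k) \<longlonglongrightarrow> l"
    by (metis Cauchy_convergent_iff convergent_def)
  then obtain l where l: "\<And>k. (\<lambda>n. coord (X n) k) \<longlonglongrightarrow> l k" by metis
  have tail: "\<exists>N. \<forall>n\<ge>N. \<forall>m. (\<Sum>k<m. (coord (X n) k - l k)\<^sup>2) \<le> e\<^sup>2" if "0 < e" for e
  proof -
    obtain N where N: "\<forall>m\<ge>N. \<forall>n\<ge>N. norm (X m - X n) < e"
      using CauchyD[OF X \<open>0 < e\<close>] by auto
    have "(\<Sum>k<m. (coord (X n) k - l k)\<^sup>2) \<le> e\<^sup>2" if n: "n \<ge> N" for n m
    proof (rule tendsto_upperbound)
      show "(\<lambda>j. \<Sum>k<m. (coord (X n) k - coord (X j) k)\<^sup>2)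
              \<longlonglongrightarrow> (\<Sum>k<m. (coord (X n) k - l k)\<^sup>2)"
        by (intro tendsto_intros l)
      show "\<forall>\<^sub>F j in sequentially. (\<Sum>k<m. (coord (X n) k - coord (X j) k)\<^sup>2) \<le> e\<^sup>2"
        using eventually_ge_at_top[of N]
      proof eventually_elim
        case (elim j)
        have "(\<Sum>k<m. (coord (X n) k - coord (X j) k)\<^sup>2) \<le> (norm (X n - X j))\<^sup>2"
          using sum_coord_sq_le[of "X n - X j" m] by (simp add: minus_ell2.rep_eq)
        also have "\<dots> \<le> e\<^sup>2" using N n elim by (intro power_mono) (auto intro: less_imp_le)
        finally show ?case .
      qed
    qed simp
    then show ?thesis by blast
  qed
  obtain N1 where N1: "\<And>m. (\<Sum>k<m. (coord (X N1) k - l k)\<^sup>2) \<le> 1\<^sup>2"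
    using tail[of 1] by auto
  have "summable (\<lambda>k. (coord (X N1) k - (coord (X N1) k - l k))\<^sup>2)"
    using summable_sq_add[OF summable_coord_sq, of "\<lambda>k. - (coord (X N1) k - l k)" "X N1"]
      ell2_of_partial_sums(1)[of "\<lambda>k. coord (X N1) k - l k" 1, OF N1]
    by (simp add: power2_commute)
  then have sl: "summable (\<lambda>k. (l k)\<^sup>2)" by simp
  have "X \<longlonglongrightarrow> Abs_ell2 l"
  proof (rule LIMSEQ_I)
    fix e :: real assume "0 < e"
    then obtain N where N: "\<forall>n\<ge>N. \<forall>m. (\<Sum>k<m. (coord (X n) k - l k)\<^sup>2) \<le> (e / 2)\<^sup>2"
      using tail[of "e / 2"] by auto
    have "norm (X n - Abs_ell2 l) < e" if "n \<ge> N" for n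
    proof -
      have "summable (\<lambda>k. (coord (X n) k - l k)\<^sup>2)"
        using ell2_of_partial_sums(1)[of "\<lambda>k. coord (X n) k - l k" "e / 2"] N that \<open>0 < e\<close> by auto
      then have "coord (X n - Abs_ell2 l) = coord (Abs_ell2 (\<lambda>k. coord (X n) k - l k))"
        using sl by (simp add: minus_ell2.rep_eq Abs_ell2_inverse)
      then have "X n - Abs_ell2 l = Abs_ell2 (\<lambda>k. coord (X n) k - l k)"
        by (simp only: coord_inject)
      then have "norm (X n - Abs_ell2 l) \<le> e / 2"
        using ell2_of_partial_sums(2)[of "\<lambda>k. coord (X n) k - l k" "e / 2"] N that \<open>0 < e\<close> by auto
      then show ?thesis using \<open>0 < e\<close> by simp
    qed
    then show "\<exists>no. \<forall>n\<ge>no. norm (X n - Abs_ell2 l) < e" by blast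
  qed
  then show "convergent X" by (auto simp: convergent_def)
qed

lift_definition ell2_basis :: "nat \<Rightarrow> ell2" is "\<lambda>k j. if j = k then 1 else 0"
  by (rule summable_finite[of "{k}" for k, OF finite.insertI[OF finite.emptyI]]) auto

lemma coord_sum: "coord (\<Sum>i\<in>I. F i) k = (\<Sum>i\<in>I. coord (F i) k)"
  by (induction I rule: infinite_finite_induct) (auto simp: zero_ell2.rep_eq plus_ell2.rep_eq)

lemma ell2_basis_sums: "(\<lambda>k. coord u k *\<^sub>R ell2_basis k) sums u"
  unfolding sums_def
proof (rule LIMSEQ_I)
  fix e :: real assume "0 < e"
  have coord_trunc: "coord (\<Sum>k<m. coord u k *\<^sub>R ell2_basis k) j = (if j < m then coord u j else 0)" for m j
  proof -
    have "coord (\<Sum>k<m. coord u k *\<^sub>R ell2_basis k) j = (\<Sum>k<m. if k = j then coord u k else 0)"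
      unfolding coord_sum by (rule sum.cong) (auto simp: scaleR_ell2.rep_eq ell2_basis.rep_eq)
    then show ?thesis by simp
  qed
  have nsq: "(norm ((\<Sum>k<m. coord u k *\<^sub>R ell2_basis k) - u))\<^sup>2 = (\<Sum>k. (coord u (k + m))\<^sup>2)" for m
  proof -
    have "(norm ((\<Sum>k<m. coord u k *\<^sub>R ell2_basis k) - u))\<^sup>2
        = (\<Sum>k. if k < m then 0 else (coord u k)\<^sup>2)"
      unfolding norm_ell2_sq by (rule arg_cong[of _ _ suminf]) (auto simp: minus_ell2.rep_eq coord_trunc)
    moreover have "summable (\<lambda>k. if k < m then 0 else (coord u k)\<^sup>2)"
      by (rule summable_comparison_test'[OF summable_coord_sq[of u], of 0]) auto
    ultimately show ?thesis
      using suminf_split_initial_segment[of "\<lambda>k. if k < m then 0 else (coord u k)\<^sup>2" m] by simp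
  qed
  obtain N where "\<And>m. m \<ge> N \<Longrightarrow> norm (\<Sum>k. (coord u (k + m))\<^sup>2) < e\<^sup>2"
    using suminf_exist_split[OF _ summable_coord_sq[of u], of "e\<^sup>2"] \<open>0 < e\<close> by auto
  then have "norm ((\<Sum>k<m. coord u k *\<^sub>R ell2_basis k) - u) < e" if "m \<ge> N" for m
    using that \<open>0 < e\<close> nsq[of m] by (intro power2_less_imp_less[of _ e]) fastforce+
  then show "\<exists>no. \<forall>m\<ge>no. norm ((\<Sum>k<m. coord u k *\<^sub>R ell2_basis k) - u) < e" by blast
qed

lemma norm_ell2_basis [simp]: "norm (ell2_basis k) = 1"
proof -
  have "(norm (ell2_basis k))\<^sup>2 = (\<Sum>j. if j = k then 1 else 0)"
    unfolding norm_ell2_sq by (rule arg_cong[of _ _ suminf]) (auto simp: ell2_basis.rep_eq)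
  also have "\<dots> = 1"
    using sums_single[of k "\<lambda>_. 1 :: real"] by (simp add: sums_iff)
  finally show ?thesis using norm_ge_zero[of "ell2_basis k"] by (simp add: power2_eq_1_iff)
qed

lemma ell2_separable: "\<exists>D :: ell2 set. countable D \<and> (\<forall>u. \<forall>e>0. \<exists>v\<in>D. dist v u < e)"
proof (intro exI conjI allI impI)
  let ?F = "\<lambda>qs. \<Sum>k<length qs. (of_rat (qs ! k) :: real) *\<^sub>R ell2_basis k"
  show "countable (range ?F)" by simp
  fix u :: ell2 and e :: real assume e: "0 < e"
  obtain m where m: "norm ((\<Sum>k<m. coord u k *\<^sub>R ell2_basis k) - u) < e / 2"
    using LIMSEQ_D[OF ell2_basis_sums[of u, unfolded sums_def], of "e / 2"] e by auto
  have "\<exists>q. \<bar>real_of_rat q - coord u k\<bar> < e / (2 * Suc m)" for k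
  proof -
    obtain q where "coord u k < real_of_rat q" "real_of_rat q < coord u k + e / (2 * Suc m)"
      using of_rat_dense[of "coord u k" "coord u k + e / (2 * Suc m)"] e by auto
    then show ?thesis by (intro exI[of _ q]) auto
  qed
  then obtain q where q: "\<And>k. \<bar>real_of_rat (q k) - coord u k\<bar> < e / (2 * Suc m)" by metis
  let ?v = "?F (map q [0..<m])"
  have "?v - (\<Sum>k<m. coord u k *\<^sub>R ell2_basis k) = (\<Sum>k<m. (of_rat (q k) - coord u k) *\<^sub>R ell2_basis k)"
    by (simp add: sum_subtractf scaleR_left_diff_distrib)
  also have "norm \<dots> \<le> (\<Sum>k<m. e / (2 * Suc m))"
    by (rule sum_norm_le) (use q in \<open>auto intro: less_imp_le\<close>)
  also have "\<dots> \<le> e / 2" using e by (simp add: field_simps)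
  finally have "norm (?v - (\<Sum>k<m. coord u k *\<^sub>R ell2_basis k)) \<le> e / 2" .
  then have "dist ?v u < e"
    using m norm_triangle_ineq[of "?v - (\<Sum>k<m. coord u k *\<^sub>R ell2_basis k)" "(\<Sum>k<m. coord u k *\<^sub>R ell2_basis k) - u"]
    by (simp add: dist_norm)
  then show "\<exists>v\<in>range ?F. dist v u < e" by blast
qed

instance ell2 :: second_countable_topology
proof
  obtain D :: "ell2 set" where D: "countable D" "\<And>u e. 0 < e \<Longrightarrow> \<exists>v\<in>D. dist v u < e"
    using ell2_separable by blast
  let ?B = "(\<lambda>(v, n). ball v (1 / real (Suc n))) ` (D \<times> UNIV)"
  have "topological_basis ?B"
  proof (rule topological_basisI)
    fix U and u :: ell2 assume "open U" "u \<in> U"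
    then obtain e where e: "0 < e" "ball u e \<subseteq> U" by (auto simp: open_contains_ball)
    obtain n where n: "1 / real (Suc n) < e / 2"
      using reals_Archimedean[of "e / 2"] e by (auto simp: inverse_eq_divide)
    obtain v where v: "v \<in> D" "dist v u < 1 / real (Suc n)" using D(2)[of "1 / real (Suc n)" u] by auto
    have "ball v (1 / real (Suc n)) \<subseteq> ball u e"
    proof
      fix w assume "w \<in> ball v (1 / real (Suc n))"
      then have "dist v w < 1 / real (Suc n)" by simp
      moreover have "dist u w \<le> dist v u + dist v w" using dist_triangle[of u w v] by (simp add: dist_commute)
      ultimately show "w \<in> ball u e" using v n by simp
    qed
    with v e show "\<exists>B'\<in>?B. u \<in> B' \<and> B' \<subseteq> U" by (intro bexI[of _ "ball v (1 / real (Suc n))"]) auto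
  qed auto
  then show "\<exists>B :: ell2 set set. countable B \<and> open = generate_topology B"
    using D(1) by (intro exI[of _ ?B]) (auto intro: topological_basis_imp_subbasis)
qed

section \<open>Hausdorff distance and isometries\<close>

definition hausdorff_dist :: "'a::metric_space set \<Rightarrow> 'a set \<Rightarrow> real"
  where "hausdorff_dist K L = max (SUP x\<in>K. infdist x L) (SUP y\<in>L. infdist y K)"

lemma infdist_le_iff_compact:
  assumes "compact L" "L \<noteq> {}"
  shows "infdist x L \<le> r \<longleftrightarrow> (\<exists>y\<in>L. dist x y \<le> r)"
proof
  have "\<exists>y\<in>L. \<forall>z\<in>L. dist x y \<le> dist x z"
    by (rule continuous_attains_inf[OF assms]) (intro continuous_intros)
  then obtain y where y: "y \<in> L" "\<And>z. z \<in> L \<Longrightarrow> dist x y \<le> dist x z" by blast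
  have "dist x y \<le> infdist x L"
    using assms y(2) by (auto simp: infdist_def intro!: cINF_greatest)
  then show "infdist x L \<le> r \<Longrightarrow> \<exists>y\<in>L. dist x y \<le> r" using y(1) by force
  show "\<exists>y\<in>L. dist x y \<le> r \<Longrightarrow> infdist x L \<le> r"
    by (auto intro: infdist_le2)
qed

lemma SUP_infdist_le_iff:
  assumes "compact K" "K \<noteq> {}" "compact L" "L \<noteq> {}"
  shows "(SUP x\<in>K. infdist x L) \<le> r \<longleftrightarrow> (\<forall>x\<in>K. \<exists>y\<in>L. dist x y \<le> r)"
proof -
  have "compact ((\<lambda>x. infdist x L) ` K)"
    using assms by (intro compact_continuous_image continuous_intros)
  then have "bdd_above ((\<lambda>x. infdist x L) ` K)"
    by (intro bounded_imp_bdd_above compact_imp_bounded)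
  then have "(SUP x\<in>K. infdist x L) \<le> r \<longleftrightarrow> (\<forall>x\<in>K. infdist x L \<le> r)"
    using assms by (intro cSUP_le_iff) auto
  then show ?thesis using assms by (simp add: infdist_le_iff_compact)
qed

lemma hausdorff_dist_le_iff:
  assumes "compact K" "K \<noteq> {}" "compact L" "L \<noteq> {}"
  shows "hausdorff_dist K L \<le> r \<longleftrightarrow>
    (\<forall>x\<in>K. \<exists>y\<in>L. dist x y \<le> r) \<and> (\<forall>y\<in>L. \<exists>x\<in>K. dist x y \<le> r)"
  using assms by (simp add: hausdorff_dist_def SUP_infdist_le_iff dist_commute)

lemma hausdorff_dist_nonneg:
  assumes "compact K" "K \<noteq> {}" "compact L" "L \<noteq> {}"
  shows "0 \<le> hausdorff_dist K L"
  using hausdorff_dist_le_iff[OF assms, of "hausdorff_dist K L"] assms(2)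
  by (meson all_not_in_conv order_refl order_trans zero_le_dist)

lemma hausdorff_dist_commute: "hausdorff_dist K L = hausdorff_dist L K"
  by (simp add: hausdorff_dist_def max.commute)

lemma hausdorff_dist_self:
  assumes "compact K" "K \<noteq> {}"
  shows "hausdorff_dist K K = 0"
proof (rule antisym)
  show "hausdorff_dist K K \<le> 0"
    by (rule iffD2[OF hausdorff_dist_le_iff[OF assms assms]]) auto
qed (rule hausdorff_dist_nonneg[OF assms assms])

definition isometric_on :: "'a::metric_space set \<Rightarrow> ('a \<Rightarrow> 'b::metric_space) \<Rightarrow> bool"
  where "isometric_on K f \<longleftrightarrow> (\<forall>x\<in>K. \<forall>y\<in>K. dist (f x) (f y) = dist x y)"

lemma isometric_on_imp_continuous: "isometric_on K f \<Longrightarrow> continuous_on K f"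
  by (auto simp: isometric_on_def continuous_on_iff)

lemma isometric_on_imp_inj: "isometric_on K f \<Longrightarrow> inj_on f K"
  unfolding isometric_on_def inj_on_def by (metis dist_eq_0_iff)

lemma isometric_on_compose:
  "isometric_on K f \<Longrightarrow> isometric_on (f ` K) g \<Longrightarrow> isometric_on K (g \<circ> f)"
  by (simp add: isometric_on_def)

lemma isometric_on_inv_into: "isometric_on K f \<Longrightarrow> isometric_on (f ` K) (inv_into K f)"
  using isometric_on_imp_inj[of K f] by (auto simp: isometric_on_def)

subsection \<open>An isometric self-map of a compact set is onto\<close>

lemma isometric_self_map_onto:
  fixes K :: "'a::metric_space set"
  assumes K: "compact K" and f: "isometric_on K f" "f ` K \<subseteq> K"
  shows "f ` K = K"
proof (rule ccontr)
  assume "f ` K \<noteq> K"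
  then obtain z where z: "z \<in> K" "z \<notin> f ` K" using f(2) by auto
  have "closed (f ` K)"
    using K f(1) by (intro compact_imp_closed compact_continuous_image isometric_on_imp_continuous)
  then have "open (- f ` K)" by (simp add: open_Compl)
  then obtain \<delta> where \<delta>: "0 < \<delta>" "ball z \<delta> \<subseteq> - f ` K"
    using z(2) unfolding open_contains_ball by (meson ComplI)
  then have \<delta>': "\<delta> \<le> dist z y" if "y \<in> f ` K" for y
    using that by (force simp: subset_iff not_less[symmetric])
  have mem: "(f ^^ n) z \<in> K" for n
    by (induction n) (use z f(2) in auto)
  have step: "\<delta> \<le> dist ((f ^^ n) z) ((f ^^ (n + Suc m)) z)" for n m
  proof (induction n)
    case 0
    show ?case using \<delta>'[of "f ((f ^^ m) z)"] mem[of m] by simp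
  next
    case (Suc n)
    then show ?case using f(1) mem[of n] mem[of "n + Suc m"] by (simp add: isometric_on_def)
  qed
  obtain l r where r: "strict_mono r" "((\<lambda>n. (f ^^ n) z) \<circ> r) \<longlonglongrightarrow> l"
    using K mem unfolding compact_eq_seq_compact_metric seq_compact_def by metis
  have "Cauchy ((\<lambda>n. (f ^^ n) z) \<circ> r)" using r(2) by (rule LIMSEQ_imp_Cauchy)
  then obtain N where "dist (((\<lambda>n. (f ^^ n) z) \<circ> r) N) (((\<lambda>n. (f ^^ n) z) \<circ> r) (Suc N)) < \<delta>"
    using \<delta>(1) unfolding Cauchy_def by (meson le_SucI order_refl)
  moreover obtain m where "r (Suc N) = r N + Suc m"
    using strict_monoD[OF r(1), of N "Suc N"] less_imp_Suc_add[of "r N" "r (Suc N)"] by auto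
  ultimately show False using step[of "r N" m] by simp
qed

text \<open>Approximate isometric embeddings into a compact set give an exact one.\<close>

lemma isometric_embedding_of_approx:
  fixes K :: "'a::metric_space set" and L :: "'b::metric_space set"
  assumes L: "compact L"
    and approx: "\<And>e. 0 < e \<Longrightarrow> \<exists>f. f ` K \<subseteq> L \<and> (\<forall>x\<in>K. \<forall>y\<in>K. \<bar>dist (f x) (f y) - dist x y\<bar> \<le> e)"
    and K: "K \<noteq> {}"
  shows "\<exists>f. f ` K \<subseteq> L \<and> isometric_on K f"
proof -
  let ?S = "PiE UNIV (\<lambda>_::'a. L)"
  let ?C = "\<lambda>e. (\<Inter>x\<in>K. \<Inter>y\<in>K. {f :: 'a \<Rightarrow> 'b. \<bar>dist (f x) (f y) - dist x y\<bar> \<le> e})"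
  have "compactin (product_topology (\<lambda>_::'a. euclidean :: 'b topology) UNIV) ?S"
    using L by (simp add: compactin_PiE)
  then have S: "compact ?S" by (simp add: euclidean_product_topology)
  have closed: "closed (?C e)" for e
    by (intro closed_INT ballI closed_Collect_le continuous_intros
        continuous_on_product_coordinates)
  have "?S \<inter> (\<Inter>e\<in>{0<..}. ?C e) \<noteq> {}"
  proof (rule compact_imp_fip_image[OF S closed])
    fix I' :: "real set" assume I': "finite I'" "I' \<subseteq> {0<..}"
    define m where "m = Min (insert 1 I')"
    have m: "0 < m" "\<And>e. e \<in> I' \<Longrightarrow> m \<le> e" using I' by (auto simp: m_def)
    obtain f where f: "f ` K \<subseteq> L" "\<forall>x\<in>K. \<forall>y\<in>K. \<bar>dist (f x) (f y) - dist x y\<bar> \<le> m"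
      using approx[OF m(1)] by blast
    obtain l where l: "l \<in> L" using K f(1) by auto
    define g where "g = (\<lambda>x. if x \<in> K then f x else l)"
    have "g \<in> ?S" using f(1) l by (auto simp: g_def image_subset_iff)
    moreover have "g \<in> ?C e" if "e \<in> I'" for e
      using f(2) m(2)[OF that] by (auto simp: g_def intro: order_trans)
    ultimately show "?S \<inter> (\<Inter>e\<in>I'. ?C e) \<noteq> {}" by blast
  qed
  then obtain f where f: "f \<in> ?S" "f \<in> (\<Inter>e\<in>{0<..}. ?C e)" by blast
  have "dist (f x) (f y) = dist x y" if "x \<in> K" "y \<in> K" for x y
  proof -
    have "\<bar>dist (f x) (f y) - dist x y\<bar> \<le> 0 + e" if "0 < e" for e
      using f(2) that \<open>x \<in> K\<close> \<open>y \<in> K\<close> by auto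
    then have "\<bar>dist (f x) (f y) - dist x y\<bar> \<le> 0" by (rule field_le_epsilon)
    then show ?thesis by simp
  qed
  with f(1) show ?thesis by (intro exI[of _ f]) (auto simp: isometric_on_def)
qed

subsection \<open>Gluing isometric copies in \<open>\<ell>\<^sup>2\<close>\<close>

lift_definition ell2_embed :: "(nat \<Rightarrow> nat) \<Rightarrow> ell2 \<Rightarrow> ell2"
  is "\<lambda>g f k. if strict_mono g \<and> k \<in> range g then f (inv g k) else 0"
proof -
  fix g :: "nat \<Rightarrow> nat" and f :: "nat \<Rightarrow> real"
  assume f: "summable (\<lambda>k. (f k)\<^sup>2)"
  show "summable (\<lambda>k. (if strict_mono g \<and> k \<in> range g then f (inv g k) else 0)\<^sup>2)"
  proof (cases "strict_mono g")
    case True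
    then have "inv g (g k) = k" for k by (simp add: inv_f_f strict_mono_imp_inj_on)
    then show ?thesis
      using True f
      by (subst summable_mono_reindex[OF True, symmetric]) auto
  qed simp
qed

lemma inner_ell2_embed:
  assumes g: "strict_mono g"
  shows "inner (ell2_embed g u) (ell2_embed g v) = inner u v"
proof -
  have inv: "inv g (g k) = k" for k using g by (simp add: inv_f_f strict_mono_imp_inj_on)
  show ?thesis
    unfolding inner_ell2_def ell2_embed.rep_eq
    by (subst suminf_mono_reindex[OF g, symmetric]) (auto simp: g inv)
qed

lemma inner_ell2_embed_disjoint:
  assumes "range g \<inter> range h = {}"
  shows "inner (ell2_embed g u) (ell2_embed h v) = 0"
proof -
  have "coord (ell2_embed g u) k * coord (ell2_embed h v) k = 0" for k
    using assms by (auto simp: ell2_embed.rep_eq)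
  then show ?thesis by (simp only: inner_ell2_def suminf_zero)
qed

lemma linear_ell2_embed: "linear (ell2_embed g)"
  by (rule linearI; transfer) auto

lemma inner_eq_of_dist:
  fixes u v p :: "'a::real_inner"
  shows "inner (u - p) (v - p) = ((dist u p)\<^sup>2 + (dist v p)\<^sup>2 - (dist u v)\<^sup>2) / 2"
  by (simp add: dist_norm power2_norm_eq_inner inner_diff_left inner_diff_right inner_commute)

lemma finite_span_projection:
  fixes B :: "'a::real_inner set"
  assumes "finite B"
  shows "\<exists>u\<in>span B. \<forall>w\<in>span B. inner (v - u) w = 0"
  using assms
proof (induction B arbitrary: v)
  case empty
  then show ?case by simp
next
  case (insert b B)
  have sub: "span B \<subseteq> span (insert b B)" by (rule span_mono) auto
  obtain b0 where b0: "b0 \<in> span B" "\<And>w. w \<in> span B \<Longrightarrow> inner (b - b0) w = 0"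
    using insert.IH[of b] by blast
  obtain u where u: "u \<in> span B" "\<And>w. w \<in> span B \<Longrightarrow> inner (v - u) w = 0"
    using insert.IH[of v] by blast
  define b1 where "b1 = b - b0"
  define c where "c = inner (v - u) b1 / inner b1 b1"
  have "b1 \<in> span (insert b B)"
    unfolding b1_def using b0(1) sub by (intro span_diff) (auto intro: span_base)
  then have mem: "u + c *\<^sub>R b1 \<in> span (insert b B)"
    using u(1) sub by (intro span_add span_scale) auto
  have orth: "inner (v - (u + c *\<^sub>R b1)) w = 0" if "w \<in> span B" for w
    using u(2)[OF that] b0(2)[OF that] unfolding b1_def[symmetric]
    by (simp add: inner_diff_left inner_add_left)
  have "inner (v - (u + c *\<^sub>R b1)) b1 = 0"
    by (cases "b1 = 0") (auto simp: c_def inner_diff_left inner_add_left)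
  then have ob: "inner (v - (u + c *\<^sub>R b1)) b = 0"
    using orth[OF b0(1)] by (simp add: b1_def inner_diff_right)
  have "inner (v - (u + c *\<^sub>R b1)) w = 0" if w: "w \<in> span (insert b B)" for w
  proof -
    obtain k where "w - k *\<^sub>R b \<in> span B" using w by (auto simp: span_insert)
    from orth[OF this] ob show ?thesis by (simp add: inner_diff_right)
  qed
  with mem show ?case by blast
qed

lemma isometry_extension:
  fixes N :: "ell2 set" and \<psi> :: "ell2 \<Rightarrow> ell2"
  defines "E \<equiv> ell2_embed (\<lambda>k. 2 * k)"
  assumes N: "finite N"
    and \<psi>: "\<And>x y. x \<in> N \<Longrightarrow> y \<in> N \<Longrightarrow> inner (\<psi> x) (\<psi> y) = inner x y"
    and E: "\<And>x. x \<in> N \<Longrightarrow> \<psi> x \<in> range E"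
  shows "\<exists>U. isometric_on UNIV U \<and> (\<forall>x\<in>N. U x = \<psi> x)"
proof -
  define D where "D = ell2_embed (\<lambda>k. 2 * k + 1)"
  have sm: "strict_mono (\<lambda>k::nat. 2 * k)" "strict_mono (\<lambda>k::nat. 2 * k + 1)"
    by (auto simp: strict_mono_def)
  have ED: "inner (E u) (D v) = 0" for u v
    unfolding E_def D_def by (rule inner_ell2_embed_disjoint) (auto, presburger)
  have linD: "linear D" unfolding D_def by (rule linear_ell2_embed)
  have normD: "inner (D u) (D u) = inner u u" for u
    unfolding D_def by (rule inner_ell2_embed[OF sm(2)])
  obtain B where B: "B \<subseteq> N" "independent B" "N \<subseteq> span B"
    using maximal_independent_subset by blast
  obtain g where g: "linear g" "\<And>x. x \<in> B \<Longrightarrow> g x = \<psi> x" "range g = span (\<psi> ` B)"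
    using linear_independent_extend_subspace[OF B(2), of \<psi>] by blast
  interpret g: linear g by fact
  have 1: "inner (g u) (\<psi> x) = inner u x" if "u \<in> span B" "x \<in> N" for u x
    using that(1)
  proof (induction rule: span_induct_alt)
    case base
    then show ?case by (simp add: g.zero)
  next
    case (step c y z)
    then show ?case using \<psi>[of y x] that B(1) g(2)[of y]
      by (simp add: g.add g.scale inner_add_left subset_iff)
  qed
  have 2: "inner (g u) (g v) = inner u v" if "u \<in> span B" "v \<in> span B" for u v
    using that(2)
  proof (induction rule: span_induct_alt)
    case base
    then show ?case by (simp add: g.zero)
  next
    case (step c y z)
    then show ?case using 1[OF that(1), of y] B(1) g(2)[of y]
      by (simp add: g.add g.scale inner_add_right subset_iff)
  qed
  have g_N: "g x = \<psi> x" if "x \<in> N" for x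
  proof -
    have x: "x \<in> span B" using that B(3) by auto
    have "inner (g x - \<psi> x) (g x - \<psi> x) = 0"
      using 1[OF x that] 2[OF x x] \<psi>[OF that that]
      by (simp add: inner_diff_left inner_diff_right inner_commute)
    then show ?thesis by simp
  qed
  have "subspace (range E)"
    unfolding E_def by (intro linear_subspace_image linear_ell2_embed subspace_UNIV)
  then have "span (\<psi> ` B) \<subseteq> range E"
    using E B(1) by (intro span_minimal) auto
  then have g_range: "g u \<in> range E" for u using g(3) by auto
  have "\<forall>v. \<exists>u\<in>span B. \<forall>w\<in>span B. inner (v - u) w = 0"
    using finite_span_projection[of B] B(1) N finite_subset by blast
  then obtain P where P: "\<And>v. P v \<in> span B" "\<And>v w. w \<in> span B \<Longrightarrow> inner (v - P v) w = 0"
    by metis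
  define U where "U = (\<lambda>v. g (P v) + D (v - P v))"
  have "dist (U v) (U w) = dist v w" for v w
  proof -
    let ?p = "P v - P w" and ?q = "(v - P v) - (w - P w)"
    have p: "?p \<in> span B" using P(1) by (intro span_diff)
    have pq: "inner ?q ?p = 0" using P(2)[OF p, of v] P(2)[OF p, of w] by (simp add: inner_diff_left)
    have "inner (g ?p) (D ?q) = 0" using g_range[of ?p] ED by auto
    then have "inner (g ?p + D ?q) (g ?p + D ?q) = inner ?p ?p + inner ?q ?q"
      using 2[OF p p] normD[of ?q] by (simp add: inner_add_left inner_add_right inner_commute)
    also have "\<dots> = inner (?p + ?q) (?p + ?q)"
      using pq by (simp only: inner_add_left inner_add_right) (simp add: inner_commute)
    finally have "inner (g ?p + D ?q) (g ?p + D ?q) = inner (v - w) (v - w)" by simp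
    moreover have "U v - U w = g ?p + D ?q"
      by (simp add: U_def g.diff linear_diff[OF linD])
    ultimately show ?thesis by (simp add: dist_norm norm_eq_sqrt_inner)
  qed
  moreover have "U x = \<psi> x" if "x \<in> N" for x
  proof -
    have "x - P x \<in> span B" using that B(3) P(1) by (intro span_diff) auto
    from P(2)[OF this, of x] have "P x = x" by simp
    then show ?thesis using g_N[OF that] by (simp add: U_def linear_0[OF linD])
  qed
  ultimately show ?thesis by (auto simp: isometric_on_def)
qed

lemma isometry_gluing:
  fixes K :: "ell2 set" and \<phi> :: "ell2 \<Rightarrow> ell2"
  assumes K: "compact K" "K \<noteq> {}" and \<phi>: "isometric_on K \<phi>" and e: "0 < e"
  shows "\<exists>F G :: ell2 \<Rightarrow> ell2. isometric_on UNIV F \<and> isometric_on UNIV G \<and>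
    (\<forall>x\<in>K. dist (F x) (G (\<phi> x)) \<le> e)"
proof -
  define E where "E = ell2_embed (\<lambda>k. 2 * k)"
  have linE: "linear E" unfolding E_def by (rule linear_ell2_embed)
  have innerE: "inner (E u) (E v) = inner u v" for u v
    unfolding E_def by (rule inner_ell2_embed) (auto simp: strict_mono_def)
  obtain p where p: "p \<in> K" using K(2) by auto
  obtain N where N: "finite N" "N \<subseteq> K" "K \<subseteq> (\<Union>x\<in>N. ball x (e / 2))"
    using seq_compact_imp_totally_bounded[of K] K(1) e
    unfolding compact_eq_seq_compact_metric by (meson half_gt_zero)
  define \<psi> where "\<psi> = (\<lambda>v. E (\<phi> (v + p) - \<phi> p))"
  have "\<exists>U. isometric_on UNIV U \<and> (\<forall>x\<in>(\<lambda>x. x - p) ` N. U x = \<psi> x)"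
  proof (rule isometry_extension)
    fix u v assume "u \<in> (\<lambda>x. x - p) ` N" "v \<in> (\<lambda>x. x - p) ` N"
    then obtain x y where xy: "x \<in> K" "y \<in> K" "u = x - p" "v = y - p" using N(2) by auto
    show "inner (\<psi> u) (\<psi> v) = inner u v"
      using \<phi> p xy(1,2) unfolding \<psi>_def xy innerE inner_eq_of_dist
      by (simp add: isometric_on_def inner_eq_of_dist)
  qed (use N in \<open>auto simp: \<psi>_def E_def\<close>)
  then obtain U where U: "isometric_on UNIV U" "\<And>x. x \<in> N \<Longrightarrow> U (x - p) = E (\<phi> x - \<phi> p)"
    by (auto simp: \<psi>_def)
  define F where "F = (\<lambda>v. U (v - p))"
  define G where "G = (\<lambda>w. E (w - \<phi> p))"
  have F: "dist (F u) (F v) = dist u v" for u v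
    using U(1) by (simp add: F_def isometric_on_def dist_norm)
  have G: "dist (G u) (G v) = dist u v" for u v
    by (simp add: G_def dist_norm linear_diff[OF linE, symmetric] norm_eq_sqrt_inner innerE)
  have "dist (F x) (G (\<phi> x)) \<le> e" if x: "x \<in> K" for x
  proof -
    obtain z where z: "z \<in> N" "dist z x < e / 2" using N(3) x by auto
    have "dist (F x) (G (\<phi> x)) \<le> dist (F x) (F z) + dist (G (\<phi> z)) (G (\<phi> x))"
      using dist_triangle[of "F x" "G (\<phi> x)" "F z"] U(2)[OF z(1)] by (simp add: F_def G_def)
    also have "\<dots> = dist z x + dist z x"
      using \<phi> x z(1) N(2) unfolding F G by (auto simp: isometric_on_def dist_commute)
    finally show ?thesis using z(2) by simp
  qed
  with F G show ?thesis by (intro exI[of _ F] exI[of _ G]) (auto simp: isometric_on_def)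
qed

section \<open>Compact subsets of \<open>\<ell>\<^sup>2\<close> up to isometry\<close>

definition compact_isometric :: "ell2 set \<Rightarrow> ell2 set \<Rightarrow> bool"
  where "compact_isometric K L \<longleftrightarrow> compact K \<and> K \<noteq> {} \<and> compact L \<and> L \<noteq> {} \<and>
    (\<exists>f. bij_betw f K L \<and> (\<forall>x\<in>K. \<forall>y\<in>K. dist (f x) (f y) = dist x y))"

lemma compact_isometric_iff:
  "compact_isometric K L \<longleftrightarrow> compact K \<and> K \<noteq> {} \<and> compact L \<and> L \<noteq> {} \<and>
    (\<exists>f. isometric_on K f \<and> f ` K = L)"
  unfolding compact_isometric_def bij_betw_def
  using isometric_on_imp_inj by (auto simp: isometric_on_def)

lemma compact_isometric_refl: "compact K \<Longrightarrow> K \<noteq> {} \<Longrightarrow> compact_isometric K K"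
  unfolding compact_isometric_iff by (auto simp: isometric_on_def intro: exI[of _ "\<lambda>x. x"])

lemma compact_isometric_image:
  assumes "compact K" "K \<noteq> {}" "isometric_on K f"
  shows "compact_isometric K (f ` K)"
  using assms unfolding compact_isometric_iff
  by (auto intro: compact_continuous_image isometric_on_imp_continuous)

lemma compact_isometric_sym:
  assumes "compact_isometric K L"
  shows "compact_isometric L K"
proof -
  obtain f where f: "isometric_on K f" "f ` K = L" using assms by (auto simp: compact_isometric_iff)
  have "inv_into K f ` L = K"
    using inv_into_image_cancel[OF isometric_on_imp_inj[OF f(1)], of K] f(2) by simp
  then show ?thesis
    using assms isometric_on_inv_into[OF f(1)] f(2) by (auto simp: compact_isometric_iff)
qed

lemma compact_isometric_trans:
  assumes "compact_isometric K L" "compact_isometric L M"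
  shows "compact_isometric K M"
proof -
  obtain f g where f: "isometric_on K f" "f ` K = L" "isometric_on L g" "g ` L = M"
    using assms by (auto simp: compact_isometric_iff)
  then have "isometric_on K (g \<circ> f)" "(g \<circ> f) ` K = M"
    using isometric_on_compose[of K f g] by auto
  then show ?thesis using assms unfolding compact_isometric_iff by blast
qed

text \<open>
  The equivalence is partial: only non-empty compact sets are related to anything, so \<^typ>\<open>ell2 set\<close>
  modulo \<^const>\<open>compact_isometric\<close> is the set of isometry classes of non-empty compact sets.
  The value of \<open>shape_of K\<close> is meaningful only for compact non-empty \<open>K\<close>.
\<close>

quotient_type shape = "ell2 set" / partial: compact_isometric
  morphisms rep_shape shape_of
proof (rule part_equivpI)
  show "\<exists>K. compact_isometric K K" using compact_isometric_refl[of "{0}"] by auto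
  show "symp compact_isometric" by (rule sympI) (rule compact_isometric_sym)
  show "transp compact_isometric" by (rule transpI) (rule compact_isometric_trans)
qed

lemma shape_of_eq_iff:
  assumes "compact K" "K \<noteq> {}" "compact L" "L \<noteq> {}"
  shows "shape_of K = shape_of L \<longleftrightarrow> compact_isometric K L"
  using Quotient3_rel[OF Quotient3_shape, of K L] assms compact_isometric_refl by blast

lemma shape_of_cases:
  obtains K where "compact K" "K \<noteq> {}" "shape_of K = A"
proof -
  have "compact_isometric (rep_shape A) (rep_shape A)"
    by (rule Quotient3_rep_reflp[OF Quotient3_shape])
  then show ?thesis
    using that[of "rep_shape A"] Quotient3_abs_rep[OF Quotient3_shape, of A]
    by (auto simp: compact_isometric_def)
qed

lemma hausdorff_glue:
  assumes K1: "compact K1" "K1 \<noteq> {}" and K2: "compact K2" "K2 \<noteq> {}"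
    and L2: "compact L2" "L2 \<noteq> {}" and L3: "compact L3" "L3 \<noteq> {}"
    and iso: "compact_isometric K2 L2" and e: "0 < e"
  shows "\<exists>M1 M3. compact_isometric M1 K1 \<and> compact_isometric M3 L3 \<and>
    hausdorff_dist M1 M3 \<le> hausdorff_dist K1 K2 + hausdorff_dist L2 L3 + e"
proof -
  obtain \<phi> where \<phi>: "isometric_on K2 \<phi>" "\<phi> ` K2 = L2" using iso by (auto simp: compact_isometric_iff)
  obtain F G :: "ell2 \<Rightarrow> ell2" where F: "isometric_on UNIV F" and G: "isometric_on UNIV G"
    and FG: "\<And>x. x \<in> K2 \<Longrightarrow> dist (F x) (G (\<phi> x)) \<le> e"
    using isometry_gluing[OF K2 \<phi>(1) e] by blast
  have M: "compact_isometric K1 (F ` K1)" "compact_isometric L3 (G ` L3)"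
    using F G K1 L3 by (auto intro!: compact_isometric_image simp: isometric_on_def)
  have h1: "\<forall>x\<in>K1. \<exists>y\<in>K2. dist x y \<le> hausdorff_dist K1 K2"
      "\<forall>y\<in>K2. \<exists>x\<in>K1. dist x y \<le> hausdorff_dist K1 K2"
    using hausdorff_dist_le_iff[OF K1 K2, of "hausdorff_dist K1 K2"] by auto
  have h2: "\<forall>x\<in>L2. \<exists>y\<in>L3. dist x y \<le> hausdorff_dist L2 L3"
      "\<forall>y\<in>L3. \<exists>x\<in>L2. dist x y \<le> hausdorff_dist L2 L3"
    using hausdorff_dist_le_iff[OF L2 L3, of "hausdorff_dist L2 L3"] by auto
  have tri: "dist (F x) (G z) \<le> hausdorff_dist K1 K2 + hausdorff_dist L2 L3 + e"
    if "y \<in> K2" "dist x y \<le> hausdorff_dist K1 K2" "dist (\<phi> y) z \<le> hausdorff_dist L2 L3" for x y z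
  proof -
    have "dist (F x) (G z) \<le> dist (F x) (F y) + dist (F y) (G (\<phi> y)) + dist (G (\<phi> y)) (G z)"
      using dist_triangle[of "F x" "G z" "F y"] dist_triangle[of "F y" "G z" "G (\<phi> y)"] by simp
    then show ?thesis using F G FG[OF that(1)] that by (simp add: isometric_on_def)
  qed
  have "hausdorff_dist (F ` K1) (G ` L3) \<le> hausdorff_dist K1 K2 + hausdorff_dist L2 L3 + e"
  proof (subst hausdorff_dist_le_iff)
    have "\<exists>z\<in>L3. dist (F x) (G z) \<le> hausdorff_dist K1 K2 + hausdorff_dist L2 L3 + e" if x: "x \<in> K1" for x
    proof -
      obtain y where y: "y \<in> K2" "dist x y \<le> hausdorff_dist K1 K2" using bspec[OF h1(1) x] by blast
      then obtain z where "z \<in> L3" "dist (\<phi> y) z \<le> hausdorff_dist L2 L3" using bspec[OF h2(1), of "\<phi> y"] \<phi>(2) by blast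
      with tri[OF y] show ?thesis by blast
    qed
    moreover have "\<exists>x\<in>K1. dist (F x) (G z) \<le> hausdorff_dist K1 K2 + hausdorff_dist L2 L3 + e" if z: "z \<in> L3" for z
    proof -
      obtain y where y: "y \<in> K2" "dist (\<phi> y) z \<le> hausdorff_dist L2 L3" using bspec[OF h2(2) z] \<phi>(2) by blast
      then obtain x where "x \<in> K1" "dist x y \<le> hausdorff_dist K1 K2" using bspec[OF h1(2)] by blast
      with tri[OF y(1) _ y(2)] show ?thesis by blast
    qed
    ultimately show "(\<forall>x\<in>F ` K1. \<exists>y\<in>G ` L3. dist x y \<le> hausdorff_dist K1 K2 + hausdorff_dist L2 L3 + e) \<and>
      (\<forall>y\<in>G ` L3. \<exists>x\<in>F ` K1. dist x y \<le> hausdorff_dist K1 K2 + hausdorff_dist L2 L3 + e)"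
      by blast
  qed (use M in \<open>auto simp: compact_isometric_def\<close>)
  with M show ?thesis by (blast intro: compact_isometric_sym)
qed

lemma hausdorff_approx_isometry:
  assumes "compact_isometric K K'" "compact_isometric L L'" "hausdorff_dist K' L' \<le> e"
  shows "\<exists>f. f ` K \<subseteq> L \<and> (\<forall>x\<in>K. \<forall>y\<in>K. \<bar>dist (f x) (f y) - dist x y\<bar> \<le> 2 * e)"
proof -
  obtain \<phi> where \<phi>: "isometric_on K \<phi>" "\<phi> ` K = K'" using assms(1) by (auto simp: compact_isometric_iff)
  obtain \<psi> where \<psi>: "isometric_on L' \<psi>" "\<psi> ` L' = L"
    using compact_isometric_sym[OF assms(2)] by (auto simp: compact_isometric_iff)
  have "\<forall>x\<in>K'. \<exists>y\<in>L'. dist x y \<le> e"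
    using assms hausdorff_dist_le_iff[of K' L' e] by (auto simp: compact_isometric_def)
  then obtain h where h: "\<And>x. x \<in> K' \<Longrightarrow> h x \<in> L'" "\<And>x. x \<in> K' \<Longrightarrow> dist x (h x) \<le> e" by metis
  have "\<bar>dist (\<psi> (h (\<phi> x))) (\<psi> (h (\<phi> y))) - dist x y\<bar> \<le> 2 * e" if xy: "x \<in> K" "y \<in> K" for x y
  proof -
    have m: "\<phi> x \<in> K'" "\<phi> y \<in> K'" using \<phi>(2) xy by auto
    have "dist (\<psi> (h (\<phi> x))) (\<psi> (h (\<phi> y))) = dist (h (\<phi> x)) (h (\<phi> y))" "dist x y = dist (\<phi> x) (\<phi> y)"
      using \<phi>(1) \<psi>(1) xy h(1) m by (auto simp: isometric_on_def)
    then show ?thesis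
      using h(2)[OF m(1)] h(2)[OF m(2)]
        dist_triangle[of "\<phi> x" "\<phi> y" "h (\<phi> x)"] dist_triangle[of "h (\<phi> x)" "\<phi> y" "h (\<phi> y)"]
        dist_triangle[of "h (\<phi> x)" "h (\<phi> y)" "\<phi> x"] dist_triangle[of "\<phi> x" "h (\<phi> y)" "\<phi> y"]
      by (simp add: dist_commute abs_le_iff)
  qed
  then show ?thesis using \<phi> \<psi> h by (intro exI[of _ "\<psi> \<circ> h \<circ> \<phi>"]) auto
qed

instantiation shape :: metric_space
begin

definition dist_shape :: "shape \<Rightarrow> shape \<Rightarrow> real"
  where "dist_shape A B = Inf {hausdorff_dist K L | K L.
    compact K \<and> K \<noteq> {} \<and> compact L \<and> L \<noteq> {} \<and> shape_of K = A \<and> shape_of L = B}"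

definition uniformity_shape :: "(shape \<times> shape) filter"
  where "uniformity_shape = (INF e\<in>{0 <..}. principal {(A, B). dist A B < e})"

definition open_shape :: "shape set \<Rightarrow> bool"
  where "open_shape U = (\<forall>A\<in>U. \<forall>\<^sub>F (A', B) in uniformity. A' = A \<longrightarrow> B \<in> U)"

lemma dist_shape_le:
  assumes "compact K" "K \<noteq> {}" "compact L" "L \<noteq> {}"
  shows "dist (shape_of K) (shape_of L) \<le> hausdorff_dist K L"
  unfolding dist_shape_def
  by (rule cInf_lower) (use assms in \<open>auto intro!: bdd_belowI[of _ 0] hausdorff_dist_nonneg\<close>)

lemma dist_shape_less:
  assumes "dist A B < r"
  obtains K L where "compact K" "K \<noteq> {}" "compact L" "L \<noteq> {}" "shape_of K = A" "shape_of L = B"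
    "hausdorff_dist K L < r"
proof -
  obtain K0 L0 where "compact K0" "K0 \<noteq> {}" "shape_of K0 = A" "compact L0" "L0 \<noteq> {}" "shape_of L0 = B"
    by (metis shape_of_cases)
  then have "{hausdorff_dist K L | K L. compact K \<and> K \<noteq> {} \<and> compact L \<and> L \<noteq> {} \<and>
      shape_of K = A \<and> shape_of L = B} \<noteq> {}" by blast
  from cInf_lessD[OF this assms[unfolded dist_shape_def]] that show ?thesis by blast
qed

instance
proof
  fix A B C :: shape
  show "uniformity = (INF e\<in>{0 <..}. principal {(A :: shape, B). dist A B < e})"
    by (rule uniformity_shape_def)
  show "open U = (\<forall>A\<in>U. \<forall>\<^sub>F (A', B) in uniformity. A' = A \<longrightarrow> B \<in> U)" for U :: "shape set"
    by (rule open_shape_def)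
  have commute: "dist A B = dist B A" for A B :: shape
  proof -
    have "hausdorff_dist K L = r \<longleftrightarrow> hausdorff_dist L K = r" for K L :: "ell2 set" and r
      by (simp add: hausdorff_dist_commute)
    then show ?thesis
      unfolding dist_shape_def by (intro arg_cong[of _ _ Inf] Collect_cong) blast
  qed
  have nonneg: "0 \<le> dist A B" for A B :: shape
    by (rule ccontr) (metis dist_shape_less hausdorff_dist_nonneg not_le)
  show "dist A B = 0 \<longleftrightarrow> A = B"
  proof
    assume "A = B"
    obtain K where K: "compact K" "K \<noteq> {}" "shape_of K = A" using shape_of_cases .
    then have "dist A B \<le> 0"
      using dist_shape_le[of K K] \<open>A = B\<close> hausdorff_dist_self[of K] by simp
    with nonneg[of A B] show "dist A B = 0" by simp
  next
    have embed: "\<exists>f. f ` K \<subseteq> L \<and> isometric_on K f"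
      if K: "compact K" "K \<noteq> {}" and L: "compact L" "L \<noteq> {}"
        and d: "dist (shape_of K) (shape_of L) = 0" for K L
    proof (rule isometric_embedding_of_approx[OF L(1) _ K(2)])
      fix e :: real assume "0 < e"
      then obtain K' L' where *: "compact K'" "K' \<noteq> {}" "compact L'" "L' \<noteq> {}"
        "shape_of K' = shape_of K" "shape_of L' = shape_of L" "hausdorff_dist K' L' < e / 2"
        using dist_shape_less[of "shape_of K" "shape_of L" "e / 2"] d by auto
      then have "compact_isometric K K'" "compact_isometric L L'"
        using K L by (metis shape_of_eq_iff)+
      from hausdorff_approx_isometry[OF this, of "e / 2"] *(7)
      show "\<exists>f. f ` K \<subseteq> L \<and> (\<forall>x\<in>K. \<forall>y\<in>K. \<bar>dist (f x) (f y) - dist x y\<bar> \<le> e)" by simp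
    qed
    assume d: "dist A B = 0"
    obtain K where K: "compact K" "K \<noteq> {}" "shape_of K = A" using shape_of_cases .
    obtain L where L: "compact L" "L \<noteq> {}" "shape_of L = B" using shape_of_cases .
    obtain f where f: "f ` K \<subseteq> L" "isometric_on K f" using embed[of K L] K L d by auto
    obtain g where g: "g ` L \<subseteq> K" "isometric_on L g" using embed[of L K] K L d commute[of A B] by auto
    have "isometric_on L (f \<circ> g)"
      using f g by (intro isometric_on_compose) (auto simp: isometric_on_def subset_iff)
    moreover have "(f \<circ> g) ` L \<subseteq> L" using f(1) g(1) by auto
    ultimately have fg: "(f \<circ> g) ` L = L" by (rule isometric_self_map_onto[OF L(1)])
    have "(f \<circ> g) ` L \<subseteq> f ` K" using g(1) by auto
    then have "f ` K = L" using f(1) unfolding fg by auto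
    then have "compact_isometric K L" using K L f(2) by (auto simp: compact_isometric_iff)
    then show "A = B" using K L shape_of_eq_iff[of K L] by simp
  qed
  have "dist A B \<le> (dist A C + dist B C) + e" if "0 < e" for e
  proof -
    obtain K1 K2 where K: "compact K1" "K1 \<noteq> {}" "compact K2" "K2 \<noteq> {}"
      "shape_of K1 = A" "shape_of K2 = C" "hausdorff_dist K1 K2 < dist A C + e / 3"
      using dist_shape_less[of A C "dist A C + e / 3"] \<open>0 < e\<close> by auto
    obtain L2 L3 where L: "compact L2" "L2 \<noteq> {}" "compact L3" "L3 \<noteq> {}"
      "shape_of L2 = C" "shape_of L3 = B" "hausdorff_dist L2 L3 < dist C B + e / 3"
      using dist_shape_less[of C B "dist C B + e / 3"] \<open>0 < e\<close> by auto
    have "compact_isometric K2 L2" using K L shape_of_eq_iff[of K2 L2] by simp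
    then obtain M1 M3 where M: "compact_isometric M1 K1" "compact_isometric M3 L3"
      "hausdorff_dist M1 M3 \<le> hausdorff_dist K1 K2 + hausdorff_dist L2 L3 + e / 3"
      using hausdorff_glue[of K1 K2 L2 L3 "e / 3"] K L \<open>0 < e\<close> by auto
    have "shape_of M1 = A" "shape_of M3 = B"
      using M K L by (metis compact_isometric_def shape_of_eq_iff)+
    then have "dist A B \<le> hausdorff_dist M1 M3"
      using dist_shape_le[of M1 M3] M(1,2) by (simp add: compact_isometric_def)
    then show ?thesis using M(3) K(7) L(7) commute[of C B] by simp
  qed
  then show "dist A B \<le> dist A C + dist B C" by (rule field_le_epsilon)
qed

end

section \<open>Vague and weak convergence\<close>

text \<open>
  Vague convergence on \<open>(0, \<infinity>]\<close>, which is the subspace \<open>{0<..}\<close> of \<^typ>\<open>ennreal\<close>; the measures may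
  also charge \<open>0\<close>, which is ignored. As integrals of non-integrable functions are \<open>0\<close> by convention,
  the limit \<open>\<nu>\<close> should be finite on compact subsets of \<open>(0, \<infinity>]\<close>.
\<close>

definition vague_conv :: "(nat \<Rightarrow> ennreal measure) \<Rightarrow> ennreal measure \<Rightarrow> bool"
  where "vague_conv \<mu> \<nu> \<longleftrightarrow>
    (\<forall>f :: ennreal \<Rightarrow> real.
      continuous_on {0<..} f \<and> (\<exists>K. compact K \<and> K \<subseteq> {0<..} \<and> (\<forall>x\<in>{0<..} - K. f x = 0)) \<longrightarrow>
      (\<lambda>d. LINT x:{0<..}|\<mu> d. f x) \<longlonglongrightarrow> (LINT x:{0<..}|\<nu>. f x))"

definition weak_conv_measure :: "(nat \<Rightarrow> 'a::metric_space measure) \<Rightarrow> 'a measure \<Rightarrow> bool"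
  where "weak_conv_measure \<mu> \<mu>' \<longleftrightarrow>
    (\<forall>f :: 'a \<Rightarrow> real. continuous_on UNIV f \<and> bounded (range f) \<longrightarrow>
      (\<lambda>d. LINT x|\<mu> d. f x) \<longlonglongrightarrow> (LINT x|\<mu>'. f x))"

section \<open>Poisson random measures and the crinkled subordinator\<close>

definition poisson_random_measure :: "'w measure \<Rightarrow> 'a measure \<Rightarrow> ('w \<Rightarrow> 'a measure) \<Rightarrow> bool"
  where "poisson_random_measure P \<mu> N \<longleftrightarrow>
    (\<forall>\<omega>\<in>space P. sets (N \<omega>) = sets \<mu>) \<and>
    (\<forall>A\<in>sets \<mu>. (\<lambda>\<omega>. emeasure (N \<omega>) A) \<in> borel_measurable P) \<and>
    (\<forall>A\<in>sets \<mu>. emeasure \<mu> A < \<infinity> \<longrightarrow>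
      (\<forall>j::nat. measure P {\<omega>\<in>space P. emeasure (N \<omega>) A = of_nat j} =
        exp (- measure \<mu> A) * measure \<mu> A ^ j / fact j)) \<and>
    (\<forall>A\<in>sets \<mu>. emeasure \<mu> A = \<infinity> \<longrightarrow> (AE \<omega> in P. emeasure (N \<omega>) A = \<infinity>)) \<and>
    (\<forall>(A :: nat \<Rightarrow> 'a set) I. finite I \<and> A ` I \<subseteq> sets \<mu> \<and> disjoint_family_on A I \<longrightarrow>
      prob_space.indep_vars P (\<lambda>_. borel) (\<lambda>i \<omega>. emeasure (N \<omega>) (A i)) I)"

definition crinkled_intensity :: "ennreal measure \<Rightarrow> (real \<times> ennreal) measure"
  where "crinkled_intensity \<nu> = restrict_space lborel {0..} \<Otimes>\<^sub>M \<nu>"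

text \<open>
  A measurable enumeration of the atoms \<open>(x\<^sub>k, y\<^sub>k)\<close> of a Poisson random measure on
  \<open>[0, \<infinity>) \<times> (0, \<infinity>]\<close>. The number of atoms may be finite (if \<open>\<nu> = 0\<close>), so an index \<open>k\<close> is
  allowed to carry no atom; this is encoded by \<open>y\<^sub>k = 0\<close>, a value outside \<open>(0, \<infinity>]\<close>. Such indices
  contribute nothing to the crinkled subordinator below.
\<close>

definition poisson_atoms ::
    "'w measure \<Rightarrow> ennreal measure \<Rightarrow> (nat \<Rightarrow> 'w \<Rightarrow> real) \<Rightarrow> (nat \<Rightarrow> 'w \<Rightarrow> ennreal) \<Rightarrow> bool"
  where "poisson_atoms P \<nu> x y \<longleftrightarrow>
    (\<forall>k. x k \<in> borel_measurable P \<and> y k \<in> borel_measurable P \<and> (\<forall>\<omega>\<in>space P. 0 \<le> x k \<omega>)) \<and>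
    poisson_random_measure P (crinkled_intensity \<nu>)
      (\<lambda>\<omega>. distr (count_space {k. 0 < y k \<omega>}) (crinkled_intensity \<nu>) (\<lambda>k. (x k \<omega>, y k \<omega>)))"

definition crinkled :: "(nat \<Rightarrow> real) \<Rightarrow> (nat \<Rightarrow> ennreal) \<Rightarrow> real \<Rightarrow> ell2"
  where "crinkled x y t = (\<Sum>\<^sub>\<infinity>k\<in>{k. x k \<le> t}. sqrt (enn2real (y k)) *\<^sub>R ell2_basis k)"

text \<open>
  If \<open>\<integral> min 1 z \<nu>(dz) < \<infinity>\<close> over \<open>(0, \<infinity>)\<close> and \<open>\<nu>\<close> does not charge \<open>\<infinity>\<close>, then almost surely all \<open>y\<^sub>k\<close>
  are finite and the series at time \<open>T\<close> (hence at all earlier times) converges. On the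
  exceptional null event where the series diverges, the range is set to \<open>{0}\<close>.
\<close>

definition crinkled_range :: "(nat \<Rightarrow> real) \<Rightarrow> (nat \<Rightarrow> ennreal) \<Rightarrow> real \<Rightarrow> ell2 set"
  where "crinkled_range x y T =
    (if (\<lambda>k. sqrt (enn2real (y k)) *\<^sub>R ell2_basis k) summable_on {k. x k \<le> T}
     then closure (crinkled x y ` {0..T}) else {0})"

section \<open>Random walks\<close>

definition walk_set :: "(nat \<Rightarrow> ell2) \<Rightarrow> real \<Rightarrow> nat \<Rightarrow> ell2 set"
  where "walk_set v c m = {(\<Sum>i=1..k. v i) /\<^sub>R sqrt c | k. k \<le> m}"

end

theory Submission
  imports Defs
begin

text \<open>
  Cut the time axis into \<open>L\<close> cells and the range of squared step lengths above a threshold \<open>s\<close> into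
  finitely many boxes whose end points are not atoms of \<open>\<nu>\<close>. With high probability every cell contains
  at most one large step, and the boxes of these steps form a code from a finite set whose
  distribution converges, as binomial counts become Poisson. Given its code, either random set is close
  to a deterministic shape: Kolmogorov's maximal inequality controls the small steps of the walk, and
  as the few large steps are nearly orthogonal, Gram--Schmidt moves them only slightly to an orthogonal
  system, whose partial sums have a shape depending on the lengths only. On the crinkled side
  orthogonality is exact, and Campbell's formula bounds the small jumps.
\<close>

section \<open>Weak convergence from finite partitions\<close>

text \<open>The walk and the limit live on different probability spaces, and no coupling is built:
  for one finite alphabet of codes and one list of deterministic shapes, both laws are compared with
  finite sums whose weights converge. Two large steps in one cell and steps above the top box get no
  code; that such outcomes are rare is read off from the total limit mass of the codes, which
  approaches \<open>exp (- T * q)\<close> as the cells shrink, \<open>q\<close> being the mass of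
  \<open>\<nu>\<close> above the top. Positions inside a cell may be forgotten because the shape
  sees only the order of the steps. Angles are the delicate point: there are of order
  \<open>n^2\<close> pairs of steps, and conditional smallness in (b) suffices because both members
  of a pair are large with probability of order \<open>n^-2\<close>. The centred small steps must be
  controlled at all times simultaneously, hence a maximal inequality; their accumulated mean is the
  quantity in (c). The constants are fixed in the order threshold, top, number of cells, mesh, angle
  tolerance, as the later ones depend on the earlier ones.\<close>

text \<open>
  A bounded continuous \<open>f\<close> is the increasing limit of the Lipschitz functions
  \<open>x \<mapsto> inf\<^sub>y (f y + k * dist x y)\<close>; applied to \<open>f\<close> and \<open>- f\<close> this gives both inequalities.
\<close>

lemma weak_conv_measureI_lipschitz:
  fixes \<mu> :: "nat \<Rightarrow> 'a::metric_space measure"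
  assumes \<mu>: "\<forall>\<^sub>F d in sequentially. prob_space (\<mu> d) \<and> sets (\<mu> d) = sets borel"
    and \<nu>: "prob_space \<nu>" "sets \<nu> = sets borel"
    and conv: "\<And>(f :: 'a \<Rightarrow> real) C. (\<And>x y. \<bar>f x - f y\<bar> \<le> C * dist x y) \<Longrightarrow> bounded (range f) \<Longrightarrow>
      (\<lambda>d. LINT x|\<mu> d. f x) \<longlonglongrightarrow> (LINT x|\<nu>. f x)"
  shows "weak_conv_measure \<mu> \<nu>"
proof -
  interpret N: prob_space \<nu> by fact
  have lower: "\<forall>\<^sub>F d in sequentially. (LINT x|\<nu>. f x) - e < (LINT x|\<mu> d. f x)"
    if f: "continuous_on UNIV f" "bounded (range f)" and e: "0 < e" for f :: "'a \<Rightarrow> real" and e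
  proof -
    obtain K where K: "\<And>x. \<bar>f x\<bar> \<le> K" using f(2) by (auto simp: bounded_iff)
    define g where "g k x = (INF y. f y + real k * dist x y)" for k x
    have lb: "- K \<le> f y + real k * dist x y" for k x y
      proof -
      have "0 \<le> real k * dist x y" by simp
      then show ?thesis using K[of y] unfolding abs_le_iff by linarith
    qed
    have bdd: "bdd_below (range (\<lambda>y. f y + real k * dist x y))" for k x
      using lb by (intro bdd_belowI[of _ "-K"]) auto
    have g_le: "g k x \<le> f y + real k * dist x y" for k x y
      unfolding g_def by (rule cINF_lower[OF bdd]) simp
    have g_le_f: "g k x \<le> f x" for k x using g_le[of k x x] by simp
    have g_ge: "- K \<le> g k x" for k x
      unfolding g_def by (rule cINF_greatest) (use lb in auto)
    have g_abs: "\<bar>g k x\<bar> \<le> K" for k x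
      using g_ge[of k x] g_le_f[of k x] K[of x] by (auto simp: abs_le_iff)
    have g_diff: "g k x \<le> g k x' + real k * dist x x'" for k x x'
    proof -
      have "g k x - real k * dist x x' \<le> f y + real k * dist x' y" for y
      proof -
        have "real k * dist x y \<le> real k * (dist x x' + dist x' y)"
          by (intro mult_left_mono dist_triangle) auto
        then show ?thesis using g_le[of k x y] by (simp add: distrib_left)
      qed
      then have "g k x - real k * dist x x' \<le> g k x'"
        unfolding g_def[of k x'] by (intro cINF_greatest) auto
      then show ?thesis by simp
    qed
    have lip: "\<bar>g k x - g k x'\<bar> \<le> real k * dist x x'" for k x x'
      using g_diff[of k x x'] g_diff[of k x' x] by (simp add: abs_le_iff dist_commute)
    have g_conv: "(\<lambda>k. g k x) \<longlonglongrightarrow> f x" for x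
    proof (rule LIMSEQ_I)
      fix r :: real assume r: "0 < r"
      obtain \<delta> where \<delta>: "0 < \<delta>" "\<And>y. dist y x < \<delta> \<Longrightarrow> dist (f y) (f x) < r / 2"
        using f(1) r by (metis UNIV_I continuous_on_iff half_gt_zero)
      \<comment> \<open>From \<open>k0\<close> on, the penalty \<open>k * dist x y\<close> outside
        the ball of radius \<open>\<delta>\<close> is at least \<open>2 * K\<close>, the largest
        possible oscillation of \<open>f\<close>, so only points near \<open>x\<close> can lower the
        infimum noticeably.\<close>
      obtain k0 where k0: "2 * K / \<delta> \<le> real k0" using real_arch_simple by blast
      have "norm (g k x - f x) < r" if k: "k0 \<le> k" for k
      proof -
        have "f x - r / 2 \<le> f y + real k * dist x y" for y
        proof (cases "dist y x < \<delta>")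
          case True
          have "\<bar>f y - f x\<bar> < r / 2" using \<delta>(2)[OF True] by (simp add: dist_real_def)
          moreover have "0 \<le> real k * dist x y" by simp
          ultimately show ?thesis by linarith
        next
          case False
          have "2 * K \<le> real k0 * \<delta>" using k0 \<delta>(1) by (simp add: field_simps)
          also have "\<dots> \<le> real k * dist x y"
            using k False \<delta>(1) by (intro mult_mono) (auto simp: dist_commute)
          finally show ?thesis using K[of x] K[of y] r by (auto simp: abs_le_iff)
        qed
        then have "f x - r / 2 \<le> g k x" unfolding g_def by (intro cINF_greatest) auto
        then show ?thesis using g_le_f[of k x] r by (auto simp: abs_less_iff)
      qed
      then show "\<exists>no. \<forall>n\<ge>no. norm (g n x - f x) < r" by blast
    qed
    have g_cont: "continuous_on UNIV (g k)" for k
    proof (rule continuous_onI)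
      fix x :: 'a and r :: real assume r: "0 < r"
      have "dist (g k x') (g k x) \<le> r" if "dist x' x < r / (real k + 1)" for x'
      proof -
        have "real k * dist x' x \<le> real k * (r / (real k + 1))"
          using that by (intro mult_left_mono) auto
        also have "\<dots> \<le> r" using r by (simp add: field_simps)
        finally show ?thesis using lip[of k x' x] by (simp add: dist_real_def)
      qed
      then show "\<exists>d>0. \<forall>x'\<in>UNIV. dist x' x < d \<longrightarrow> dist (g k x') (g k x) \<le> r"
        using r by (intro exI[of _ "r / (real k + 1)"]) (auto intro!: divide_pos_pos)
    qed
    have g_meas: "g k \<in> borel_measurable borel" for k
      using g_cont by (rule borel_measurable_continuous_onI)
    have f_meas: "f \<in> borel_measurable borel"
      using f(1) by (rule borel_measurable_continuous_onI)
    have meas_cong: "h \<in> borel_measurable \<mu>'" if "sets \<mu>' = sets borel" "h \<in> borel_measurable borel"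
      for \<mu>' and h :: "'a \<Rightarrow> real"
      by (subst measurable_cong_sets[OF that(1) refl]) (rule that(2))
    have "(\<lambda>k. LINT x|\<nu>. g k x) \<longlonglongrightarrow> (LINT x|\<nu>. f x)"
      by (rule integral_dominated_convergence[where w = "\<lambda>_. K", OF meas_cong[OF \<nu>(2) f_meas] meas_cong[OF \<nu>(2) g_meas]])
        (use g_abs g_conv in simp_all)
    then obtain k where k: "\<bar>(LINT x|\<nu>. g k x) - (LINT x|\<nu>. f x)\<bar> < e / 2"
      using e by (metis LIMSEQ_D half_gt_zero order_refl real_norm_def)
    have "bounded (range (g k))" using g_abs by (auto simp: bounded_iff)
    from conv[OF lip this] have "(\<lambda>d. LINT x|\<mu> d. g k x) \<longlonglongrightarrow> (LINT x|\<nu>. g k x)" .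
    then have "\<forall>\<^sub>F d in sequentially. (LINT x|\<nu>. g k x) - e / 2 < (LINT x|\<mu> d. g k x)"
      using e by (intro order_tendstoD) auto
    then show ?thesis using \<mu>
    proof eventually_elim
      case (elim d)
      interpret prob_space "\<mu> d" using elim by simp
      have "(LINT x|\<mu> d. g k x) \<le> (LINT x|\<mu> d. f x)"
        using meas_cong[OF _ g_meas] meas_cong[OF _ f_meas] elim K g_abs g_le_f
        by (intro integral_mono integrable_const_bound[where B = K]) simp_all
      then show ?case using elim k by linarith
    qed
  qed
  show ?thesis unfolding weak_conv_measure_def
  proof (intro allI impI)
    fix f :: "'a \<Rightarrow> real" assume f: "continuous_on UNIV f \<and> bounded (range f)"
    show "(\<lambda>d. LINT x|\<mu> d. f x) \<longlonglongrightarrow> (LINT x|\<nu>. f x)"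
    proof (rule tendstoI)
      fix e :: real assume e: "0 < e"
      have "continuous_on UNIV (\<lambda>x. - f x)" "bounded (range (\<lambda>x. - f x))"
        using f by (auto intro: continuous_on_minus simp: bounded_iff)
      from lower[OF this e] lower[OF conjunct1[OF f] conjunct2[OF f] e]
      show "\<forall>\<^sub>F d in sequentially. dist (LINT x|\<mu> d. f x) (LINT x|\<nu>. f x) < e"
        by eventually_elim (simp add: dist_real_def abs_less_iff)
    qed
  qed
qed

text \<open>\<open>S\<close> is the alphabet, \<open>E s\<close> the event that the code is
  \<open>s\<close>, \<open>D s\<close> the point standing for that code, and \<open>A\<close> an
  exceptional event. The events \<open>E s\<close> may leave part of the space uncovered; that mass
  is accounted for separately, through the sum of their probabilities.\<close>

definition cell_approx ::
    "'w measure \<Rightarrow> ('w \<Rightarrow> 'a::metric_space) \<Rightarrow> 's set \<Rightarrow> ('s \<Rightarrow> 'a) \<Rightarrow> ('s \<Rightarrow> 'w set) \<Rightarrow> 'w set \<Rightarrow> real \<Rightarrow> bool"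
  where "cell_approx M Z S D E A e \<longleftrightarrow> (\<forall>s\<in>S. E s \<in> sets M) \<and> disjoint_family_on E S \<and>
    A \<in> sets M \<and> measure M A \<le> e \<and> (\<forall>s\<in>S. \<forall>\<omega>\<in>E s - A. dist (Z \<omega>) (D s) \<le> e)"

text \<open>Integrates a pointwise bound with three regimes: inside a cell and off \<open>A\<close>
  the Lipschitz bound gives \<open>C * e\<close>, on \<open>A\<close> two values of \<open>f\<close>
  differ by at most \<open>2 * K\<close>, and outside all cells the sum vanishes while
  \<open>f\<close> is at most \<open>K\<close>. There the last factor, one minus the sum of the
  indicators, equals one.\<close>

lemma (in prob_space) cell_approx_expectation:
  fixes Z :: "'a \<Rightarrow> 'b::metric_space" and f :: "'b \<Rightarrow> real"
  assumes Z: "Z \<in> borel_measurable M" and S: "finite S" and ap: "cell_approx M Z S D E A e"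
    and lip: "\<And>x y. \<bar>f x - f y\<bar> \<le> C * dist x y" and K: "\<And>x. \<bar>f x\<bar> \<le> K" and "0 \<le> C" "0 \<le> e"
    and fm: "f \<in> borel_measurable borel"
  shows "\<bar>expectation (\<lambda>\<omega>. f (Z \<omega>)) - (\<Sum>s\<in>S. prob (E s) * f (D s))\<bar>
    \<le> C * e + 2 * K * e + K * (1 - (\<Sum>s\<in>S. prob (E s)))"
proof -
  have E: "\<And>s. s \<in> S \<Longrightarrow> E s \<in> events" and dis: "disjoint_family_on E S"
    and A: "A \<in> events" "prob A \<le> e"
    and d: "\<And>s \<omega>. s \<in> S \<Longrightarrow> \<omega> \<in> E s \<Longrightarrow> \<omega> \<notin> A \<Longrightarrow> dist (Z \<omega>) (D s) \<le> e"
    using ap by (auto simp: cell_approx_def)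
  have K0: "0 \<le> K" using K[of undefined] by linarith
  have fZ: "integrable M (\<lambda>\<omega>. f (Z \<omega>))"
    using K measurable_compose[OF Z fm] by (intro integrable_const_bound[where B = K]) auto
  have iE: "integrable M (\<lambda>\<omega>. indicator (E s) \<omega> :: real)" if "s \<in> S" for s
    using E[OF that] by (intro integrable_const_bound[where B = 1]) auto
  have eq: "(\<Sum>s\<in>S. prob (E s) * f (D s)) = expectation (\<lambda>\<omega>. \<Sum>s\<in>S. indicator (E s) \<omega> * f (D s))"
    using E iE by (subst Bochner_Integration.integral_sum) auto
  have int2: "integrable M (\<lambda>\<omega>. \<Sum>s\<in>S. indicator (E s) \<omega> * f (D s))"
    using iE by (intro Bochner_Integration.integrable_sum integrable_mult_left) auto
  let ?b = "\<lambda>\<omega>. C * e + 2 * K * indicator A \<omega> + K * (1 - (\<Sum>s\<in>S. indicator (E s) \<omega>))"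
  have int3: "integrable M ?b"
    using A(1) by (intro Bochner_Integration.integrable_add integrable_mult_right
      Bochner_Integration.integrable_diff Bochner_Integration.integrable_sum iE)
      (simp_all add: integrable_indicator_iff emeasure_eq_measure)
  have pt: "\<bar>f (Z \<omega>) - (\<Sum>s\<in>S. indicator (E s) \<omega> * f (D s))\<bar> \<le> ?b \<omega>" for \<omega>
  proof (cases "\<exists>s\<in>S. \<omega> \<in> E s")
    case True
    then obtain s where s: "s \<in> S" "\<omega> \<in> E s" by blast
    have ind: "indicator (E s') \<omega> = (if s' = s then 1 else 0 :: real)" if "s' \<in> S" for s'
      using dis s that by (auto simp: disjoint_family_on_def indicator_def)
    have "(\<Sum>s'\<in>S. indicator (E s') \<omega> * f (D s')) = (\<Sum>s'\<in>S. if s' = s then f (D s') else 0)"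
      by (rule sum.cong) (auto simp: ind)
    also have "\<dots> = f (D s)" using s S by simp
    finally have 1: "(\<Sum>s'\<in>S. indicator (E s') \<omega> * f (D s')) = f (D s)" .
    have "(\<Sum>s'\<in>S. indicator (E s') \<omega>) = (\<Sum>s'\<in>S. if s' = s then 1 else 0 :: real)"
      by (rule sum.cong) (auto simp: ind)
    also have "\<dots> = 1" using s S by simp
    finally have 2: "(\<Sum>s'\<in>S. indicator (E s') \<omega>) = (1::real)" .
    show ?thesis
    proof (cases "\<omega> \<in> A")
      case True
      have "\<bar>f (Z \<omega>) - f (D s)\<bar> \<le> 2 * K" using K[of "Z \<omega>"] K[of "D s"] by linarith
      then show ?thesis using True 1 2 \<open>0 \<le> C\<close> \<open>0 \<le> e\<close> by (simp add: add_increasing)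
    next
      case False
      have "\<bar>f (Z \<omega>) - f (D s)\<bar> \<le> C * dist (Z \<omega>) (D s)" by (rule lip)
      also have "\<dots> \<le> C * e" using d[OF s False] \<open>0 \<le> C\<close> by (rule mult_left_mono)
      finally show ?thesis using False 1 2 by simp
    qed
  next
    case False
    then have z: "\<forall>s\<in>S. indicator (E s) \<omega> = (0::real)" by auto
    have "\<bar>f (Z \<omega>)\<bar> \<le> K" by (rule K)
    then show ?thesis using z \<open>0 \<le> C\<close> \<open>0 \<le> e\<close> K0 by (simp add: add_increasing)
  qed
  have "\<bar>expectation (\<lambda>\<omega>. f (Z \<omega>)) - (\<Sum>s\<in>S. prob (E s) * f (D s))\<bar>
      = \<bar>expectation (\<lambda>\<omega>. f (Z \<omega>) - (\<Sum>s\<in>S. indicator (E s) \<omega> * f (D s)))\<bar>"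
    unfolding eq using fZ int2 by simp
  also have "\<dots> \<le> expectation (\<lambda>\<omega>. \<bar>f (Z \<omega>) - (\<Sum>s\<in>S. indicator (E s) \<omega> * f (D s))\<bar>)"
    by (rule integral_abs_bound)
  also have "\<dots> \<le> expectation ?b"
    using fZ int2 int3 pt by (intro integral_mono integrable_abs Bochner_Integration.integrable_diff) auto
  also have "\<dots> = C * e + 2 * K * prob A + K * (1 - (\<Sum>s\<in>S. prob (E s)))"
  proof -
    have iA: "integrable M (\<lambda>\<omega>. indicator A \<omega> :: real)"
      using A(1) by (intro integrable_const_bound[where B = 1]) auto
    have iS: "integrable M (\<lambda>\<omega>. \<Sum>s\<in>S. indicator (E s) \<omega> :: real)"
      by (intro Bochner_Integration.integrable_sum iE)
    have eS: "expectation (\<lambda>\<omega>. \<Sum>s\<in>S. indicator (E s) \<omega>) = (\<Sum>s\<in>S. prob (E s))"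
      using E by (subst Bochner_Integration.integral_sum[OF iE]) auto
    have i1: "integrable M (\<lambda>\<omega>. 2 * K * indicator A \<omega>)" using iA by (rule integrable_mult_right)
    have i2: "integrable M (\<lambda>\<omega>. K * (1 - (\<Sum>s\<in>S. indicator (E s) \<omega>)))"
      using iS by (intro integrable_mult_right Bochner_Integration.integrable_diff) auto
    have "expectation ?b = C * e + expectation (\<lambda>\<omega>. 2 * K * indicator A \<omega>)
        + expectation (\<lambda>\<omega>. K * (1 - (\<Sum>s\<in>S. indicator (E s) \<omega>)))"
      using i1 i2 by (simp add: prob_space)
    moreover have "expectation (\<lambda>\<omega>. 2 * K * indicator A \<omega>) = 2 * K * prob A"
      using A(1) by simp
    moreover have "expectation (\<lambda>\<omega>. K * (1 - (\<Sum>s\<in>S. indicator (E s) \<omega>))) = K * (1 - (\<Sum>s\<in>S. prob (E s)))"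
      using iS eS by (simp add: prob_space)
    ultimately show ?thesis by (simp only:)
  qed
  also have "\<dots> \<le> C * e + 2 * K * e + K * (1 - (\<Sum>s\<in>S. prob (E s)))"
    using A(2) K0 by (auto intro!: mult_left_mono)
  finally show ?thesis .
qed

text \<open>Since \<open>S\<close> and \<open>D\<close> are shared by both sides, the two
  expectations are close to the sums of \<open>f (D s)\<close> weighted by the probabilities of
  \<open>E d s\<close> and of \<open>F s\<close>. These sums are finite, so convergence of the
  weights is enough.\<close>

lemma weak_conv_of_cell_approx:
  fixes Z :: "nat \<Rightarrow> 'w \<Rightarrow> 'b::metric_space" and Y :: "'v \<Rightarrow> 'b"
  assumes M: "\<And>d. 1 \<le> d \<Longrightarrow> prob_space (M d)" and P: "prob_space P"
    and Z: "\<And>d. 1 \<le> d \<Longrightarrow> Z d \<in> borel_measurable (M d)" and Y: "Y \<in> borel_measurable P"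
    and approx: "\<And>e. 0 < e \<Longrightarrow> \<exists>(S :: 's set) D E F A B. finite S \<and>
      (\<forall>\<^sub>F d in sequentially. cell_approx (M d) (Z d) S D (E d) (A d) e) \<and>
      cell_approx P Y S D F B e \<and>
      (\<forall>s\<in>S. (\<lambda>d. measure (M d) (E d s)) \<longlonglongrightarrow> measure P (F s)) \<and>
      1 - e \<le> (\<Sum>s\<in>S. measure P (F s))"
  shows "weak_conv_measure (\<lambda>d. distr (M d) borel (Z d)) (distr P borel Y)"
proof (rule weak_conv_measureI_lipschitz)
  interpret P: prob_space P by fact
  have ev1: "\<forall>\<^sub>F d in sequentially. 1 \<le> (d::nat)" by (rule eventually_ge_at_top)
  show "\<forall>\<^sub>F d in sequentially. prob_space (distr (M d) borel (Z d)) \<and> sets (distr (M d) borel (Z d)) = sets borel"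
    using ev1 by eventually_elim (simp add: prob_space.prob_space_distr[OF M Z])
  show "prob_space (distr P borel Y)" by (rule P.prob_space_distr[OF Y])
  show "sets (distr P borel Y) = sets borel" by simp
  fix f :: "'b \<Rightarrow> real" and C
  assume lip0: "\<And>x y. \<bar>f x - f y\<bar> \<le> C * dist x y" and "bounded (range f)"
  then obtain K where K: "\<And>x. \<bar>f x\<bar> \<le> K" by (auto simp: bounded_iff)
  have K0: "0 \<le> K" using K[of undefined] by linarith
  \<comment> \<open>On a one-point space the Lipschitz hypothesis allows a negative
    \<open>C\<close>.\<close>
  define C' where "C' = \<bar>C\<bar>"
  have lip: "\<bar>f x - f y\<bar> \<le> C' * dist x y" for x y
    using lip0[of x y] mult_right_mono[of C C' "dist x y"] unfolding C'_def by force
  have C': "0 \<le> C'" by (simp add: C'_def)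
  have "continuous_on UNIV f"
  proof (rule continuous_onI)
    fix x :: 'b and r :: real assume r: "0 < r"
    have "dist (f x') (f x) \<le> r" if "dist x' x < r / (C' + 1)" for x'
    proof -
      have "C' * dist x' x \<le> C' * (r / (C' + 1))"
        using that C' by (intro mult_left_mono) auto
      also have "\<dots> \<le> r" using r C' by (simp add: field_simps)
      finally show ?thesis using lip[of x' x] by (simp add: dist_real_def)
    qed
    then show "\<exists>d>0. \<forall>x'\<in>UNIV. dist x' x < d \<longrightarrow> dist (f x') (f x) \<le> r"
      using r C' by (intro exI[of _ "r / (C' + 1)"]) (auto intro!: divide_pos_pos)
  qed
  then have fm: "f \<in> borel_measurable borel" by (rule borel_measurable_continuous_onI)
  have "(\<lambda>d. LINT \<omega>|M d. f (Z d \<omega>)) \<longlonglongrightarrow> (LINT \<omega>|P. f (Y \<omega>))"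
  proof (rule LIMSEQ_I, unfold eventually_sequentially[symmetric])
    fix r :: real assume r: "0 < r"
    \<comment> \<open>Adds up the errors, in units of \<open>e\<close>: \<open>C' + 4 * K\<close>
      for the walk, whose uncovered mass is at most \<open>2 * e\<close>, \<open>C' + 3 * K\<close>
      for the limit, and 1 for the difference of the two finite sums. One spare unit makes the final
      inequality strict.\<close>
    define Q where "Q = 2 * C' + 7 * K + 2"
    have Q: "0 < Q" using K0 C' by (simp add: Q_def)
    define e where "e = r / Q"
    have e: "0 < e" using r Q by (simp add: e_def)
    obtain S :: "'s set" and D E F A B where S: "finite S"
      and apM: "\<forall>\<^sub>F d in sequentially. cell_approx (M d) (Z d) S D (E d) (A d) e"
      and apP: "cell_approx P Y S D F B e"
      and EF: "\<And>s. s \<in> S \<Longrightarrow> (\<lambda>d. measure (M d) (E d s)) \<longlonglongrightarrow> measure P (F s)"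
      and F: "1 - e \<le> (\<Sum>s\<in>S. measure P (F s))"
      using approx[OF e] by blast
    have l1: "(\<lambda>d. \<Sum>s\<in>S. measure (M d) (E d s)) \<longlonglongrightarrow> (\<Sum>s\<in>S. measure P (F s))"
      by (intro tendsto_sum EF)
    have l2: "(\<lambda>d. \<Sum>s\<in>S. measure (M d) (E d s) * f (D s)) \<longlonglongrightarrow> (\<Sum>s\<in>S. measure P (F s) * f (D s))"
      by (intro tendsto_intros EF)
    have e1: "\<forall>\<^sub>F d in sequentially. 1 - 2 * e < (\<Sum>s\<in>S. measure (M d) (E d s))"
      using order_tendstoD(1)[OF l1, of "1 - 2 * e"] F e by simp
    have e2: "\<forall>\<^sub>F d in sequentially. dist (\<Sum>s\<in>S. measure (M d) (E d s) * f (D s)) (\<Sum>s\<in>S. measure P (F s) * f (D s)) < e"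
      using tendstoD[OF l2 e] .
    have bP: "\<bar>(LINT \<omega>|P. f (Y \<omega>)) - (\<Sum>s\<in>S. measure P (F s) * f (D s))\<bar>
        \<le> C' * e + 2 * K * e + K * (1 - (\<Sum>s\<in>S. measure P (F s)))"
      by (rule P.cell_approx_expectation[OF Y S apP lip K C' _ fm]) (use e in simp)
    have bP': "K * (1 - (\<Sum>s\<in>S. measure P (F s))) \<le> K * e"
      using F K0 by (intro mult_left_mono) auto
    show "\<forall>\<^sub>F d in sequentially. norm ((LINT \<omega>|M d. f (Z d \<omega>)) - (LINT \<omega>|P. f (Y \<omega>))) < r"
      using e1 e2 apM ev1
    proof eventually_elim
      case (elim d)
      interpret prob_space "M d" using elim M by simp
      have b: "\<bar>(LINT \<omega>|M d. f (Z d \<omega>)) - (\<Sum>s\<in>S. measure (M d) (E d s) * f (D s))\<bar>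
        \<le> C' * e + 2 * K * e + K * (1 - (\<Sum>s\<in>S. measure (M d) (E d s)))"
        by (rule cell_approx_expectation[OF Z S _ lip K C' _ fm]) (use e elim in auto)
      have "K * (1 - (\<Sum>s\<in>S. measure (M d) (E d s))) \<le> K * (2 * e)"
        using elim K0 by (intro mult_left_mono) auto
      then have "\<bar>(LINT \<omega>|M d. f (Z d \<omega>)) - (LINT \<omega>|P. f (Y \<omega>))\<bar> \<le> (2 * C' + 7 * K + 1) * e"
        using b bP bP' elim(2) by (simp add: dist_real_def algebra_simps)
      also have "\<dots> < r" using Q r e by (simp add: e_def Q_def field_simps)
      finally show ?case by simp
    qed
  qed
  moreover have "\<forall>\<^sub>F d in sequentially. (LINT x|distr (M d) borel (Z d). f x) = (LINT \<omega>|M d. f (Z d \<omega>))"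
    using ev1 by eventually_elim (rule integral_distr[OF Z fm])
  ultimately show "(\<lambda>d. LINT x|distr (M d) borel (Z d). f x) \<longlonglongrightarrow> (LINT x|distr P borel Y. f x)"
    using integral_distr[OF Y fm] by (simp add: tendsto_cong)
qed

section \<open>Nearly orthogonal steps\<close>

text \<open>Stability of Gram--Schmidt, by induction on the number of vectors: the last vector has
  small coefficients along the orthonormal system already found, so removing its projection and
  normalising the rest moves it little. The tolerance \<open>e\<close> is fixed before the vectors,
  and only a subset \<open>I\<close> of the indices is used, because cells without a large step
  contribute no direction.\<close>

lemma orthonormal_approx:
  fixes L :: nat and \<delta> :: real
  assumes "0 < \<delta>"
  shows "\<exists>e>0. \<forall>\<Theta> :: nat \<Rightarrow> 'a::real_inner. \<forall>I \<subseteq> {..<L}.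
    (\<forall>i\<in>I. norm (\<Theta> i) = 1) \<and> (\<forall>i\<in>I. \<forall>j\<in>I. i \<noteq> j \<longrightarrow> \<bar>inner (\<Theta> i) (\<Theta> j)\<bar> \<le> e) \<longrightarrow>
    (\<exists>q. (\<forall>i\<in>I. norm (q i) = 1 \<and> dist (\<Theta> i) (q i) \<le> \<delta>) \<and>
         (\<forall>i\<in>I. \<forall>j\<in>I. i \<noteq> j \<longrightarrow> inner (q i) (q j) = 0))"
  using assms
proof (induction L arbitrary: \<delta>)
  case 0
  then show ?case by (intro exI[of _ 1]) auto
next
  case (Suc L)
  \<comment> \<open>\<open>\<eta>\<close> bounds the removed projection and then the effect of
    normalising, so \<open>2 * \<eta> \<le> \<delta>\<close> is needed, while
    \<open>\<eta> \<le> 1/2\<close> keeps the remainder away from zero. Each coefficient is at most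
    \<open>e' + \<delta>'\<close>; both bounds being \<open>\<eta> / (2 * (L + 1))\<close>, at most
    \<open>L\<close> coefficients sum to \<open>\<eta>\<close> or less.\<close>
  define \<eta> where "\<eta> = min (1/2) (\<delta> / 2)"
  define \<delta>' where "\<delta>' = min \<delta> (\<eta> / (2 * (real L + 1)))"
  have \<eta>: "0 < \<eta>" "\<eta> \<le> 1/2" "2 * \<eta> \<le> \<delta>" using Suc.prems by (auto simp: \<eta>_def min_def)
  have \<delta>': "0 < \<delta>'" "\<delta>' \<le> \<delta>" "\<delta>' \<le> \<eta> / (2 * (real L + 1))" using \<eta> Suc.prems by (auto simp: \<delta>'_def)
  obtain e where e: "0 < e" and ex: "\<forall>\<Theta> :: nat \<Rightarrow> 'a. \<forall>I \<subseteq> {..<L}.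
    (\<forall>i\<in>I. norm (\<Theta> i) = 1) \<and> (\<forall>i\<in>I. \<forall>j\<in>I. i \<noteq> j \<longrightarrow> \<bar>inner (\<Theta> i) (\<Theta> j)\<bar> \<le> e) \<longrightarrow>
    (\<exists>q. (\<forall>i\<in>I. norm (q i) = 1 \<and> dist (\<Theta> i) (q i) \<le> \<delta>') \<and>
         (\<forall>i\<in>I. \<forall>j\<in>I. i \<noteq> j \<longrightarrow> inner (q i) (q j) = 0))"
    using Suc.IH[OF \<delta>'(1)] by (elim exE conjE)
  note IH = ex[rule_format]
  define e' where "e' = min e (\<eta> / (2 * (real L + 1)))"
  have e': "0 < e'" "e' \<le> e" "e' \<le> \<eta> / (2 * (real L + 1))" using e \<eta> by (auto simp: e'_def)
  show ?case
  proof (intro exI[of _ e'] conjI allI impI, rule e'(1), elim conjE)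
    fix \<Theta> :: "nat \<Rightarrow> 'a" and I
    assume I: "I \<subseteq> {..<Suc L}" and unit: "\<forall>i\<in>I. norm (\<Theta> i) = 1"
      and small: "\<forall>i\<in>I. \<forall>j\<in>I. i \<noteq> j \<longrightarrow> \<bar>inner (\<Theta> i) (\<Theta> j)\<bar> \<le> e'"
    define I0 where "I0 = I - {L}"
    have I0: "I0 \<subseteq> {..<L}" using I by (auto simp: I0_def less_Suc_eq)
    have "finite I0" using I0 finite_subset by blast
    have card: "real (card I0) \<le> real L" using card_mono[OF _ I0] by simp
    obtain q where q: "\<And>i. i \<in> I0 \<Longrightarrow> norm (q i) = 1" "\<And>i. i \<in> I0 \<Longrightarrow> dist (\<Theta> i) (q i) \<le> \<delta>'"
      "\<And>i j. i \<in> I0 \<Longrightarrow> j \<in> I0 \<Longrightarrow> i \<noteq> j \<Longrightarrow> inner (q i) (q j) = 0"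
    proof -
      have "\<bar>inner (\<Theta> i) (\<Theta> j)\<bar> \<le> e" if "i \<in> I" "j \<in> I" "i \<noteq> j" for i j
        using small that e'(2) order_trans by blast
      then have "\<exists>q. (\<forall>i\<in>I0. norm (q i) = 1 \<and> dist (\<Theta> i) (q i) \<le> \<delta>') \<and>
         (\<forall>i\<in>I0. \<forall>j\<in>I0. i \<noteq> j \<longrightarrow> inner (q i) (q j) = 0)"
        using unit by (intro IH[OF I0]) (auto simp: I0_def)
      then obtain q where "(\<forall>i\<in>I0. norm (q i) = 1 \<and> dist (\<Theta> i) (q i) \<le> \<delta>') \<and>
         (\<forall>i\<in>I0. \<forall>j\<in>I0. i \<noteq> j \<longrightarrow> inner (q i) (q j) = 0)" ..
      then show ?thesis by (intro that[of q]) simp_all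
    qed
    show "\<exists>q. (\<forall>i\<in>I. norm (q i) = 1 \<and> dist (\<Theta> i) (q i) \<le> \<delta>) \<and>
         (\<forall>i\<in>I. \<forall>j\<in>I. i \<noteq> j \<longrightarrow> inner (q i) (q j) = 0)"
    proof (cases "L \<in> I")
      case False
      then have "I0 = I" by (auto simp: I0_def)
      then show ?thesis using q \<delta>'(2) by (intro exI[of _ q]) (auto intro: order_trans)
    next
      case True
      define p where "p = (\<Sum>i\<in>I0. inner (\<Theta> L) (q i) *\<^sub>R q i)"
      define w where "w = \<Theta> L - p"
      have np: "norm p \<le> \<eta>"
      proof -
        have "norm (inner (\<Theta> L) (q i) *\<^sub>R q i) \<le> \<eta> / (real L + 1)" if i: "i \<in> I0" for i
        proof -
          have "inner (\<Theta> L) (q i) = inner (\<Theta> L) (\<Theta> i) + inner (\<Theta> L) (q i - \<Theta> i)"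
            by (simp add: inner_diff_right)
          moreover have "\<bar>inner (\<Theta> L) (q i - \<Theta> i)\<bar> \<le> \<delta>'"
            using Cauchy_Schwarz_ineq2[of "\<Theta> L" "q i - \<Theta> i"] unit True q(2)[OF i]
            by (simp add: dist_norm norm_minus_commute)
          moreover have "\<bar>inner (\<Theta> L) (\<Theta> i)\<bar> \<le> e'" using small True i by (auto simp: I0_def)
          ultimately have "\<bar>inner (\<Theta> L) (q i)\<bar> \<le> e' + \<delta>'" by linarith
          also have "\<dots> \<le> \<eta> / (real L + 1)" using e'(3) \<delta>'(3) by (simp add: field_simps)
          finally show ?thesis using q(1)[OF i] by simp
        qed
        then have "norm p \<le> of_nat (card I0) * (\<eta> / (real L + 1))"
          unfolding p_def by (rule sum_norm_bound)
        also have "\<dots> \<le> (real L + 1) * (\<eta> / (real L + 1))"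
          using card \<eta> by (intro mult_right_mono) auto
        finally show ?thesis by simp
      qed
      have nw: "\<bar>norm w - 1\<bar> \<le> \<eta>"
        using norm_triangle_ineq3[of "\<Theta> L - p" "\<Theta> L"] np unit True by (simp add: w_def)
      then have w0: "norm w \<noteq> 0" "0 < norm w" using \<eta> by auto
      have orth: "inner w (q j) = 0" if j: "j \<in> I0" for j
      proof -
        have "inner p (q j) = (\<Sum>i\<in>I0. if i = j then inner (\<Theta> L) (q j) else 0)"
          unfolding p_def inner_sum_left
        proof (rule sum.cong)
          fix i assume i: "i \<in> I0"
          show "inner (inner (\<Theta> L) (q i) *\<^sub>R q i) (q j) = (if i = j then inner (\<Theta> L) (q j) else 0)"
            using q(3)[OF i j] q(1)[OF j] by (auto simp: dot_square_norm)
        qed simp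
        then show ?thesis using j \<open>finite I0\<close> by (simp add: w_def inner_diff_left)
      qed
      define q' where "q' = q(L := w /\<^sub>R norm w)"
      have "dist (\<Theta> L) (w /\<^sub>R norm w) \<le> dist (\<Theta> L) w + dist w (w /\<^sub>R norm w)" by (rule dist_triangle)
      also have "dist (\<Theta> L) w \<le> \<eta>" using np by (simp add: w_def dist_norm)
      also have "dist w (w /\<^sub>R norm w) = \<bar>norm w - 1\<bar>"
      proof -
        have "w - w /\<^sub>R norm w = (1 - inverse (norm w)) *\<^sub>R w" by (simp add: scaleR_diff_left)
        then have "norm (w - w /\<^sub>R norm w) = \<bar>1 - inverse (norm w)\<bar> * \<bar>norm w\<bar>" by simp
        also have "\<dots> = \<bar>(1 - inverse (norm w)) * norm w\<bar>" by (simp only: abs_mult)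
        also have "\<dots> = \<bar>norm w - 1\<bar>" using w0 by (simp add: left_diff_distrib)
        finally show ?thesis by (simp add: dist_norm)
      qed
      finally have "dist (\<Theta> L) (w /\<^sub>R norm w) \<le> \<delta>" using nw \<eta> by linarith
      then have a1: "norm (q' L) = 1" "dist (\<Theta> L) (q' L) \<le> \<delta>" using w0 by (auto simp: q'_def)
      have a2: "norm (q' i) = 1" "dist (\<Theta> i) (q' i) \<le> \<delta>" "inner (q' L) (q' i) = 0" if "i \<in> I0" for i
        using that q(1,2)[OF that] \<delta>'(2) orth[OF that] by (auto simp: q'_def I0_def)
      have a3: "inner (q' i) (q' j) = 0" if "i \<in> I0" "j \<in> I0" "i \<noteq> j" for i j
        using that q(3)[OF that] by (auto simp: q'_def I0_def)
      have "I = insert L I0" using True by (auto simp: I0_def)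
      then show ?thesis using a1 a2 a3 by (intro exI[of _ q']) (auto simp: inner_commute)
    qed
  qed
qed

text \<open>Sending \<open>u i\<close> to \<open>v i\<close> is well defined although
  \<open>u\<close> may repeat values: equal values of \<open>u\<close> have distance zero, hence so
  do the corresponding values of \<open>v\<close>.\<close>

lemma shape_of_isometric_families:
  fixes u v :: "'i \<Rightarrow> ell2"
  assumes "finite I" "I \<noteq> {}"
    and "\<And>i j. i \<in> I \<Longrightarrow> j \<in> I \<Longrightarrow> dist (u i) (u j) = dist (v i) (v j)"
  shows "shape_of (u ` I) = shape_of (v ` I)"
proof -
  define f where "f = v \<circ> inv_into I u"
  have f: "f (u i) = v i" if "i \<in> I" for i
  proof -
    have "inv_into I u (u i) \<in> I" "u (inv_into I u (u i)) = u i"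
      using that by (auto intro: inv_into_into f_inv_into_f)
    then have "dist (v (inv_into I u (u i))) (v i) = 0" using assms(3) that by (metis dist_self)
    then show ?thesis by (simp add: f_def)
  qed
  have "isometric_on (u ` I) f" using f assms(3) by (auto simp: isometric_on_def)
  moreover have "f ` u ` I = v ` I" using f by force
  ultimately have "compact_isometric (u ` I) (v ` I)"
    using assms by (auto simp: compact_isometric_iff intro: finite_imp_compact)
  then show ?thesis using shape_of_eq_iff assms by (auto simp: compact_isometric_def)
qed

lemma dist_shape_of_le:
  assumes "compact K" "K \<noteq> {}" "compact K'" "K' \<noteq> {}"
    and "\<And>x. x \<in> K \<Longrightarrow> \<exists>y\<in>K'. dist x y \<le> r" "\<And>y. y \<in> K' \<Longrightarrow> \<exists>x\<in>K. dist x y \<le> r"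
  shows "dist (shape_of K) (shape_of K') \<le> r"
  using dist_shape_le[OF assms(1-4)] hausdorff_dist_le_iff[OF assms(1-4), of r] assms(5,6)
  by fastforce

lemma dist_shape_of_families_le:
  fixes u v :: "'i \<Rightarrow> ell2"
  assumes "finite I" "I \<noteq> {}" "\<And>i. i \<in> I \<Longrightarrow> dist (u i) (v i) \<le> r"
  shows "dist (shape_of (u ` I)) (shape_of (v ` I)) \<le> r"
  using assms by (intro dist_shape_of_le) (auto intro: finite_imp_compact)

lemma norm_sum_orthogonal:
  fixes v :: "'i \<Rightarrow> 'a::real_inner"
  assumes "finite A" "\<And>i j. i \<in> A \<Longrightarrow> j \<in> A \<Longrightarrow> i \<noteq> j \<Longrightarrow> inner (v i) (v j) = 0"
  shows "(norm (\<Sum>i\<in>A. v i))\<^sup>2 = (\<Sum>i\<in>A. (norm (v i))\<^sup>2)"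
  using assms
proof (induction A rule: finite_induct)
  case (insert a A)
  have "inner (v a) (\<Sum>i\<in>A. v i) = 0"
    unfolding inner_sum_right using insert by (intro sum.neutral) auto
  then show ?case
    using insert by (simp add: power2_norm_eq_inner inner_add_left inner_add_right inner_commute)
qed simp

lemma inner_ell2_basis: "inner (ell2_basis i) (ell2_basis j) = (if i = j then 1 else 0)"
proof (cases "i = j")
  case True
  then show ?thesis by (simp add: dot_square_norm)
next
  case False
  have "coord (ell2_basis i) k * coord (ell2_basis j) k = 0" for k
    using False by (simp add: ell2_basis.rep_eq)
  then show ?thesis using False by (simp only: inner_ell2_def suminf_zero) simp
qed

text \<open>The path that walks along a new coordinate axis at each step. A zero length repeats a
  point, so empty cells do not alter the shape.\<close>

definition model_shape :: "nat \<Rightarrow> (nat \<Rightarrow> real) \<Rightarrow> shape"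
  where "model_shape L g = shape_of ((\<lambda>q. \<Sum>l<q. g l *\<^sub>R ell2_basis l) ` {..L})"

text \<open>A named predicate, so that \<open>\<epsilon>\<close> can be fixed before the dimension
  and the outcome enter. The angle condition is multiplied out by the norms, hence holds trivially
  for zero steps.\<close>

definition angle_tolerance :: "nat \<Rightarrow> real \<Rightarrow> real \<Rightarrow> real \<Rightarrow> bool"
  where "angle_tolerance L B \<delta> \<epsilon> \<longleftrightarrow> (\<forall>(w :: nat \<Rightarrow> ell2) g \<eta>.
    (\<forall>l<L. norm (w l) \<le> B \<and> \<bar>norm (w l) - g l\<bar> \<le> \<eta>) \<and>
    (\<forall>l<L. \<forall>l'<L. l \<noteq> l' \<longrightarrow> \<bar>inner (w l) (w l')\<bar> \<le> \<epsilon> * (norm (w l) * norm (w l'))) \<longrightarrow>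
    dist (shape_of ((\<lambda>q. \<Sum>l<q. w l) ` {..L})) (model_shape L g) \<le> \<delta> + real L * \<eta>)"

lemma angle_toleranceD:
  assumes "angle_tolerance L B \<delta> \<epsilon>" "\<And>l. l < L \<Longrightarrow> norm (w l) \<le> B" "\<And>l. l < L \<Longrightarrow> \<bar>norm (w l) - g l\<bar> \<le> \<eta>"
    and "\<And>l l'. l < L \<Longrightarrow> l' < L \<Longrightarrow> l \<noteq> l' \<Longrightarrow> \<bar>inner (w l) (w l')\<bar> \<le> \<epsilon> * (norm (w l) * norm (w l'))"
  shows "dist (shape_of ((\<lambda>q. \<Sum>l<q. w l) ` {..L})) (model_shape L g) \<le> \<delta> + real L * \<eta>"
  using assms unfolding angle_tolerance_def by blast

text \<open>Three paths link the two shapes. Replacing the directions of the nonzero steps by an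
  orthonormal system moves the path by at most \<open>\<delta>\<close>; passing to coordinate axes
  keeps the shape exactly, since by Pythagoras the distance of two partial sums involves only the
  lengths in between; correcting the lengths costs \<open>\<eta>\<close> per step.\<close>

lemma angle_tolerance_exists:
  fixes L :: nat and B \<delta> :: real
  assumes \<delta>: "0 < \<delta>" and B: "0 \<le> B"
  shows "\<exists>\<epsilon>>0. angle_tolerance L B \<delta> \<epsilon>"
proof -
  \<comment> \<open>At most \<open>L\<close> steps of length at most \<open>B\<close> are turned by
    \<open>\<delta>'\<close> each; the added ones avoid division by zero.\<close>
  define \<delta>' where "\<delta>' = \<delta> / ((real L + 1) * (B + 1))"
  have \<delta>': "0 < \<delta>'" using \<delta> B by (simp add: \<delta>'_def)
  obtain e where e: "0 < e" and ex: "\<forall>\<Theta> :: nat \<Rightarrow> ell2. \<forall>I \<subseteq> {..<L}.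
    (\<forall>i\<in>I. norm (\<Theta> i) = 1) \<and> (\<forall>i\<in>I. \<forall>j\<in>I. i \<noteq> j \<longrightarrow> \<bar>inner (\<Theta> i) (\<Theta> j)\<bar> \<le> e) \<longrightarrow>
    (\<exists>q. (\<forall>i\<in>I. norm (q i) = 1 \<and> dist (\<Theta> i) (q i) \<le> \<delta>') \<and>
         (\<forall>i\<in>I. \<forall>j\<in>I. i \<noteq> j \<longrightarrow> inner (q i) (q j) = 0))"
    using orthonormal_approx[OF \<delta>', of L] by (elim exE conjE)
  note orth = ex[rule_format]
  show ?thesis unfolding angle_tolerance_def
  proof (intro exI[of _ e] conjI allI impI, rule e, elim conjE)
    fix w :: "nat \<Rightarrow> ell2" and g \<eta>
    assume w: "\<forall>l<L. norm (w l) \<le> B \<and> \<bar>norm (w l) - g l\<bar> \<le> \<eta>"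
      and ang: "\<forall>l<L. \<forall>l'<L. l \<noteq> l' \<longrightarrow> \<bar>inner (w l) (w l')\<bar> \<le> e * (norm (w l) * norm (w l'))"
    define I where "I = {l. l < L \<and> w l \<noteq> 0}"
    have "\<bar>inner (w i /\<^sub>R norm (w i)) (w j /\<^sub>R norm (w j))\<bar> \<le> e" if "i \<in> I" "j \<in> I" "i \<noteq> j" for i j
    proof -
      have "\<bar>inner (w i) (w j)\<bar> \<le> e * (norm (w i) * norm (w j))" "norm (w i) \<noteq> 0" "norm (w j) \<noteq> 0"
        using that ang by (auto simp: I_def)
      then show ?thesis by (simp add: abs_mult field_simps)
    qed
    moreover have "norm (w i /\<^sub>R norm (w i)) = 1" if "i \<in> I" for i
      using that by (simp add: I_def)
    ultimately obtain q where q: "\<And>i. i \<in> I \<Longrightarrow> norm (q i) = 1"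
        "\<And>i. i \<in> I \<Longrightarrow> dist (w i /\<^sub>R norm (w i)) (q i) \<le> \<delta>'"
        "\<And>i j. i \<in> I \<Longrightarrow> j \<in> I \<Longrightarrow> i \<noteq> j \<Longrightarrow> inner (q i) (q j) = 0"
      using orth[of I "\<lambda>i. w i /\<^sub>R norm (w i)"] unfolding I_def by fastforce
    define W where "W = (\<lambda>m. \<Sum>l<m. w l)"
    define U where "U = (\<lambda>m. \<Sum>l<m. norm (w l) *\<^sub>R q l)"
    define V where "V = (\<lambda>m. \<Sum>l<m. norm (w l) *\<^sub>R ell2_basis l)"
    define G where "G = (\<lambda>m. \<Sum>l<m. g l *\<^sub>R ell2_basis l)"
    have "dist (W m) (U m) \<le> \<delta>" if m: "m \<le> L" for m
    proof -
      have "norm (w l - norm (w l) *\<^sub>R q l) \<le> B * \<delta>'" if "l < m" for l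
      proof (cases "w l = 0")
        case False
        then have l: "l \<in> I" using that m by (simp add: I_def)
        have "w l - norm (w l) *\<^sub>R q l = norm (w l) *\<^sub>R (w l /\<^sub>R norm (w l) - q l)"
          using False by (simp add: scaleR_diff_right)
        then have "norm (w l - norm (w l) *\<^sub>R q l) = norm (w l) * dist (w l /\<^sub>R norm (w l)) (q l)"
          by (simp add: dist_norm)
        also have "\<dots> \<le> B * \<delta>'" using q(2)[OF l] w that m B by (intro mult_mono) auto
        finally show ?thesis .
      qed (use B \<delta>' in simp)
      then have "norm (\<Sum>l<m. w l - norm (w l) *\<^sub>R q l) \<le> of_nat (card {..<m}) * (B * \<delta>')"
        by (intro sum_norm_bound) auto
      also have "\<dots> \<le> (real L + 1) * ((B + 1) * \<delta>')"
        using m B \<delta>' by (intro mult_mono) auto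
      also have "\<dots> = \<delta>"
      proof -
        have "(real L + 1) * (B + 1) \<noteq> 0" using B by simp
        then have "\<delta>' * ((real L + 1) * (B + 1)) = \<delta>" unfolding \<delta>'_def by (simp del: mult_eq_0_iff)
        then show ?thesis by (simp only: mult_ac)
      qed
      finally show ?thesis by (simp add: W_def U_def dist_norm sum_subtractf)
    qed
    then have 1: "dist (shape_of (W ` {..L})) (shape_of (U ` {..L})) \<le> \<delta>"
      by (intro dist_shape_of_families_le) auto
    have "dist (U i) (U j) = dist (V i) (V j)" if ij: "i \<le> L" "j \<le> L" "i \<le> j" for i j
    proof -
      have split: "(\<Sum>l<j. f l) - (\<Sum>l<i. f l) = (\<Sum>l\<in>{i..<j}. f l)" for f :: "nat \<Rightarrow> ell2"
        using ij(3) sum.atLeastLessThan_concat[of 0 i j f] by (simp add: lessThan_atLeast0 algebra_simps)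
      have "(dist (U i) (U j))\<^sup>2 = (norm (\<Sum>l\<in>{i..<j}. norm (w l) *\<^sub>R q l))\<^sup>2"
        by (simp add: U_def dist_norm norm_minus_commute[of "sum _ {..<i}"] split)
      also have "\<dots> = (\<Sum>l\<in>{i..<j}. (norm (norm (w l) *\<^sub>R q l))\<^sup>2)"
      proof (rule norm_sum_orthogonal)
        fix a b assume ab: "a \<in> {i..<j}" "b \<in> {i..<j}" "a \<noteq> b"
        show "inner (norm (w a) *\<^sub>R q a) (norm (w b) *\<^sub>R q b) = 0"
          using q(3)[of a b] ab ij by (cases "w a = 0 \<or> w b = 0") (auto simp: I_def)
      qed simp
      also have "\<dots> = (\<Sum>l\<in>{i..<j}. (norm (norm (w l) *\<^sub>R ell2_basis l))\<^sup>2)"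
      proof (rule sum.cong)
        fix l assume l: "l \<in> {i..<j}"
        show "(norm (norm (w l) *\<^sub>R q l))\<^sup>2 = (norm (norm (w l) *\<^sub>R ell2_basis l))\<^sup>2"
          using q(1)[of l] l ij by (cases "w l = 0") (auto simp: I_def)
      qed simp
      also have "\<dots> = (norm (\<Sum>l\<in>{i..<j}. norm (w l) *\<^sub>R ell2_basis l))\<^sup>2"
        by (rule norm_sum_orthogonal[symmetric]) (auto simp: inner_ell2_basis)
      also have "\<dots> = (dist (V i) (V j))\<^sup>2"
        by (simp add: V_def dist_norm norm_minus_commute[of "sum _ {..<i}"] split)
      finally show ?thesis by simp
    qed
    then have "dist (U i) (U j) = dist (V i) (V j)" if "i \<in> {..L}" "j \<in> {..L}" for i j
      using that nat_le_linear[of i j] by (metis atMost_iff dist_commute)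
    then have 2: "shape_of (U ` {..L}) = shape_of (V ` {..L})"
      by (intro shape_of_isometric_families) auto
    have "dist (V m) (G m) \<le> real L * \<eta>" if m: "m \<le> L" for m
    proof -
      have "norm (norm (w l) *\<^sub>R ell2_basis l - g l *\<^sub>R ell2_basis l) \<le> \<eta>" if "l < m" for l
        using w that m by (simp add: scaleR_diff_left[symmetric])
      then have "norm (\<Sum>l<m. norm (w l) *\<^sub>R ell2_basis l - g l *\<^sub>R ell2_basis l) \<le> of_nat (card {..<m}) * \<eta>"
        by (intro sum_norm_bound) auto
      also have "\<dots> \<le> real L * \<eta>"
      \<comment> \<open>The sign of \<open>\<eta>\<close> comes from the hypothesis on the lengths,
        which bounds an absolute value by \<open>\<eta>\<close> as soon as some index below
        \<open>L\<close> exists. If there is none, the factor \<open>real L\<close> is zero.\<close>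
      proof (cases "m = 0")
        case False
        then have "0 \<le> \<eta>" using w m by (metis abs_ge_zero less_le_trans not_gr_zero order_trans)
        then show ?thesis using m by (intro mult_right_mono) auto
      next
        case True
        have "0 \<le> real L * \<eta>"
        proof (cases "L = 0")
          case False
          then have "0 \<le> \<eta>" using w by (metis abs_ge_zero not_gr_zero order_trans)
          then show ?thesis by simp
        qed simp
        then show ?thesis using True by simp
      qed
      finally show ?thesis by (simp add: V_def G_def dist_norm sum_subtractf)
    qed
    then have 3: "dist (shape_of (V ` {..L})) (shape_of (G ` {..L})) \<le> real L * \<eta>"
      by (intro dist_shape_of_families_le) auto
    show "dist (shape_of ((\<lambda>q. \<Sum>l<q. w l) ` {..L})) (model_shape L g) \<le> \<delta> + real L * \<eta>"
      using 1 2 3 dist_triangle[of "shape_of (W ` {..L})" "shape_of (G ` {..L})" "shape_of (U ` {..L})"]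
      unfolding model_shape_def W_def[symmetric] G_def[symmetric] by simp
  qed
qed

section \<open>Measurability and the crinkled range\<close>

instance ell2 :: banach ..

text \<open>Each \<open>u i\<close> is a pointwise limit of simple functions. The shape of a simple
  family takes finitely many values on measurable pieces, and shapes converge because their distance
  is at most the sum of the distances of the members.\<close>

lemma measurable_shape_of_family:
  fixes u :: "'i \<Rightarrow> 'w \<Rightarrow> ell2"
  assumes I: "finite I" "I \<noteq> {}" and u: "\<And>i. i \<in> I \<Longrightarrow> u i \<in> borel_measurable M"
  shows "(\<lambda>\<omega>. shape_of ((\<lambda>i. u i \<omega>) ` I)) \<in> borel_measurable M"
proof -
  have "\<exists>F. (\<forall>k. simple_function M (F k)) \<and> (\<forall>\<omega>\<in>space M. (\<lambda>k. F k \<omega>) \<longlonglongrightarrow> u i \<omega>)" if "i \<in> I" for i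
    using borel_measurable_implies_sequence_metric[OF u[OF that], of 0] by blast
  then obtain F where F: "\<And>i k. i \<in> I \<Longrightarrow> simple_function M (F i k)"
    "\<And>i \<omega>. i \<in> I \<Longrightarrow> \<omega> \<in> space M \<Longrightarrow> (\<lambda>k. F i k \<omega>) \<longlonglongrightarrow> u i \<omega>"
    by metis
  show ?thesis
  proof (rule borel_measurable_LIMSEQ_metric)
    fix k
    \<comment> \<open>Collecting the family into one simple function lets it be composed with an
      arbitrary map, so the passage from a set to its shape raises no measurability
      question.\<close>
    define t where "t = (\<lambda>\<omega>. \<lambda>i\<in>I. F i k \<omega>)"
    have "simple_function M t"
      unfolding simple_function_def
    proof (intro conjI ballI)
      have "finite (PiE I (\<lambda>i. F i k ` space M))"
        using I F(1) by (intro finite_PiE) (auto simp: simple_function_def)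
      moreover have "t ` space M \<subseteq> PiE I (\<lambda>i. F i k ` space M)" by (auto simp: t_def)
      ultimately show "finite (t ` space M)" by (rule rev_finite_subset)
      fix s assume "s \<in> t ` space M"
      then have s: "s \<in> extensional I" by (auto simp: t_def)
      have "t -` {s} \<inter> space M = (\<Inter>i\<in>I. F i k -` {s i} \<inter> space M)"
        using I(2) s by (auto simp: t_def restrict_def extensional_def fun_eq_iff)
      also have "\<dots> \<in> sets M"
        using I F(1) by (intro sets.finite_INT) (auto intro: simple_functionD)
      finally show "t -` {s} \<inter> space M \<in> sets M" .
    qed
    then have "simple_function M (\<lambda>\<omega>. shape_of (t \<omega> ` I))"
      by (rule simple_function_compose1)
    then have "(\<lambda>\<omega>. shape_of (t \<omega> ` I)) \<in> borel_measurable M" by (rule borel_measurable_simple_function)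
    moreover have "t \<omega> ` I = (\<lambda>i. F i k \<omega>) ` I" for \<omega> by (auto simp: t_def)
    ultimately show "(\<lambda>\<omega>. shape_of ((\<lambda>i. F i k \<omega>) ` I)) \<in> borel_measurable M" by simp
  next
    fix \<omega> assume \<omega>: "\<omega> \<in> space M"
    show "(\<lambda>k. shape_of ((\<lambda>i. F i k \<omega>) ` I)) \<longlonglongrightarrow> shape_of ((\<lambda>i. u i \<omega>) ` I)"
    proof (rule tendsto_dist_iff[THEN iffD2], rule tendsto_sandwich[where f = "\<lambda>_. 0"])
      have "(\<lambda>k. \<Sum>i\<in>I. dist (F i k \<omega>) (u i \<omega>)) \<longlonglongrightarrow> (\<Sum>i\<in>I. 0)"
        by (intro tendsto_sum tendsto_dist_iff[THEN iffD1] F(2)[OF _ \<omega>])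
      then show "(\<lambda>k. \<Sum>i\<in>I. dist (F i k \<omega>) (u i \<omega>)) \<longlonglongrightarrow> 0" by simp
      show "\<forall>\<^sub>F k in sequentially. dist (shape_of ((\<lambda>i. F i k \<omega>) ` I)) (shape_of ((\<lambda>i. u i \<omega>) ` I))
          \<le> (\<Sum>i\<in>I. dist (F i k \<omega>) (u i \<omega>))"
      proof (intro always_eventually allI dist_shape_of_families_le I)
        fix k i assume i: "i \<in> I"
        show "dist (F i k \<omega>) (u i \<omega>) \<le> (\<Sum>i\<in>I. dist (F i k \<omega>) (u i \<omega>))"
          by (rule member_le_sum[OF i _ I(1)]) simp
      qed
    qed (auto intro: always_eventually)
  qed
qed

lemma walk_set_eq: "walk_set v c m = (\<lambda>k. (\<Sum>i=1..k. v i) /\<^sub>R sqrt c) ` {..m}"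
  by (auto simp: walk_set_def)

lemma measurable_walk_set:
  assumes "\<And>i. 1 \<le> i \<Longrightarrow> V i \<in> borel_measurable M"
  shows "(\<lambda>\<omega>. shape_of (walk_set (\<lambda>i. V i \<omega>) c m)) \<in> borel_measurable M"
  unfolding walk_set_eq using assms
  by (intro measurable_shape_of_family borel_measurable_scaleR borel_measurable_sum borel_measurable_const) auto

lemma norm_ell2_mono:
  assumes "\<And>k. \<bar>coord u k\<bar> \<le> \<bar>coord v k\<bar>"
  shows "norm u \<le> norm v"
proof -
  have "(norm u)\<^sup>2 \<le> (norm v)\<^sup>2"
    unfolding norm_ell2_sq using assms
    by (intro suminf_le summable_coord_sq) (simp add: abs_le_square_iff)
  then show ?thesis by (rule power2_le_imp_le) simp
qed

lemma coord_basis_sum: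
  assumes "finite F"
  shows "coord (\<Sum>k\<in>F. c k *\<^sub>R ell2_basis k) j = (if j \<in> F then c j else 0)"
proof -
  have "coord (\<Sum>k\<in>F. c k *\<^sub>R ell2_basis k) j = (\<Sum>k\<in>F. if k = j then c k else 0)"
    unfolding coord_sum by (rule sum.cong) (auto simp: scaleR_ell2.rep_eq ell2_basis.rep_eq)
  then show ?thesis using assms by simp
qed

text \<open>Once a finite \<open>F\<close> inside \<open>A\<close> contains the indices of
  \<open>A\<close> below \<open>N\<close>, its remainder is coordinatewise dominated by that of the
  ordinary partial sum up to \<open>N\<close>; this turns convergence of the series into unordered
  convergence.\<close>

lemma basis_has_sum:
  assumes u: "\<And>k. coord u k = (if k \<in> A then c k else 0)"
  shows "((\<lambda>k. c k *\<^sub>R ell2_basis k) has_sum u) A"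
  unfolding has_sum_def
proof (rule tendstoI)
  fix e :: real assume e: "0 < e"
  obtain N where N: "norm ((\<Sum>k<N. coord u k *\<^sub>R ell2_basis k) - u) < e"
    using LIMSEQ_D[OF ell2_basis_sums[of u, unfolded sums_def] e] by auto
  have "dist (\<Sum>k\<in>F. c k *\<^sub>R ell2_basis k) u < e" if F: "finite F" "A \<inter> {..<N} \<subseteq> F" "F \<subseteq> A" for F
  proof -
    have "norm ((\<Sum>k\<in>F. c k *\<^sub>R ell2_basis k) - u) \<le> norm ((\<Sum>k<N. coord u k *\<^sub>R ell2_basis k) - u)"
      using F by (intro norm_ell2_mono) (auto simp: minus_ell2.rep_eq coord_basis_sum u)
    then show ?thesis using N by (simp add: dist_norm)
  qed
  then show "\<forall>\<^sub>F F in finite_subsets_at_top A. dist (\<Sum>k\<in>F. c k *\<^sub>R ell2_basis k) u < e"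
    unfolding eventually_finite_subsets_at_top
    by (intro exI[of _ "A \<inter> {..<N}"]) auto
qed

lemma bounded_linear_coord: "bounded_linear (\<lambda>u. coord u k)"
  by (rule bounded_linear_intro[of _ 1])
    (use abs_coord_le in \<open>auto simp: plus_ell2.rep_eq scaleR_ell2.rep_eq\<close>)

lemma coord_of_basis_has_sum:
  assumes "((\<lambda>k. c k *\<^sub>R ell2_basis k) has_sum u) A"
  shows "coord u j = (if j \<in> A then c j else 0)"
proof -
  have 1: "((\<lambda>k. coord (c k *\<^sub>R ell2_basis k) j) has_sum coord u j) A"
    by (rule has_sum_bounded_linear[OF bounded_linear_coord assms])
  have "((\<lambda>k. coord (c k *\<^sub>R ell2_basis k) j) has_sum (if j \<in> A then c j else 0)) A"
    by (rule has_sum_finite_neutralI[of "A \<inter> {j}"]) (auto simp: scaleR_ell2.rep_eq ell2_basis.rep_eq)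
  with 1 show ?thesis by (rule has_sum_unique)
qed

text \<open>A sum exists exactly when its only possible coordinates, \<open>c k\<close> on
  \<open>A\<close> and zero elsewhere, are square-summable.\<close>

lemma summable_on_basis_iff:
  "(\<lambda>k. c k *\<^sub>R ell2_basis k) summable_on A \<longleftrightarrow> summable (\<lambda>k. if k \<in> A then (c k)\<^sup>2 else 0)"
proof
  assume "(\<lambda>k. c k *\<^sub>R ell2_basis k) summable_on A"
  then obtain u where u: "((\<lambda>k. c k *\<^sub>R ell2_basis k) has_sum u) A" by (auto simp: summable_on_def)
  have "(\<lambda>k. (coord u k)\<^sup>2) = (\<lambda>k. if k \<in> A then (c k)\<^sup>2 else 0)"
    using coord_of_basis_has_sum[OF u] by auto
  then show "summable (\<lambda>k. if k \<in> A then (c k)\<^sup>2 else 0)" using summable_coord_sq[of u] by simp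
next
  assume s: "summable (\<lambda>k. if k \<in> A then (c k)\<^sup>2 else 0)"
  have "(\<lambda>k. if k \<in> A then (c k)\<^sup>2 else 0) = (\<lambda>k. (if k \<in> A then c k else 0)\<^sup>2)" by auto
  with s have "coord (Abs_ell2 (\<lambda>k. if k \<in> A then c k else 0)) k = (if k \<in> A then c k else 0)" for k
    by (simp add: Abs_ell2_inverse)
  from basis_has_sum[OF this] show "(\<lambda>k. c k *\<^sub>R ell2_basis k) summable_on A"
    by (auto simp: summable_on_def)
qed

section \<open>Finite truncations of the crinkled path and compactness of its range\<close>

definition crinkled_part :: "(nat \<Rightarrow> real) \<Rightarrow> (nat \<Rightarrow> ennreal) \<Rightarrow> nat set \<Rightarrow> real \<Rightarrow> ell2"
  where "crinkled_part x y B t = (\<Sum>k\<in>{k\<in>B. x k \<le> t}. sqrt (enn2real (y k)) *\<^sub>R ell2_basis k)"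

text \<open>The test occurring in \<open>crinkled_range\<close>, rewritten for the squared
  coefficients, which are the sizes \<open>enn2real (y k)\<close> themselves.\<close>

definition crinkled_summable :: "(nat \<Rightarrow> real) \<Rightarrow> (nat \<Rightarrow> ennreal) \<Rightarrow> real \<Rightarrow> bool"
  where "crinkled_summable x y T \<longleftrightarrow> summable (\<lambda>k. if x k \<le> T then enn2real (y k) else 0)"

lemma crinkled_range_eq:
  "crinkled_range x y T = (if crinkled_summable x y T then closure (crinkled x y ` {0..T}) else {0})"
  by (simp add: crinkled_range_def crinkled_summable_def summable_on_basis_iff cong: if_cong)

lemma coord_crinkled:
  assumes "crinkled_summable x y T" "t \<le> T"
  shows "coord (crinkled x y t) k = (if x k \<le> t then sqrt (enn2real (y k)) else 0)"
proof -
  have "summable (\<lambda>k. if x k \<le> t then enn2real (y k) else 0)"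
    using assms(1)[unfolded crinkled_summable_def]
    by (rule summable_comparison_test'[where N = 0]) (use assms(2) in auto)
  then have "(\<lambda>k. sqrt (enn2real (y k)) *\<^sub>R ell2_basis k) summable_on {k. x k \<le> t}"
    by (simp add: summable_on_basis_iff cong: if_cong)
  then have "((\<lambda>k. sqrt (enn2real (y k)) *\<^sub>R ell2_basis k) has_sum crinkled x y t) {k. x k \<le> t}"
    unfolding crinkled_def by (rule has_sum_infsum)
  from coord_of_basis_has_sum[OF this, of k] show ?thesis by simp
qed

text \<open>The omitted jumps occupy separate coordinates, so the squared error at time
  \<open>t\<close> is the sum of the omitted sizes up to \<open>t\<close>. Bounding it by the sum up
  to \<open>T\<close> makes the estimate uniform in \<open>t\<close>.\<close>

lemma dist_crinkled_part:
  assumes s: "crinkled_summable x y T" and t: "t \<le> T" and B: "finite B"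
  shows "dist (crinkled x y t) (crinkled_part x y B t)
    \<le> sqrt (\<Sum>k. if x k \<le> T \<and> k \<notin> B then enn2real (y k) else 0)"
proof -
  define u where "u = crinkled x y t - crinkled_part x y B t"
  have c: "coord u k = (if x k \<le> t \<and> k \<notin> B then sqrt (enn2real (y k)) else 0)" for k
    using B by (simp add: u_def minus_ell2.rep_eq coord_crinkled[OF s t] crinkled_part_def coord_basis_sum)
  have "(norm u)\<^sup>2 \<le> (\<Sum>k. if x k \<le> T \<and> k \<notin> B then enn2real (y k) else 0)"
    unfolding norm_ell2_sq
  proof (rule suminf_le[OF _ summable_coord_sq])
    show "(coord u k)\<^sup>2 \<le> (if x k \<le> T \<and> k \<notin> B then enn2real (y k) else 0)" for k
      using t by (simp add: c)
    show "summable (\<lambda>k. if x k \<le> T \<and> k \<notin> B then enn2real (y k) else 0)"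
      using s[unfolded crinkled_summable_def]
      by (rule summable_comparison_test'[where N = 0]) auto
  qed
  then have "sqrt ((norm u)\<^sup>2) \<le> sqrt (\<Sum>k. if x k \<le> T \<and> k \<notin> B then enn2real (y k) else 0)"
    by (rule real_sqrt_le_mono)
  then show ?thesis by (simp add: u_def dist_norm)
qed

lemma crinkled_tail:
  assumes s: "crinkled_summable x y T" and e: "0 < e"
  obtains N where "\<And>m. N \<le> m \<Longrightarrow>
    sqrt (\<Sum>k. if x k \<le> T \<and> k \<notin> {..<m} then enn2real (y k) else 0) < e"
proof -
  define f where "f = (\<lambda>k. if x k \<le> T then enn2real (y k) else 0)"
  have f: "summable f" using s by (simp add: crinkled_summable_def f_def)
  obtain N where N: "\<And>m. m \<ge> N \<Longrightarrow> norm (\<Sum>k. f (k + m)) < e\<^sup>2"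
    using suminf_exist_split[OF _ f, of "e\<^sup>2"] e by auto
  have "sqrt (\<Sum>k. if x k \<le> T \<and> k \<notin> {..<m} then enn2real (y k) else 0) < e" if "N \<le> m" for m
  proof -
    define g where "g = (\<lambda>k. if x k \<le> T \<and> k \<notin> {..<m} then enn2real (y k) else 0)"
    have "summable g"
      using f by (rule summable_comparison_test'[where N = 0]) (auto simp: f_def g_def)
    from suminf_split_initial_segment[OF this, of m]
    have "suminf g = (\<Sum>k. f (k + m))" by (simp add: g_def f_def)
    then have "suminf g < e\<^sup>2" using N[OF that] by simp
    then have "sqrt (suminf g) < sqrt (e\<^sup>2)" by (rule real_sqrt_less_mono)
    then show ?thesis using e by (simp add: g_def)
  qed
  then show ?thesis by (rule that)
qed

lemma finite_crinkled_part: "finite B \<Longrightarrow> finite (crinkled_part x y B ` S)"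
proof -
  assume B: "finite B"
  have "crinkled_part x y B ` S \<subseteq> (\<lambda>C. \<Sum>k\<in>C. sqrt (enn2real (y k)) *\<^sub>R ell2_basis k) ` Pow B"
    by (auto simp: crinkled_part_def)
  then show ?thesis by (rule finite_subset) (use B in simp)
qed

text \<open>Total boundedness: a path with finitely many jumps takes finitely many values, and these
  form a net because the tail is small uniformly in time.\<close>

lemma compact_crinkled_range: "0 \<le> T \<Longrightarrow> compact (crinkled_range x y T)"
proof (cases "crinkled_summable x y T")
  case True
  have "compact (closure (crinkled x y ` {0..T}))"
    unfolding compact_eq_totally_bounded
  proof (intro conjI allI impI)
    show "Topological_Spaces.complete (closure (crinkled x y ` {0..T}))" by (simp add: complete_eq_closed)
    fix e :: real assume e: "0 < e"
    obtain N where N: "\<And>m. N \<le> m \<Longrightarrow>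
      sqrt (\<Sum>k. if x k \<le> T \<and> k \<notin> {..<m} then enn2real (y k) else 0) < e / 2"
      using crinkled_tail[OF True, of "e / 2"] e by auto
    let ?F = "crinkled_part x y {..<N} ` {0..T}"
    have "closure (crinkled x y ` {0..T}) \<subseteq> (\<Union>z\<in>?F. ball z e)"
    proof
      fix u assume "u \<in> closure (crinkled x y ` {0..T})"
      then obtain t where t: "t \<in> {0..T}" "dist (crinkled x y t) u < e / 2"
        using e by (auto simp: closure_approachable dest: spec[of _ "e / 2"])
      have "dist (crinkled x y t) (crinkled_part x y {..<N} t) < e / 2"
        using dist_crinkled_part[OF True, of t "{..<N}"] t N[of N] by simp
      then have "dist (crinkled_part x y {..<N} t) u < e"
        using t(2) dist_triangle[of "crinkled_part x y {..<N} t" u "crinkled x y t"] by (simp add: dist_commute)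
      then show "u \<in> (\<Union>z\<in>?F. ball z e)" using t(1) by auto
    qed
    then show "\<exists>k. finite k \<and> closure (crinkled x y ` {0..T}) \<subseteq> (\<Union>z\<in>k. ball z e)"
      using finite_crinkled_part[of "{..<N}" x y "{0..T}"] by blast
  qed
  then show ?thesis using True by (simp add: crinkled_range_eq)
qed (simp add: crinkled_range_eq)

lemma crinkled_range_nonempty: "0 \<le> T \<Longrightarrow> crinkled_range x y T \<noteq> {}"
  by (simp add: crinkled_range_eq)

text \<open>The uniform estimate along the path extends to its closure, since the points within
  \<open>r\<close> of the finite set of truncated values form a closed set.\<close>

lemma dist_shape_crinkled_range:
  assumes s: "crinkled_summable x y T" and T: "0 \<le> T" and B: "finite B"
    and tail: "sqrt (\<Sum>k. if x k \<le> T \<and> k \<notin> B then enn2real (y k) else 0) \<le> r"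
  shows "dist (shape_of (crinkled_range x y T)) (shape_of (crinkled_part x y B ` {0..T})) \<le> r"
proof (rule dist_shape_of_le[OF compact_crinkled_range[OF T] crinkled_range_nonempty[OF T]])
  let ?F = "crinkled_part x y B ` {0..T}"
  have F: "compact ?F" "?F \<noteq> {}" using finite_crinkled_part[OF B] T by (auto intro: finite_imp_compact)
  then show "compact ?F" "?F \<noteq> {}" by auto
  have d: "dist (crinkled x y t) (crinkled_part x y B t) \<le> r" if "t \<in> {0..T}" for t
    using dist_crinkled_part[OF s _ B, of t] that tail by simp
  have "crinkled x y ` {0..T} \<subseteq> {u. infdist u ?F \<le> r}"
    using d F by (auto intro: infdist_le2)
  moreover have "closed {u. infdist u ?F \<le> r}"
    by (intro closed_Collect_le continuous_intros)
  ultimately have "crinkled_range x y T \<subseteq> {u. infdist u ?F \<le> r}"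
    unfolding crinkled_range_eq using s by (simp add: closure_minimal)
  then show "\<exists>z\<in>?F. dist u z \<le> r" if "u \<in> crinkled_range x y T" for u
    using that infdist_le_iff_compact[OF F] by auto
  show "\<exists>u\<in>crinkled_range x y T. dist u z \<le> r" if "z \<in> ?F" for z
  proof -
    from that obtain t where "t \<in> {0..T}" "z = crinkled_part x y B t" by auto
    then show ?thesis using d[of t] s closure_subset[of "crinkled x y ` {0..T}"]
      by (intro bexI[of _ "crinkled x y t"]) (auto simp: crinkled_range_eq)
  qed
qed

text \<open>A path with finitely many jumps has only its value at time 0 and its values at jump
  times. Index \<open>m\<close> and jumps after \<open>T\<close> are sent to time 0, so the family
  has a finite index set independent of the outcome, as measurability of its shape requires.\<close>

lemma crinkled_part_image_eq:
  fixes m :: nat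
  assumes T: "0 \<le> T" and x: "\<And>k. 0 \<le> x k"
  shows "crinkled_part x y {..<m} ` {0..T}
    = (\<lambda>j. crinkled_part x y {..<m} (if j < m \<and> x j \<le> T then x j else 0)) ` {..m}"
proof (intro equalityI subsetI)
  fix u assume "u \<in> crinkled_part x y {..<m} ` {0..T}"
  then obtain t where t: "0 \<le> t" "t \<le> T" "u = crinkled_part x y {..<m} t" by auto
  define C where "C = {k\<in>{..<m}. x k \<le> t}"
  show "u \<in> (\<lambda>j. crinkled_part x y {..<m} (if j < m \<and> x j \<le> T then x j else 0)) ` {..m}"
  proof (cases "C = {}")
    case True
    then have "{k\<in>{..<m}. x k \<le> 0} = {}" using t(1) by (force simp: C_def)
    then have "u = crinkled_part x y {..<m} 0"
      unfolding t(3) crinkled_part_def C_def[symmetric] True by (simp only:)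
    then show ?thesis by (intro image_eqI[of _ _ m]) auto
  next
    case False
    have "finite C" by (simp add: C_def)
    then have "Max (x ` C) \<in> x ` C" using False by (intro Max_in) auto
    then obtain j where j: "j \<in> C" "x j = Max (x ` C)" by auto
    then have "\<And>k. k \<in> C \<Longrightarrow> x k \<le> x j" using \<open>finite C\<close> by simp
    note j = j(1) this
    then have "C = {k\<in>{..<m}. x k \<le> x j}" by (fastforce simp: C_def)
    then have "u = crinkled_part x y {..<m} (x j)" using t(3) by (simp add: crinkled_part_def C_def)
    then show ?thesis using j(1) t by (intro image_eqI[of _ _ j]) (auto simp: C_def)
  qed
qed (use T x in \<open>auto\<close>)

text \<open>On the event of summability the shapes of the truncations converge to the shape of the
  range; elsewhere the range is the constant \<open>{0}\<close>.\<close>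

lemma measurable_crinkled_range:
  assumes x: "\<And>k. x k \<in> borel_measurable P" "\<And>k \<omega>. \<omega> \<in> space P \<Longrightarrow> 0 \<le> x k \<omega>"
    and y: "\<And>k. y k \<in> borel_measurable P" and T: "0 \<le> T"
  shows "(\<lambda>\<omega>. shape_of (crinkled_range (\<lambda>k. x k \<omega>) (\<lambda>k. y k \<omega>) T)) \<in> borel_measurable P"
proof -
  note [measurable] = x(1) y
  define F where "F = (\<lambda>m \<omega>. shape_of ((\<lambda>j. crinkled_part (\<lambda>k. x k \<omega>) (\<lambda>k. y k \<omega>) {..<m}
    (if j < m \<and> x j \<omega> \<le> T then x j \<omega> else 0)) ` {..m}))"
  have "crinkled_part x' y' {..<m} t = (\<Sum>k<m. (if x' k \<le> t then sqrt (enn2real (y' k)) else 0) *\<^sub>R ell2_basis k)"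
    for x' y' t and m :: nat
  proof -
    have "(\<Sum>k<m. (if x' k \<le> t then sqrt (enn2real (y' k)) else 0) *\<^sub>R ell2_basis k)
      = (\<Sum>k<m. (if x' k \<le> t then sqrt (enn2real (y' k)) *\<^sub>R ell2_basis k else 0))"
      by (rule sum.cong) auto
    then show ?thesis unfolding crinkled_part_def by (subst sum.inter_filter) auto
  qed
  note part = this
  have jump: "(\<lambda>\<omega>. if x k \<omega> \<le> \<tau> \<omega> then sqrt (enn2real (y k \<omega>)) else 0) \<in> borel_measurable P"
    if [measurable]: "\<tau> \<in> borel_measurable P" for k \<tau>
    by measurable
  have "(\<lambda>\<omega>. if j < m \<and> x j \<omega> \<le> T then x j \<omega> else 0) \<in> borel_measurable P" for m j
    by (cases "j < m") simp_all
  from jump[OF this] have "(\<lambda>\<omega>. crinkled_part (\<lambda>k. x k \<omega>) (\<lambda>k. y k \<omega>) {..<m}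
      (if j < m \<and> x j \<omega> \<le> T then x j \<omega> else 0)) \<in> borel_measurable P" for m j
    unfolding part by (rule borel_measurable_sum[OF borel_measurable_scaleR[OF _ borel_measurable_const]])
  then have "F m \<in> borel_measurable P" for m
    unfolding F_def by (intro measurable_shape_of_family) auto
  moreover have "Measurable.pred P (\<lambda>\<omega>. crinkled_summable (\<lambda>k. x k \<omega>) (\<lambda>k. y k \<omega>) T)"
  proof -
    \<comment> \<open>Finiteness of an extended nonnegative series is visibly a measurable
      condition, while \<open>summable\<close> is an existence statement.\<close>
    have "crinkled_summable x' y' T \<longleftrightarrow> (\<Sum>k. ennreal (if x' k \<le> T then enn2real (y' k) else 0)) \<noteq> top" for x' y'
      unfolding crinkled_summable_def
    proof
      assume "summable (\<lambda>k. if x' k \<le> T then enn2real (y' k) else 0)"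
      from suminf_ennreal2[OF _ this]
      show "(\<Sum>k. ennreal (if x' k \<le> T then enn2real (y' k) else 0)) \<noteq> top" by simp
    next
      assume "(\<Sum>k. ennreal (if x' k \<le> T then enn2real (y' k) else 0)) \<noteq> top"
      then show "summable (\<lambda>k. if x' k \<le> T then enn2real (y' k) else 0)"
        by (rule summable_suminf_not_top[rotated]) simp
    qed
    then show ?thesis by simp
  qed
  ultimately have 1: "(\<lambda>\<omega>. if crinkled_summable (\<lambda>k. x k \<omega>) (\<lambda>k. y k \<omega>) T then F m \<omega> else shape_of {0})
      \<in> borel_measurable P" for m
    by (intro measurable_If) auto
  show ?thesis
  proof (rule borel_measurable_LIMSEQ_metric[OF 1])
    fix \<omega> assume \<omega>: "\<omega> \<in> space P"
    show "(\<lambda>m. if crinkled_summable (\<lambda>k. x k \<omega>) (\<lambda>k. y k \<omega>) T then F m \<omega> else shape_of {0})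
      \<longlonglongrightarrow> shape_of (crinkled_range (\<lambda>k. x k \<omega>) (\<lambda>k. y k \<omega>) T)"
    proof (cases "crinkled_summable (\<lambda>k. x k \<omega>) (\<lambda>k. y k \<omega>) T")
      case True
      have "(\<lambda>m. F m \<omega>) \<longlonglongrightarrow> shape_of (crinkled_range (\<lambda>k. x k \<omega>) (\<lambda>k. y k \<omega>) T)"
      proof (rule metric_LIMSEQ_I)
        fix r :: real assume r: "0 < r"
        obtain N where N: "\<And>m. N \<le> m \<Longrightarrow>
          sqrt (\<Sum>k. if x k \<omega> \<le> T \<and> k \<notin> {..<m} then enn2real (y k \<omega>) else 0) < r / 2"
          using crinkled_tail[OF True, of "r / 2"] r by auto
        have "dist (F m \<omega>) (shape_of (crinkled_range (\<lambda>k. x k \<omega>) (\<lambda>k. y k \<omega>) T)) < r" if "N \<le> m" for m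
        proof -
          have "F m \<omega> = shape_of (crinkled_part (\<lambda>k. x k \<omega>) (\<lambda>k. y k \<omega>) {..<m} ` {0..T})"
            unfolding F_def by (subst crinkled_part_image_eq[OF T]) (use x(2)[OF \<omega>] in auto)
          then show ?thesis
            using dist_shape_crinkled_range[OF True T, of "{..<m}" "r / 2"] N[OF that] r
            by (simp add: dist_commute)
        qed
        then show "\<exists>no. \<forall>n\<ge>no. dist (F n \<omega>) (shape_of (crinkled_range (\<lambda>k. x k \<omega>) (\<lambda>k. y k \<omega>) T)) < r" by blast
      qed
      then show ?thesis using True by simp
    qed (simp add: crinkled_range_eq)
  qed
qed

section \<open>Kolmogorov's maximal inequality\<close>

text \<open>By independence the joint law is a product, and boundedness of \<open>U\<close> with
  integrability of \<open>Y\<close> permits Fubini; for fixed \<open>u\<close> the inner integral is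
  the inner product of \<open>u\<close> with the mean of \<open>Y\<close>, which is zero.\<close>

lemma (in prob_space) expectation_inner_indep:
  fixes U Y :: "'a \<Rightarrow> 'b::{real_inner, banach, second_countable_topology}"
  assumes ind: "indep_var borel U borel Y" and U: "\<And>\<omega>. norm (U \<omega>) \<le> c"
    and Y: "integrable M Y" and EY: "expectation Y = 0"
  shows "expectation (\<lambda>\<omega>. inner (U \<omega>) (Y \<omega>)) = 0"
proof -
  have mU: "U \<in> borel_measurable M" and mY: "Y \<in> borel_measurable M"
    and dist: "distr M borel U \<Otimes>\<^sub>M distr M borel Y = distr M (borel \<Otimes>\<^sub>M borel) (\<lambda>\<omega>. (U \<omega>, Y \<omega>))"
    using ind by (auto simp: indep_var_distribution_eq)
  have c: "0 \<le> c" using U[of undefined] norm_ge_zero order_trans by blast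
  interpret DU: prob_space "distr M borel U" by (rule prob_space_distr[OF mU])
  interpret DY: prob_space "distr M borel Y" by (rule prob_space_distr[OF mY])
  interpret pair_sigma_finite "distr M borel U" "distr M borel Y" ..
  have mi: "(\<lambda>z. inner (fst z) (snd z)) \<in> borel_measurable (borel \<Otimes>\<^sub>M (borel :: 'b measure))"
    by measurable
  have mp: "(\<lambda>\<omega>. (U \<omega>, Y \<omega>)) \<in> M \<rightarrow>\<^sub>M borel \<Otimes>\<^sub>M borel"
    using mU mY by measurable
  have int: "integrable M (\<lambda>\<omega>. inner (U \<omega>) (Y \<omega>))"
  proof (rule Bochner_Integration.integrable_bound)
    show "integrable M (\<lambda>\<omega>. c * norm (Y \<omega>))" using Y by simp
    show "(\<lambda>\<omega>. inner (U \<omega>) (Y \<omega>)) \<in> borel_measurable M" using mU mY by measurable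
    have "\<bar>inner (U \<omega>) (Y \<omega>)\<bar> \<le> c * norm (Y \<omega>)" for \<omega>
      using Cauchy_Schwarz_ineq2[of "U \<omega>" "Y \<omega>"] mult_right_mono[OF U[of \<omega>] norm_ge_zero[of "Y \<omega>"]] by linarith
    then show "AE \<omega> in M. norm (inner (U \<omega>) (Y \<omega>)) \<le> norm (c * norm (Y \<omega>))"
      using c by simp
  qed
  have "expectation (\<lambda>\<omega>. inner (U \<omega>) (Y \<omega>))
      = (\<integral>z. inner (fst z) (snd z) \<partial>distr M (borel \<Otimes>\<^sub>M borel) (\<lambda>\<omega>. (U \<omega>, Y \<omega>)))"
    using integral_distr[OF mp mi] by simp
  also have "\<dots> = (\<integral>z. inner (fst z) (snd z) \<partial>(distr M borel U \<Otimes>\<^sub>M distr M borel Y))"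
    by (simp only: dist)
  also have "\<dots> = (\<integral>u. (\<integral>y. inner u y \<partial>distr M borel Y) \<partial>distr M borel U)"
  proof -
    have "integrable (distr M borel U \<Otimes>\<^sub>M distr M borel Y) (\<lambda>z. inner (fst z) (snd z))"
      unfolding dist using int by (subst integrable_distr_eq[OF mp mi]) simp
    from integral_fst'[OF this] show ?thesis by simp
  qed
  also have "\<dots> = 0"
  proof -
    have "(\<integral>y. inner u y \<partial>distr M borel Y) = 0" for u
    proof -
      have "integrable (distr M borel Y) (\<lambda>y. y)" using Y by (subst integrable_distr_eq[OF mY]) simp_all
      then have "(\<integral>y. inner u y \<partial>distr M borel Y) = inner u (\<integral>y. y \<partial>distr M borel Y)"
        by (rule integral_inner_right)
      also have "(\<integral>y. y \<partial>distr M borel Y) = 0" using EY by (subst integral_distr[OF mY]) simp_all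
      finally show ?thesis by simp
    qed
    then show ?thesis by simp
  qed
  finally show ?thesis .
qed

text \<open>
  Partial sums frozen once they leave the ball of radius \<open>c\<close>: the maximum reaches \<open>c\<close> iff the frozen
  sum at the final time does, and its second moment grows no faster than that of the free sum.
\<close>

fun stopped_sum :: "real \<Rightarrow> (nat \<Rightarrow> 'b::real_normed_vector) \<Rightarrow> nat \<Rightarrow> 'b" where
  "stopped_sum c v 0 = 0"
| "stopped_sum c v (Suc k) =
    (if c \<le> norm (stopped_sum c v k) then stopped_sum c v k else stopped_sum c v k + v (Suc k))"

lemma stopped_sum_mono: "c \<le> norm (stopped_sum c v j) \<Longrightarrow> j \<le> k \<Longrightarrow> c \<le> norm (stopped_sum c v k)"
  by (induction k) (auto simp: le_Suc_eq)

lemma stopped_sum_cases: "stopped_sum c v k = (\<Sum>i=1..k. v i) \<or> c \<le> norm (stopped_sum c v k)"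
  by (induction k) auto

lemma stopped_sum_hits: "c \<le> norm (\<Sum>i=1..j. v i) \<Longrightarrow> j \<le> k \<Longrightarrow> c \<le> norm (stopped_sum c v k)"
  using stopped_sum_cases[of c v j] stopped_sum_mono[of c v j k] by auto

lemma stopped_sum_cong: "(\<And>i. 1 \<le> i \<Longrightarrow> i \<le> k \<Longrightarrow> v i = w i) \<Longrightarrow> stopped_sum c v k = stopped_sum c w k"
  by (induction k) auto

lemma norm_stopped_sum_le: "0 \<le> B \<Longrightarrow> (\<And>i. norm (v i) \<le> B) \<Longrightarrow> norm (stopped_sum c v k) \<le> real k * B"
proof (induction k)
  case (Suc k)
  then have IH: "norm (stopped_sum c v k) \<le> real k * B" by simp
  have "norm (stopped_sum c v k + v (Suc k)) \<le> real k * B + B"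
    using IH Suc.prems(2)[of "Suc k"] norm_triangle_ineq[of "stopped_sum c v k" "v (Suc k)"] by linarith
  then show ?case using IH Suc.prems(1) by (auto simp: distrib_right)
qed simp

lemma measurable_stopped_sum:
  fixes c :: real
  shows "k \<le> m \<Longrightarrow> (\<lambda>v. stopped_sum c v k)
    \<in> borel_measurable (PiM {1..m} (\<lambda>_. borel :: 'b::{real_normed_vector, second_countable_topology} measure))"
proof (induction k)
  case (Suc k)
  then have [measurable]: "(\<lambda>v. stopped_sum c v k) \<in> borel_measurable (PiM {1..m} (\<lambda>_. borel :: 'b measure))"
    by simp
  have [measurable]: "(\<lambda>v. v (Suc k)) \<in> borel_measurable (PiM {1..m} (\<lambda>_. borel :: 'b measure))"
    using Suc.prems by (intro measurable_component_singleton) auto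
  show ?case unfolding stopped_sum.simps by measurable
qed simp

lemma (in prob_space) Kolmogorov_maximal_inequality:
  fixes Y :: "nat \<Rightarrow> 'a \<Rightarrow> 'b::{real_inner, banach, second_countable_topology}"
  assumes ind: "indep_vars (\<lambda>_. borel) Y {1..}"
    and Y: "\<And>i \<omega>. norm (Y i \<omega>) \<le> B" and EY: "\<And>i. 1 \<le> i \<Longrightarrow> expectation (Y i) = 0" and c: "0 < c"
  shows "prob {\<omega>\<in>space M. \<exists>k\<le>m. c \<le> norm (\<Sum>i=1..k. Y i \<omega>)} \<le> (\<Sum>i=1..m. expectation (\<lambda>\<omega>. (norm (Y i \<omega>))\<^sup>2)) / c\<^sup>2"
    and "{\<omega>\<in>space M. \<exists>k\<le>m. c \<le> norm (\<Sum>i=1..k. Y i \<omega>)} \<in> events"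
proof -
  have B: "0 \<le> B" using Y[of 0 undefined] norm_ge_zero order_trans by blast
  have mY [measurable]: "Y i \<in> borel_measurable M" if "1 \<le> i" for i
    using ind that by (auto simp: indep_vars_def)
  define V where "V = (\<lambda>k \<omega>. stopped_sum c (\<lambda>i. Y i \<omega>) k)"
  have V_restrict: "V k \<omega> = stopped_sum c (restrict (\<lambda>i. Y i \<omega>) {1..k}) k" for k \<omega>
    unfolding V_def by (rule stopped_sum_cong) auto
  have mrestr: "(\<lambda>\<omega>. restrict (\<lambda>i. Y i \<omega>) {1..k}) \<in> M \<rightarrow>\<^sub>M PiM {1..k} (\<lambda>_. borel)" for k
    by (rule measurable_restrict) auto
  have mV: "V k \<in> borel_measurable M" for k
    unfolding V_restrict[abs_def] using measurable_compose[OF mrestr measurable_stopped_sum[OF order_refl]] .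
  have nV: "norm (V k \<omega>) \<le> real k * B" for k \<omega>
    unfolding V_def using B Y by (rule norm_stopped_sum_le)
  have iV: "integrable M (\<lambda>\<omega>. (norm (V k \<omega>))\<^sup>2)" for k
    using mV nV by (intro integrable_const_bound[where B = "(real k * B)\<^sup>2"]) (auto intro!: power_mono)
  have iY2: "integrable M (\<lambda>\<omega>. (norm (Y i \<omega>))\<^sup>2)" if "1 \<le> i" for i
    using mY[OF that] Y by (intro integrable_const_bound[where B = "B\<^sup>2"]) (auto intro!: power_mono)
  have iY: "integrable M (Y i)" if "1 \<le> i" for i
    using mY[OF that] Y by (intro integrable_const_bound[where B = B]) auto
  have bound: "expectation (\<lambda>\<omega>. (norm (V k \<omega>))\<^sup>2) \<le> (\<Sum>i=1..k. expectation (\<lambda>\<omega>. (norm (Y i \<omega>))\<^sup>2))" for k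
  proof (induction k)
    case (Suc k)
    define g where "g = (\<lambda>v :: nat \<Rightarrow> 'b. if c \<le> norm (stopped_sum c v k) then 0 else stopped_sum c v k)"
    \<comment> \<open>Setting the sum to zero after freezing removes the cross term exactly when no
      step is added, and keeps \<open>U\<close> bounded by \<open>c\<close>.\<close>
    define U where "U = (\<lambda>\<omega>. if c \<le> norm (V k \<omega>) then 0 else V k \<omega>)"
    have mg: "g \<in> borel_measurable (PiM {1..k} (\<lambda>_. borel))"
      unfolding g_def using measurable_stopped_sum[OF order_refl, of c k] by measurable
    have "indep_var (PiM {1..k} (\<lambda>_. borel)) (\<lambda>\<omega>. restrict (\<lambda>i. Y i \<omega>) {1..k})
        (PiM {Suc k} (\<lambda>_. borel)) (\<lambda>\<omega>. restrict (\<lambda>i. Y i \<omega>) {Suc k})"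
      by (rule indep_var_restrict[OF ind]) auto
    from indep_var_compose[OF this mg, of "\<lambda>v. v (Suc k)" borel]
    have "indep_var borel (g \<circ> (\<lambda>\<omega>. restrict (\<lambda>i. Y i \<omega>) {1..k})) borel
        ((\<lambda>v. v (Suc k)) \<circ> (\<lambda>\<omega>. restrict (\<lambda>i. Y i \<omega>) {Suc k}))"
      by (simp add: measurable_component_singleton)
    moreover have "g \<circ> (\<lambda>\<omega>. restrict (\<lambda>i. Y i \<omega>) {1..k}) = U"
      by (simp add: fun_eq_iff g_def U_def V_restrict)
    moreover have "(\<lambda>v. v (Suc k)) \<circ> (\<lambda>\<omega>. restrict (\<lambda>i. Y i \<omega>) {Suc k}) = Y (Suc k)"
      by (simp add: fun_eq_iff)
    ultimately have indU: "indep_var borel U borel (Y (Suc k))" by simp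
    have nU: "norm (U \<omega>) \<le> c" for \<omega> using c by (auto simp: U_def)
    have mU: "U \<in> borel_measurable M" unfolding U_def using mV[of k] by measurable
    have z: "expectation (\<lambda>\<omega>. inner (U \<omega>) (Y (Suc k) \<omega>)) = 0"
      by (rule expectation_inner_indep[OF indU nU iY EY]) auto
    have iU: "integrable M (\<lambda>\<omega>. inner (U \<omega>) (Y (Suc k) \<omega>))"
    proof (rule integrable_const_bound[where B = "c * B"])
      show "AE \<omega> in M. norm (inner (U \<omega>) (Y (Suc k) \<omega>)) \<le> c * B"
      proof (rule AE_I2)
        fix \<omega>
        have "\<bar>inner (U \<omega>) (Y (Suc k) \<omega>)\<bar> \<le> norm (U \<omega>) * norm (Y (Suc k) \<omega>)" by (rule Cauchy_Schwarz_ineq2)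
        also have "\<dots> \<le> c * B" using nU Y c by (intro mult_mono) auto
        finally show "norm (inner (U \<omega>) (Y (Suc k) \<omega>)) \<le> c * B" by simp
      qed
      show "(\<lambda>\<omega>. inner (U \<omega>) (Y (Suc k) \<omega>)) \<in> borel_measurable M"
        using mU mY[of "Suc k"] by (intro borel_measurable_inner) auto
    qed
    have "(norm (V (Suc k) \<omega>))\<^sup>2 \<le> (norm (V k \<omega>))\<^sup>2 + 2 * inner (U \<omega>) (Y (Suc k) \<omega>) + (norm (Y (Suc k) \<omega>))\<^sup>2" for \<omega>
      by (simp add: V_def U_def power2_norm_eq_inner inner_add_left inner_add_right inner_commute)
    then have "expectation (\<lambda>\<omega>. (norm (V (Suc k) \<omega>))\<^sup>2)
      \<le> expectation (\<lambda>\<omega>. (norm (V k \<omega>))\<^sup>2 + 2 * inner (U \<omega>) (Y (Suc k) \<omega>) + (norm (Y (Suc k) \<omega>))\<^sup>2)"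
      using iV iU iY2 by (intro integral_mono) auto
    also have "\<dots> = expectation (\<lambda>\<omega>. (norm (V k \<omega>))\<^sup>2) + expectation (\<lambda>\<omega>. (norm (Y (Suc k) \<omega>))\<^sup>2)"
      using iV iU iY2 z by simp
    finally show ?case using Suc by simp
  qed (simp add: V_def)
  have eq: "{\<omega>\<in>space M. \<exists>k\<le>m. c \<le> norm (\<Sum>i=1..k. Y i \<omega>)} = (\<Union>k\<le>m. {\<omega>\<in>space M. c \<le> norm (\<Sum>i=1..k. Y i \<omega>)})"
    by auto
  have "{\<omega>\<in>space M. c \<le> norm (\<Sum>i=1..k. Y i \<omega>)} \<in> events" for k
  proof -
    have [measurable]: "(\<lambda>\<omega>. \<Sum>i=1..k. Y i \<omega>) \<in> borel_measurable M"
      by (intro borel_measurable_sum mY) auto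
    show ?thesis by measurable
  qed
  then show "{\<omega>\<in>space M. \<exists>k\<le>m. c \<le> norm (\<Sum>i=1..k. Y i \<omega>)} \<in> events"
    unfolding eq by (intro sets.finite_UN) auto
  have "prob {\<omega>\<in>space M. \<exists>k\<le>m. c \<le> norm (\<Sum>i=1..k. Y i \<omega>)} \<le> prob {\<omega>\<in>space M. c\<^sup>2 \<le> (norm (V m \<omega>))\<^sup>2}"
  proof (rule finite_measure_mono)
    show "{\<omega>\<in>space M. \<exists>k\<le>m. c \<le> norm (\<Sum>i=1..k. Y i \<omega>)} \<subseteq> {\<omega>\<in>space M. c\<^sup>2 \<le> (norm (V m \<omega>))\<^sup>2}"
      using c stopped_sum_hits[of c _ _ m] by (auto simp: V_def intro!: power_mono)
    show "{\<omega>\<in>space M. c\<^sup>2 \<le> (norm (V m \<omega>))\<^sup>2} \<in> events" using mV[of m] by measurable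
  qed
  also have "\<dots> \<le> expectation (\<lambda>\<omega>. (norm (V m \<omega>))\<^sup>2) / c\<^sup>2"
    by (rule integral_Markov_inequality_measure[where A = "space M" and u = "\<lambda>\<omega>. (norm (V m \<omega>))\<^sup>2", simplified])
      (use iV c in auto)
  also have "\<dots> \<le> (\<Sum>i=1..m. expectation (\<lambda>\<omega>. (norm (Y i \<omega>))\<^sup>2)) / c\<^sup>2"
    by (intro divide_right_mono bound) simp
  finally show "prob {\<omega>\<in>space M. \<exists>k\<le>m. c \<le> norm (\<Sum>i=1..k. Y i \<omega>)} \<le> (\<Sum>i=1..m. expectation (\<lambda>\<omega>. (norm (Y i \<omega>))\<^sup>2)) / c\<^sup>2" .
qed

section \<open>Tails of vaguely convergent measures\<close>

text \<open>The piecewise linear function rising from 0 at \<open>u\<close> to 1 at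
  \<open>v\<close>. Truncating before the conversion to reals keeps it continuous at
  \<open>\<infinity>\<close>, where \<open>enn2real\<close> itself jumps to 0.\<close>

definition ramp :: "real \<Rightarrow> real \<Rightarrow> ennreal \<Rightarrow> real"
  where "ramp u v x = (enn2real (min x (ennreal v)) - enn2real (min x (ennreal u))) / (v - u)"

lemma continuous_on_ramp: "continuous_on S (ramp u v)"
proof -
  have "((\<lambda>x. enn2real (min x (ennreal w))) \<longlongrightarrow> enn2real (min x0 (ennreal w))) (at x0 within S)" for w x0
  proof (rule tendsto_enn2real)
    have "min x0 (ennreal w) < top" by (simp add: min_less_iff_disj)
    then have "ennreal (enn2real (min x0 (ennreal w))) = min x0 (ennreal w)" by simp
    moreover have "((\<lambda>x. min x (ennreal w)) \<longlongrightarrow> min x0 (ennreal w)) (at x0 within S)"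
      by (intro tendsto_min tendsto_ident_at tendsto_const)
    ultimately show "((\<lambda>x. min x (ennreal w)) \<longlongrightarrow> ennreal (enn2real (min x0 (ennreal w)))) (at x0 within S)"
      by simp
  qed simp
  then have "continuous_on S (\<lambda>x. enn2real (min x (ennreal w)))" for w
    by (auto simp: continuous_on)
  then show ?thesis unfolding ramp_def divide_inverse by (intro continuous_intros)
qed

lemma ramp_bounds:
  assumes "0 < u" "u < v"
  shows "0 \<le> ramp u v x" "ramp u v x \<le> 1" "x \<le> ennreal u \<Longrightarrow> ramp u v x = 0" "ennreal v \<le> x \<Longrightarrow> ramp u v x = 1"
proof -
  have uv: "ennreal u \<le> ennreal v" using assms by (intro ennreal_leI) auto
  have m: "min x (ennreal u) \<le> min x (ennreal v)" using uv by (auto simp: min_def)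
  have f: "min x (ennreal v) < top" by (simp add: min_less_iff_disj)
  have "enn2real (min x (ennreal u)) \<le> enn2real (min x (ennreal v))" by (rule enn2real_mono[OF m f])
  then show "0 \<le> ramp u v x" using assms by (simp add: ramp_def)
  show z: "ramp u v x = 0" if "x \<le> ennreal u" using that uv by (simp add: ramp_def min_absorb1)
  show "ramp u v x = 1" if "ennreal v \<le> x"
    using that order_trans[OF uv that] assms by (simp add: ramp_def min_absorb2)
  show "ramp u v x \<le> 1"
  proof (cases "x \<le> ennreal u")
    case False
    then have "min x (ennreal u) = ennreal u" by (simp add: min_absorb2)
    moreover have "enn2real (min x (ennreal v)) \<le> enn2real (ennreal v)" by (intro enn2real_mono) auto
    ultimately show ?thesis using assms by (simp add: ramp_def)
  qed (simp add: z)
qed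

locale levy_measure =
  fixes \<nu> :: "ennreal measure"
  assumes \<nu>_sets: "sets \<nu> = sets (restrict_space borel {0<..})"
    and \<nu>_levy: "(\<integral>\<^sup>+z\<in>{0<..<\<infinity>}. min 1 z \<partial>\<nu>) < \<infinity>"
    and \<nu>_infty: "emeasure \<nu> {\<infinity>} = 0"
begin

lemma levy_space: "space \<nu> = {0<..}"
  using sets_eq_imp_space_eq[OF \<nu>_sets] by (simp add: space_restrict_space)

lemma levy_sets_iff: "A \<in> sets \<nu> \<longleftrightarrow> A \<in> sets borel \<and> A \<subseteq> {0<..}"
  unfolding \<nu>_sets by (subst sets_restrict_space_iff) auto

lemma levy_borel_measurable: "f \<in> borel_measurable borel \<Longrightarrow> f \<in> borel_measurable \<nu>"
  by (subst measurable_cong_sets[OF \<nu>_sets refl]) (rule measurable_restrict_space1)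

text \<open>Above \<open>u\<close> the integrand \<open>min 1 z\<close> is at least
  \<open>min 1 u\<close>, so the integral controls the mass; the point \<open>\<infinity>\<close> is
  null.\<close>

lemma levy_tail_finite:
  assumes "0 < u"
  shows "emeasure \<nu> {ennreal u<..} < \<infinity>"
proof -
  define c where "c = ennreal (min 1 u)"
  have c: "c \<noteq> 0" "c \<noteq> \<infinity>" using assms by (auto simp: c_def)
  have s2: "{ennreal u<..<\<infinity>} \<in> sets \<nu>" "{\<infinity>} \<in> sets \<nu>"
    using assms by (auto simp: levy_sets_iff intro: le_less_trans[of 0])
  have "c * emeasure \<nu> {ennreal u<..<\<infinity>} = (\<integral>\<^sup>+z. c * indicator {ennreal u<..<\<infinity>} z \<partial>\<nu>)"
    using s2 by (simp add: nn_integral_cmult_indicator)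
  also have "\<dots> \<le> (\<integral>\<^sup>+z\<in>{0<..<\<infinity>}. min 1 z \<partial>\<nu>)"
  proof (rule nn_integral_mono)
    fix z
    have "c \<le> min 1 z" if "ennreal u < z"
    proof -
      have "c \<le> ennreal u" "c \<le> ennreal 1" unfolding c_def by (intro ennreal_leI; simp)+
      then show ?thesis using that by auto
    qed
    then show "c * indicator {ennreal u<..<\<infinity>} z \<le> min 1 z * indicator {0<..<\<infinity>} z"
      using assms by (auto simp: indicator_def intro: le_less_trans[of 0])
  qed
  finally have "c * emeasure \<nu> {ennreal u<..<\<infinity>} < \<infinity>" using \<nu>_levy by (rule le_less_trans)
  then have "emeasure \<nu> {ennreal u<..<\<infinity>} < \<infinity>" using c by (auto simp: ennreal_mult_less_top)
  moreover have "{ennreal u<..} = {ennreal u<..<\<infinity>} \<union> {\<infinity>}" by (auto simp: less_top[symmetric])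
  ultimately show ?thesis
    using emeasure_subadditive[OF s2] \<nu>_infty by (metis add.right_neutral le_less_trans)
qed

lemma levy_sigma_finite: "sigma_finite_measure \<nu>"
proof
  let ?A = "(\<lambda>k::nat. {ennreal (1 / real (Suc k))<..}) ` UNIV"
  have "\<Union>?A = space \<nu>"
  proof (unfold levy_space, intro equalityI subsetI)
    fix z :: ennreal assume "z \<in> {0<..}"
    then have z: "0 < z" by simp
    show "z \<in> \<Union>?A"
    proof (cases z)
      case (real r)
      then have "0 < r" using z by simp
      then obtain k where "1 / real (Suc k) < r" using reals_Archimedean[of r] by (auto simp: inverse_eq_divide)
      then show ?thesis using real by (auto intro!: exI[of _ k] ennreal_lessI \<open>0 < r\<close>)
    qed auto
  qed (auto intro: le_less_trans[of 0])
  moreover have "a \<in> sets \<nu>" "emeasure \<nu> a \<noteq> \<infinity>" if "a \<in> ?A" for a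
  proof -
    obtain k where a: "a = {ennreal (1 / real (Suc k))<..}" using \<open>a \<in> ?A\<close> by auto
    show "a \<in> sets \<nu>" unfolding a by (auto simp: levy_sets_iff intro: le_less_trans[of 0])
    show "emeasure \<nu> a \<noteq> \<infinity>" unfolding a using levy_tail_finite[of "1 / real (Suc k)"] by auto
  qed
  ultimately show "\<exists>A. countable A \<and> A \<subseteq> sets \<nu> \<and> \<Union>A = space \<nu> \<and> (\<forall>a\<in>A. emeasure \<nu> a \<noteq> \<infinity>)"
    by (intro exI[of _ ?A]) auto
qed

lemma levy_tail_sets: "0 < u \<Longrightarrow> {ennreal u<..} \<in> sets \<nu>" "0 < u \<Longrightarrow> {ennreal u..} \<in> sets \<nu>"
  by (auto simp: levy_sets_iff intro: le_less_trans[of 0] less_le_trans[of 0 "ennreal u"])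

lemma levy_tail_fmeasurable: "0 < u \<Longrightarrow> {ennreal u<..} \<in> fmeasurable \<nu>"
  using levy_tail_sets(1) levy_tail_finite by (intro fmeasurableI) auto

lemma levy_fmeasurable:
  assumes "0 < u" "A \<subseteq> {ennreal u<..}" "A \<in> sets borel"
  shows "A \<in> fmeasurable \<nu>"
  by (rule fmeasurableI2[OF levy_tail_fmeasurable[OF assms(1)] assms(2)])
    (use assms in \<open>auto simp: levy_sets_iff intro: le_less_trans[of 0]\<close>)

text \<open>The part of \<open>\<nu>\<close> above \<open>\<alpha>\<close> is finite, so it has
  countably many atoms, whereas the interval is uncountable.\<close>

lemma levy_continuity_point:
  assumes "0 < \<alpha>" "\<alpha> < \<beta>"
  shows "\<exists>c. \<alpha> < c \<and> c < \<beta> \<and> measure \<nu> {ennreal c} = 0"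
proof -
  define N where "N = restrict_space \<nu> {ennreal \<alpha><..}"
  have s: "{ennreal \<alpha><..} \<inter> space \<nu> \<in> sets \<nu>"
    using levy_tail_sets(1)[OF assms(1)] by (rule sets.Int) simp
  have spN: "space N = {ennreal \<alpha><..}"
    using assms by (auto simp: N_def space_restrict_space levy_space intro: le_less_trans[of 0])
  interpret N: finite_measure N
    by (rule finite_measureI) (use levy_tail_finite[OF assms(1)] spN s in
      \<open>auto simp: N_def emeasure_restrict_space\<close>)
  have "countable {c\<in>{\<alpha><..<\<beta>}. measure N {ennreal c} \<noteq> 0}"
  proof (rule countable_image_inj_on[of ennreal])
    show "countable (ennreal ` {c\<in>{\<alpha><..<\<beta>}. measure N {ennreal c} \<noteq> 0})"
      by (rule countable_subset[OF _ N.countable_support]) auto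
    show "inj_on ennreal {c\<in>{\<alpha><..<\<beta>}. measure N {ennreal c} \<noteq> 0}"
      using assms by (auto simp: inj_on_def)
  qed
  moreover have "uncountable {\<alpha><..<\<beta>}" using assms by (simp add: uncountable_open_interval)
  ultimately have "\<not> {\<alpha><..<\<beta>} \<subseteq> {c\<in>{\<alpha><..<\<beta>}. measure N {ennreal c} \<noteq> 0}"
    using countable_subset by blast
  then obtain c where c: "c \<in> {\<alpha><..<\<beta>}" "measure N {ennreal c} = 0" by blast
  have "ennreal \<alpha> < ennreal c" using c assms by (intro ennreal_lessI) auto
  then have "measure N {ennreal c} = measure \<nu> {ennreal c}"
    unfolding N_def using s by (intro measure_restrict_space) auto
  with c show ?thesis by auto
qed

text \<open>Test functions between indicators: a ramp from \<open>c\<close> up to \<open>v\<close>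
  lies below the indicator of the open tail, a ramp from \<open>u\<close> up to \<open>c\<close>
  lies above it. Letting \<open>v\<close> decrease to \<open>c\<close> recovers the open tail of
  \<open>\<nu>\<close>; letting \<open>u\<close> increase to \<open>c\<close> gives the closed tail,
  and the two agree because \<open>c\<close> carries no mass.\<close>

lemma vague_conv_tail:
  assumes fin: "\<forall>\<^sub>F d in sequentially. finite_measure (\<mu> d) \<and> sets (\<mu> d) = sets borel"
    and vague: "vague_conv \<mu> \<nu>" and c: "0 < c" "measure \<nu> {ennreal c} = 0"
  shows "(\<lambda>d. measure (\<mu> d) {ennreal c<..}) \<longlonglongrightarrow> measure \<nu> {ennreal c<..}"
proof -
  have ramp_conv: "(\<lambda>d. LINT x:{0<..}|\<mu> d. ramp u v x) \<longlonglongrightarrow> (LINT x:{0<..}|\<nu>. ramp u v x)" if "0 < u" "u < v" for u v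
  proof -
    \<comment> \<open>A closed tail including the point \<open>\<infinity>\<close> is compact, being
      closed in the compact space of extended nonnegative reals; this makes ramps admissible test
      functions although they equal 1 far out.\<close>
    have "compact {ennreal u..}" by (metis closed_atLeast compact_UNIV compact_Int_closed inf_top_left)
    moreover have "{ennreal u..} \<subseteq> {0<..}" using that by (auto intro: less_le_trans[of 0 "ennreal u"])
    moreover have "\<forall>x\<in>{0<..} - {ennreal u..}. ramp u v x = 0"
      by (intro ballI ramp_bounds(3)[OF that]) auto
    ultimately have "\<exists>K. compact K \<and> K \<subseteq> {0<..} \<and> (\<forall>x\<in>{0<..} - K. ramp u v x = 0)" by blast
    then show ?thesis using vague continuous_on_ramp[of "{0<..}" u v] unfolding vague_conv_def by blast
  qed
  have mramp: "ramp u v \<in> borel_measurable borel" for u v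
    by (rule borel_measurable_continuous_onI[OF continuous_on_ramp])
  have sandwich: "measure \<mu>' {ennreal v..} \<le> (LINT x:{0<..}|\<mu>'. ramp u v x)"
      "(LINT x:{0<..}|\<mu>'. ramp u v x) \<le> measure \<mu>' {ennreal u<..}"
    if uv: "0 < u" "u < v" and S: "{ennreal u<..} \<in> fmeasurable \<mu>'" "{ennreal v..} \<in> sets \<mu>'"
      and ms: "(\<lambda>x. indicator {0<..} x * ramp u v x) \<in> borel_measurable \<mu>'" for \<mu>' u v
  proof -
    have "ennreal u < ennreal v" using uv by (intro ennreal_lessI) auto
    then have ss: "{ennreal v..} \<subseteq> {ennreal u<..}" by (auto intro: less_le_trans)
    have S2: "{ennreal v..} \<in> fmeasurable \<mu>'" by (rule fmeasurableI2[OF S(1) ss S(2)])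
    have i1: "integrable \<mu>' (indicator {ennreal u<..} :: ennreal \<Rightarrow> real)"
      using S(1) by (simp add: fmeasurable_def less_top[symmetric])
    have i2: "integrable \<mu>' (indicator {ennreal v..} :: ennreal \<Rightarrow> real)"
      using S2 by (simp add: fmeasurable_def less_top[symmetric])
    have le: "indicator {0<..} x * ramp u v x \<le> indicator {ennreal u<..} x" for x
      using ramp_bounds[OF uv, of x] by (auto simp: indicator_def not_less)
    have ge: "indicator {ennreal v..} x \<le> indicator {0<..} x * ramp u v x" for x
    proof (cases "ennreal v \<le> x")
      case True
      moreover have "0 < ennreal v" using uv by simp
      ultimately have "0 < x" by (rule less_le_trans[rotated])
      then show ?thesis using ramp_bounds(4)[OF uv True] True by simp
    qed (use ramp_bounds(1)[OF uv, of x] in simp)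
    have i3: "integrable \<mu>' (\<lambda>x. indicator {0<..} x * ramp u v x)"
      by (rule Bochner_Integration.integrable_bound[OF i1 ms])
        (use le ramp_bounds(1)[OF uv] in \<open>auto simp: abs_mult\<close>)
    have "measure \<mu>' {ennreal v..} = (LINT x|\<mu>'. indicator {ennreal v..} x)"
      using S2 sets.sets_into_space[OF S(2)] by (simp add: Int_absorb2)
    also have "\<dots> \<le> (LINT x|\<mu>'. indicator {0<..} x * ramp u v x)" by (rule integral_mono[OF i2 i3 ge])
    finally show "measure \<mu>' {ennreal v..} \<le> (LINT x:{0<..}|\<mu>'. ramp u v x)" by (simp add: set_lebesgue_integral_def)
    have "(LINT x|\<mu>'. indicator {0<..} x * ramp u v x) \<le> (LINT x|\<mu>'. indicator {ennreal u<..} x)"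
      by (rule integral_mono[OF i3 i1 le])
    also have "\<dots> = measure \<mu>' {ennreal u<..}"
      using S(1) sets.sets_into_space[OF fmeasurableD[OF S(1)]] by (simp add: Int_absorb2)
    finally show "(LINT x:{0<..}|\<mu>'. ramp u v x) \<le> measure \<mu>' {ennreal u<..}" by (simp add: set_lebesgue_integral_def)
  qed
  have sandwich_\<nu>: "measure \<nu> {ennreal v..} \<le> (LINT x:{0<..}|\<nu>. ramp u v x)"
      "(LINT x:{0<..}|\<nu>. ramp u v x) \<le> measure \<nu> {ennreal u<..}" if "0 < u" "u < v" for u v
    using that mramp by (auto intro!: sandwich levy_tail_fmeasurable levy_tail_sets(2) levy_borel_measurable)
  have sandwich_\<mu>: "measure (\<mu> d) {ennreal v..} \<le> (LINT x:{0<..}|\<mu> d. ramp u v x)"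
      "(LINT x:{0<..}|\<mu> d. ramp u v x) \<le> measure (\<mu> d) {ennreal u<..}"
    if "0 < u" "u < v" and d: "finite_measure (\<mu> d) \<and> sets (\<mu> d) = sets borel" for u v d
  proof -
    interpret finite_measure "\<mu> d" using d by simp
    have "(\<lambda>x. indicator {0<..} x * ramp u v x) \<in> borel_measurable (\<mu> d)"
      by (subst measurable_cong_sets[OF conjunct2[OF d] refl]) (intro borel_measurable_times mramp, simp)
    then show "measure (\<mu> d) {ennreal v..} \<le> (LINT x:{0<..}|\<mu> d. ramp u v x)"
      "(LINT x:{0<..}|\<mu> d. ramp u v x) \<le> measure (\<mu> d) {ennreal u<..}"
      using sandwich[OF that(1,2), of "\<mu> d"] d by (auto simp: fmeasurable_eq_sets)
  qed
  let ?F = "measure \<nu> {ennreal c<..}"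
  have approx_below: "\<exists>v>c. ?F - e < measure \<nu> {ennreal v..}" if e: "0 < e" for e
  proof -
    let ?A = "\<lambda>k::nat. {ennreal (c + 1 / real (Suc k))..}"
    have A_eq: "(\<Union>k. ?A k) = {ennreal c<..}"
    proof (intro equalityI subsetI)
      fix z assume "z \<in> {ennreal c<..}"
      then have z: "ennreal c < z" by simp
      show "z \<in> (\<Union>k. ?A k)"
      proof (cases z)
        case (real r)
        then have "0 < r - c" using z c by (simp add: ennreal_less_iff)
        then obtain k where "1 / real (Suc k) < r - c" using reals_Archimedean[of "r - c"] by (auto simp: inverse_eq_divide)
        then show ?thesis using real by (auto intro!: exI[of _ k] ennreal_leI)
      qed auto
    next
      fix z assume "z \<in> (\<Union>k. ?A k)"
      then obtain k :: nat where "ennreal (c + 1 / real (Suc k)) \<le> z" by blast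
      moreover have "ennreal c < ennreal (c + 1 / real (Suc k))"
        by (intro ennreal_lessI add_pos_nonneg c(1)) simp_all
      ultimately show "z \<in> {ennreal c<..}" by simp
    qed
    have "(\<lambda>k. measure \<nu> (?A k)) \<longlonglongrightarrow> measure \<nu> (\<Union>k. ?A k)"
    proof (rule Lim_measure_incseq)
      show "range ?A \<subseteq> sets \<nu>" by (intro image_subsetI levy_tail_sets(2) add_pos_nonneg c(1)) simp
      show "incseq ?A"
        using c by (auto simp: incseq_def frac_le intro!: order_trans[OF ennreal_leI] )
      show "emeasure \<nu> (\<Union>k. ?A k) \<noteq> \<infinity>" unfolding A_eq using levy_tail_finite[OF c(1)] by auto
    qed
    then have "(\<lambda>k. measure \<nu> (?A k)) \<longlonglongrightarrow> ?F" unfolding A_eq .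
    from order_tendstoD(1)[OF this, of "?F - e"] e obtain k where "?F - e < measure \<nu> (?A k)"
      by (auto simp: eventually_sequentially)
    then show ?thesis by (intro exI[of _ "c + 1 / real (Suc k)"]) auto
  qed
  have approx_above: "\<exists>u. 0 < u \<and> u < c \<and> measure \<nu> {ennreal u<..} < ?F + e" if e: "0 < e" for e
  proof -
    \<comment> \<open>The factor 2 keeps the first term at \<open>c / 2\<close>, so every tail in
      the sequence has finite mass.\<close>
    let ?u = "\<lambda>k::nat. c - c / (2 * real (Suc k))"
    let ?A = "\<lambda>k::nat. {ennreal (?u k)<..}"
    have u: "0 < ?u k" "?u k < c" for k
    proof -
      have "c / (2 * real (Suc k)) \<le> c / 2" using c by (intro divide_left_mono) auto
      moreover have "0 < c / (2 * real (Suc k))" using c by simp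
      ultimately show "0 < ?u k" "?u k < c" using c(1) by linarith+
    qed
    have "(\<lambda>k. measure \<nu> (?A k)) \<longlonglongrightarrow> measure \<nu> (\<Inter>k. ?A k)"
    proof (rule Lim_measure_decseq)
      show "range ?A \<subseteq> sets \<nu>" using u by (auto intro!: levy_tail_sets(1))
      show "decseq ?A"
      proof (rule decseq_SucI)
        fix k
        have "c / (2 * real (Suc (Suc k))) \<le> c / (2 * real (Suc k))" using c by (intro divide_left_mono) auto
        then have "ennreal (?u k) \<le> ennreal (?u (Suc k))" by (intro ennreal_leI) auto
        then show "?A (Suc k) \<subseteq> ?A k" by auto
      qed
      show "emeasure \<nu> (?A k) \<noteq> \<infinity>" for k using levy_tail_finite[OF u(1)[of k]] by simp
    qed
    moreover have "(\<Inter>k. ?A k) = {ennreal c<..} \<union> {ennreal c}"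
    proof (intro equalityI subsetI)
      fix z assume z: "z \<in> (\<Inter>k. ?A k)"
      have "\<not> z < ennreal c"
      proof
        assume lt: "z < ennreal c"
        then obtain r where r: "z = ennreal r" "0 \<le> r" by (cases z) auto
        then have "0 < (c - r) / c" using lt c by (simp add: ennreal_less_iff)
        then obtain k where "1 / real (Suc k) < (c - r) / c"
          using reals_Archimedean[of "(c - r) / c"] by (auto simp: inverse_eq_divide)
        then have "c / real (Suc k) < c - r" using c by (simp add: field_simps)
        moreover have "c / (2 * real (Suc k)) \<le> c / real (Suc k)" using c by (intro divide_left_mono) auto
        ultimately have "r \<le> ?u k" by linarith
        then have "z \<le> ennreal (?u k)" unfolding r(1) by (rule ennreal_leI)
        then show False using z by (auto simp: not_less[symmetric])
      qed
      then show "z \<in> {ennreal c<..} \<union> {ennreal c}" by auto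
    next
      fix z assume "z \<in> {ennreal c<..} \<union> {ennreal c}"
      then have "ennreal c \<le> z" by auto
      moreover have "ennreal (?u k) < ennreal c" for k using u[of k] by (intro ennreal_lessI) (use c in auto)
      ultimately show "z \<in> (\<Inter>k. ?A k)" by (auto intro: less_le_trans)
    qed
    moreover have "measure \<nu> ({ennreal c<..} \<union> {ennreal c}) = ?F"
    proof -
      have 1: "{ennreal c} \<in> fmeasurable \<nu>" using c by (intro levy_fmeasurable[of "c / 2"]) (auto intro!: ennreal_lessI)
      have "measure \<nu> ({ennreal c<..} \<union> {ennreal c}) \<le> ?F + measure \<nu> {ennreal c}"
        using 1 levy_tail_fmeasurable[OF c(1)] by (intro measure_Un_le) (auto dest: fmeasurableD)
      moreover have "?F \<le> measure \<nu> ({ennreal c<..} \<union> {ennreal c})"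
        using 1 levy_tail_fmeasurable[OF c(1)] by (intro measure_mono_fmeasurable fmeasurable.Un) (auto dest: fmeasurableD)
      ultimately show ?thesis using c(2) by simp
    qed
    ultimately have "(\<lambda>k. measure \<nu> (?A k)) \<longlonglongrightarrow> ?F" by simp
    from order_tendstoD(2)[OF this, of "?F + e"] e obtain k where "measure \<nu> (?A k) < ?F + e"
      by (auto simp: eventually_sequentially)
    then show ?thesis using u[of k] by blast
  qed
  show ?thesis
  proof (rule order_tendstoI)
    fix b assume "b < ?F"
    then obtain v where v: "c < v" "b < measure \<nu> {ennreal v..}" using approx_below[of "?F - b"] by auto
    then have "b < (LINT x:{0<..}|\<nu>. ramp c v x)" using sandwich_\<nu>(1)[OF c(1) v(1)] by simp
    from order_tendstoD(1)[OF ramp_conv[OF c(1) v(1)] this] fin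
    show "\<forall>\<^sub>F d in sequentially. b < measure (\<mu> d) {ennreal c<..}"
      by eventually_elim (use sandwich_\<mu>(2)[OF c(1) v(1)] in force)
  next
    fix b assume "?F < b"
    then obtain u where u: "0 < u" "u < c" "measure \<nu> {ennreal u<..} < b" using approx_above[of "b - ?F"] by auto
    then have "(LINT x:{0<..}|\<nu>. ramp u c x) < b" using sandwich_\<nu>(2)[OF u(1,2)] by simp
    from order_tendstoD(2)[OF ramp_conv[OF u(1,2)] this] fin
    show "\<forall>\<^sub>F d in sequentially. measure (\<mu> d) {ennreal c<..} < b"
    proof eventually_elim
      case (elim d)
      interpret finite_measure "\<mu> d" using elim by simp
      have "measure (\<mu> d) {ennreal c<..} \<le> measure (\<mu> d) {ennreal c..}"
        using elim by (intro finite_measure_mono) auto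
      then show ?case using sandwich_\<mu>(1)[OF u(1,2) elim(2)] elim(1) by linarith
    qed
  qed
qed

text \<open>The tails decrease to the point \<open>\<infinity>\<close>, which is null. This is what
  allows a top for the size boxes.\<close>

lemma levy_tail_tendsto_0: "(\<lambda>k::nat. measure \<nu> {ennreal (real k + 1)<..}) \<longlonglongrightarrow> 0"
proof -
  let ?A = "\<lambda>k::nat. {ennreal (real k + 1)<..}"
  have "(\<lambda>k. measure \<nu> (?A k)) \<longlonglongrightarrow> measure \<nu> (\<Inter>k. ?A k)"
  proof (rule Lim_measure_decseq)
    show "range ?A \<subseteq> sets \<nu>" by (intro image_subsetI levy_tail_sets(1)) simp
    show "decseq ?A" by (auto simp: decseq_def intro: le_less_trans[OF ennreal_leI])
    show "emeasure \<nu> (?A k) \<noteq> \<infinity>" for k using levy_tail_finite[of "real k + 1"] by simp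
  qed
  moreover have "(\<Inter>k. ?A k) = {\<infinity>}"
  proof (intro equalityI subsetI)
    fix z assume z: "z \<in> (\<Inter>k. ?A k)"
    show "z \<in> {\<infinity>}"
    proof (cases z)
      case (real r)
      obtain k where "r < real k" using reals_Archimedean2 by blast
      then have "z \<le> ennreal (real k + 1)" unfolding real by (intro ennreal_leI) simp
      then show ?thesis using z by (auto simp: not_less[symmetric])
    qed simp
  qed auto
  ultimately show ?thesis using \<nu>_infty by (simp add: measure_def)
qed

end

section \<open>Poisson random measures\<close>

lemma poisson_mean_sums: "(\<lambda>j. real j * (exp (- m) * m ^ j / fact j)) sums m"
proof -
  have "(\<lambda>j. m ^ j / fact j) sums exp m"
    using exp_converges[of m] by (simp add: divide_inverse mult.commute)
  then have "(\<lambda>j. (m * exp (- m)) * (m ^ j / fact j)) sums (m * exp (- m) * exp m)" by (rule sums_mult)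
  moreover have "m * exp (- m) * exp m = m" by (simp add: exp_minus)
  moreover have "(\<lambda>j. (m * exp (- m)) * (m ^ j / fact j)) = (\<lambda>j. real (Suc j) * (exp (- m) * m ^ Suc j / fact (Suc j)))"
    by (simp add: fun_eq_iff field_simps del: of_nat_Suc)
  ultimately have "(\<lambda>j. real (Suc j) * (exp (- m) * m ^ Suc j / fact (Suc j))) sums m" by simp
  from sums_Suc[OF this] show ?thesis by simp
qed

context prob_space
begin

text \<open>Only the probabilities of natural values are given, but they sum to 1, so almost surely
  the variable takes such a value and equals the series of its values weighted by indicators.
  Integrating termwise gives the mean.\<close>

lemma poisson_variable_mean:
  fixes N :: "'a \<Rightarrow> ennreal" and m :: real
  assumes N: "N \<in> borel_measurable M" and m: "0 \<le> m"
    and pois: "\<And>j::nat. prob {\<omega>\<in>space M. N \<omega> = of_nat j} = exp (- m) * m ^ j / fact j"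
  shows "(\<integral>\<^sup>+\<omega>. N \<omega> \<partial>M) = ennreal m"
proof -
  define E where "E j = {\<omega>\<in>space M. N \<omega> = of_nat j}" for j :: nat
  have E: "E j \<in> events" for j unfolding E_def using N by measurable
  have dis: "disjoint_family E" by (auto simp: disjoint_family_on_def E_def)
  have "(\<lambda>j. prob (E j)) sums prob (\<Union>j. E j)"
    by (rule finite_measure_UNION) (use E dis in auto)
  moreover have "(\<lambda>j. prob (E j)) sums (exp (- m) * exp m)"
    using sums_mult[OF exp_converges[of m], of "exp (- m)"] unfolding E_def pois
    by (simp add: divide_inverse mult_ac)
  ultimately have "prob (\<Union>j. E j) = exp (- m) * exp m" by (rule sums_unique2)
  then have "prob (\<Union>j. E j) = 1" by (simp add: exp_minus)
  then have "AE \<omega> in M. \<omega> \<in> (\<Union>j. E j)" by (rule AE_prob_1)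
  then have "AE \<omega> in M. N \<omega> = (\<Sum>j. of_nat j * indicator (E j) \<omega>)"
  proof eventually_elim
    case (elim \<omega>)
    then obtain j where j: "\<omega> \<in> E j" by auto
    then have "indicator (E i) \<omega> = (if i = j then 1 else 0 :: ennreal)" for i
      by (auto simp: E_def indicator_def)
    then have "(\<Sum>i. of_nat i * indicator (E i) \<omega>) = (\<Sum>i. if i = j then of_nat i else (0::ennreal))"
      by (intro arg_cong[where f = suminf]) auto
    also have "\<dots> = of_nat j" using sums_single[of j "\<lambda>i. of_nat i :: ennreal"] by (simp add: sums_iff)
    finally show ?case using j by (simp add: E_def)
  qed
  then have "(\<integral>\<^sup>+\<omega>. N \<omega> \<partial>M) = (\<integral>\<^sup>+\<omega>. (\<Sum>j. of_nat j * indicator (E j) \<omega>) \<partial>M)"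
    by (rule nn_integral_cong_AE)
  also have "\<dots> = (\<Sum>j. \<integral>\<^sup>+\<omega>. of_nat j * indicator (E j) \<omega> \<partial>M)"
    using E by (intro nn_integral_suminf) auto
  also have "\<dots> = (\<Sum>j. ennreal (real j * (exp (- m) * m ^ j / fact j)))"
  proof (intro arg_cong[where f = suminf] ext)
    fix j
    have "(\<integral>\<^sup>+\<omega>. of_nat j * indicator (E j) \<omega> \<partial>M) = of_nat j * emeasure M (E j)"
      using E by (simp add: nn_integral_cmult_indicator)
    also have "\<dots> = ennreal (real j) * ennreal (exp (- m) * m ^ j / fact j)"
      unfolding emeasure_eq_measure using pois[of j] by (simp add: E_def ennreal_of_nat_eq_real_of_nat)
    also have "\<dots> = ennreal (real j * (exp (- m) * m ^ j / fact j))"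
      using m by (intro ennreal_mult[symmetric]) auto
    finally show "(\<integral>\<^sup>+\<omega>. of_nat j * indicator (E j) \<omega> \<partial>M) = ennreal (real j * (exp (- m) * m ^ j / fact j))" .
  qed
  also have "\<dots> = ennreal m"
    using poisson_mean_sums[of m] m by (subst suminf_ennreal2) (auto simp: sums_iff)
  finally show ?thesis .
qed

lemma poisson_random_measure_intensity:
  assumes prm: "poisson_random_measure M \<mu> N" and A: "A \<in> sets \<mu>"
  shows "(\<integral>\<^sup>+\<omega>. emeasure (N \<omega>) A \<partial>M) = emeasure \<mu> A"
proof (cases "emeasure \<mu> A < \<infinity>")
  case True
  have "(\<integral>\<^sup>+\<omega>. emeasure (N \<omega>) A \<partial>M) = ennreal (measure \<mu> A)"
    by (rule poisson_variable_mean) (use prm A True in \<open>auto simp: poisson_random_measure_def\<close>)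
  then show ?thesis using True by (simp add: emeasure_eq_ennreal_measure)
next
  case False
  then have inf: "emeasure \<mu> A = \<infinity>" by (simp add: less_top[symmetric])
  then have "AE \<omega> in M. emeasure (N \<omega>) A = \<infinity>" using prm A by (auto simp: poisson_random_measure_def)
  then have "(\<integral>\<^sup>+\<omega>. emeasure (N \<omega>) A \<partial>M) = (\<integral>\<^sup>+\<omega>. \<infinity> \<partial>M)" by (rule nn_integral_cong_AE)
  also have "\<dots> = \<infinity>" by (simp add: emeasure_space_1)
  finally show ?thesis using inf by simp
qed

text \<open>For indicators this is the intensity identity, and both sides respect sums, multiples
  and monotone limits. Measurability of the random integral is carried along in the same induction
  because each step needs it.\<close>

lemma Campbell:
  assumes prm: "poisson_random_measure M \<mu> N" and \<phi>: "\<phi> \<in> borel_measurable \<mu>"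
  shows "(\<lambda>\<omega>. \<integral>\<^sup>+z. \<phi> z \<partial>N \<omega>) \<in> borel_measurable M \<and>
    (\<integral>\<^sup>+\<omega>. (\<integral>\<^sup>+z. \<phi> z \<partial>N \<omega>) \<partial>M) = (\<integral>\<^sup>+z. \<phi> z \<partial>\<mu>)"
proof -
  have sN: "sets (N \<omega>) = sets \<mu>" if "\<omega> \<in> space M" for \<omega>
    using prm that by (auto simp: poisson_random_measure_def)
  have spN: "space (N \<omega>) = space \<mu>" if "\<omega> \<in> space M" for \<omega>
    using sN[OF that] by (rule sets_eq_imp_space_eq)
  have mN: "f \<in> borel_measurable (N \<omega>)" if "\<omega> \<in> space M" "f \<in> borel_measurable \<mu>" for \<omega> and f :: "_ \<Rightarrow> ennreal"
    using that(2) by (subst measurable_cong_sets[OF sN[OF that(1)] refl])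
  show ?thesis using \<phi>
  proof (induction rule: borel_measurable_induct)
    case (cong f g)
    have "(\<integral>\<^sup>+z. f z \<partial>N \<omega>) = (\<integral>\<^sup>+z. g z \<partial>N \<omega>)" if "\<omega> \<in> space M" for \<omega>
      using cong(3) spN[OF that] by (intro nn_integral_cong) auto
    moreover have "(\<integral>\<^sup>+z. f z \<partial>\<mu>) = (\<integral>\<^sup>+z. g z \<partial>\<mu>)" using cong(3) by (rule nn_integral_cong)
    ultimately show ?case using cong(4) by (simp cong: measurable_cong nn_integral_cong)
  next
    case (set A)
    have "(\<integral>\<^sup>+z. indicator A z \<partial>N \<omega>) = emeasure (N \<omega>) A" if "\<omega> \<in> space M" for \<omega>
      using set sN[OF that] by simp
    moreover have "(\<lambda>\<omega>. emeasure (N \<omega>) A) \<in> borel_measurable M"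
      using prm set by (auto simp: poisson_random_measure_def)
    ultimately show ?case using poisson_random_measure_intensity[OF prm set] set
      by (simp cong: measurable_cong nn_integral_cong)
  next
    case (mult u c)
    have "(\<integral>\<^sup>+z. c * u z \<partial>N \<omega>) = c * (\<integral>\<^sup>+z. u z \<partial>N \<omega>)" if "\<omega> \<in> space M" for \<omega>
      using mN[OF that mult(2)] by (rule nn_integral_cmult)
    moreover have [measurable]: "(\<lambda>\<omega>. \<integral>\<^sup>+z. u z \<partial>N \<omega>) \<in> borel_measurable M" using mult by simp
    then have "(\<lambda>\<omega>. c * (\<integral>\<^sup>+z. u z \<partial>N \<omega>)) \<in> borel_measurable M" by measurable
    ultimately show ?case using mult by (simp add: nn_integral_cmult cong: measurable_cong nn_integral_cong)
  next
    case (add u v)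
    have "(\<integral>\<^sup>+z. v z + u z \<partial>N \<omega>) = (\<integral>\<^sup>+z. v z \<partial>N \<omega>) + (\<integral>\<^sup>+z. u z \<partial>N \<omega>)" if "\<omega> \<in> space M" for \<omega>
      using mN[OF that add.hyps(1)] mN[OF that add.hyps(3)] by (intro nn_integral_add) auto
    moreover have [measurable]: "(\<lambda>\<omega>. \<integral>\<^sup>+z. u z \<partial>N \<omega>) \<in> borel_measurable M"
      "(\<lambda>\<omega>. \<integral>\<^sup>+z. v z \<partial>N \<omega>) \<in> borel_measurable M" using add by simp_all
    then have "(\<lambda>\<omega>. (\<integral>\<^sup>+z. v z \<partial>N \<omega>) + (\<integral>\<^sup>+z. u z \<partial>N \<omega>)) \<in> borel_measurable M" by measurable
    ultimately show ?case using add by (simp add: nn_integral_add cong: measurable_cong nn_integral_cong)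
  next
    case (seq U)
    have sup: "(SUP i. U i) z = (SUP i. U i z)" for z by (simp add: image_comp)
    have "(\<integral>\<^sup>+z. (SUP i. U i) z \<partial>N \<omega>) = (SUP i. \<integral>\<^sup>+z. U i z \<partial>N \<omega>)" if "\<omega> \<in> space M" for \<omega>
      using nn_integral_monotone_convergence_SUP[OF seq.hyps(3) mN[OF that seq.hyps(1)]] unfolding sup .
    moreover have "(\<integral>\<^sup>+z. (SUP i. U i) z \<partial>\<mu>) = (SUP i. \<integral>\<^sup>+z. U i z \<partial>\<mu>)"
      using nn_integral_monotone_convergence_SUP[OF seq.hyps(3) seq.hyps(1)] unfolding sup .
    moreover have "(\<integral>\<^sup>+\<omega>. (SUP i. \<integral>\<^sup>+z. U i z \<partial>N \<omega>) \<partial>M) = (SUP i. \<integral>\<^sup>+\<omega>. (\<integral>\<^sup>+z. U i z \<partial>N \<omega>) \<partial>M)"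
      using seq.IH seq.hyps(3) by (intro nn_integral_monotone_convergence_SUP)
        (auto simp: incseq_def le_fun_def intro!: nn_integral_mono)
    moreover have "(\<lambda>\<omega>. SUP i. \<integral>\<^sup>+z. U i z \<partial>N \<omega>) \<in> borel_measurable M"
      using seq.IH by (intro borel_measurable_SUP) auto
    ultimately show ?case using seq.IH by (simp cong: measurable_cong nn_integral_cong)
  qed
qed

lemma poisson_counts_prob:
  fixes c :: "nat \<Rightarrow> nat"
  assumes prm: "poisson_random_measure M \<mu> N" and I: "finite I" "I \<noteq> {}"
    and A: "\<And>i. i \<in> I \<Longrightarrow> A i \<in> fmeasurable \<mu>" and dis: "disjoint_family_on A I"
  shows "prob {\<omega>\<in>space M. \<forall>i\<in>I. emeasure (N \<omega>) (A i) = of_nat (c i)} =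
      (\<Prod>i\<in>I. exp (- measure \<mu> (A i)) * measure \<mu> (A i) ^ c i / fact (c i))"
    and "{\<omega>\<in>space M. \<forall>i\<in>I. emeasure (N \<omega>) (A i) = of_nat (c i)} \<in> events"
proof -
  have A': "A ` I \<subseteq> sets \<mu>" using A by (auto dest: fmeasurableD)
  have ind: "indep_vars (\<lambda>_. borel) (\<lambda>i \<omega>. emeasure (N \<omega>) (A i)) I"
    using prm I(1) A' dis by (auto simp: poisson_random_measure_def)
  have m: "(\<lambda>\<omega>. emeasure (N \<omega>) (A i)) \<in> borel_measurable M" if "i \<in> I" for i
    using prm A' that by (auto simp: poisson_random_measure_def)
  have eq: "{\<omega>\<in>space M. \<forall>i\<in>I. emeasure (N \<omega>) (A i) = of_nat (c i)} =
    (\<Inter>i\<in>I. (\<lambda>\<omega>. emeasure (N \<omega>) (A i)) -` {of_nat (c i)} \<inter> space M)"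
    using I(2) by auto
  show "{\<omega>\<in>space M. \<forall>i\<in>I. emeasure (N \<omega>) (A i) = of_nat (c i)} \<in> events"
    unfolding eq using I m by (intro sets.finite_INT) (auto intro: measurable_sets)
  have "prob (\<Inter>i\<in>I. (\<lambda>\<omega>. emeasure (N \<omega>) (A i)) -` {of_nat (c i)} \<inter> space M)
    = (\<Prod>i\<in>I. prob ((\<lambda>\<omega>. emeasure (N \<omega>) (A i)) -` {of_nat (c i)} \<inter> space M))"
    by (rule indep_varsD_finite[OF ind I(2,1)]) auto
  also have "\<dots> = (\<Prod>i\<in>I. exp (- measure \<mu> (A i)) * measure \<mu> (A i) ^ c i / fact (c i))"
  proof (rule prod.cong)
    fix i assume i: "i \<in> I"
    have "(\<lambda>\<omega>. emeasure (N \<omega>) (A i)) -` {of_nat (c i)} \<inter> space M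
      = {\<omega>\<in>space M. emeasure (N \<omega>) (A i) = of_nat (c i)}" by auto
    then show "prob ((\<lambda>\<omega>. emeasure (N \<omega>) (A i)) -` {of_nat (c i)} \<inter> space M)
      = exp (- measure \<mu> (A i)) * measure \<mu> (A i) ^ c i / fact (c i)"
      using prm A[OF i] by (auto simp: poisson_random_measure_def fmeasurable_def)
  qed simp
  finally show "prob {\<omega>\<in>space M. \<forall>i\<in>I. emeasure (N \<omega>) (A i) = of_nat (c i)} =
      (\<Prod>i\<in>I. exp (- measure \<mu> (A i)) * measure \<mu> (A i) ^ c i / fact (c i))"
    unfolding eq .
qed

end

text \<open>With at most one item per cell and times increasing with the cells, the items present at
  any time are an initial segment in the order of cells, and \<open>times\<close> supplies a time
  for every such segment. So the exact times disappear from the set of partial sums. It serves both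
  sides: real jump times with \<open>I\<close> the interval up to \<open>T\<close>, and step indices
  with \<open>I\<close> the initial indices.\<close>

lemma partial_sums_by_cells:
  fixes v :: "'i \<Rightarrow> 'b::comm_monoid_add" and \<tau> :: "'i \<Rightarrow> 'c::linorder" and c :: "'i \<Rightarrow> nat"
  assumes A: "finite A" "\<And>i. i \<in> A \<Longrightarrow> c i < L" "inj_on c A"
    and mono: "\<And>i j. i \<in> A \<Longrightarrow> j \<in> A \<Longrightarrow> c i < c j \<Longrightarrow> \<tau> i < \<tau> j"
    and times: "\<And>q. q \<le> L \<Longrightarrow> \<exists>t\<in>I. \<forall>i\<in>A. \<tau> i \<le> t \<longleftrightarrow> c i < q"
  shows "(\<lambda>t. \<Sum>i\<in>{i\<in>A. \<tau> i \<le> t}. v i) ` I = (\<lambda>q. \<Sum>l<q. \<Sum>i\<in>{i\<in>A. c i = l}. v i) ` {..L}"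
proof -
  have cells: "(\<Sum>l<q. \<Sum>i\<in>{i\<in>A. c i = l}. v i) = (\<Sum>i\<in>{i\<in>A. c i < q}. v i)" for q
  proof -
    have "(\<Sum>l<q. \<Sum>i\<in>{i\<in>A. c i = l}. v i) = (\<Sum>l<q. \<Sum>i\<in>{i\<in>{i\<in>A. c i < q}. c i = l}. v i)"
      by (intro sum.cong) auto
    also have "\<dots> = (\<Sum>i\<in>{i\<in>A. c i < q}. v i)"
      using A(1) by (intro sum.group) auto
    finally show ?thesis .
  qed
  show ?thesis
  proof (intro equalityI subsetI)
    fix u assume "u \<in> (\<lambda>t. \<Sum>i\<in>{i\<in>A. \<tau> i \<le> t}. v i) ` I"
    then obtain t where t: "t \<in> I" "u = (\<Sum>i\<in>{i\<in>A. \<tau> i \<le> t}. v i)" by auto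
    define C where "C = {i\<in>A. \<tau> i \<le> t}"
    have "finite C" using A(1) by (simp add: C_def)
    \<comment> \<open>The latest occupied cell among the items in \<open>C\<close> determines
      \<open>q\<close>; an item in the same cell is the same item by injectivity, and one in an
      earlier cell is earlier in time.\<close>
    have "\<exists>q\<le>L. C = {i\<in>A. c i < q}"
    proof (cases "C = {}")
      case True
      then show ?thesis by (intro exI[of _ 0]) auto
    next
      case False
      then have "Max (c ` C) \<in> c ` C" using \<open>finite C\<close> by (intro Max_in) auto
      then obtain j where j: "j \<in> C" "c j = Max (c ` C)" by auto
      have jA: "j \<in> A" "\<tau> j \<le> t" using j(1) by (auto simp: C_def)
      have "C = {i\<in>A. c i < Suc (c j)}"
      proof (intro equalityI subsetI)
        fix i assume i: "i \<in> C"
        then have "c i \<le> c j" unfolding j(2) using \<open>finite C\<close> by simp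
        then show "i \<in> {i\<in>A. c i < Suc (c j)}" using i by (simp add: C_def)
      next
        fix i assume i: "i \<in> {i\<in>A. c i < Suc (c j)}"
        then have "c i < c j \<or> c i = c j" "i \<in> A" by auto
        then have "\<tau> i \<le> \<tau> j" using mono[of i j] jA(1) inj_onD[OF A(3), of i j] by auto
        then show "i \<in> C" using i jA(2) by (auto simp: C_def)
      qed
      then show ?thesis using A(2)[OF jA(1)] by (intro exI[of _ "Suc (c j)"]) auto
    qed
    then obtain q where "q \<le> L" "C = {i\<in>A. c i < q}" by blast
    then show "u \<in> (\<lambda>q. \<Sum>l<q. \<Sum>i\<in>{i\<in>A. c i = l}. v i) ` {..L}"
      unfolding t(2) cells by (intro image_eqI[of _ _ q]) (auto simp: C_def)
  next
    fix u assume "u \<in> (\<lambda>q. \<Sum>l<q. \<Sum>i\<in>{i\<in>A. c i = l}. v i) ` {..L}"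
    then obtain q where q: "q \<le> L" "u = (\<Sum>i\<in>{i\<in>A. c i < q}. v i)" unfolding cells by auto
    obtain t where t: "t \<in> I" "\<forall>i\<in>A. \<tau> i \<le> t \<longleftrightarrow> c i < q" using times[OF q(1)] by blast
    have "{i\<in>A. \<tau> i \<le> t} = {i\<in>A. c i < q}" using t(2) by auto
    then show "u \<in> (\<lambda>t. \<Sum>i\<in>{i\<in>A. \<tau> i \<le> t}. v i) ` I" using t(1) q(2) by (intro image_eqI[of _ _ t]) auto
  qed
qed

section \<open>Coding by time cells and size boxes\<close>

text \<open>Boxes 1 to \<open>J\<close> tile the sizes above \<open>h 0\<close> up to
  \<open>h J\<close>; half-open boxes do so without overlap, and their masses become differences of
  open tails.\<close>

definition size_box :: "(nat \<Rightarrow> real) \<Rightarrow> nat \<Rightarrow> ennreal set"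
  where "size_box h j = (if j = 0 then {} else {ennreal (h (j - 1))<..ennreal (h j)})"

text \<open>Poisson probabilities for a cell of length \<open>t\<close>: for \<open>j = 0\<close>,
  no large jump; otherwise exactly one large jump, lying in box \<open>j\<close>. The exponential
  contains the whole tail above \<open>h 0\<close>, which also excludes jumps beyond the top
  box.\<close>

definition cell_prob :: "ennreal measure \<Rightarrow> (nat \<Rightarrow> real) \<Rightarrow> real \<Rightarrow> nat \<Rightarrow> real"
  where "cell_prob \<nu> h t j =
    (if j = 0 then 1 else t * measure \<nu> (size_box h j)) * exp (- (t * measure \<nu> {ennreal (h 0)<..}))"

definition cell_codes :: "nat \<Rightarrow> nat \<Rightarrow> (nat \<Rightarrow> nat) set"
  where "cell_codes L J = PiE {..<L} (\<lambda>_. {..J})"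

text \<open>Each occupied cell is represented by the right end of its box; the square root turns a
  squared length into a length.\<close>

definition code_shape :: "nat \<Rightarrow> (nat \<Rightarrow> real) \<Rightarrow> (nat \<Rightarrow> nat) \<Rightarrow> shape"
  where "code_shape L h \<sigma> = model_shape L (\<lambda>l. if \<sigma> l = 0 then 0 else sqrt (h (\<sigma> l)))"

text \<open>The mesh is measured on the scale of square roots because lengths, not squared lengths,
  enter the shapes.\<close>

locale size_grid =
  fixes h :: "nat \<Rightarrow> real" and J :: nat and \<eta> :: real
  assumes h0: "0 < h 0" and h_less: "\<And>j. j < J \<Longrightarrow> h j < h (Suc j)"
    and mesh: "\<And>j. j < J \<Longrightarrow> sqrt (h (Suc j)) - sqrt (h j) \<le> \<eta>" and \<eta>: "0 \<le> \<eta>"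
begin

lemma h_mono: "i \<le> j \<Longrightarrow> j \<le> J \<Longrightarrow> h i \<le> h j"
proof (induction j)
  case (Suc j)
  then show ?case using h_less[of j] by (auto simp: le_Suc_eq)
qed simp

lemma h_pos: "j \<le> J \<Longrightarrow> 0 < h j"
  using h_mono[of 0 j] h0 by simp

lemma box_subset: "j \<le> J \<Longrightarrow> size_box h j \<subseteq> {ennreal (h 0)<..}"
proof -
  assume "j \<le> J"
  then have "j - 1 \<le> J" by linarith
  then have "ennreal (h 0) \<le> ennreal (h (j - 1))" by (intro ennreal_leI h_mono) auto
  then show ?thesis by (auto simp: size_box_def intro: le_less_trans)
qed

lemma box_disjoint: "i \<le> J \<Longrightarrow> j \<le> J \<Longrightarrow> z \<in> size_box h i \<Longrightarrow> z \<in> size_box h j \<Longrightarrow> i = j"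
proof (induction i j rule: linorder_wlog)
  case (le i j)
  show ?case
  proof (rule ccontr)
    assume "i \<noteq> j"
    then have "ennreal (h i) \<le> ennreal (h (j - 1))" using le by (intro ennreal_leI h_mono) auto
    then show False using le by (auto simp: size_box_def split: if_splits)
  qed
qed auto

lemma sets_box: "size_box h j \<in> sets borel"
  by (simp add: size_box_def)

lemma box_sqrt:
  assumes j: "0 < j" "j \<le> J" and z: "z \<in> size_box h j"
  shows "sqrt (enn2real z) \<le> sqrt (h J)" "\<bar>sqrt (enn2real z) - sqrt (h j)\<bar> \<le> \<eta>" "0 < z" "z < \<infinity>"
proof -
  have z': "ennreal (h (j - 1)) < z" "z \<le> ennreal (h j)" using z j by (auto simp: size_box_def)
  show "0 < z" using z'(1) by (rule le_less_trans[rotated]) simp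
  show "z < \<infinity>" using z'(2) by (rule le_less_trans) simp
  then obtain r where r: "z = ennreal r" "0 \<le> r" by (cases z) auto
  have "j - 1 \<le> J" using j by linarith
  then have "0 \<le> h (j - 1)" using h_pos[of "j - 1"] by linarith
  then have "h (j - 1) \<le> r" using z'(1) r by (simp add: ennreal_less_iff)
  moreover have "r \<le> h j" using z'(2) r h_pos[of j] j by (auto simp: ennreal_le_iff)
  moreover have "sqrt (h j) - sqrt (h (j - 1)) \<le> \<eta>" using mesh[of "j - 1"] j by simp
  moreover have "h j \<le> h J" using h_mono[of j J] j by simp
  ultimately show "sqrt (enn2real z) \<le> sqrt (h J)" "\<bar>sqrt (enn2real z) - sqrt (h j)\<bar> \<le> \<eta>"
    using r real_sqrt_le_mono[of "h (j - 1)" r] real_sqrt_le_mono[of r "h j"] real_sqrt_le_mono[of "h j" "h J"] \<eta>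
    unfolding abs_le_iff by (simp, linarith?)+
qed

end

context levy_measure
begin

text \<open>Dominated convergence along thresholds \<open>1 / (k + 1)\<close>, with dominating
  function \<open>min 1 z\<close> from the integrability condition on \<open>\<nu>\<close>.
  Monotonicity in the threshold then covers every smaller \<open>s\<close>.\<close>

lemma small_integral_tendsto_0:
  assumes "0 < (e::real)"
  shows "\<exists>s0>0. \<forall>s. 0 < s \<and> s \<le> s0 \<longrightarrow> (\<integral>\<^sup>+z\<in>{0<..ennreal s}. z \<partial>\<nu>) \<le> ennreal e"
proof -
  let ?u = "\<lambda>k z. z * indicator {0<..ennreal (1 / real (Suc k))} z"
  note meas = levy_borel_measurable
  have "(\<lambda>k. \<integral>\<^sup>+z. ?u k z \<partial>\<nu>) \<longlonglongrightarrow> (\<integral>\<^sup>+z. 0 \<partial>\<nu>)"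
  proof (rule nn_integral_dominated_convergence[where w = "\<lambda>z. min 1 z * indicator {0<..<\<infinity>} z"])
    show "?u k \<in> borel_measurable \<nu>" for k by (rule meas) simp
    show "(\<lambda>z. min 1 z * indicator {0<..<\<infinity>} z) \<in> borel_measurable \<nu>" by (rule meas) simp
    show "(\<integral>\<^sup>+z\<in>{0<..<\<infinity>}. min 1 z \<partial>\<nu>) < \<infinity>" by (rule \<nu>_levy)
    show "AE z in \<nu>. ?u k z \<le> min 1 z * indicator {0<..<\<infinity>} z" for k
    proof (rule AE_I2)
      fix z :: ennreal
      have "ennreal (1 / real (Suc k)) \<le> ennreal 1" by (intro ennreal_leI) simp
      then have "z \<le> ennreal (1 / real (Suc k)) \<Longrightarrow> z \<le> 1" by (metis ennreal_1 order_trans)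
      moreover have "z \<le> ennreal (1 / real (Suc k)) \<Longrightarrow> z < \<infinity>" by (erule le_less_trans) simp
      ultimately show "?u k z \<le> min 1 z * indicator {0<..<\<infinity>} z"
        by (auto simp: indicator_def min_def)
    qed
    show "AE z in \<nu>. (\<lambda>k. ?u k z) \<longlonglongrightarrow> 0"
    proof (rule AE_I2)
      fix z :: ennreal
      show "(\<lambda>k. ?u k z) \<longlonglongrightarrow> 0"
      proof (cases "z = 0")
        case False
        have "\<forall>\<^sub>F k in sequentially. ?u k z = 0"
        proof -
          have "\<exists>K. \<forall>k\<ge>K. ennreal (1 / real (Suc k)) < z"
          proof (cases z)
            case (real r)
            then have "0 < r" using False by simp
            then obtain K where K: "1 / real (Suc K) < r" using reals_Archimedean[of r] by (auto simp: inverse_eq_divide)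
            have "1 / real (Suc k) < r" if "K \<le> k" for k
            proof -
              have "1 / real (Suc k) \<le> 1 / real (Suc K)" using that by (intro divide_left_mono) auto
              then show ?thesis using K by linarith
            qed
            then show ?thesis using real \<open>0 < r\<close> by (intro exI[of _ K]) (auto intro!: ennreal_lessI)
          qed auto
          then obtain K where K: "\<And>k. K \<le> k \<Longrightarrow> ennreal (1 / real (Suc k)) < z" by blast
          show ?thesis unfolding eventually_sequentially
          proof (intro exI[of _ K] allI impI)
            fix k assume "K \<le> k"
            then have "z \<notin> {0<..ennreal (1 / real (Suc k))}" using K[of k] by (metis greaterThanAtMost_iff not_le)
            then show "?u k z = 0" unfolding indicator_simps(2)[OF \<open>z \<notin> _\<close>] by simp
          qed
        qed
        then show ?thesis by (rule tendsto_eventually)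
      qed simp
    qed
  qed simp
  then have "(\<lambda>k. \<integral>\<^sup>+z. ?u k z \<partial>\<nu>) \<longlonglongrightarrow> 0" by simp
  from order_tendstoD(2)[OF this, of "ennreal e"] assms
  obtain k where k: "(\<integral>\<^sup>+z. ?u k z \<partial>\<nu>) < ennreal e" by (auto simp: eventually_sequentially)
  have "(\<integral>\<^sup>+z\<in>{0<..ennreal s}. z \<partial>\<nu>) \<le> ennreal e" if "0 < s" "s \<le> 1 / real (Suc k)" for s
  proof -
    have "ennreal s \<le> ennreal (1 / real (Suc k))" using that by (intro ennreal_leI)
    then have "{0<..ennreal s} \<subseteq> {0<..ennreal (1 / real (Suc k))}" by (intro subsetI) (metis greaterThanAtMost_iff order_trans)
    note sub = this
    have "(\<integral>\<^sup>+z\<in>{0<..ennreal s}. z \<partial>\<nu>) \<le> (\<integral>\<^sup>+z. ?u k z \<partial>\<nu>)"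
    proof (rule nn_integral_mono)
      fix z
      show "z * indicator {0<..ennreal s} z \<le> ?u k z"
      proof (cases "z \<in> {0<..ennreal s}")
        case True
        then have "z \<in> {0<..ennreal (1 / real (Suc k))}" using sub by (rule subsetD[rotated])
        then show ?thesis using True by (simp only: indicator_simps order_refl)
      next
        case False
        show ?thesis unfolding indicator_simps(2)[OF False] by simp
      qed
    qed
    also have "\<dots> \<le> ennreal e" using k by (rule less_imp_le)
    finally show ?thesis .
  qed
  then show ?thesis by (intro exI[of _ "1 / real (Suc k)"]) auto
qed

end

section \<open>The Poisson atoms behind the crinkled subordinator\<close>

locale crinkled_atoms = levy_measure \<nu> + prob_space P
  for \<nu> :: "ennreal measure" and P :: "'v measure" +
  fixes x :: "nat \<Rightarrow> 'v \<Rightarrow> real" and y :: "nat \<Rightarrow> 'v \<Rightarrow> ennreal"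
  assumes atoms: "poisson_atoms P \<nu> x y"
begin

abbreviation "\<mu> \<equiv> crinkled_intensity \<nu>"

definition N :: "'v \<Rightarrow> (real \<times> ennreal) measure"
  where "N \<omega> = distr (count_space {k. 0 < y k \<omega>}) \<mu> (\<lambda>k. (x k \<omega>, y k \<omega>))"

lemma N_prm: "poisson_random_measure P \<mu> N"
  using atoms unfolding poisson_atoms_def N_def[abs_def] by simp

lemma x_measurable: "x k \<in> borel_measurable P" and y_measurable: "y k \<in> borel_measurable P"
  and x_nonneg: "\<omega> \<in> space P \<Longrightarrow> 0 \<le> x k \<omega>"
  using atoms by (auto simp: poisson_atoms_def)

lemma space_\<mu>: "space \<mu> = {0..} \<times> {0<..}"
  by (simp add: crinkled_intensity_def space_pair_measure space_restrict_space levy_space)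

lemma atom_measurable:
  "\<omega> \<in> space P \<Longrightarrow> (\<lambda>k. (x k \<omega>, y k \<omega>)) \<in> count_space {k. 0 < y k \<omega>} \<rightarrow>\<^sub>M \<mu>"
  using x_nonneg by (auto simp: space_\<mu>)

lemma emeasure_N:
  assumes "\<omega> \<in> space P" "A \<in> sets \<mu>"
  shows "emeasure (N \<omega>) A = emeasure (count_space UNIV) {k. 0 < y k \<omega> \<and> (x k \<omega>, y k \<omega>) \<in> A}"
proof -
  define Q where "Q = {k. 0 < y k \<omega> \<and> (x k \<omega>, y k \<omega>) \<in> A}"
  have Q: "Q \<subseteq> {k. 0 < y k \<omega>}" by (auto simp: Q_def)
  have "(\<lambda>k. (x k \<omega>, y k \<omega>)) -` A \<inter> {k. 0 < y k \<omega>} = Q" by (auto simp: Q_def)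
  then have "emeasure (N \<omega>) A = emeasure (count_space {k. 0 < y k \<omega>}) Q"
    unfolding N_def using assms by (subst emeasure_distr[OF atom_measurable]) auto
  also have "\<dots> = emeasure (count_space UNIV) Q"
    unfolding emeasure_count_space[OF Q] emeasure_count_space[OF subset_UNIV] ..
  finally show ?thesis unfolding Q_def .
qed

lemma N_eq_0_iff:
  assumes "\<omega> \<in> space P" "A \<in> sets \<mu>"
  shows "emeasure (N \<omega>) A = 0 \<longleftrightarrow> {k. 0 < y k \<omega> \<and> (x k \<omega>, y k \<omega>) \<in> A} = {}"
  unfolding emeasure_N[OF assms] by (simp add: emeasure_count_space_eq_0)

lemma N_eq_1D:
  assumes "\<omega> \<in> space P" "A \<in> sets \<mu>" "emeasure (N \<omega>) A = 1"
  shows "\<exists>\<kappa>. {k. 0 < y k \<omega> \<and> (x k \<omega>, y k \<omega>) \<in> A} = {\<kappa>}"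
proof -
  define Q where "Q = {k. 0 < y k \<omega> \<and> (x k \<omega>, y k \<omega>) \<in> A}"
  have 1: "emeasure (count_space UNIV) Q = 1" using emeasure_N[OF assms(1,2)] assms(3) by (simp add: Q_def)
  then have "finite Q" by (cases "finite Q") auto
  then have "of_nat (card Q) = (1 :: ennreal)" using 1 by simp
  then have "card Q = 1" by (metis of_nat_1 of_nat_eq_iff)
  then show ?thesis by (auto simp: Q_def card_1_singleton_iff)
qed

lemma \<mu>_times:
  assumes "I \<in> sets borel" "I \<subseteq> {0..}" "A \<in> sets \<nu>"
  shows "I \<times> A \<in> sets \<mu>" "emeasure \<mu> (I \<times> A) = emeasure lborel I * emeasure \<nu> A"
proof -
  interpret sigma_finite_measure \<nu> by (rule levy_sigma_finite)
  have I: "I \<in> sets (restrict_space lborel {0..})" using assms(1,2) by (subst sets_restrict_space_iff) auto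
  show "I \<times> A \<in> sets \<mu>" unfolding crinkled_intensity_def using I assms(3) by (rule pair_measureI)
  show "emeasure \<mu> (I \<times> A) = emeasure lborel I * emeasure \<nu> A"
    unfolding crinkled_intensity_def emeasure_pair_measure_Times[OF I assms(3)]
    using assms by (subst emeasure_restrict_space) auto
qed

lemma \<mu>_cell:
  assumes a: "0 \<le> a" "0 < t" and s: "0 < s" and A: "A \<subseteq> {ennreal s<..}" "A \<in> sets borel"
  shows "{a<..a + t} \<times> A \<in> fmeasurable \<mu>" "measure \<mu> ({a<..a + t} \<times> A) = t * measure \<nu> A"
proof -
  have f: "A \<in> fmeasurable \<nu>" by (rule levy_fmeasurable[OF s A])
  have sub: "{a<..a + t} \<subseteq> {0..}" using a by auto
  note e = \<mu>_times[OF _ sub fmeasurableD[OF f], simplified]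
  have "emeasure \<mu> ({a<..a + t} \<times> A) = ennreal t * ennreal (measure \<nu> A)"
  proof -
    have "emeasure lborel {a<..a + t} = ennreal t" using a by simp
    moreover have "emeasure \<nu> A = ennreal (measure \<nu> A)"
      using fmeasurableD2[OF f] by (rule emeasure_eq_ennreal_measure)
    ultimately show ?thesis unfolding e(2) by simp
  qed
  then have em: "emeasure \<mu> ({a<..a + t} \<times> A) = ennreal (t * measure \<nu> A)"
    using a by (simp add: ennreal_mult)
  then show "{a<..a + t} \<times> A \<in> fmeasurable \<mu>" using e(1) by (intro fmeasurableI) auto
  show "measure \<mu> ({a<..a + t} \<times> A) = t * measure \<nu> A"
    using em a by (simp add: measure_def)
qed

text \<open>Campbell's formula for the size \<open>z\<close> restricted to times up to
  \<open>T\<close> and sizes up to \<open>s\<close>; the intensity is a product, so the integral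
  factors into the length of the time interval and the small-size integral.\<close>

lemma small_jumps:
  assumes T: "0 \<le> T" and s: "0 < s"
  defines "V \<equiv> \<lambda>\<omega>. \<Sum>k. if 0 < y k \<omega> \<and> x k \<omega> \<le> T \<and> y k \<omega> \<le> ennreal s then y k \<omega> else 0"
  shows "V \<in> borel_measurable P" "(\<integral>\<^sup>+\<omega>. V \<omega> \<partial>P) = ennreal T * (\<integral>\<^sup>+z\<in>{0<..ennreal s}. z \<partial>\<nu>)"
proof -
  interpret \<nu>: sigma_finite_measure \<nu> by (rule levy_sigma_finite)
  define \<phi> where "\<phi> = (\<lambda>(r::real, z). indicator {0..T} r * (z * indicator {0<..ennreal s} z) :: ennreal)"
  have m1: "(\<lambda>r. indicator {0..T} r :: ennreal) \<in> borel_measurable (restrict_space lborel {0..})"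
    by (intro measurable_restrict_space1) simp
  have m2: "(\<lambda>z. z * indicator {0<..ennreal s} z) \<in> borel_measurable \<nu>"
    by (rule levy_borel_measurable) simp
  have m\<phi>: "\<phi> \<in> borel_measurable \<mu>"
    unfolding \<phi>_def crinkled_intensity_def case_prod_beta
    using measurable_compose[OF measurable_fst m1] measurable_compose[OF measurable_snd m2] by measurable
  have V: "(\<integral>\<^sup>+z. \<phi> z \<partial>N \<omega>) = V \<omega>" if "\<omega> \<in> space P" for \<omega>
  proof -
    have "(\<integral>\<^sup>+z. \<phi> z \<partial>N \<omega>) = (\<integral>\<^sup>+k. \<phi> (x k \<omega>, y k \<omega>) \<partial>count_space {k. 0 < y k \<omega>})"
      unfolding N_def by (rule nn_integral_distr[OF atom_measurable[OF that]]) (simp add: m\<phi>)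
    also have "\<dots> = (\<integral>\<^sup>+k. \<phi> (x k \<omega>, y k \<omega>) * indicator {k. 0 < y k \<omega>} k \<partial>count_space UNIV)"
      by (rule nn_integral_count_space_indicator) simp
    also have "\<dots> = (\<Sum>k. \<phi> (x k \<omega>, y k \<omega>) * indicator {k. 0 < y k \<omega>} k)"
      by (rule nn_integral_count_space_nat)
    also have "\<dots> = V \<omega>"
      unfolding V_def using x_nonneg[OF that]
      by (intro arg_cong[where f = suminf] ext) (auto simp: \<phi>_def indicator_def)
    finally show ?thesis .
  qed
  have C: "(\<lambda>\<omega>. \<integral>\<^sup>+z. \<phi> z \<partial>N \<omega>) \<in> borel_measurable P"
    "(\<integral>\<^sup>+\<omega>. (\<integral>\<^sup>+z. \<phi> z \<partial>N \<omega>) \<partial>P) = (\<integral>\<^sup>+z. \<phi> z \<partial>\<mu>)"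
    using Campbell[OF N_prm m\<phi>] by auto
  show "V \<in> borel_measurable P" using C(1) V by (simp cong: measurable_cong)
  have "(\<integral>\<^sup>+\<omega>. V \<omega> \<partial>P) = (\<integral>\<^sup>+z. \<phi> z \<partial>\<mu>)"
    unfolding C(2)[symmetric] using V by (intro nn_integral_cong) simp
  also have "\<dots> = (\<integral>\<^sup>+r. \<integral>\<^sup>+z. \<phi> (r, z) \<partial>\<nu> \<partial>restrict_space lborel {0..})"
    using \<nu>.nn_integral_fst[of \<phi> "restrict_space lborel {0..}"] m\<phi> by (simp add: crinkled_intensity_def)
  also have "\<dots> = (\<integral>\<^sup>+r. indicator {0..T} r * (\<integral>\<^sup>+z\<in>{0<..ennreal s}. z \<partial>\<nu>) \<partial>restrict_space lborel {0..})"
    unfolding \<phi>_def using m2 by (simp add: nn_integral_cmult)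
  also have "\<dots> = (\<integral>\<^sup>+r. indicator {0..T} r \<partial>restrict_space lborel {0..}) * (\<integral>\<^sup>+z\<in>{0<..ennreal s}. z \<partial>\<nu>)"
    using m1 by (rule nn_integral_multc)
  also have "(\<integral>\<^sup>+r. indicator {0..T} r \<partial>restrict_space lborel {0..}) = ennreal T"
  proof -
    have "{0..T} \<in> sets (restrict_space lborel {0..})" by (subst sets_restrict_space_iff) auto
    then show ?thesis using T by (simp add: emeasure_restrict_space)
  qed
  finally show "(\<integral>\<^sup>+\<omega>. V \<omega> \<partial>P) = ennreal T * (\<integral>\<^sup>+z\<in>{0<..ennreal s}. z \<partial>\<nu>)" .
qed

end

section \<open>Coding the crinkled range\<close>

locale crinkled_grid = crinkled_atoms \<nu> P x y + size_grid h J \<eta>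
  for \<nu> :: "ennreal measure" and P :: "'v measure" and x y and h :: "nat \<Rightarrow> real" and J :: nat and \<eta> :: real +
  fixes T :: real and L :: nat
  assumes T: "0 < T" and L: "0 < L"
begin

definition dt :: real
  where "dt = T / real L"

text \<open>Cells are open on the left, so together they cover the positive times up to
  \<open>T\<close>. An atom at time 0 belongs to no cell and is put into the exceptional
  event.\<close>

definition cell_time :: "nat \<Rightarrow> real set"
  where "cell_time l = {real l * dt<..real l * dt + dt}"

definition large_atoms :: "'v \<Rightarrow> nat \<Rightarrow> nat set"
  where "large_atoms \<omega> l = {k. x k \<omega> \<in> cell_time l \<and> ennreal (h 0) < y k \<omega>}"

text \<open>
  Indices \<open>2 * l\<close> and \<open>2 * l + 1\<close> belong to cell \<open>l\<close>: the box prescribed by the code and the remaining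
  large sizes. As \<open>size_box h 0\<close> is empty, code \<open>0\<close> says that the cell has no large atom.
\<close>

definition count_set :: "(nat \<Rightarrow> nat) \<Rightarrow> nat \<Rightarrow> (real \<times> ennreal) set"
  where "count_set \<sigma> i = cell_time (i div 2) \<times>
    (if even i then size_box h (\<sigma> (i div 2)) else {ennreal (h 0)<..} - size_box h (\<sigma> (i div 2)))"

definition count_value :: "(nat \<Rightarrow> nat) \<Rightarrow> nat \<Rightarrow> nat"
  where "count_value \<sigma> i = (if even i \<and> \<sigma> (i div 2) \<noteq> 0 then 1 else 0)"

text \<open>Phrased by counts of the random measure on disjoint sets, because independence and the
  Poisson law are given for these counts and not for the enumerated atoms.\<close>

definition code_event :: "(nat \<Rightarrow> nat) \<Rightarrow> 'v set"
  where "code_event \<sigma> = {\<omega>\<in>space P. \<forall>i\<in>{..<L * 2}. emeasure (N \<omega>) (count_set \<sigma> i) = of_nat (count_value \<sigma> i)}"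

lemma t_pos: "0 < dt" and L_dt: "real L * dt = T"
  using T L by (auto simp: dt_def)

lemma count_set_fmeasurable:
  assumes "\<sigma> \<in> cell_codes L J" "i < L * 2"
  shows "count_set \<sigma> i \<in> fmeasurable \<mu>"
    and "measure \<mu> (count_set \<sigma> i) = dt *
      measure \<nu> (if even i then size_box h (\<sigma> (i div 2)) else {ennreal (h 0)<..} - size_box h (\<sigma> (i div 2)))"
proof -
  have "i div 2 < L" using assms(2) by auto
  then have "\<sigma> (i div 2) \<le> J" using assms(1) by (auto simp: cell_codes_def PiE_iff)
  then have sub: "(if even i then size_box h (\<sigma> (i div 2)) else {ennreal (h 0)<..} - size_box h (\<sigma> (i div 2))) \<subseteq> {ennreal (h 0)<..}"
    using box_subset by auto
  have sets: "(if even i then size_box h (\<sigma> (i div 2)) else {ennreal (h 0)<..} - size_box h (\<sigma> (i div 2))) \<in> sets borel"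
    using sets_box by auto
  have a: "0 \<le> real (i div 2) * dt" using t_pos by simp
  show "count_set \<sigma> i \<in> fmeasurable \<mu>"
    and "measure \<mu> (count_set \<sigma> i) = dt *
      measure \<nu> (if even i then size_box h (\<sigma> (i div 2)) else {ennreal (h 0)<..} - size_box h (\<sigma> (i div 2)))"
    unfolding count_set_def cell_time_def by (rule \<mu>_cell[OF a t_pos h0 sub sets])+
qed

lemma cell_time_disjoint: "z \<in> cell_time l \<Longrightarrow> z \<in> cell_time l' \<Longrightarrow> l = l'"
proof (induction l l' rule: linorder_wlog)
  case (le l l')
  show ?case
  proof (rule ccontr)
    assume "l \<noteq> l'"
    then have "real l + 1 \<le> real l'" using le by simp
    then have "(real l + 1) * dt \<le> real l' * dt" using t_pos by (intro mult_right_mono) auto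
    then show False using le by (auto simp: cell_time_def distrib_right)
  qed
qed auto

lemma count_sets_disjoint: "disjoint_family_on (count_set \<sigma>) {..<L * 2}"
  unfolding disjoint_family_on_def
proof (intro ballI impI)
  fix i j :: nat assume "i \<noteq> j"
  show "count_set \<sigma> i \<inter> count_set \<sigma> j = {}"
  proof (rule ccontr)
    assume "count_set \<sigma> i \<inter> count_set \<sigma> j \<noteq> {}"
    then obtain r z where rz: "(r, z) \<in> count_set \<sigma> i" "(r, z) \<in> count_set \<sigma> j" by auto
    then have "i div 2 = j div 2" by (auto simp: count_set_def intro: cell_time_disjoint)
    moreover from this rz have "even i = even j" by (auto simp: count_set_def split: if_splits)
    ultimately show False using \<open>i \<noteq> j\<close> by (metis div_mult_mod_eq even_iff_mod_2_eq_zero odd_iff_mod_2_eq_one)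
  qed
qed

text \<open>Independence splits the probability over the \<open>2 * L\<close> sets. Pairing the two
  sets of one cell, the exponents add up to the mass of the whole tail, so the dependence on the box
  survives only in the factor for a single point.\<close>

lemma code_event_prob:
  assumes \<sigma>: "\<sigma> \<in> cell_codes L J"
  shows "prob (code_event \<sigma>) = (\<Prod>l<L. cell_prob \<nu> h dt (\<sigma> l))" "code_event \<sigma> \<in> events"
proof -
  have I: "finite {..<L * 2}" "{..<L * 2} \<noteq> {}" using L by (auto simp: lessThan_empty_iff)
  show "code_event \<sigma> \<in> events" unfolding code_event_def by (rule poisson_counts_prob(2)[OF N_prm I _ count_sets_disjoint]) (use count_set_fmeasurable(1)[OF \<sigma>] in auto)
  define g where "g i = exp (- measure \<mu> (count_set \<sigma> i)) * measure \<mu> (count_set \<sigma> i) ^ count_value \<sigma> i / fact (count_value \<sigma> i)" for i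
  have "prob (code_event \<sigma>) = (\<Prod>i<L * 2. g i)"
    unfolding code_event_def g_def
    by (rule poisson_counts_prob(1)[OF N_prm I _ count_sets_disjoint]) (use count_set_fmeasurable(1)[OF \<sigma>] in auto)
  also have "\<dots> = (\<Prod>l<L. \<Prod>i\<in>{l * 2..<l * 2 + 2}. g i)" by (rule prod.nat_group[symmetric])
  also have "\<dots> = (\<Prod>l<L. cell_prob \<nu> h dt (\<sigma> l))"
  proof (rule prod.cong)
    fix l assume l: "l \<in> {..<L}"
    then have \<sigma>l: "\<sigma> l \<le> J" using \<sigma> by (auto simp: cell_codes_def PiE_iff)
    have "{l * 2..<l * 2 + 2} = {l * 2, Suc (l * 2)}" by auto
    then have 1: "(\<Prod>i\<in>{l * 2..<l * 2 + 2}. g i) = g (l * 2) * g (Suc (l * 2))" by simp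
    have m1: "measure \<mu> (count_set \<sigma> (l * 2)) = dt * measure \<nu> (size_box h (\<sigma> l))"
      using count_set_fmeasurable(2)[OF \<sigma>, of "l * 2"] l by simp
    have f: "{ennreal (h 0)<..} \<in> fmeasurable \<nu>" "size_box h (\<sigma> l) \<in> fmeasurable \<nu>"
      using levy_fmeasurable[OF h0 _ ] box_subset[OF \<sigma>l] sets_box by auto
    have "measure \<nu> ({ennreal (h 0)<..} - size_box h (\<sigma> l)) = measure \<nu> {ennreal (h 0)<..} - measure \<nu> (size_box h (\<sigma> l))"
      using f box_subset[OF \<sigma>l] by (intro measure_Diff) (auto dest: fmeasurableD fmeasurableD2)
    then have m2: "measure \<mu> (count_set \<sigma> (Suc (l * 2))) = dt * (measure \<nu> {ennreal (h 0)<..} - measure \<nu> (size_box h (\<sigma> l)))"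
      using count_set_fmeasurable(2)[OF \<sigma>, of "Suc (l * 2)"] l by simp
    have v: "count_value \<sigma> (l * 2) = (if \<sigma> l = 0 then 0 else 1)" "count_value \<sigma> (Suc (l * 2)) = 0"
      by (auto simp: count_value_def)
    define b where "b = measure \<nu> (size_box h (\<sigma> l))"
    define r where "r = measure \<nu> {ennreal (h 0)<..}"
    have g1: "g (l * 2) = exp (- (dt * b)) * (dt * b) ^ (if \<sigma> l = 0 then 0 else 1)"
      unfolding g_def m1 v b_def by simp
    have g2: "g (Suc (l * 2)) = exp (- (dt * (r - b)))"
      unfolding g_def m2 v b_def r_def by simp
    have "exp (- (dt * b)) * exp (- (dt * (r - b))) = exp (- (dt * r))"
      unfolding exp_add[symmetric] by (simp add: algebra_simps)
    then have "g (l * 2) * g (Suc (l * 2)) = (if \<sigma> l = 0 then 1 else dt * b) * exp (- (dt * r))"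
      unfolding g1 g2 by simp
    then show "(\<Prod>i\<in>{l * 2..<l * 2 + 2}. g i) = cell_prob \<nu> h dt (\<sigma> l)"
      unfolding 1 cell_prob_def b_def r_def .
  qed simp
  finally show "prob (code_event \<sigma>) = (\<Prod>l<L. cell_prob \<nu> h dt (\<sigma> l))" .
qed

lemma y_pos: "ennreal (h 0) < y k \<omega> \<Longrightarrow> 0 < y k \<omega>"
  by (rule le_less_trans[OF zero_le])

text \<open>Translates counts into indices: a zero count of the remaining sizes forces each large
  atom of the cell into the prescribed box, and the count in the box then says how many there
  are.\<close>

lemma code_event_cell:
  assumes \<sigma>: "\<sigma> \<in> cell_codes L J" and \<omega>: "\<omega> \<in> code_event \<sigma>" and l: "l < L"
  shows "if \<sigma> l = 0 then large_atoms \<omega> l = {} else \<exists>\<kappa>. large_atoms \<omega> l = {\<kappa>} \<and> y \<kappa> \<omega> \<in> size_box h (\<sigma> l)"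
proof -
  have \<sigma>l: "\<sigma> l \<le> J" using \<sigma> l by (auto simp: cell_codes_def PiE_iff)
  have sp: "\<omega> \<in> space P" using \<omega> by (simp add: code_event_def)
  have "emeasure (N \<omega>) (count_set \<sigma> i) = of_nat (count_value \<sigma> i)" if "i < L * 2" for i
    using \<omega> that by (auto simp: code_event_def)
  from this[of "l * 2"] this[of "Suc (l * 2)"] l
  have c: "emeasure (N \<omega>) (count_set \<sigma> (l * 2)) = of_nat (count_value \<sigma> (l * 2))"
    "emeasure (N \<omega>) (count_set \<sigma> (Suc (l * 2))) = 0" by (auto simp: count_value_def)
  have s: "count_set \<sigma> (l * 2) \<in> sets \<mu>" "count_set \<sigma> (Suc (l * 2)) \<in> sets \<mu>"
    using count_set_fmeasurable(1)[OF \<sigma>] l by (auto dest!: fmeasurableD)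
  have "{k. 0 < y k \<omega> \<and> (x k \<omega>, y k \<omega>) \<in> count_set \<sigma> (Suc (l * 2))} = {}"
    using N_eq_0_iff[OF sp s(2)] c(2) by simp
  then have others: "y k \<omega> \<in> size_box h (\<sigma> l)" if "k \<in> large_atoms \<omega> l" for k
    using that y_pos[of k \<omega>] by (auto simp: large_atoms_def count_set_def)
  have boxed: "{k. 0 < y k \<omega> \<and> (x k \<omega>, y k \<omega>) \<in> count_set \<sigma> (l * 2)} = large_atoms \<omega> l"
  proof (intro equalityI subsetI)
    fix k assume "k \<in> {k. 0 < y k \<omega> \<and> (x k \<omega>, y k \<omega>) \<in> count_set \<sigma> (l * 2)}"
    then show "k \<in> large_atoms \<omega> l"
      using box_subset[OF \<sigma>l] by (auto simp: large_atoms_def count_set_def)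
  next
    fix k assume k: "k \<in> large_atoms \<omega> l"
    then show "k \<in> {k. 0 < y k \<omega> \<and> (x k \<omega>, y k \<omega>) \<in> count_set \<sigma> (l * 2)}"
      using others[OF k] y_pos[of k \<omega>] by (auto simp: large_atoms_def count_set_def)
  qed
  show ?thesis
  proof (cases "\<sigma> l = 0")
    case True
    then show ?thesis using others by (auto simp: size_box_def)
  next
    case False
    then have "emeasure (N \<omega>) (count_set \<sigma> (l * 2)) = 1" using c(1) by (simp add: count_value_def)
    from N_eq_1D[OF sp s(1) this] obtain \<kappa> where "large_atoms \<omega> l = {\<kappa>}" unfolding boxed by blast
    then show ?thesis using False others by auto
  qed
qed

lemma code_events_disjoint: "disjoint_family_on code_event (cell_codes L J)"
  unfolding disjoint_family_on_def
proof (intro ballI impI)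
  fix \<sigma> \<sigma>' assume \<sigma>: "\<sigma> \<in> cell_codes L J" and \<sigma>': "\<sigma>' \<in> cell_codes L J" and ne: "\<sigma> \<noteq> \<sigma>'"
  show "code_event \<sigma> \<inter> code_event \<sigma>' = {}"
  proof (rule ccontr)
    assume "code_event \<sigma> \<inter> code_event \<sigma>' \<noteq> {}"
    then obtain \<omega> where \<omega>: "\<omega> \<in> code_event \<sigma>" "\<omega> \<in> code_event \<sigma>'" by auto
    have "\<sigma> l = \<sigma>' l" if l: "l \<in> {..<L}" for l
    proof -
      have "\<sigma> l \<le> J" "\<sigma>' l \<le> J" using \<sigma> \<sigma>' l by (auto simp: cell_codes_def PiE_iff)
      then show ?thesis
        using code_event_cell[OF \<sigma> \<omega>(1), of l] code_event_cell[OF \<sigma>' \<omega>(2), of l] l box_disjoint[of "\<sigma> l" "\<sigma>' l"]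
        by (auto split: if_splits)
    qed
    then have "\<sigma> = \<sigma>'" using \<sigma> \<sigma>' unfolding cell_codes_def by (intro PiE_ext)
    then show False using ne by simp
  qed
qed

text \<open>Two ways of failing: a large atom at time 0, outside all cells, or small jumps with
  total size at least \<open>e\<^sup>2\<close>, which could move the path by \<open>e\<close>. The
  second is written in the form to which Markov's inequality applies.\<close>

definition bad_event :: "real \<Rightarrow> 'v set"
  where "bad_event e = {\<omega>\<in>space P. emeasure (N \<omega>) ({0} \<times> {ennreal (h 0)<..}) \<noteq> 0} \<union>
    {\<omega>\<in>space P. 1 \<le> ennreal (1 / e\<^sup>2) *
      (\<Sum>k. if 0 < y k \<omega> \<and> x k \<omega> \<le> T \<and> y k \<omega> \<le> ennreal (h 0) then y k \<omega> else 0)}"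

text \<open>The slice at time 0 has zero intensity, hence almost surely no atom. For the small jumps
  a mean of at most \<open>e ^ 3\<close> against the threshold \<open>e\<^sup>2\<close> gives
  probability at most \<open>e\<close>; this is where the cube comes from.\<close>

lemma bad_event:
  assumes e: "0 < e" and small: "ennreal T * (\<integral>\<^sup>+z\<in>{0<..ennreal (h 0)}. z \<partial>\<nu>) \<le> ennreal (e ^ 3)"
  shows "bad_event e \<in> events" "prob (bad_event e) \<le> e"
proof -
  define V where "V = (\<lambda>\<omega>. \<Sum>k. if 0 < y k \<omega> \<and> x k \<omega> \<le> T \<and> y k \<omega> \<le> ennreal (h 0) then y k \<omega> else 0)"
  have V: "V \<in> borel_measurable P" "(\<integral>\<^sup>+\<omega>. V \<omega> \<partial>P) \<le> ennreal (e ^ 3)"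
    using small_jumps[OF less_imp_le[OF T] h0] small by (auto simp: V_def)
  define A where "A = {0::real} \<times> {ennreal (h 0)<..}"
  have A: "A \<in> sets \<mu>" "emeasure \<mu> A = 0"
    using \<mu>_times[of "{0}" "{ennreal (h 0)<..}"] levy_tail_sets(1)[OF h0] by (auto simp: A_def)
  have m [measurable]: "(\<lambda>\<omega>. emeasure (N \<omega>) A) \<in> borel_measurable P"
    using N_prm A(1) by (auto simp: poisson_random_measure_def)
  have s1: "{\<omega>\<in>space P. emeasure (N \<omega>) A \<noteq> 0} \<in> events" by measurable
  have s2: "{\<omega>\<in>space P. 1 \<le> ennreal (1 / e\<^sup>2) * V \<omega>} \<in> events" using V(1) by measurable
  have bad_eq: "bad_event e = {\<omega>\<in>space P. emeasure (N \<omega>) A \<noteq> 0} \<union> {\<omega>\<in>space P. 1 \<le> ennreal (1 / e\<^sup>2) * V \<omega>}"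
    by (simp only: bad_event_def V_def A_def)
  show "bad_event e \<in> events" unfolding bad_eq
    using s1 s2 by (rule sets.Un)
  have "(\<integral>\<^sup>+\<omega>. emeasure (N \<omega>) A \<partial>P) = 0"
    using poisson_random_measure_intensity[OF N_prm A(1)] A(2) by simp
  then have "AE \<omega> in P. emeasure (N \<omega>) A = 0" using m by (simp add: nn_integral_0_iff_AE)
  then have p1: "prob {\<omega>\<in>space P. emeasure (N \<omega>) A \<noteq> 0} = 0"
    using s1 by (subst prob_eq_0) auto
  have "emeasure P {\<omega>\<in>space P. 1 \<le> ennreal (1 / e\<^sup>2) * V \<omega>} \<le> ennreal (1 / e\<^sup>2) * (\<integral>\<^sup>+\<omega>. V \<omega> * indicator (space P) \<omega> \<partial>P)"
    using V(1) by (intro nn_integral_Markov_inequality) auto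
  also have "(\<integral>\<^sup>+\<omega>. V \<omega> * indicator (space P) \<omega> \<partial>P) = (\<integral>\<^sup>+\<omega>. V \<omega> \<partial>P)"
    by (intro nn_integral_cong) auto
  also have "ennreal (1 / e\<^sup>2) * (\<integral>\<^sup>+\<omega>. V \<omega> \<partial>P) \<le> ennreal (1 / e\<^sup>2) * ennreal (e ^ 3)"
    using V(2) by (intro mult_left_mono) auto
  also have "\<dots> = ennreal (1 / e\<^sup>2 * e ^ 3)" using e by (intro ennreal_mult[symmetric]) auto
  also have "1 / e\<^sup>2 * e ^ 3 = e" using e by (simp add: power2_eq_square power3_eq_cube)
  finally have p2: "prob {\<omega>\<in>space P. 1 \<le> ennreal (1 / e\<^sup>2) * V \<omega>} \<le> e"
    using e by (simp add: emeasure_eq_measure)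
  have "prob (bad_event e) \<le> prob {\<omega>\<in>space P. emeasure (N \<omega>) A \<noteq> 0} + prob {\<omega>\<in>space P. 1 \<le> ennreal (1 / e\<^sup>2) * V \<omega>}"
    unfolding bad_eq using s1 s2 by (rule measure_Un_le)
  then show "prob (bad_event e) \<le> e" using p1 p2 by simp
qed

text \<open>One \<open>e\<close> for the small jumps, one for the angle tolerance and one for the
  mesh accumulated over \<open>L\<close> cells. The large jumps are finite in number, one per
  occupied cell, so the truncated path is a sum over cells.\<close>

lemma shape_near_code:
  assumes e: "0 < e" and mesh': "real L * \<eta> \<le> e"
    and \<sigma>: "\<sigma> \<in> cell_codes L J" and \<omega>: "\<omega> \<in> code_event \<sigma>" "\<omega> \<notin> bad_event e"
  shows "dist (shape_of (crinkled_range (\<lambda>k. x k \<omega>) (\<lambda>k. y k \<omega>) T)) (code_shape L h \<sigma>) \<le> 3 * e"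
proof -
  have sp: "\<omega> \<in> space P" using \<omega>(1) by (simp add: code_event_def)
  define B where "B = {k. x k \<omega> \<le> T \<and> ennreal (h 0) < y k \<omega>}"
  \<comment> \<open>The cell containing the time \<open>x k \<omega>\<close>: ceiling minus one,
    since cells contain their right end.\<close>
  define c where "c = (\<lambda>k. nat (\<lceil>x k \<omega> / dt\<rceil> - 1))"
  have x0: "x k \<omega> \<noteq> 0" if "ennreal (h 0) < y k \<omega>" for k
  proof
    assume x: "x k \<omega> = 0"
    have "{0::real} \<times> {ennreal (h 0)<..} \<in> sets \<mu>"
      using \<mu>_times[of "{0}" "{ennreal (h 0)<..}"] levy_tail_sets(1)[OF h0] by auto
    from N_eq_0_iff[OF sp this] have "{k. 0 < y k \<omega> \<and> (x k \<omega>, y k \<omega>) \<in> {0} \<times> {ennreal (h 0)<..}} = {}"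
      using \<omega>(2) sp by (simp add: bad_event_def)
    then show False using x that y_pos[OF that] by auto
  qed
  have cell_c: "x k \<omega> \<in> cell_time (c k)" "c k < L" if k: "k \<in> B" for k
  proof -
    have x: "0 < x k \<omega>" "x k \<omega> \<le> T" using x0[of k] x_nonneg[OF sp, of k] k by (auto simp: B_def less_le)
    have "0 < x k \<omega> / dt" using x t_pos by simp
    then have c1: "1 \<le> \<lceil>x k \<omega> / dt\<rceil>" by linarith
    then have rc: "real (c k) = real_of_int \<lceil>x k \<omega> / dt\<rceil> - 1" by (simp add: c_def)
    have "real (c k) < x k \<omega> / dt" "x k \<omega> / dt \<le> real (c k) + 1" unfolding rc by linarith+
    then have "real (c k) * dt < x k \<omega>" "x k \<omega> \<le> (real (c k) + 1) * dt"
      using t_pos by (simp_all only: pos_less_divide_eq pos_divide_le_eq)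
    then show "x k \<omega> \<in> cell_time (c k)" by (simp add: cell_time_def distrib_right)
    have "x k \<omega> / dt \<le> real L" using x(2) t_pos by (simp only: pos_divide_le_eq L_dt)
    then have "\<lceil>x k \<omega> / dt\<rceil> \<le> int L" by (simp add: ceiling_le_iff)
    then show "c k < L" using c1 L by (simp add: c_def)
  qed
  have cell_le_T: "z \<le> T" if "z \<in> cell_time l" "l < L" for z l
  proof -
    have "(real l + 1) * dt \<le> real L * dt" using that(2) t_pos by (intro mult_right_mono) auto
    then show ?thesis using that(1) L_dt by (simp add: cell_time_def distrib_right)
  qed
  have B_cell: "{k\<in>B. c k = l} = large_atoms \<omega> l" if l: "l < L" for l
  proof (intro equalityI subsetI)
    fix k assume "k \<in> {k\<in>B. c k = l}"
    then show "k \<in> large_atoms \<omega> l" using cell_c[of k] by (auto simp: large_atoms_def B_def)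
  next
    fix k assume k: "k \<in> large_atoms \<omega> l"
    then have "k \<in> B" using cell_le_T[OF _ l] by (auto simp: B_def large_atoms_def)
    moreover from this have "c k = l" using cell_c(1)[of k] k by (auto simp: large_atoms_def intro: cell_time_disjoint)
    ultimately show "k \<in> {k\<in>B. c k = l}" by simp
  qed
  have one: "large_atoms \<omega> l = {} \<or> (\<exists>\<kappa>. large_atoms \<omega> l = {\<kappa>})" if "l < L" for l
    using code_event_cell[OF \<sigma> \<omega>(1) that] by (auto split: if_splits)
  have "B = (\<Union>l<L. large_atoms \<omega> l)"
  proof (intro equalityI subsetI)
    fix k assume k: "k \<in> B"
    then have "k \<in> large_atoms \<omega> (c k)" using B_cell[OF cell_c(2)[OF k]] by blast
    then show "k \<in> (\<Union>l<L. large_atoms \<omega> l)" using cell_c(2)[OF k] by blast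
  next
    fix k assume "k \<in> (\<Union>l<L. large_atoms \<omega> l)"
    then obtain l where "l < L" "k \<in> large_atoms \<omega> l" by blast
    then show "k \<in> B" using B_cell[of l] by blast
  qed
  moreover have "finite (large_atoms \<omega> l)" if "l < L" for l using one[OF that] by auto
  ultimately have finB: "finite B" by auto
  have inj: "inj_on c B"
  proof (rule inj_onI)
    fix i j assume ij: "i \<in> B" "j \<in> B" "c i = c j"
    then have "i \<in> large_atoms \<omega> (c i)" "j \<in> large_atoms \<omega> (c i)"
      unfolding B_cell[OF cell_c(2)[OF ij(1)], symmetric] by auto
    then show "i = j" using one[OF cell_c(2)[OF ij(1)]] by auto
  qed
  have mono: "x i \<omega> < x j \<omega>" if ij: "i \<in> B" "j \<in> B" "c i < c j" for i j
  proof -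
    have "(real (c i) + 1) * dt \<le> real (c j) * dt" using ij(3) t_pos by (intro mult_right_mono) auto
    then show ?thesis using cell_c(1)[OF ij(1)] cell_c(1)[OF ij(2)] by (auto simp: cell_time_def distrib_right)
  qed
  have times: "\<exists>t\<in>{0..T}. \<forall>i\<in>B. x i \<omega> \<le> t \<longleftrightarrow> c i < q" if q: "q \<le> L" for q
  proof (intro bexI[of _ "real q * dt"] ballI)
    fix i assume i: "i \<in> B"
    show "x i \<omega> \<le> real q * dt \<longleftrightarrow> c i < q"
    proof
      assume "x i \<omega> \<le> real q * dt"
      moreover have "real (c i) * dt < x i \<omega>" using cell_c(1)[OF i] by (simp add: cell_time_def)
      ultimately have "real (c i) * dt < real q * dt" by linarith
      then show "c i < q" using t_pos by simp
    next
      assume "c i < q"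
      then have "(real (c i) + 1) * dt \<le> real q * dt" using t_pos by (intro mult_right_mono) auto
      then show "x i \<omega> \<le> real q * dt" using cell_c(1)[OF i] by (auto simp: cell_time_def distrib_right)
    qed
  next
    have "real q * dt \<le> real L * dt" using q t_pos by (intro mult_right_mono) auto
    then show "real q * dt \<in> {0..T}" using t_pos L_dt by simp
  qed
  define w where "w = (\<lambda>l. \<Sum>k\<in>{k\<in>B. c k = l}. sqrt (enn2real (y k \<omega>)) *\<^sub>R ell2_basis k)"
  have img: "crinkled_part (\<lambda>k. x k \<omega>) (\<lambda>k. y k \<omega>) B ` {0..T} = (\<lambda>q. \<Sum>l<q. w l) ` {..L}"
    unfolding crinkled_part_def w_def by (rule partial_sums_by_cells[OF finB cell_c(2) inj mono times])
  have w: "(\<sigma> l = 0 \<and> w l = 0) \<or> (\<sigma> l \<noteq> 0 \<and> (\<exists>\<kappa>. large_atoms \<omega> l = {\<kappa>} \<and> y \<kappa> \<omega> \<in> size_box h (\<sigma> l)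
      \<and> w l = sqrt (enn2real (y \<kappa> \<omega>)) *\<^sub>R ell2_basis \<kappa>))" if l: "l < L" for l
    using code_event_cell[OF \<sigma> \<omega>(1) l] unfolding w_def B_cell[OF l] by (auto split: if_splits)
  have \<sigma>J: "\<sigma> l \<le> J" if "l < L" for l using \<sigma> that by (auto simp: cell_codes_def PiE_iff)
  have w1: "norm (w l) \<le> sqrt (h J) \<and> \<bar>norm (w l) - (if \<sigma> l = 0 then 0 else sqrt (h (\<sigma> l)))\<bar> \<le> \<eta>" if l: "l < L" for l
    using w[OF l] box_sqrt[of "\<sigma> l"] \<sigma>J[OF l] \<eta> h_pos[of J] by auto
  have w2: "inner (w l) (w l') = 0" if ll: "l < L" "l' < L" "l \<noteq> l'" for l l'
  proof (cases "w l = 0 \<or> w l' = 0")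
    case False
    then obtain \<kappa> \<kappa>' where k: "large_atoms \<omega> l = {\<kappa>}" "w l = sqrt (enn2real (y \<kappa> \<omega>)) *\<^sub>R ell2_basis \<kappa>"
      "large_atoms \<omega> l' = {\<kappa>'}" "w l' = sqrt (enn2real (y \<kappa>' \<omega>)) *\<^sub>R ell2_basis \<kappa>'"
      using w[OF ll(1)] w[OF ll(2)] by auto
    have "\<kappa> \<noteq> \<kappa>'"
    proof
      assume "\<kappa> = \<kappa>'"
      then have "x \<kappa> \<omega> \<in> cell_time l" "x \<kappa> \<omega> \<in> cell_time l'" using k(1,3) by (auto simp: large_atoms_def)
      then show False using ll(3) cell_time_disjoint by blast
    qed
    then show ?thesis unfolding k(2,4) by (simp add: inner_ell2_basis)
  qed auto
  \<comment> \<open>Different atoms use different basis vectors, so all inner products vanish and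
    any positive tolerance is met.\<close>
  obtain \<epsilon> where \<epsilon>: "0 < \<epsilon>" "angle_tolerance L (sqrt (h J)) e \<epsilon>"
    using angle_tolerance_exists[OF e, of "sqrt (h J)" L] h_pos[of J] by auto
  have "dist (shape_of ((\<lambda>q. \<Sum>l<q. w l) ` {..L})) (code_shape L h \<sigma>) \<le> e + real L * \<eta>"
    unfolding code_shape_def by (rule angle_toleranceD[OF \<epsilon>(2)]) (use w1 w2 \<epsilon>(1) in auto)
  then have d1: "dist (shape_of (crinkled_part (\<lambda>k. x k \<omega>) (\<lambda>k. y k \<omega>) B ` {0..T})) (code_shape L h \<sigma>) \<le> 2 * e"
    unfolding img using mesh' by linarith
  define g where "g = (\<lambda>k. if x k \<omega> \<le> T \<and> k \<notin> B then enn2real (y k \<omega>) else 0)"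
  define V where "V = (\<Sum>k. if 0 < y k \<omega> \<and> x k \<omega> \<le> T \<and> y k \<omega> \<le> ennreal (h 0) then y k \<omega> else 0)"
  have "ennreal (g k) \<le> (if 0 < y k \<omega> \<and> x k \<omega> \<le> T \<and> y k \<omega> \<le> ennreal (h 0) then y k \<omega> else 0)" for k
  proof (cases "x k \<omega> \<le> T \<and> k \<notin> B")
    case True
    then have le: "y k \<omega> \<le> ennreal (h 0)" by (auto simp: B_def not_less)
    then have "y k \<omega> < top" by (rule le_less_trans) simp
    then have "ennreal (g k) = y k \<omega>" using True by (simp add: g_def)
    then show ?thesis using True le by (auto simp: zero_less_iff_neq_zero)
  next
    case False
    then have "g k = 0" by (auto simp: g_def)
    then show ?thesis by simp
  qed
  then have gV: "(\<Sum>k. ennreal (g k)) \<le> V" unfolding V_def by (intro suminf_le) auto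
  have V: "V < ennreal (e\<^sup>2)"
  proof (rule ccontr)
    assume "\<not> V < ennreal (e\<^sup>2)"
    then have "ennreal (1 / e\<^sup>2) * ennreal (e\<^sup>2) \<le> ennreal (1 / e\<^sup>2) * V" by (intro mult_left_mono) auto
    moreover have "ennreal (1 / e\<^sup>2) * ennreal (e\<^sup>2) = 1" using e by (simp add: ennreal_mult[symmetric])
    ultimately have "1 \<le> ennreal (1 / e\<^sup>2) * V" by simp
    then show False using \<omega>(2) sp by (simp add: bad_event_def V_def)
  qed
  have g0: "0 \<le> g k" for k by (simp add: g_def)
  have sg: "summable g"
  proof (rule summable_suminf_not_top[OF g0])
    have "V < top" using V by (rule less_trans) simp
    then show "(\<Sum>k. ennreal (g k)) \<noteq> top" using gV by (auto simp: top_unique)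
  qed
  have "ennreal (suminf g) < ennreal (e\<^sup>2)" using suminf_ennreal2[OF g0 sg] gV V by simp
  then have "suminf g < e\<^sup>2" by (simp add: ennreal_less_iff suminf_nonneg[OF sg g0])
  then have "sqrt (suminf g) < sqrt (e\<^sup>2)" by (rule real_sqrt_less_mono)
  then have tail: "sqrt (suminf g) \<le> e" using e by simp
  \<comment> \<open>Convergence of the whole series is not known in advance: it follows here from
    the bound on the small jumps together with finiteness of \<open>B\<close>.\<close>
  have "summable (\<lambda>k. g k + (if k \<in> B then (if x k \<omega> \<le> T then enn2real (y k \<omega>) else 0) else 0))"
    using sg finB by (intro summable_add summable_If_finite_set)
  moreover have "(\<lambda>k. g k + (if k \<in> B then (if x k \<omega> \<le> T then enn2real (y k \<omega>) else 0) else 0))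
    = (\<lambda>k. if x k \<omega> \<le> T then enn2real (y k \<omega>) else 0)" by (auto simp: g_def)
  ultimately have cs: "crinkled_summable (\<lambda>k. x k \<omega>) (\<lambda>k. y k \<omega>) T" by (simp add: crinkled_summable_def)
  have "dist (shape_of (crinkled_range (\<lambda>k. x k \<omega>) (\<lambda>k. y k \<omega>) T))
      (shape_of (crinkled_part (\<lambda>k. x k \<omega>) (\<lambda>k. y k \<omega>) B ` {0..T})) \<le> e"
    by (rule dist_shape_crinkled_range[OF cs less_imp_le[OF T] finB]) (use tail in \<open>simp add: g_def\<close>)
  then show ?thesis using d1 dist_triangle[of "shape_of (crinkled_range (\<lambda>k. x k \<omega>) (\<lambda>k. y k \<omega>) T)" "code_shape L h \<sigma>"
      "shape_of (crinkled_part (\<lambda>k. x k \<omega>) (\<lambda>k. y k \<omega>) B ` {0..T})"] by linarith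
qed

lemma crinkled_cell_approx:
  assumes e: "0 < e" and mesh': "real L * \<eta> \<le> e"
    and small: "ennreal T * (\<integral>\<^sup>+z\<in>{0<..ennreal (h 0)}. z \<partial>\<nu>) \<le> ennreal (e ^ 3)"
  shows "cell_approx P (\<lambda>\<omega>. shape_of (crinkled_range (\<lambda>k. x k \<omega>) (\<lambda>k. y k \<omega>) T))
    (cell_codes L J) (code_shape L h) code_event (bad_event e) (3 * e)"
  unfolding cell_approx_def
  using code_event_prob(2) code_events_disjoint bad_event[OF e small] e shape_near_code[OF e mesh'] by auto

end

section \<open>The random walk\<close>

text \<open>The \<open>m\<close> steps are cut into \<open>L\<close> blocks of equal length
  \<open>b\<close>, the discrete time cells; at most \<open>L\<close> steps are left over by
  rounding.\<close>

locale walk_grid = prob_space M + size_grid h J \<eta>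
  for M :: "'w measure" and h :: "nat \<Rightarrow> real" and J :: nat and \<eta> :: real +
  fixes X :: "nat \<Rightarrow> 'w \<Rightarrow> ell2" and a :: real and L b m :: nat
  assumes indep: "indep_vars (\<lambda>_. borel) X {1..}"
    and ident: "\<And>i. 1 \<le> i \<Longrightarrow> distr M borel (X i) = distr M borel (X 1)"
    and a: "0 < a" and L: "0 < L" and b: "0 < b" and m: "L * b \<le> m" "m \<le> L * b + L"
begin

definition sq :: "ell2 \<Rightarrow> real"
  where "sq u = (norm u)\<^sup>2 / a"

definition small_part :: "nat \<Rightarrow> 'w \<Rightarrow> ell2"
  where "small_part i \<omega> = (if sq (X i \<omega>) \<le> h 0 then X i \<omega> else 0)"

definition drift :: ell2
  where "drift = expectation (small_part 1)"

definition tail_prob :: real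
  where "tail_prob = prob {\<omega>\<in>space M. h 0 < sq (X 1 \<omega>)}"

definition box_prob :: "nat \<Rightarrow> real"
  where "box_prob j = prob {\<omega>\<in>space M. h (j - 1) < sq (X 1 \<omega>) \<and> sq (X 1 \<omega>) \<le> h j}"

definition block :: "nat \<Rightarrow> nat set"
  where "block l = {l * b + 1..l * b + b}"

definition large :: "'w \<Rightarrow> nat \<Rightarrow> nat set"
  where "large \<omega> l = {i\<in>block l. h 0 < sq (X i \<omega>)}"

text \<open>Stated for a sequence of vectors rather than an outcome: it then depends only on the
  coordinates of one block and defines a measurable set in the product space on which independence
  of blocks is expressed.\<close>

definition one_large :: "nat \<Rightarrow> nat \<Rightarrow> (nat \<Rightarrow> ell2) \<Rightarrow> bool"
  where "one_large l j v = (if j = 0 then \<forall>i\<in>block l. sq (v i) \<le> h 0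
    else \<exists>\<kappa>\<in>block l. (h (j - 1) < sq (v \<kappa>) \<and> sq (v \<kappa>) \<le> h j) \<and> (\<forall>i\<in>block l - {\<kappa>}. sq (v i) \<le> h 0))"

definition walk_event :: "(nat \<Rightarrow> nat) \<Rightarrow> 'w set"
  where "walk_event \<sigma> = {\<omega>\<in>space M. \<forall>l<L. one_large l (\<sigma> l) (\<lambda>i. X i \<omega>)}"

text \<open>The binomial counterpart of \<open>cell_prob\<close>: the factor \<open>b\<close>
  chooses the position of the large step and the power says that the other steps are small.\<close>

definition block_prob :: "nat \<Rightarrow> real"
  where "block_prob j = (if j = 0 then (1 - tail_prob) ^ b else real b * box_prob j * (1 - tail_prob) ^ (b - 1))"

lemma X_measurable: "1 \<le> i \<Longrightarrow> X i \<in> borel_measurable M"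
  using indep by (auto simp: indep_vars_def)

lemma sq_measurable [measurable]: "sq \<in> borel_measurable borel"
  unfolding sq_def[abs_def] by measurable

lemma block_ge: "i \<in> block l \<Longrightarrow> 1 \<le> i"
  by (auto simp: block_def)

lemma finite_block: "finite (block l)" and card_block: "card (block l) = b" and block_ne: "block l \<noteq> {}"
  using b by (auto simp: block_def)

lemma prob_ident:
  assumes "1 \<le> i" "B \<in> sets borel"
  shows "prob (X i -` B \<inter> space M) = prob (X 1 -` B \<inter> space M)"
proof -
  have "measure (distr M borel (X i)) B = measure (distr M borel (X 1)) B"
    using ident[OF assms(1)] by simp
  then show ?thesis using assms X_measurable by (simp add: measure_distr)
qed

lemma prob_sq_ident:
  assumes "1 \<le> i" "A \<in> sets borel"
  shows "prob {\<omega>\<in>space M. sq (X i \<omega>) \<in> A} = prob {\<omega>\<in>space M. sq (X 1 \<omega>) \<in> A}"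
proof -
  have "sq -` A \<in> sets borel" using measurable_sets[OF sq_measurable assms(2)] by simp
  from prob_ident[OF assms(1) this] show ?thesis by (simp add: vimage_def Int_def conj_commute)
qed

lemma expectation_ident:
  fixes g :: "ell2 \<Rightarrow> 'c::{banach, second_countable_topology}"
  assumes "1 \<le> i" "g \<in> borel_measurable borel"
  shows "expectation (\<lambda>\<omega>. g (X i \<omega>)) = expectation (\<lambda>\<omega>. g (X 1 \<omega>))"
  using integral_distr[OF X_measurable[OF assms(1)] assms(2)] integral_distr[OF X_measurable[of 1] assms(2)] ident[OF assms(1)]
  by simp

lemma prob_small: "1 \<le> i \<Longrightarrow> prob {\<omega>\<in>space M. sq (X i \<omega>) \<le> h 0} = 1 - tail_prob"
proof -
  assume i: "1 \<le> i"
  have "{\<omega>\<in>space M. sq (X 1 \<omega>) \<le> h 0} = space M - {\<omega>\<in>space M. h 0 < sq (X 1 \<omega>)}" by auto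
  moreover have "{\<omega>\<in>space M. h 0 < sq (X 1 \<omega>)} \<in> events"
    using X_measurable[of 1] by measurable
  ultimately have "prob {\<omega>\<in>space M. sq (X 1 \<omega>) \<le> h 0} = 1 - tail_prob"
    by (simp add: prob_compl tail_prob_def)
  then show ?thesis using prob_sq_ident[OF i, of "{..h 0}"] by simp
qed

lemma cylinder:
  assumes K: "finite K" "K \<noteq> {}" "\<And>i. i \<in> K \<Longrightarrow> 1 \<le> i" and A: "\<And>i. i \<in> K \<Longrightarrow> A i \<in> sets borel"
  shows "prob {\<omega>\<in>space M. \<forall>i\<in>K. sq (X i \<omega>) \<in> A i} = (\<Prod>i\<in>K. prob {\<omega>\<in>space M. sq (X i \<omega>) \<in> A i})"
    and "{\<omega>\<in>space M. \<forall>i\<in>K. sq (X i \<omega>) \<in> A i} \<in> events"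
proof -
  have s: "sq -` A i \<in> sets borel" if "i \<in> K" for i
    using measurable_sets[OF sq_measurable A[OF that]] by simp
  have eq: "{\<omega>\<in>space M. \<forall>i\<in>K. sq (X i \<omega>) \<in> A i} = (\<Inter>i\<in>K. X i -` (sq -` A i) \<inter> space M)"
    using K(2) by auto
  have "prob (\<Inter>i\<in>K. X i -` (sq -` A i) \<inter> space M) = (\<Prod>i\<in>K. prob (X i -` (sq -` A i) \<inter> space M))"
    by (rule indep_varsD[OF indep]) (use K s in auto)
  then show "prob {\<omega>\<in>space M. \<forall>i\<in>K. sq (X i \<omega>) \<in> A i} = (\<Prod>i\<in>K. prob {\<omega>\<in>space M. sq (X i \<omega>) \<in> A i})"
    unfolding eq by (simp add: vimage_def Int_def conj_commute)
  show "{\<omega>\<in>space M. \<forall>i\<in>K. sq (X i \<omega>) \<in> A i} \<in> events"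
    unfolding eq using K s X_measurable by (intro sets.finite_INT) (auto intro: measurable_sets)
qed

text \<open>Splits according to the position of the large step. The pieces are disjoint because
  sizes in box \<open>j\<close> exceed \<open>h 0\<close>, and each is a cylinder whose probability
  factors by independence.\<close>

lemma one_large_prob:
  assumes "j \<le> J"
  shows "prob {\<omega>\<in>space M. one_large l j (\<lambda>i. X i \<omega>)} = block_prob j"
proof (cases "j = 0")
  case True
  have "prob {\<omega>\<in>space M. \<forall>i\<in>block l. sq (X i \<omega>) \<in> {..h 0}} = (\<Prod>i\<in>block l. prob {\<omega>\<in>space M. sq (X i \<omega>) \<in> {..h 0}})"
    by (rule cylinder[OF finite_block block_ne block_ge]) auto
  also have "\<dots> = (\<Prod>i\<in>block l. 1 - tail_prob)" using prob_small block_ge by (intro prod.cong) auto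
  finally show ?thesis using True by (simp add: one_large_def block_prob_def card_block)
next
  case False
  define A where "A = (\<lambda>(\<kappa>::nat) i. if i = \<kappa> then {h (j - 1)<..h j} else {..h 0})"
  define E where "E = (\<lambda>\<kappa>. {\<omega>\<in>space M. \<forall>i\<in>block l. sq (X i \<omega>) \<in> A \<kappa> i})"
  have "j - 1 \<le> J" using assms by linarith
  then have h0j: "h 0 \<le> h (j - 1)" using h_mono[of 0 "j - 1"] by simp
  have E: "E \<kappa> \<in> events" for \<kappa>
    unfolding E_def by (rule cylinder(2)[OF finite_block block_ne block_ge]) (auto simp: A_def)
  have eq: "{\<omega>\<in>space M. one_large l j (\<lambda>i. X i \<omega>)} = (\<Union>\<kappa>\<in>block l. E \<kappa>)"
    using False unfolding one_large_def E_def A_def by force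
  have dis: "disjoint_family_on E (block l)"
    unfolding disjoint_family_on_def
  proof (intro ballI impI)
    fix \<kappa> \<kappa>' assume k: "\<kappa> \<in> block l" "\<kappa>' \<in> block l" "\<kappa> \<noteq> \<kappa>'"
    show "E \<kappa> \<inter> E \<kappa>' = {}"
    proof (rule ccontr)
      assume "E \<kappa> \<inter> E \<kappa>' \<noteq> {}"
      then obtain \<omega> where "\<omega> \<in> E \<kappa>" "\<omega> \<in> E \<kappa>'" by auto
      then have "sq (X \<kappa> \<omega>) \<in> A \<kappa> \<kappa>" "sq (X \<kappa> \<omega>) \<in> A \<kappa>' \<kappa>" using k(1) by (auto simp: E_def)
      then show False using k(3) h0j by (auto simp: A_def)
    qed
  qed
  have pE: "prob (E \<kappa>) = box_prob j * (1 - tail_prob) ^ (b - 1)" if k: "\<kappa> \<in> block l" for \<kappa>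
  proof -
    have "prob (E \<kappa>) = (\<Prod>i\<in>block l. prob {\<omega>\<in>space M. sq (X i \<omega>) \<in> A \<kappa> i})"
      unfolding E_def by (rule cylinder(1)[OF finite_block block_ne block_ge]) (auto simp: A_def)
    also have "\<dots> = prob {\<omega>\<in>space M. sq (X \<kappa> \<omega>) \<in> A \<kappa> \<kappa>} * (\<Prod>i\<in>block l - {\<kappa>}. prob {\<omega>\<in>space M. sq (X i \<omega>) \<in> A \<kappa> i})"
      using finite_block k by (rule prod.remove)
    also have "prob {\<omega>\<in>space M. sq (X \<kappa> \<omega>) \<in> A \<kappa> \<kappa>} = box_prob j"
      using prob_sq_ident[OF block_ge[OF k], of "{h (j - 1)<..h j}"] by (simp add: A_def box_prob_def)
    also have "(\<Prod>i\<in>block l - {\<kappa>}. prob {\<omega>\<in>space M. sq (X i \<omega>) \<in> A \<kappa> i}) = (\<Prod>i\<in>block l - {\<kappa>}. 1 - tail_prob)"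
      using prob_small block_ge by (intro prod.cong) (auto simp: A_def)
    also have "\<dots> = (1 - tail_prob) ^ (b - 1)" using k finite_block by (simp add: card_block)
    finally show ?thesis .
  qed
  have "prob (\<Union>\<kappa>\<in>block l. E \<kappa>) = (\<Sum>\<kappa>\<in>block l. prob (E \<kappa>))"
    by (rule finite_measure_finite_Union[OF finite_block _ dis]) (use E in auto)
  also have "\<dots> = block_prob j" using False pE by (simp add: block_prob_def card_block)
  finally show ?thesis unfolding eq .
qed

lemma block_disjoint: "l \<noteq> l' \<Longrightarrow> block l \<inter> block l' = {}"
proof (induction l l' rule: linorder_wlog)
  case (le l l')
  then have "Suc l * b \<le> l' * b" by (intro mult_right_mono) auto
  then show ?case by (auto simp: block_def)
qed auto

text \<open>Restrictions of an independent sequence to disjoint blocks are independent, so the code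
  of each block contributes its own factor.\<close>

lemma walk_event_prob:
  assumes \<sigma>: "\<sigma> \<in> cell_codes L J"
  shows "prob (walk_event \<sigma>) = (\<Prod>l<L. block_prob (\<sigma> l))" "walk_event \<sigma> \<in> events"
proof -
  define R where "R = (\<lambda>l \<omega>. restrict (\<lambda>i. X i \<omega>) (block l))"
  define C where "C = (\<lambda>l. {v\<in>space (PiM (block l) (\<lambda>_. borel :: ell2 measure)). one_large l (\<sigma> l) v})"
  have ind: "indep_vars (\<lambda>l. PiM (block l) (\<lambda>_. borel)) R {..<L}"
    unfolding R_def by (rule indep_vars_restrict[OF indep])
      (use block_ge block_disjoint in \<open>auto simp: disjoint_family_on_def\<close>)
  have C: "C l \<in> sets (PiM (block l) (\<lambda>_. borel))" for l
  proof -
    have comp: "(\<lambda>v. sq (v i)) \<in> borel_measurable (PiM (block l) (\<lambda>_. borel :: ell2 measure))" if "i \<in> block l" for i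
      using measurable_compose[OF measurable_component_singleton[OF that] sq_measurable] by simp
    have s1: "Measurable.pred (PiM (block l) (\<lambda>_. borel :: ell2 measure)) (\<lambda>v. \<forall>i\<in>K. sq (v i) \<le> h 0)"
      if "K \<subseteq> block l" for K
      using comp that finite_subset[OF that finite_block] by (intro pred_intros_finite) (auto intro!: borel_measurable_pred_less borel_measurable_le)
    have s2: "Measurable.pred (PiM (block l) (\<lambda>_. borel :: ell2 measure)) (\<lambda>v. h j < sq (v \<kappa>) \<and> sq (v \<kappa>) \<le> h j')"
      if "\<kappa> \<in> block l" for \<kappa> j j'
      using comp[OF that] by measurable
    have "Measurable.pred (PiM (block l) (\<lambda>_. borel :: ell2 measure)) (one_large l (\<sigma> l))"
    proof (cases "\<sigma> l = 0")
      case True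
      then show ?thesis using s1[of "block l"] by (simp add: one_large_def[abs_def])
    next
      case False
      then show ?thesis unfolding one_large_def[abs_def] if_not_P[OF False]
        by (intro pred_intros_finite(4)[OF finite_block] pred_intros_logic(3) s1 s2) auto
    qed
    then show ?thesis unfolding C_def by measurable
  qed
  have eq1: "R l -` C l \<inter> space M = {\<omega>\<in>space M. one_large l (\<sigma> l) (\<lambda>i. X i \<omega>)}" for l
  proof -
    have "one_large l (\<sigma> l) (R l \<omega>) \<longleftrightarrow> one_large l (\<sigma> l) (\<lambda>i. X i \<omega>)" for \<omega>
      by (simp add: one_large_def R_def)
    moreover have "R l \<omega> \<in> space (PiM (block l) (\<lambda>_. borel :: ell2 measure))" for \<omega>
      by (simp add: R_def space_PiM)
    ultimately show ?thesis by (auto simp: C_def)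
  qed
  have Lne: "{..<L} \<noteq> {}" using L by (auto simp: lessThan_empty_iff)
  have eq: "walk_event \<sigma> = (\<Inter>l\<in>{..<L}. R l -` C l \<inter> space M)"
    unfolding eq1 walk_event_def using Lne by auto
  have mR: "R l \<in> M \<rightarrow>\<^sub>M PiM (block l) (\<lambda>_. borel)" if "l < L" for l
    using ind that by (auto simp: indep_vars_def)
  show "walk_event \<sigma> \<in> events" unfolding eq
    using Lne by (intro sets.finite_INT measurable_sets[OF mR C]) auto
  have "prob (walk_event \<sigma>) = (\<Prod>l<L. prob (R l -` C l \<inter> space M))"
    unfolding eq by (rule indep_varsD_finite[OF ind Lne]) (auto intro: C)
  also have "\<dots> = (\<Prod>l<L. block_prob (\<sigma> l))"
    unfolding eq1 using \<sigma> by (intro prod.cong one_large_prob) (auto simp: cell_codes_def PiE_iff)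
  finally show "prob (walk_event \<sigma>) = (\<Prod>l<L. block_prob (\<sigma> l))" .
qed

lemma walk_event_block:
  assumes \<sigma>: "\<sigma> \<in> cell_codes L J" and \<omega>: "\<omega> \<in> walk_event \<sigma>" and l: "l < L"
  shows "if \<sigma> l = 0 then large \<omega> l = {} else \<exists>\<kappa>. large \<omega> l = {\<kappa>} \<and> h (\<sigma> l - 1) < sq (X \<kappa> \<omega>) \<and> sq (X \<kappa> \<omega>) \<le> h (\<sigma> l)"
proof -
  have *: "one_large l (\<sigma> l) (\<lambda>i. X i \<omega>)" using \<omega> l by (simp add: walk_event_def)
  show ?thesis
  proof (cases "\<sigma> l = 0")
    case True
    then show ?thesis using * by (force simp: one_large_def large_def not_less)
  next
    case False
    then obtain \<kappa> where k: "\<kappa> \<in> block l" "h (\<sigma> l - 1) < sq (X \<kappa> \<omega>)" "sq (X \<kappa> \<omega>) \<le> h (\<sigma> l)"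
      "\<forall>i\<in>block l - {\<kappa>}. sq (X i \<omega>) \<le> h 0"
      using * by (auto simp: one_large_def)
    have "\<sigma> l \<le> J" using \<sigma> l by (auto simp: cell_codes_def PiE_iff)
    then have "\<sigma> l - 1 \<le> J" by linarith
    then have "h 0 \<le> h (\<sigma> l - 1)" using h_mono[of 0 "\<sigma> l - 1"] by simp
    then have "large \<omega> l = {\<kappa>}" using k by (force simp: large_def)
    then show ?thesis using False k by auto
  qed
qed

lemma walk_events_disjoint: "disjoint_family_on walk_event (cell_codes L J)"
  unfolding disjoint_family_on_def
proof (intro ballI impI)
  fix \<sigma> \<sigma>' assume \<sigma>: "\<sigma> \<in> cell_codes L J" and \<sigma>': "\<sigma>' \<in> cell_codes L J" and ne: "\<sigma> \<noteq> \<sigma>'"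
  show "walk_event \<sigma> \<inter> walk_event \<sigma>' = {}"
  proof (rule ccontr)
    assume "walk_event \<sigma> \<inter> walk_event \<sigma>' \<noteq> {}"
    then obtain \<omega> where \<omega>: "\<omega> \<in> walk_event \<sigma>" "\<omega> \<in> walk_event \<sigma>'" by auto
    have "\<sigma> l = \<sigma>' l" if l: "l \<in> {..<L}" for l
    proof -
      have le: "\<sigma> l \<le> J" "\<sigma>' l \<le> J" using \<sigma> \<sigma>' l by (auto simp: cell_codes_def PiE_iff)
      have w: "if \<sigma> l = 0 then large \<omega> l = {} else \<exists>\<kappa>. large \<omega> l = {\<kappa>} \<and> h (\<sigma> l - 1) < sq (X \<kappa> \<omega>) \<and> sq (X \<kappa> \<omega>) \<le> h (\<sigma> l)"
        "if \<sigma>' l = 0 then large \<omega> l = {} else \<exists>\<kappa>. large \<omega> l = {\<kappa>} \<and> h (\<sigma>' l - 1) < sq (X \<kappa> \<omega>) \<and> sq (X \<kappa> \<omega>) \<le> h (\<sigma>' l)"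
        using walk_event_block[OF \<sigma> \<omega>(1), of l] walk_event_block[OF \<sigma>' \<omega>(2), of l] l by auto
      have False if "i < j" "i \<noteq> 0" "j \<le> J" "h (j - 1) < z" "z \<le> h i" for i j z
      proof -
        have "i \<le> j - 1" "j - 1 \<le> J" using that by linarith+
        then have "h i \<le> h (j - 1)" by (rule h_mono)
        then show False using that by simp
      qed
      then show ?thesis using w le by (cases "\<sigma> l" "\<sigma>' l" rule: linorder_cases) (force split: if_splits)+
    qed
    then have "\<sigma> = \<sigma>'" using \<sigma> \<sigma>' unfolding cell_codes_def by (intro PiE_ext)
    then show False using ne by simp
  qed
qed

section \<open>Exceptional events of the walk\<close>

definition leftover_event :: "'w set"
  where "leftover_event = {\<omega>\<in>space M. \<exists>i\<in>{L * b<..m}. h 0 < sq (X i \<omega>)}"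

text \<open>Intersects the angle event of (b) with its conditioning event at level
  \<open>s = h 0\<close>: its probability is the numerator of the conditional probability
  there.\<close>

definition aligned :: "real \<Rightarrow> ell2 \<Rightarrow> ell2 \<Rightarrow> bool"
  where "aligned \<epsilon> u v \<longleftrightarrow> \<epsilon> < \<bar>inner (u /\<^sub>R norm u) (v /\<^sub>R norm v)\<bar> \<and> h 0 * a \<le> (norm u)\<^sup>2 \<and> h 0 * a \<le> (norm v)\<^sup>2"

definition angle_event :: "real \<Rightarrow> 'w set"
  where "angle_event \<epsilon> = {\<omega>\<in>space M. \<exists>i\<in>{1..m}. \<exists>j\<in>{1..m}. i \<noteq> j \<and> aligned \<epsilon> (X i \<omega>) (X j \<omega>)}"

definition fluctuation_event :: "real \<Rightarrow> 'w set"
  where "fluctuation_event e = {\<omega>\<in>space M. \<exists>k\<le>m. e * sqrt a \<le> norm (\<Sum>i=1..k. small_part i \<omega> - drift)}"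

text \<open>A union bound over at most \<open>L\<close> steps, a number that does not grow with the
  dimension while the tail probability tends to zero.\<close>

lemma leftover_event: "leftover_event \<in> events" "prob leftover_event \<le> real L * tail_prob"
proof -
  let ?E = "\<lambda>i. {\<omega>\<in>space M. h 0 < sq (X i \<omega>)}"
  have E: "?E i \<in> events" if "i \<in> {L * b<..m}" for i
  proof -
    have [measurable]: "X i \<in> borel_measurable M" using that by (intro X_measurable) auto
    show ?thesis by measurable
  qed
  have eq: "leftover_event = (\<Union>i\<in>{L * b<..m}. ?E i)" by (auto simp: leftover_event_def)
  show "leftover_event \<in> events" unfolding eq using E by (intro sets.finite_UN) auto
  have "prob leftover_event \<le> (\<Sum>i\<in>{L * b<..m}. prob (?E i))"
    unfolding eq by (rule finite_measure_subadditive_finite) (use E in auto)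
  also have "\<dots> = (\<Sum>i\<in>{L * b<..m}. tail_prob)"
  proof (rule sum.cong[OF refl])
    fix i assume "i \<in> {L * b<..m}"
    then show "prob (?E i) = tail_prob"
      using prob_sq_ident[of i "{h 0<..}"] by (simp add: tail_prob_def)
  qed
  also have "\<dots> = real (m - L * b) * tail_prob" by simp
  also have "\<dots> \<le> real L * tail_prob"
  proof (rule mult_right_mono)
    have "m - L * b \<le> L" using m by linarith
    then show "real (m - L * b) \<le> real L" by (rule of_nat_mono)
  qed (simp add: tail_prob_def)
  finally show "prob leftover_event \<le> real L * tail_prob" .
qed

lemma aligned_measurable: "{z. aligned \<epsilon> (fst z) (snd z)} \<in> sets (borel \<Otimes>\<^sub>M borel)"
proof -
  have "Measurable.pred (borel \<Otimes>\<^sub>M borel) (\<lambda>z :: ell2 \<times> ell2. aligned \<epsilon> (fst z) (snd z))"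
    unfolding aligned_def by measurable
  then show ?thesis by (simp add: pred_def space_pair_measure)
qed

lemma pair_distr:
  assumes "1 \<le> i" "1 \<le> j" "i \<noteq> j"
  shows "distr M (borel \<Otimes>\<^sub>M borel) (\<lambda>\<omega>. (X i \<omega>, X j \<omega>)) = distr M borel (X 1) \<Otimes>\<^sub>M distr M borel (X 1)"
proof -
  have "indep_var (PiM {i} (\<lambda>_. borel)) (\<lambda>\<omega>. restrict (\<lambda>i. X i \<omega>) {i}) (PiM {j} (\<lambda>_. borel)) (\<lambda>\<omega>. restrict (\<lambda>i. X i \<omega>) {j})"
    by (rule indep_var_restrict[OF indep]) (use assms in auto)
  from indep_var_compose[OF this measurable_component_singleton measurable_component_singleton, of i j]
  have "indep_var borel (X i) borel (X j)" by (simp add: comp_def)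
  then show ?thesis using ident[OF assms(1)] ident[OF assms(2)] by (simp add: indep_var_distribution_eq)
qed

lemma aligned_prob:
  assumes "1 \<le> i" "1 \<le> j" "i \<noteq> j"
  shows "{\<omega>\<in>space M. aligned \<epsilon> (X i \<omega>) (X j \<omega>)} \<in> events"
    and "prob {\<omega>\<in>space M. aligned \<epsilon> (X i \<omega>) (X j \<omega>)} = prob {\<omega>\<in>space M. aligned \<epsilon> (X 1 \<omega>) (X 2 \<omega>)}"
proof -
  let ?A = "{z. aligned \<epsilon> (fst z) (snd z)}"
  have mp: "(\<lambda>\<omega>. (X i \<omega>, X j \<omega>)) \<in> M \<rightarrow>\<^sub>M borel \<Otimes>\<^sub>M borel" if "1 \<le> i" "1 \<le> j" for i j
    using X_measurable that by (intro measurable_Pair) auto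
  have eq: "(\<lambda>\<omega>. (X i \<omega>, X j \<omega>)) -` ?A \<inter> space M = {\<omega>\<in>space M. aligned \<epsilon> (X i \<omega>) (X j \<omega>)}" for i j by auto
  show "{\<omega>\<in>space M. aligned \<epsilon> (X i \<omega>) (X j \<omega>)} \<in> events"
    using measurable_sets[OF mp[OF assms(1,2)] aligned_measurable[of \<epsilon>]] unfolding eq .
  have "prob {\<omega>\<in>space M. aligned \<epsilon> (X i \<omega>) (X j \<omega>)} = measure (distr M borel (X 1) \<Otimes>\<^sub>M distr M borel (X 1)) ?A"
    if "1 \<le> i" "1 \<le> j" "i \<noteq> j" for i j
    using measure_distr[OF mp[OF that(1,2)] aligned_measurable[of \<epsilon>]] unfolding eq pair_distr[OF that] by simp
  from this[OF assms] this[of 1 2]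
  show "prob {\<omega>\<in>space M. aligned \<epsilon> (X i \<omega>) (X j \<omega>)} = prob {\<omega>\<in>space M. aligned \<epsilon> (X 1 \<omega>) (X 2 \<omega>)}" by simp
qed

text \<open>A union bound over all pairs; any two distinct steps have the same joint law as the
  first two.\<close>

lemma angle_event:
  "angle_event \<epsilon> \<in> events"
  "prob (angle_event \<epsilon>) \<le> (real m)\<^sup>2 * prob {\<omega>\<in>space M. aligned \<epsilon> (X 1 \<omega>) (X 2 \<omega>)}"
proof -
  define E where "E = (\<lambda>(i, j). {\<omega>\<in>space M. i \<noteq> j \<and> aligned \<epsilon> (X i \<omega>) (X j \<omega>)})"
  have E: "E z \<in> events" "prob (E z) \<le> prob {\<omega>\<in>space M. aligned \<epsilon> (X 1 \<omega>) (X 2 \<omega>)}"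
    if "z \<in> {1..m} \<times> {1..m}" for z
  proof -
    obtain i j where z: "z = (i, j)" "1 \<le> i" "1 \<le> j" using \<open>z \<in> _\<close> by (cases z) auto
    show "E z \<in> events" "prob (E z) \<le> prob {\<omega>\<in>space M. aligned \<epsilon> (X 1 \<omega>) (X 2 \<omega>)}"
      using aligned_prob[OF z(2,3), of \<epsilon>] by (cases "i = j"; simp add: E_def z(1))+
  qed
  have eq: "angle_event \<epsilon> = (\<Union>z\<in>{1..m} \<times> {1..m}. E z)" by (auto simp: angle_event_def E_def)
  show "angle_event \<epsilon> \<in> events" unfolding eq using E(1) by (intro sets.finite_UN) auto
  have "prob (angle_event \<epsilon>) \<le> (\<Sum>z\<in>{1..m} \<times> {1..m}. prob (E z))"
    unfolding eq by (rule finite_measure_subadditive_finite) (use E(1) in auto)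
  also have "\<dots> \<le> (\<Sum>z\<in>{1..m} \<times> {1..m}. prob {\<omega>\<in>space M. aligned \<epsilon> (X 1 \<omega>) (X 2 \<omega>)})"
    by (intro sum_mono E(2))
  also have "\<dots> = (real m)\<^sup>2 * prob {\<omega>\<in>space M. aligned \<epsilon> (X 1 \<omega>) (X 2 \<omega>)}"
    by (simp add: power2_eq_square)
  finally show "prob (angle_event \<epsilon>) \<le> (real m)\<^sup>2 * prob {\<omega>\<in>space M. aligned \<epsilon> (X 1 \<omega>) (X 2 \<omega>)}" .
qed

lemma norm_small_part: "norm (small_part i \<omega>) \<le> sqrt (h 0 * a)"
proof (cases "sq (X i \<omega>) \<le> h 0")
  case True
  then have "(norm (X i \<omega>))\<^sup>2 \<le> h 0 * a" using a by (simp add: sq_def field_simps)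
  then have "sqrt ((norm (X i \<omega>))\<^sup>2) \<le> sqrt (h 0 * a)" by (rule real_sqrt_le_mono)
  then show ?thesis using True by (simp add: small_part_def)
qed (use h0 a in \<open>simp add: small_part_def\<close>)

lemma truncate_measurable: "(\<lambda>u. if sq u \<le> h 0 then u else 0) \<in> borel_measurable borel"
  by measurable

lemma small_part_measurable: "1 \<le> i \<Longrightarrow> small_part i \<in> borel_measurable M"
  using measurable_compose[OF X_measurable truncate_measurable] by (simp add: small_part_def[abs_def])

lemma small_part_integrable: "1 \<le> i \<Longrightarrow> integrable M (small_part i)"
  using norm_small_part small_part_measurable
  by (intro integrable_const_bound[where B = "sqrt (h 0 * a)"]) auto

lemma drift_eq: "1 \<le> i \<Longrightarrow> expectation (small_part i) = drift"
  using expectation_ident[OF _ truncate_measurable, of i] by (simp add: drift_def small_part_def[abs_def] cong: if_cong)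

lemma norm_drift: "norm drift \<le> sqrt (h 0 * a)"
proof -
  have "norm drift \<le> expectation (\<lambda>\<omega>. norm (small_part 1 \<omega>))" unfolding drift_def by (rule integral_norm_bound)
  also have "\<dots> \<le> expectation (\<lambda>_. sqrt (h 0 * a))"
    using norm_small_part small_part_integrable[of 1] by (intro integral_mono) auto
  finally show ?thesis by (simp add: prob_space)
qed

text \<open>Expanding the square, the cross term subtracts twice the squared norm of the mean and
  only one such square is added back.\<close>

lemma centred_second_moment:
  assumes "1 \<le> i"
  shows "expectation (\<lambda>\<omega>. (norm (small_part i \<omega> - drift))\<^sup>2) \<le> expectation (\<lambda>\<omega>. (norm (small_part 1 \<omega>))\<^sup>2)"
proof -
  have i1: "integrable M (\<lambda>\<omega>. (norm (small_part i \<omega>))\<^sup>2)"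
    using norm_small_part[of i] small_part_measurable[OF assms]
    by (intro integrable_const_bound[where B = "(sqrt (h 0 * a))\<^sup>2"]) (auto intro!: power_mono simp del: real_sqrt_pow2_iff)
  have i2: "integrable M (\<lambda>\<omega>. inner (small_part i \<omega>) drift)"
    using small_part_integrable[OF assms] by (rule integrable_inner_left)
  have e2: "expectation (\<lambda>\<omega>. inner (small_part i \<omega>) drift) = inner drift drift"
    using integral_inner_left[OF small_part_integrable[OF assms], of drift] drift_eq[OF assms] by simp
  have "(norm (small_part i \<omega> - drift))\<^sup>2 = (norm (small_part i \<omega>))\<^sup>2 - 2 * inner (small_part i \<omega>) drift + inner drift drift" for \<omega>
    by (simp add: power2_norm_eq_inner inner_diff_left inner_diff_right inner_commute)
  then have "expectation (\<lambda>\<omega>. (norm (small_part i \<omega> - drift))\<^sup>2)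
      = expectation (\<lambda>\<omega>. (norm (small_part i \<omega>))\<^sup>2) - 2 * inner drift drift + inner drift drift"
    using i1 i2 e2 by (simp add: prob_space)
  also have "\<dots> \<le> expectation (\<lambda>\<omega>. (norm (small_part i \<omega>))\<^sup>2)" by simp
  also have "\<dots> = expectation (\<lambda>\<omega>. (norm (small_part 1 \<omega>))\<^sup>2)"
    using expectation_ident[OF assms, of "\<lambda>u. (norm (if sq u \<le> h 0 then u else 0))\<^sup>2"] truncate_measurable
    by (simp add: small_part_def[abs_def] cong: if_cong)
  finally show ?thesis .
qed

text \<open>The maximal inequality for the centred truncated steps, which are bounded by twice the
  truncation level. The threshold carries \<open>sqrt a\<close> because the walk is divided by
  it.\<close>

lemma fluctuation_event:
  assumes e: "0 < e"
  shows "fluctuation_event e \<in> events"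
    "prob (fluctuation_event e) \<le> real m * expectation (\<lambda>\<omega>. (norm (small_part 1 \<omega>))\<^sup>2) / (e\<^sup>2 * a)"
proof -
  define Y where "Y = (\<lambda>i \<omega>. small_part i \<omega> - drift)"
  have "indep_vars (\<lambda>_. borel) (\<lambda>i \<omega>. (\<lambda>u. (if sq u \<le> h 0 then u else 0) - drift) (X i \<omega>)) {1..}"
    using truncate_measurable by (intro indep_vars_compose2[OF indep]) auto
  then have ind: "indep_vars (\<lambda>_. borel) Y {1..}" by (simp add: Y_def small_part_def)
  have nY: "norm (Y i \<omega>) \<le> 2 * sqrt (h 0 * a)" for i \<omega>
    using norm_triangle_ineq4[of "small_part i \<omega>" drift] norm_small_part[of i \<omega>] norm_drift by (simp add: Y_def)
  have EY: "expectation (Y i) = 0" if "1 \<le> i" for i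
    unfolding Y_def using small_part_integrable[OF that] drift_eq[OF that] by (simp add: prob_space)
  have c: "0 < e * sqrt a" using e a by simp
  note K = Kolmogorov_maximal_inequality[OF ind nY EY c, of m]
  have eq: "fluctuation_event e = {\<omega>\<in>space M. \<exists>k\<le>m. e * sqrt a \<le> norm (\<Sum>i=1..k. Y i \<omega>)}"
    by (simp add: fluctuation_event_def Y_def)
  show "fluctuation_event e \<in> events" unfolding eq by (rule K(2))
  have "prob (fluctuation_event e) \<le> (\<Sum>i=1..m. expectation (\<lambda>\<omega>. (norm (Y i \<omega>))\<^sup>2)) / (e * sqrt a)\<^sup>2"
    unfolding eq by (rule K(1))
  also have "\<dots> \<le> (\<Sum>i=1..m. expectation (\<lambda>\<omega>. (norm (small_part 1 \<omega>))\<^sup>2)) / (e * sqrt a)\<^sup>2"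
    unfolding Y_def by (intro divide_right_mono sum_mono centred_second_moment) auto
  also have "\<dots> = real m * expectation (\<lambda>\<omega>. (norm (small_part 1 \<omega>))\<^sup>2) / (e\<^sup>2 * a)"
    using a by (simp add: power_mult_distrib)
  finally show "prob (fluctuation_event e) \<le> real m * expectation (\<lambda>\<omega>. (norm (small_part 1 \<omega>))\<^sup>2) / (e\<^sup>2 * a)" .
qed

text \<open>Of the four multiples of \<open>e\<close>, two come from the small steps, namely their
  fluctuation and their accumulated mean, one from the angles and one from the mesh. The large steps
  alone form a path of \<open>L\<close> nearly orthogonal sums, at most one step in each.\<close>

lemma walk_near_code:
  assumes e: "0 < e" and mesh': "real L * \<eta> \<le> e" and dr: "real m * norm drift \<le> e * sqrt a"
    and \<epsilon>: "0 < \<epsilon>" "angle_tolerance L (sqrt (h J)) e \<epsilon>"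
    and \<sigma>: "\<sigma> \<in> cell_codes L J" and \<omega>: "\<omega> \<in> walk_event \<sigma>"
      "\<omega> \<notin> leftover_event" "\<omega> \<notin> angle_event \<epsilon>" "\<omega> \<notin> fluctuation_event e"
  shows "dist (shape_of (walk_set (\<lambda>i. X i \<omega>) a m)) (code_shape L h \<sigma>) \<le> 4 * e"
proof -
  have sp: "\<omega> \<in> space M" using \<omega>(1) by (simp add: walk_event_def)
  define A where "A = {i\<in>{1..m}. h 0 < sq (X i \<omega>)}"
  \<comment> \<open>Step indices start at 1, hence the shift.\<close>
  define c where "c = (\<lambda>i. (i - 1) div b)"
  define v where "v = (\<lambda>i. X i \<omega> /\<^sub>R sqrt a)"
  have finA: "finite A" by (simp add: A_def)
  have c_block: "i \<in> block l \<longleftrightarrow> c i = l" if "1 \<le> i" for i l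
  proof -
    have "c i * b \<le> i - 1" "i - 1 < c i * b + b"
      using div_mult_mod_eq[of "i - 1" b] mod_less_divisor[OF b, of "i - 1"] unfolding c_def by linarith+
    then have "i \<in> block (c i)" using that by (auto simp: block_def)
    then show ?thesis using block_disjoint[of "c i" l] by auto
  qed
  have A_le: "i \<le> L * b" if "i \<in> A" for i
    using \<omega>(2) sp that by (auto simp: leftover_event_def A_def not_less[symmetric])
  have cL: "c i < L" if i: "i \<in> A" for i
  proof -
    have "i - 1 < L * b" using A_le[OF i] i L b by (auto simp: A_def)
    then show ?thesis unfolding c_def by (rule less_mult_imp_div_less)
  qed
  have block_m: "block l \<subseteq> {1..m}" if "l < L" for l
  proof -
    have "Suc l * b \<le> L * b" using that by (intro mult_right_mono) auto
    then show ?thesis using m(1) by (auto simp: block_def)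
  qed
  have A_cell: "{i\<in>A. c i = l} = large \<omega> l" if "l < L" for l
    using block_m[OF that] c_block by (auto simp: A_def large_def)
  have one: "large \<omega> l = {} \<or> (\<exists>\<kappa>. large \<omega> l = {\<kappa>})" if "l < L" for l
    using walk_event_block[OF \<sigma> \<omega>(1) that] by (auto split: if_splits)
  have inj: "inj_on c A"
  proof (rule inj_onI)
    fix i j assume ij: "i \<in> A" "j \<in> A" "c i = c j"
    then have "i \<in> large \<omega> (c i)" "j \<in> large \<omega> (c i)"
      unfolding A_cell[OF cL[OF ij(1)], symmetric] by auto
    then show "i = j" using one[OF cL[OF ij(1)]] by auto
  qed
  have mono: "i < j" if "i \<in> A" "j \<in> A" "c i < c j" for i j
  proof (rule ccontr)
    assume "\<not> i < j"
    then have "c j \<le> c i" unfolding c_def by (intro div_le_mono) auto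
    then show False using that by simp
  qed
  have times: "\<exists>t\<in>{..m}. \<forall>i\<in>A. i \<le> t \<longleftrightarrow> c i < q" if q: "q \<le> L" for q
  proof (intro bexI[of _ "q * b"] ballI)
    fix i assume i: "i \<in> A"
    then have "i \<le> q * b \<longleftrightarrow> i - 1 < q * b" by (auto simp: A_def)
    also have "\<dots> \<longleftrightarrow> c i < q" unfolding c_def using b by (simp add: div_less_iff_less_mult)
    finally show "i \<le> q * b \<longleftrightarrow> c i < q" .
  next
    have "q * b \<le> L * b" using q by (rule mult_right_mono) simp
    then have "q * b \<le> m" using m(1) by (rule order_trans)
    then show "q * b \<in> {..m}" by simp
  qed
  define w where "w = (\<lambda>l. \<Sum>i\<in>{i\<in>A. c i = l}. v i)"
  define big where "big = (\<lambda>k. \<Sum>i\<in>{i\<in>A. i \<le> k}. v i)"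
  have img: "big ` {..m} = (\<lambda>q. \<Sum>l<q. w l) ` {..L}"
    unfolding big_def w_def by (rule partial_sums_by_cells[OF finA cL inj mono times])
  have w: "(\<sigma> l = 0 \<and> w l = 0) \<or> (\<sigma> l \<noteq> 0 \<and> (\<exists>\<kappa>. large \<omega> l = {\<kappa>} \<and> h (\<sigma> l - 1) < sq (X \<kappa> \<omega>)
      \<and> sq (X \<kappa> \<omega>) \<le> h (\<sigma> l) \<and> w l = v \<kappa>))" if l: "l < L" for l
    using walk_event_block[OF \<sigma> \<omega>(1) l] unfolding w_def A_cell[OF l] by (auto split: if_splits)
  have \<sigma>J: "\<sigma> l \<le> J" if "l < L" for l using \<sigma> that by (auto simp: cell_codes_def PiE_iff)
  have nv: "norm (v i) = sqrt (sq (X i \<omega>))" for i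
    using a by (simp add: v_def sq_def real_sqrt_divide field_simps)
  have w1: "norm (w l) \<le> sqrt (h J)" "\<bar>norm (w l) - (if \<sigma> l = 0 then 0 else sqrt (h (\<sigma> l)))\<bar> \<le> \<eta>" if l: "l < L" for l
  proof (atomize(full), cases "\<sigma> l = 0")
    case True
    then show "norm (w l) \<le> sqrt (h J) \<and> \<bar>norm (w l) - (if \<sigma> l = 0 then 0 else sqrt (h (\<sigma> l)))\<bar> \<le> \<eta>"
      using w[OF l] \<eta> h_pos[of J] by auto
  next
    case False
    then obtain \<kappa> where k: "h (\<sigma> l - 1) < sq (X \<kappa> \<omega>)" "sq (X \<kappa> \<omega>) \<le> h (\<sigma> l)" "w l = v \<kappa>" using w[OF l] by auto
    have b1: "sqrt (h (\<sigma> l - 1)) \<le> norm (w l)" "norm (w l) \<le> sqrt (h (\<sigma> l))"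
      unfolding k(3) nv using k(1,2) by (auto intro: real_sqrt_le_mono)
    have b2: "sqrt (h (\<sigma> l)) \<le> sqrt (h J)" using h_mono[OF \<sigma>J[OF l]] by simp
    have b3: "sqrt (h (\<sigma> l)) - sqrt (h (\<sigma> l - 1)) \<le> \<eta>"
      using mesh[of "\<sigma> l - 1"] False \<sigma>J[OF l] by simp
    have "norm (w l) \<le> sqrt (h J)" "\<bar>norm (w l) - sqrt (h (\<sigma> l))\<bar> \<le> \<eta>" using b1 b2 b3 by linarith+
    then show "norm (w l) \<le> sqrt (h J) \<and> \<bar>norm (w l) - (if \<sigma> l = 0 then 0 else sqrt (h (\<sigma> l)))\<bar> \<le> \<eta>"
      using False by simp
  qed
  have w2: "\<bar>inner (w l) (w l')\<bar> \<le> \<epsilon> * (norm (w l) * norm (w l'))" if ll: "l < L" "l' < L" "l \<noteq> l'" for l l'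
  proof (cases "w l = 0 \<or> w l' = 0")
    case True
    then show ?thesis by auto
  next
    case False
    then obtain \<kappa> \<kappa>' where k: "large \<omega> l = {\<kappa>}" "w l = v \<kappa>" "large \<omega> l' = {\<kappa>'}" "w l' = v \<kappa>'"
      using w[OF ll(1)] w[OF ll(2)] by auto
    have "\<kappa> \<in> large \<omega> l" "\<kappa>' \<in> large \<omega> l'" using k(1,3) by auto
    then have kb: "\<kappa> \<in> block l" "\<kappa>' \<in> block l'" "h 0 < sq (X \<kappa> \<omega>)" "h 0 < sq (X \<kappa>' \<omega>)" by (auto simp: large_def)
    then have "\<kappa> \<noteq> \<kappa>'" using block_disjoint[OF ll(3)] by auto
    moreover have "\<kappa> \<in> {1..m}" "\<kappa>' \<in> {1..m}" using kb(1,2) block_m[OF ll(1)] block_m[OF ll(2)] by auto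
    ultimately have na: "\<not> aligned \<epsilon> (X \<kappa> \<omega>) (X \<kappa>' \<omega>)" using \<omega>(3) sp unfolding angle_event_def by blast
    have "h 0 * a \<le> (norm (X \<kappa> \<omega>))\<^sup>2" "h 0 * a \<le> (norm (X \<kappa>' \<omega>))\<^sup>2"
      using kb(3,4) a by (auto simp: sq_def field_simps)
    then have ang: "\<bar>inner (X \<kappa> \<omega> /\<^sub>R norm (X \<kappa> \<omega>)) (X \<kappa>' \<omega> /\<^sub>R norm (X \<kappa>' \<omega>))\<bar> \<le> \<epsilon>" using na by (simp add: aligned_def)
    have "X \<kappa> \<omega> \<noteq> 0" "X \<kappa>' \<omega> \<noteq> 0" using kb(3,4) h0 by (auto simp: sq_def)
    then have i1: "\<bar>inner (X \<kappa> \<omega>) (X \<kappa>' \<omega>)\<bar> \<le> \<epsilon> * (norm (X \<kappa> \<omega>) * norm (X \<kappa>' \<omega>))"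
      using ang by (simp add: abs_mult field_simps)
    define s where "s = inverse (sqrt a)"
    have s: "0 \<le> s" using a by (simp add: s_def)
    have "\<bar>inner (v \<kappa>) (v \<kappa>')\<bar> = s * s * \<bar>inner (X \<kappa> \<omega>) (X \<kappa>' \<omega>)\<bar>"
      unfolding v_def s_def[symmetric] using s by (simp add: abs_mult)
    also have "\<dots> \<le> s * s * (\<epsilon> * (norm (X \<kappa> \<omega>) * norm (X \<kappa>' \<omega>)))" using i1 s by (intro mult_left_mono) auto
    also have "\<dots> = \<epsilon> * (norm (v \<kappa>) * norm (v \<kappa>'))" unfolding v_def s_def[symmetric] using s by simp
    finally show ?thesis unfolding k(2,4) .
  qed
  have d1: "dist (shape_of (big ` {..m})) (code_shape L h \<sigma>) \<le> e + real L * \<eta>"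
    unfolding img code_shape_def by (rule angle_toleranceD[OF \<epsilon>(2)]) (use w1 w2 in auto)
  have "dist ((\<Sum>i=1..k. X i \<omega>) /\<^sub>R sqrt a) (big k) \<le> 2 * e" if k: "k \<le> m" for k
  proof -
    have "{i\<in>A. i \<le> k} = {i\<in>{1..k}. h 0 < sq (X i \<omega>)}" using k by (auto simp: A_def)
    then have "big k = (\<Sum>i=1..k. if h 0 < sq (X i \<omega>) then v i else 0)"
      unfolding big_def by (simp only: sum.inter_filter[OF finite_atLeastAtMost])
    \<comment> \<open>Removing the truncated step leaves exactly the large steps, so the distance
      between the walk and \<open>big\<close> is the norm of the sum of truncated steps.\<close>
    also have "\<dots> = (\<Sum>i=1..k. (X i \<omega> - small_part i \<omega>) /\<^sub>R sqrt a)"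
      by (intro sum.cong) (auto simp: small_part_def v_def)
    also have "\<dots> = (\<Sum>i=1..k. X i \<omega>) /\<^sub>R sqrt a - (\<Sum>i=1..k. small_part i \<omega>) /\<^sub>R sqrt a"
      by (simp add: scaleR_right.sum[symmetric] sum_subtractf scaleR_diff_right)
    finally have "dist ((\<Sum>i=1..k. X i \<omega>) /\<^sub>R sqrt a) (big k) = norm (\<Sum>i=1..k. small_part i \<omega>) / sqrt a"
      using a by (simp add: dist_norm divide_inverse mult.commute)
    also have "norm (\<Sum>i=1..k. small_part i \<omega>) \<le> norm (\<Sum>i=1..k. small_part i \<omega> - drift) + real k * norm drift"
    proof -
      have "(\<Sum>i=1..k. small_part i \<omega>) = (\<Sum>i=1..k. small_part i \<omega> - drift) + real k *\<^sub>R drift"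
        by (simp add: sum_subtractf sum_constant_scaleR)
      then show ?thesis using norm_triangle_ineq[of "\<Sum>i=1..k. small_part i \<omega> - drift" "real k *\<^sub>R drift"] by simp
    qed
    also have "\<dots> \<le> e * sqrt a + e * sqrt a"
    proof (rule add_mono)
      have "\<not> e * sqrt a \<le> norm (\<Sum>i=1..k. small_part i \<omega> - drift)"
        using \<omega>(4) sp k unfolding fluctuation_event_def by blast
      then show "norm (\<Sum>i=1..k. small_part i \<omega> - drift) \<le> e * sqrt a" by linarith
      have "real k * norm drift \<le> real m * norm drift" using k by (intro mult_right_mono) auto
      then show "real k * norm drift \<le> e * sqrt a" using dr by linarith
    qed
    also have "(e * sqrt a + e * sqrt a) / sqrt a = 2 * e" using a by simp
    finally show ?thesis using a by (simp add: divide_right_mono)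
  qed
  then have d2: "dist (shape_of (walk_set (\<lambda>i. X i \<omega>) a m)) (shape_of (big ` {..m})) \<le> 2 * e"
    unfolding walk_set_eq by (intro dist_shape_of_families_le) auto
  show ?thesis using d1 d2 mesh'
      dist_triangle[of "shape_of (walk_set (\<lambda>i. X i \<omega>) a m)" "code_shape L h \<sigma>" "shape_of (big ` {..m})"] by linarith
qed

lemma walk_cell_approx:
  assumes e: "0 < e" and mesh': "real L * \<eta> \<le> e" and dr: "real m * norm drift \<le> e * sqrt a"
    and \<epsilon>: "0 < \<epsilon>" "angle_tolerance L (sqrt (h J)) e \<epsilon>"
    and small: "real L * tail_prob + (real m)\<^sup>2 * prob {\<omega>\<in>space M. aligned \<epsilon> (X 1 \<omega>) (X 2 \<omega>)}
      + real m * expectation (\<lambda>\<omega>. (norm (small_part 1 \<omega>))\<^sup>2) / (e\<^sup>2 * a) \<le> 4 * e"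
  shows "cell_approx M (\<lambda>\<omega>. shape_of (walk_set (\<lambda>i. X i \<omega>) a m)) (cell_codes L J) (code_shape L h)
    walk_event (leftover_event \<union> angle_event \<epsilon> \<union> fluctuation_event e) (4 * e)"
proof -
  have "prob (leftover_event \<union> angle_event \<epsilon> \<union> fluctuation_event e)
      \<le> prob (leftover_event \<union> angle_event \<epsilon>) + prob (fluctuation_event e)"
    using leftover_event(1) angle_event(1) fluctuation_event(1)[OF e] by (intro measure_Un_le) auto
  moreover have "prob (leftover_event \<union> angle_event \<epsilon>) \<le> prob leftover_event + prob (angle_event \<epsilon>)"
    using leftover_event(1) angle_event(1) by (intro measure_Un_le)
  ultimately have "prob (leftover_event \<union> angle_event \<epsilon> \<union> fluctuation_event e) \<le> 4 * e"
    using leftover_event(2) angle_event(2)[of \<epsilon>] fluctuation_event(2)[OF e] small by linarith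
  moreover have "leftover_event \<union> angle_event \<epsilon> \<union> fluctuation_event e \<in> events"
    using leftover_event(1) angle_event(1) fluctuation_event(1)[OF e] by (intro sets.Un)
  ultimately show ?thesis
    unfolding cell_approx_def
    using walk_event_prob(2) walk_events_disjoint walk_near_code[OF e mesh' dr \<epsilon>] by blast
qed

end

section \<open>Passage to the limit\<close>

lemma cell_approx_mono: "cell_approx M Z S D E A e \<Longrightarrow> e \<le> e' \<Longrightarrow> cell_approx M Z S D E A e'"
  unfolding cell_approx_def by (meson order_trans)

text \<open>Sandwiched by \<open>1 - p \<le> exp (- p)\<close> from above and
  \<open>exp (- p / (1 - p)) \<le> 1 - p\<close> from below; as \<open>p\<close> tends to 0 both
  exponents have the same limit after multiplication by \<open>b\<close>.\<close>

lemma power_one_minus_tendsto_exp: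
  fixes p :: "nat \<Rightarrow> real" and b :: "nat \<Rightarrow> nat"
  assumes p: "p \<longlonglongrightarrow> 0" "\<And>d. 0 \<le> p d" and bp: "(\<lambda>d. real (b d) * p d) \<longlonglongrightarrow> c"
  shows "(\<lambda>d. (1 - p d) ^ b d) \<longlonglongrightarrow> exp (- c)"
proof (rule tendsto_sandwich)
  have "(\<lambda>d. exp (- ((real (b d) * p d) / (1 - p d)))) \<longlonglongrightarrow> exp (- (c / (1 - 0)))"
    by (intro tendsto_intros bp p(1)) simp
  then show "(\<lambda>d. exp (- ((real (b d) * p d) / (1 - p d)))) \<longlonglongrightarrow> exp (- c)" by simp
  show "(\<lambda>d. exp (- (real (b d) * p d))) \<longlonglongrightarrow> exp (- c)" by (intro tendsto_intros bp)
  have small: "\<forall>\<^sub>F d in sequentially. p d < 1" using order_tendstoD(2)[OF p(1), of 1] by simp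
  then show "\<forall>\<^sub>F d in sequentially. exp (- ((real (b d) * p d) / (1 - p d))) \<le> (1 - p d) ^ b d"
  proof eventually_elim
    case (elim d)
    have "1 + p d / (1 - p d) \<le> exp (p d / (1 - p d))" by (rule exp_ge_add_one_self)
    moreover have "1 + p d / (1 - p d) = 1 / (1 - p d)" using elim by (simp add: field_simps)
    ultimately have "1 / exp (p d / (1 - p d)) \<le> 1 / (1 / (1 - p d))"
      using elim by (intro divide_left_mono) auto
    then have "exp (- (p d / (1 - p d))) \<le> 1 - p d" by (simp add: exp_minus inverse_eq_divide)
    then have "exp (- (p d / (1 - p d))) ^ b d \<le> (1 - p d) ^ b d" by (intro power_mono) auto
    then show ?case by (simp add: exp_of_nat_mult[symmetric] mult.commute)
  qed
  show "\<forall>\<^sub>F d in sequentially. (1 - p d) ^ b d \<le> exp (- (real (b d) * p d))"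
    using small
  proof eventually_elim
    case (elim d)
    have "1 - p d \<le> exp (- p d)" using exp_ge_add_one_self[of "- p d"] by simp
    then have "(1 - p d) ^ b d \<le> exp (- p d) ^ b d" using elim by (intro power_mono) auto
    then show ?case by (simp add: exp_of_nat_mult[symmetric] mult.commute)
  qed
qed

lemma sqrt_diff_le:
  assumes "0 \<le> x" "x \<le> y" "y - x \<le> \<eta>\<^sup>2" "0 \<le> \<eta>"
  shows "sqrt y - sqrt x \<le> \<eta>"
proof -
  have "sqrt (x + (y - x)) \<le> sqrt x + sqrt (y - x)" using assms by (intro sqrt_add_le_add_sqrt) auto
  moreover have "sqrt (y - x) \<le> sqrt (\<eta>\<^sup>2)" using assms(3) by (rule real_sqrt_le_mono)
  ultimately show ?thesis using assms(4) by simp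
qed

text \<open>The interval is divided into \<open>K\<close> pieces of length \<open>w\<close>, and one
  good point is taken inside each; neighbours, including the two ends, are at most
  \<open>2 * w\<close> apart. As the square root increases by at most the root of the increment,
  \<open>2 * w \<le> \<eta>\<^sup>2\<close> yields the mesh.\<close>

lemma size_grid_exists:
  fixes good :: "real \<Rightarrow> bool"
  assumes s: "0 < s" "good s" and H: "s < H" "good H" and \<eta>: "0 < \<eta>"
    and dense: "\<And>\<alpha> \<beta>. 0 < \<alpha> \<Longrightarrow> \<alpha> < \<beta> \<Longrightarrow> \<exists>c. \<alpha> < c \<and> c < \<beta> \<and> good c"
  shows "\<exists>h J. size_grid h J \<eta> \<and> h 0 = s \<and> h J = H \<and> (\<forall>j\<le>J. good (h j))"
proof -
  obtain K0 :: nat where K0: "2 * (H - s) / \<eta>\<^sup>2 \<le> real K0" using real_arch_simple by blast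
  define K where "K = Suc K0"
  define w where "w = (H - s) / real K"
  have w: "0 < w" "real K * w = H - s" using H by (auto simp: w_def K_def)
  have "2 * (H - s) / \<eta>\<^sup>2 \<le> real K" using K0 by (simp add: K_def)
  then have "2 * (H - s) \<le> real K * \<eta>\<^sup>2" using \<eta> by (simp add: pos_divide_le_eq)
  then have w\<eta>: "2 * w \<le> \<eta>\<^sup>2" by (simp add: w_def K_def field_simps)
  have "\<exists>c. s + real i * w < c \<and> c < s + (real i + 1) * w \<and> good c" for i :: nat
    using s w by (intro dense) (auto intro!: add_pos_nonneg simp: distrib_right)
  then obtain c where c: "\<And>i. s + real i * w < c i" "\<And>i. c i < s + (real i + 1) * w" "\<And>i. good (c i)" by metis
  \<comment> \<open>The \<open>K\<close> chosen points sit at positions 1 to \<open>K\<close>,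
    between the ends at positions 0 and \<open>K + 1\<close>.\<close>
  define h where "h = (\<lambda>j. if j = 0 then s else if j \<le> K then c (j - 1) else H)"
  have step: "h j < h (Suc j)" "h (Suc j) - h j \<le> 2 * w" if j: "j < Suc K" for j
  proof -
    consider "j = 0" | "0 < j" "j < K" | "0 < j" "j = K" using j by linarith
    then have "h j < h (Suc j) \<and> h (Suc j) - h j \<le> 2 * w"
    proof cases
      case 1
      then show ?thesis using c(1)[of 0] c(2)[of 0] w by (simp add: h_def K_def)
    next
      case 2
      then have "real (j - 1) = real j - 1" by simp
      then have "s + (real j - 1) * w < c (j - 1)" "c (j - 1) < s + real j * w" using c(1)[of "j - 1"] c(2)[of "j - 1"] by auto
      moreover have "(real j + 1) * w = (real j - 1) * w + 2 * w" by (simp add: algebra_simps)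
      ultimately have "c (j - 1) < c j" "c j - c (j - 1) \<le> 2 * w" using c(1)[of j] c(2)[of j] by linarith+
      then show ?thesis using 2 by (simp add: h_def)
    next
      case 3
      then have "real (j - 1) = real j - 1" by simp
      then have "s + (real K - 1) * w < c (K - 1)" "c (K - 1) < s + real K * w" using c(1)[of "j - 1"] c(2)[of "j - 1"] 3 by auto
      moreover have "(real K - 1) * w = real K * w - w" by (simp add: algebra_simps)
      ultimately have "c (K - 1) < H" "H - c (K - 1) \<le> 2 * w" using w by linarith+
      then show ?thesis using 3 by (simp add: h_def)
    qed
    then show "h j < h (Suc j)" "h (Suc j) - h j \<le> 2 * w" by auto
  qed
  have "0 < c i" for i
  proof -
    have "0 \<le> real i * w" using w by simp
    then show ?thesis using c(1)[of i] s by linarith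
  qed
  then have pos: "0 < h j" for j
    unfolding h_def using s H by auto
  have "size_grid h (Suc K) \<eta>"
  proof
    show "0 < h 0" by (rule pos)
    show "0 \<le> \<eta>" using \<eta> by simp
    fix j assume j: "j < Suc K"
    show "h j < h (Suc j)" by (rule step(1)[OF j])
    show "sqrt (h (Suc j)) - sqrt (h j) \<le> \<eta>"
      using step[OF j] pos[of j] \<eta> w\<eta> by (intro sqrt_diff_le) auto
  qed
  moreover have "h 0 = s" "h (Suc K) = H" "\<forall>j\<le>Suc K. good (h j)"
    using s H c(3) by (auto simp: h_def)
  ultimately show ?thesis by blast
qed

context levy_measure
begin

lemma box_measure:
  assumes g: "size_grid h J \<eta>" and j: "0 < j" "j \<le> J"
  shows "measure \<nu> (size_box h j) = measure \<nu> {ennreal (h (j - 1))<..} - measure \<nu> {ennreal (h j)<..}"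
proof -
  interpret size_grid h J \<eta> by fact
  have jj: "j - 1 \<le> J" using j by linarith
  have f: "{ennreal (h (j - 1))<..} \<in> fmeasurable \<nu>" "{ennreal (h j)<..} \<in> fmeasurable \<nu>"
    using levy_tail_fmeasurable h_pos[OF jj] h_pos[OF j(2)] by auto
  have sub: "{ennreal (h j)<..} \<subseteq> {ennreal (h (j - 1))<..}"
    using ennreal_leI[OF h_mono[of "j - 1" j]] j by (auto intro: le_less_trans)
  have "size_box h j = {ennreal (h (j - 1))<..} - {ennreal (h j)<..}"
    using j by (auto simp: size_box_def)
  then show ?thesis using f sub by (simp add: measure_Diff fmeasurableD fmeasurableD2)
qed

lemma sum_cell_prob:
  assumes g: "size_grid h J \<eta>"
  shows "(\<Sum>j\<le>J. cell_prob \<nu> h t j) =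
    (1 + t * (measure \<nu> {ennreal (h 0)<..} - measure \<nu> {ennreal (h J)<..})) * exp (- (t * measure \<nu> {ennreal (h 0)<..}))"
proof -
  have "(\<Sum>j\<le>k. if j = 0 then 1 else t * measure \<nu> (size_box h j)) =
      1 + t * (measure \<nu> {ennreal (h 0)<..} - measure \<nu> {ennreal (h k)<..})" if "k \<le> J" for k
    using that
  proof (induction k)
    case (Suc k)
    then have "measure \<nu> (size_box h (Suc k)) = measure \<nu> {ennreal (h k)<..} - measure \<nu> {ennreal (h (Suc k))<..}"
      using box_measure[OF g, of "Suc k"] by simp
    then show ?case using Suc by (simp add: right_diff_distrib)
  qed simp
  then show ?thesis unfolding cell_prob_def sum_distrib_right[symmetric] by simp
qed

text \<open>A sum of products over all codes is the \<open>L\<close>-th power of the one-cell sum.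
  Its value is the probability that no cell has more than one large jump and no jump exceeds the
  top.\<close>

lemma sum_code_prob:
  assumes g: "size_grid h J \<eta>"
  shows "(\<Sum>\<sigma>\<in>cell_codes L J. \<Prod>l<L. cell_prob \<nu> h t (\<sigma> l)) =
    ((1 + t * (measure \<nu> {ennreal (h 0)<..} - measure \<nu> {ennreal (h J)<..})) * exp (- (t * measure \<nu> {ennreal (h 0)<..}))) ^ L"
proof -
  have "(\<Prod>l<L. \<Sum>j\<le>J. cell_prob \<nu> h t j) = (\<Sum>\<sigma>\<in>cell_codes L J. \<Prod>l<L. cell_prob \<nu> h t (\<sigma> l))"
    unfolding cell_codes_def by (rule prod_sum_PiE) auto
  then show ?thesis unfolding sum_cell_prob[OF g] by simp
qed

text \<open>As the cells shrink, two large jumps in one cell become impossible in the limit, and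
  only the probability \<open>exp (- (T * q))\<close> of no jump above the top remains.\<close>

lemma many_cells:
  assumes T: "0 < (T::real)" and e: "0 < e"
  shows "\<exists>L>0. exp (- (T * q)) - e \<le>
    ((1 + T / real L * (r - q)) * exp (- (T / real L * r))) ^ L"
proof -
  have "(\<lambda>L. (1 + (T * (r - q)) / real L) ^ L * exp (- (T * r))) \<longlonglongrightarrow> exp (T * (r - q)) * exp (- (T * r))"
    by (intro tendsto_mult tendsto_exp_limit_sequentially tendsto_const)
  moreover have "exp (T * (r - q)) * exp (- (T * r)) = exp (- (T * q))"
    unfolding exp_add[symmetric] by (simp add: algebra_simps)
  ultimately have "\<forall>\<^sub>F L in sequentially. exp (- (T * q)) - e < (1 + (T * (r - q)) / real L) ^ L * exp (- (T * r))"
    using e by (intro order_tendstoD(1)) auto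
  then have "\<forall>\<^sub>F L in sequentially. 0 < L \<and> exp (- (T * q)) - e < (1 + (T * (r - q)) / real L) ^ L * exp (- (T * r))"
    using eventually_gt_at_top[of 0] by eventually_elim auto
  then obtain L where L: "0 < L" "exp (- (T * q)) - e < (1 + (T * (r - q)) / real L) ^ L * exp (- (T * r))"
    by (auto simp: eventually_sequentially)
  have "exp (- (T / real L * r)) ^ L = exp (- (T * r))"
    using L(1) by (simp add: exp_of_nat_mult[symmetric])
  then have "((1 + T / real L * (r - q)) * exp (- (T / real L * r))) ^ L = (1 + (T * (r - q)) / real L) ^ L * exp (- (T * r))"
    by (simp add: power_mult_distrib)
  then show ?thesis using L by (intro exI[of _ L]) auto
qed

end

section \<open>Limits of the counting and angle probabilities\<close>

locale walk_limit = levy_measure \<nu> for \<nu> +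
  fixes M :: "nat \<Rightarrow> 'w measure" and X :: "nat \<Rightarrow> 'w \<Rightarrow> ell2" and Xs :: "nat \<Rightarrow> nat \<Rightarrow> 'w \<Rightarrow> ell2"
    and n :: "nat \<Rightarrow> nat" and a :: "nat \<Rightarrow> real" and T :: real
  assumes prob: "\<And>d. 1 \<le> d \<Longrightarrow> prob_space (M d)"
    and X_measurable: "\<And>d. 1 \<le> d \<Longrightarrow> X d \<in> borel_measurable (M d)"
    and Xs_indep: "\<And>d. 1 \<le> d \<Longrightarrow> prob_space.indep_vars (M d) (\<lambda>_. borel) (Xs d) {1..}"
    and Xs_distr: "\<And>d i. 1 \<le> d \<Longrightarrow> 1 \<le> i \<Longrightarrow> distr (M d) borel (Xs d i) = distr (M d) borel (X d)"
    and n_pos: "\<And>d. 1 \<le> d \<Longrightarrow> 1 \<le> n d"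
    and n_lim: "filterlim n at_top sequentially"
    and a_pos: "\<And>k. 1 \<le> k \<Longrightarrow> 0 < a k"
    and a_vague: "vague_conv
      (\<lambda>d. scale_measure (of_nat (n d))
        (distr (M d) borel (\<lambda>\<omega>. ennreal ((norm (X d \<omega>))\<^sup>2 / a (n d))))) \<nu>"
    and a_trunc: "((\<lambda>s. limsup (\<lambda>d. ereal (real (n d) / a (n d) *
        (LINT \<omega>|M d. (norm (X d \<omega>))\<^sup>2 * indicator {\<omega>. (norm (X d \<omega>))\<^sup>2 \<le> s * a (n d)} \<omega>))))
      \<longlongrightarrow> 0) (at_right 0)"
    and b_angles: "\<And>s \<epsilon>. 0 < s \<Longrightarrow> 0 < \<epsilon> \<Longrightarrow>
      (\<lambda>d. cond_prob (M d)
        (\<lambda>\<omega>. \<epsilon> < \<bar>inner (Xs d 1 \<omega> /\<^sub>R norm (Xs d 1 \<omega>)) (Xs d 2 \<omega> /\<^sub>R norm (Xs d 2 \<omega>))\<bar>)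
        (\<lambda>\<omega>. s * a (n d) \<le> (norm (Xs d 1 \<omega>))\<^sup>2 \<and> s * a (n d) \<le> (norm (Xs d 2 \<omega>))\<^sup>2))
      \<longlonglongrightarrow> 0"
    and c_mean: "((\<lambda>s. limsup (\<lambda>d. ereal (real (n d) / sqrt (a (n d)) *
        norm (LINT \<omega>|M d. indicator {\<omega>. (norm (X d \<omega>))\<^sup>2 \<le> s * a (n d)} \<omega> *\<^sub>R X d \<omega>))))
      \<longlongrightarrow> 0) (at_right 0)"
    and T_pos: "0 < T"
begin

definition norm_tail :: "nat \<Rightarrow> real \<Rightarrow> real"
  where "norm_tail d c = measure (M d) {\<omega>\<in>space (M d). c < (norm (X d \<omega>))\<^sup>2 / a (n d)}"

definition steps :: "nat \<Rightarrow> nat"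
  where "steps d = nat \<lfloor>real (n d) * T\<rfloor>"

definition blen :: "nat \<Rightarrow> nat \<Rightarrow> nat"
  where "blen L d = nat \<lfloor>real (n d) * T / real L\<rfloor>"

lemma an_pos: "1 \<le> d \<Longrightarrow> 0 < a (n d)"
  by (intro a_pos n_pos)

lemma ev1: "\<forall>\<^sub>F d in sequentially. 1 \<le> (d::nat)"
  by (rule eventually_ge_at_top)

lemma norm_tail_nonneg: "0 \<le> norm_tail d c"
  by (simp add: norm_tail_def)

lemma Xs_measurable: "1 \<le> d \<Longrightarrow> 1 \<le> i \<Longrightarrow> Xs d i \<in> borel_measurable (M d)"
  using Xs_indep[of d] prob[of d] by (auto simp: prob_space.indep_vars_def)

lemma measure_Xs:
  assumes "1 \<le> d" "1 \<le> i" and B: "Measurable.pred borel B"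
  shows "measure (M d) {\<omega>\<in>space (M d). B (Xs d i \<omega>)} = measure (M d) {\<omega>\<in>space (M d). B (X d \<omega>)}"
proof -
  have B': "Collect B \<in> sets borel" using B by (simp add: pred_def)
  have "measure (distr (M d) borel (Xs d i)) (Collect B) = measure (distr (M d) borel (X d)) (Collect B)"
    using Xs_distr[OF assms(1,2)] by simp
  then show ?thesis
    using measure_distr[OF Xs_measurable[OF assms(1,2)] B'] measure_distr[OF X_measurable[OF assms(1)] B']
    by (simp add: vimage_def Int_def conj_commute)
qed

lemma integral_Xs:
  fixes g :: "ell2 \<Rightarrow> 'c::{banach, second_countable_topology}"
  assumes "1 \<le> d" "1 \<le> i" "g \<in> borel_measurable borel"
  shows "(LINT \<omega>|M d. g (Xs d i \<omega>)) = (LINT \<omega>|M d. g (X d \<omega>))"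
  using integral_distr[OF Xs_measurable[OF assms(1,2)] assms(3)] integral_distr[OF X_measurable[OF assms(1)] assms(3)]
    Xs_distr[OF assms(1,2)] by simp

lemma tail_limit:
  assumes c: "0 < c" "measure \<nu> {ennreal c} = 0"
  shows "(\<lambda>d. real (n d) * norm_tail d c) \<longlonglongrightarrow> measure \<nu> {ennreal c<..}"
proof -
  define \<mu> where "\<mu> = (\<lambda>d. scale_measure (of_nat (n d)) (distr (M d) borel (\<lambda>\<omega>. ennreal ((norm (X d \<omega>))\<^sup>2 / a (n d)))))"
  have mX: "(\<lambda>\<omega>. ennreal ((norm (X d \<omega>))\<^sup>2 / a (n d))) \<in> borel_measurable (M d)" if "1 \<le> d" for d
    using X_measurable[OF that] by measurable
  have fin: "\<forall>\<^sub>F d in sequentially. finite_measure (\<mu> d) \<and> sets (\<mu> d) = sets borel"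
    using ev1
  proof eventually_elim
    case (elim d)
    interpret prob_space "distr (M d) borel (\<lambda>\<omega>. ennreal ((norm (X d \<omega>))\<^sup>2 / a (n d)))"
      by (rule prob_space.prob_space_distr[OF prob[OF elim] mX[OF elim]])
    have "emeasure (\<mu> d) (space (\<mu> d)) \<noteq> \<infinity>"
      unfolding \<mu>_def using emeasure_space_1 by (simp add: space_scale_measure ennreal_mult_eq_top_iff)
    then show ?case by (auto intro: finite_measureI simp: \<mu>_def)
  qed
  have "(\<lambda>d. measure (\<mu> d) {ennreal c<..}) \<longlonglongrightarrow> measure \<nu> {ennreal c<..}"
    by (rule vague_conv_tail[OF fin _ c]) (use a_vague in \<open>simp add: \<mu>_def\<close>)
  moreover have "\<forall>\<^sub>F d in sequentially. measure (\<mu> d) {ennreal c<..} = real (n d) * norm_tail d c"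
    using ev1
  proof eventually_elim
    case (elim d)
    have "(\<lambda>\<omega>. ennreal ((norm (X d \<omega>))\<^sup>2 / a (n d))) -` {ennreal c<..} \<inter> space (M d)
      = {\<omega>\<in>space (M d). c < (norm (X d \<omega>))\<^sup>2 / a (n d)}"
      using c(1) by (auto simp: ennreal_less_iff)
    then show ?case
      using mX[OF elim] by (simp add: \<mu>_def measure_distr norm_tail_def ennreal_of_nat_eq_real_of_nat)
  qed
  ultimately show ?thesis by (simp add: tendsto_cong)
qed

lemma n_real: "filterlim (\<lambda>d. real (n d)) at_top sequentially"
  by (rule filterlim_compose[OF filterlim_real_sequentially n_lim])

lemma inverse_n: "(\<lambda>d. 1 / real (n d)) \<longlonglongrightarrow> 0"
  using tendsto_inverse_0_at_top[OF n_real] by (simp add: inverse_eq_divide)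

lemma tail_vanishes:
  assumes c: "0 < c" "measure \<nu> {ennreal c} = 0"
  shows "(\<lambda>d. norm_tail d c) \<longlonglongrightarrow> 0"
proof -
  have "(\<lambda>d. (1 / real (n d)) * (real (n d) * norm_tail d c)) \<longlonglongrightarrow> 0 * measure \<nu> {ennreal c<..}"
    by (intro tendsto_mult inverse_n tail_limit c)
  moreover have "\<forall>\<^sub>F d in sequentially. (1 / real (n d)) * (real (n d) * norm_tail d c) = norm_tail d c"
    using ev1 by eventually_elim (use n_pos in force)
  ultimately show ?thesis by (simp add: tendsto_cong)
qed

lemma blen_bounds:
  assumes "0 < L"
  shows "real (blen L d) \<le> real (n d) * T / real L" "real (n d) * T / real L < real (blen L d) + 1"
proof -
  have "0 \<le> real (n d) * T / real L" using T_pos by simp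
  then have "real (blen L d) = of_int \<lfloor>real (n d) * T / real L\<rfloor>" unfolding blen_def by (simp add: of_nat_nat)
  then show "real (blen L d) \<le> real (n d) * T / real L" "real (n d) * T / real L < real (blen L d) + 1" by linarith+
qed

lemma steps_le: "real (steps d) \<le> real (n d) * T"
proof -
  have "0 \<le> real (n d) * T" using T_pos by simp
  then have "real (steps d) = of_int \<lfloor>real (n d) * T\<rfloor>" unfolding steps_def by (simp add: of_nat_nat)
  then show ?thesis by linarith
qed

lemma blen_steps:
  assumes L: "0 < L"
  shows "L * blen L d \<le> steps d" "steps d \<le> L * blen L d + L"
proof -
  have "real L * real (blen L d) \<le> real (n d) * T" "real (n d) * T < real L * (real (blen L d) + 1)"
    using blen_bounds[OF L, of d] L by (auto simp: field_simps)
  then have 1: "real (L * blen L d) \<le> real (n d) * T" and 2: "real (n d) * T < real (L * blen L d + L)"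
    by (auto simp: algebra_simps)
  have "int (L * blen L d) \<le> \<lfloor>real (n d) * T\<rfloor>" using 1 by (simp only: le_floor_iff of_int_of_nat_eq)
  then show "L * blen L d \<le> steps d" unfolding steps_def by linarith
  have "real (steps d) < real (L * blen L d + L)" using steps_le[of d] 2 by linarith
  then show "steps d \<le> L * blen L d + L" by linarith
qed

lemma blen_ratio:
  assumes L: "0 < L"
  shows "(\<lambda>d. real (blen L d) / real (n d)) \<longlonglongrightarrow> T / real L"
proof (rule tendsto_sandwich)
  have "(\<lambda>d. T / real L - 1 / real (n d)) \<longlonglongrightarrow> T / real L - 0" by (intro tendsto_diff tendsto_const inverse_n)
  then show "(\<lambda>d. T / real L - 1 / real (n d)) \<longlonglongrightarrow> T / real L" by simp
  show "\<forall>\<^sub>F d in sequentially. T / real L - 1 / real (n d) \<le> real (blen L d) / real (n d)"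
    using ev1
  proof eventually_elim
    case (elim d)
    then have nd: "0 < real (n d)" using n_pos[of d] by simp
    have "T / real L - 1 / real (n d) = (real (n d) * T / real L - 1) / real (n d)" using nd by (simp add: diff_divide_distrib)
    also have "\<dots> \<le> real (blen L d) / real (n d)" using nd blen_bounds(2)[OF L, of d] by (intro divide_right_mono) auto
    finally show ?case .
  qed
  show "\<forall>\<^sub>F d in sequentially. real (blen L d) / real (n d) \<le> T / real L"
    using ev1
  proof eventually_elim
    case (elim d)
    then have nd: "0 < real (n d)" using n_pos[of d] by simp
    have "real (blen L d) / real (n d) \<le> (real (n d) * T / real L) / real (n d)"
      using nd blen_bounds(1)[OF L, of d] by (intro divide_right_mono) auto
    then show ?case using nd by simp
  qed
qed auto

lemma blen_large:
  assumes L: "0 < L"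
  shows "\<forall>\<^sub>F d in sequentially. 0 < blen L d"
proof -
  have "\<forall>\<^sub>F d in sequentially. real L / T \<le> real (n d)"
    using n_real by (simp add: filterlim_at_top)
  then show ?thesis
  proof eventually_elim
    case (elim d)
    then have "1 \<le> real (n d) * T / real L" using L T_pos by (simp add: field_simps)
    then show ?case using blen_bounds(2)[OF L, of d] by linarith
  qed
qed

lemma blen_tail:
  assumes L: "0 < L" and c: "0 < c" "measure \<nu> {ennreal c} = 0"
  shows "(\<lambda>d. real (blen L d) * norm_tail d c) \<longlonglongrightarrow> T / real L * measure \<nu> {ennreal c<..}"
proof -
  have "(\<lambda>d. (real (blen L d) / real (n d)) * (real (n d) * norm_tail d c)) \<longlonglongrightarrow> T / real L * measure \<nu> {ennreal c<..}"
    by (intro tendsto_mult blen_ratio L tail_limit c)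
  moreover have "\<forall>\<^sub>F d in sequentially. (real (blen L d) / real (n d)) * (real (n d) * norm_tail d c) = real (blen L d) * norm_tail d c"
    using ev1 by eventually_elim (use n_pos in force)
  ultimately show ?thesis by (simp add: tendsto_cong)
qed

text \<open>Both exponents occur: \<open>blen\<close> for a block without large steps, one less for
  the companions of a single large step. The difference is one tail probability, which vanishes in
  the limit.\<close>

lemma no_large_limit:
  assumes L: "0 < L" and c: "0 < c" "measure \<nu> {ennreal c} = 0"
  shows "(\<lambda>d. (1 - norm_tail d c) ^ blen L d) \<longlonglongrightarrow> exp (- (T / real L * measure \<nu> {ennreal c<..}))"
    and "(\<lambda>d. (1 - norm_tail d c) ^ (blen L d - 1)) \<longlonglongrightarrow> exp (- (T / real L * measure \<nu> {ennreal c<..}))"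
proof -
  show "(\<lambda>d. (1 - norm_tail d c) ^ blen L d) \<longlonglongrightarrow> exp (- (T / real L * measure \<nu> {ennreal c<..}))"
    by (rule power_one_minus_tendsto_exp[OF tail_vanishes[OF c] norm_tail_nonneg blen_tail[OF L c]])
  have "(\<lambda>d. real (blen L d) * norm_tail d c - norm_tail d c) \<longlonglongrightarrow> T / real L * measure \<nu> {ennreal c<..} - 0"
    by (intro tendsto_diff blen_tail[OF L c] tail_vanishes[OF c])
  moreover have "\<forall>\<^sub>F d in sequentially. real (blen L d) * norm_tail d c - norm_tail d c = real (blen L d - 1) * norm_tail d c"
    using blen_large[OF L] by eventually_elim (simp add: of_nat_diff left_diff_distrib)
  ultimately have "(\<lambda>d. real (blen L d - 1) * norm_tail d c) \<longlonglongrightarrow> T / real L * measure \<nu> {ennreal c<..}"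
    by (simp add: tendsto_cong)
  then show "(\<lambda>d. (1 - norm_tail d c) ^ (blen L d - 1)) \<longlonglongrightarrow> exp (- (T / real L * measure \<nu> {ennreal c<..}))"
    by (rule power_one_minus_tendsto_exp[OF tail_vanishes[OF c] norm_tail_nonneg])
qed

text \<open>The joint probability is the conditional one times the probability that both steps are
  large, and the latter is at most a squared tail by independence. The number of pairs is at most
  \<open>(n * T)\<^sup>2\<close>, so the conditional probability is multiplied by a convergent,
  hence bounded, factor.\<close>

lemma aligned_limit:
  assumes s: "0 < s" and \<epsilon>: "0 < \<epsilon>"
  shows "(\<lambda>d. (real (steps d))\<^sup>2 * measure (M d) {\<omega>\<in>space (M d).
    \<epsilon> < \<bar>inner (Xs d 1 \<omega> /\<^sub>R norm (Xs d 1 \<omega>)) (Xs d 2 \<omega> /\<^sub>R norm (Xs d 2 \<omega>))\<bar> \<and>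
    s * a (n d) \<le> (norm (Xs d 1 \<omega>))\<^sup>2 \<and> s * a (n d) \<le> (norm (Xs d 2 \<omega>))\<^sup>2}) \<longlonglongrightarrow> 0"
    (is "(\<lambda>d. _ * measure _ (?E d)) \<longlonglongrightarrow> 0")
proof -
  \<comment> \<open>\<open>s\<close> may be an atom of \<open>\<nu>\<close>; a slightly smaller
    continuity point has a convergent tail containing the event in question.\<close>
  obtain c where c: "s / 2 < c" "c < s" "measure \<nu> {ennreal c} = 0"
    using levy_continuity_point[of "s / 2" s] s by auto
  have c0: "0 < c" using c(1) s by linarith
  define cp where "cp = (\<lambda>d. cond_prob (M d)
        (\<lambda>\<omega>. \<epsilon> < \<bar>inner (Xs d 1 \<omega> /\<^sub>R norm (Xs d 1 \<omega>)) (Xs d 2 \<omega> /\<^sub>R norm (Xs d 2 \<omega>))\<bar>)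
        (\<lambda>\<omega>. s * a (n d) \<le> (norm (Xs d 1 \<omega>))\<^sup>2 \<and> s * a (n d) \<le> (norm (Xs d 2 \<omega>))\<^sup>2))"
  have lim: "(\<lambda>d. T\<^sup>2 * (real (n d) * norm_tail d c)\<^sup>2 * cp d) \<longlonglongrightarrow> T\<^sup>2 * (measure \<nu> {ennreal c<..})\<^sup>2 * 0"
    unfolding cp_def by (intro tendsto_intros tail_limit c0 c(3) b_angles s \<epsilon>)
  show ?thesis
  proof (rule tendsto_sandwich[where f = "\<lambda>_. 0"])
    show "(\<lambda>d. T\<^sup>2 * (real (n d) * norm_tail d c)\<^sup>2 * cp d) \<longlonglongrightarrow> 0" using lim by simp
    show "\<forall>\<^sub>F d in sequentially. (real (steps d))\<^sup>2 * measure (M d) (?E d) \<le> T\<^sup>2 * (real (n d) * norm_tail d c)\<^sup>2 * cp d"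
      using ev1
    proof eventually_elim
      case (elim d)
      interpret prob_space "M d" by (rule prob[OF elim])
      define Q where "Q = {\<omega>\<in>space (M d). s * a (n d) \<le> (norm (Xs d 1 \<omega>))\<^sup>2 \<and> s * a (n d) \<le> (norm (Xs d 2 \<omega>))\<^sup>2}"
      define G where "G = {u :: ell2. s * a (n d) \<le> (norm u)\<^sup>2}"
      have G: "G \<in> sets borel" unfolding G_def by measurable
      have mX: "Xs d i -` G \<inter> space (M d) \<in> events" if "1 \<le> i" for i
        using measurable_sets[OF Xs_measurable[OF elim that] G] .
      have "prob (Xs d i -` G \<inter> space (M d)) \<le> norm_tail d c" if i: "1 \<le> i" for i
      proof -
        have "Measurable.pred borel (\<lambda>u :: ell2. s * a (n d) \<le> (norm u)\<^sup>2)" by measurable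
        from measure_Xs[OF elim i this]
        have "prob (Xs d i -` G \<inter> space (M d)) = prob {\<omega>\<in>space (M d). s * a (n d) \<le> (norm (X d \<omega>))\<^sup>2}"
          by (simp add: G_def vimage_def Int_def conj_commute)
        also have "\<dots> \<le> norm_tail d c"
          unfolding norm_tail_def
        proof (rule finite_measure_mono)
          show "{\<omega>\<in>space (M d). s * a (n d) \<le> (norm (X d \<omega>))\<^sup>2} \<subseteq> {\<omega>\<in>space (M d). c < (norm (X d \<omega>))\<^sup>2 / a (n d)}"
          proof safe
            fix \<omega> assume "s * a (n d) \<le> (norm (X d \<omega>))\<^sup>2"
            moreover have "c * a (n d) < s * a (n d)" using c(2) an_pos[OF elim] by simp
            ultimately have "c * a (n d) < (norm (X d \<omega>))\<^sup>2" by linarith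
            then show "c < (norm (X d \<omega>))\<^sup>2 / a (n d)" using an_pos[OF elim] by (simp add: pos_less_divide_eq)
          qed
          show "{\<omega>\<in>space (M d). c < (norm (X d \<omega>))\<^sup>2 / a (n d)} \<in> events"
            using X_measurable[OF elim] by measurable
        qed
        finally show ?thesis .
      qed
      then have p12: "prob (Xs d 1 -` G \<inter> space (M d)) * prob (Xs d 2 -` G \<inter> space (M d)) \<le> norm_tail d c * norm_tail d c"
        by (intro mult_mono) (auto simp: norm_tail_nonneg)
      have "prob (\<Inter>i\<in>{1,2}. Xs d i -` G \<inter> space (M d)) = (\<Prod>i\<in>{1,2}. prob (Xs d i -` G \<inter> space (M d)))"
        by (rule indep_varsD[OF Xs_indep[OF elim]]) (use G in auto)
      moreover have "(\<Inter>i\<in>{1,2}. Xs d i -` G \<inter> space (M d)) = Q" by (auto simp: Q_def G_def)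
      ultimately have pQ: "prob Q \<le> (norm_tail d c)\<^sup>2" using p12 by (simp add: power2_eq_square)
      have Qev: "Q \<in> events"
        using mX[of 1] mX[of 2] \<open>(\<Inter>i\<in>{1,2}. Xs d i -` G \<inter> space (M d)) = Q\<close> by auto
      have cpd: "cp d = prob (?E d) / prob Q" unfolding cp_def cond_prob_def Q_def ..
      have EQ: "prob (?E d) \<le> prob Q" by (rule finite_measure_mono[OF _ Qev]) (auto simp: Q_def)
      have cp0: "0 \<le> cp d" unfolding cpd by simp
      have "prob (?E d) = cp d * prob Q"
      \<comment> \<open>If the conditioning event is null, the quotient is 0 by convention, in
        agreement with the numerator, which is then null as well.\<close>
      proof (cases "prob Q = 0")
        case True
        then have "prob (?E d) = 0" using EQ measure_nonneg[of "M d" "?E d"] by linarith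
        then show ?thesis using True by simp
      qed (simp add: cpd)
      also have "\<dots> \<le> cp d * (norm_tail d c)\<^sup>2" using pQ cp0 by (rule mult_left_mono)
      finally have "(real (steps d))\<^sup>2 * prob (?E d) \<le> (real (n d) * T)\<^sup>2 * (cp d * (norm_tail d c)\<^sup>2)"
        using steps_le[of d] by (intro mult_mono power_mono) auto
      then show ?case by (simp add: power_mult_distrib mult_ac)
    qed
  qed (auto intro: always_eventually)
qed

text \<open>Turns the two iterated limits of (a) and (c) into one range of thresholds for which both
  bounds hold eventually in \<open>d\<close>. A whole range is needed because the threshold must
  also avoid the atoms of \<open>\<nu>\<close>.\<close>

lemma small_parts:
  assumes \<delta>: "0 < \<delta>"
  shows "\<exists>s0>0. \<forall>s. 0 < s \<and> s < s0 \<longrightarrow> (\<forall>\<^sub>F d in sequentially.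
    real (n d) / a (n d) * (LINT \<omega>|M d. (norm (X d \<omega>))\<^sup>2 * indicator {\<omega>. (norm (X d \<omega>))\<^sup>2 \<le> s * a (n d)} \<omega>) < \<delta> \<and>
    real (n d) / sqrt (a (n d)) * norm (LINT \<omega>|M d. indicator {\<omega>. (norm (X d \<omega>))\<^sup>2 \<le> s * a (n d)} \<omega> *\<^sub>R X d \<omega>) < \<delta>)"
proof -
  have "\<forall>\<^sub>F s in at_right 0. limsup (\<lambda>d. ereal (real (n d) / a (n d) *
        (LINT \<omega>|M d. (norm (X d \<omega>))\<^sup>2 * indicator {\<omega>. (norm (X d \<omega>))\<^sup>2 \<le> s * a (n d)} \<omega>))) < ereal \<delta>"
    using order_tendstoD(2)[OF a_trunc, of "ereal \<delta>"] \<delta> by simp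
  moreover have "\<forall>\<^sub>F s in at_right 0. limsup (\<lambda>d. ereal (real (n d) / sqrt (a (n d)) *
        norm (LINT \<omega>|M d. indicator {\<omega>. (norm (X d \<omega>))\<^sup>2 \<le> s * a (n d)} \<omega> *\<^sub>R X d \<omega>))) < ereal \<delta>"
    using order_tendstoD(2)[OF c_mean, of "ereal \<delta>"] \<delta> by simp
  ultimately have "\<forall>\<^sub>F s in at_right 0. \<forall>\<^sub>F d in sequentially.
    real (n d) / a (n d) * (LINT \<omega>|M d. (norm (X d \<omega>))\<^sup>2 * indicator {\<omega>. (norm (X d \<omega>))\<^sup>2 \<le> s * a (n d)} \<omega>) < \<delta> \<and>
    real (n d) / sqrt (a (n d)) * norm (LINT \<omega>|M d. indicator {\<omega>. (norm (X d \<omega>))\<^sup>2 \<le> s * a (n d)} \<omega> *\<^sub>R X d \<omega>) < \<delta>"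
  proof eventually_elim
    case (elim s)
    show ?case using Limsup_lessD[OF elim(1)] Limsup_lessD[OF elim(2)] by eventually_elim simp
  qed
  then show ?thesis unfolding eventually_at_right_field by blast
qed

end

section \<open>Convergence of the walk codes for a fixed grid\<close>

context walk_limit
begin

context
  fixes h :: "nat \<Rightarrow> real" and J :: nat and \<eta> :: real and L :: nat
  assumes grid: "size_grid h J \<eta>" and L: "0 < L"
    and good: "\<And>j. j \<le> J \<Longrightarrow> measure \<nu> {ennreal (h j)} = 0"
begin

interpretation size_grid h J \<eta> by (rule grid)

lemma walk_grid_at:
  assumes "1 \<le> d" "0 < blen L d"
  shows "walk_grid (M d) h J \<eta> (Xs d) (a (n d)) L (blen L d) (steps d)"
proof (intro walk_grid.intro walk_grid_axioms.intro)
  show "prob_space (M d)" by (rule prob[OF assms(1)])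
  show "size_grid h J \<eta>" by (rule grid)
  show "prob_space.indep_vars (M d) (\<lambda>_. borel) (Xs d) {1..}" by (rule Xs_indep[OF assms(1)])
  show "distr (M d) borel (Xs d i) = distr (M d) borel (Xs d 1)" if "1 \<le> i" for i
    using Xs_distr[OF assms(1) that] Xs_distr[OF assms(1), of 1] by simp
  show "0 < a (n d)" by (rule an_pos[OF assms(1)])
qed (use L assms blen_steps[OF L] in auto)

lemma tail_prob_eq:
  assumes "1 \<le> d" "0 < blen L d"
  shows "walk_grid.tail_prob (M d) h (Xs d) (a (n d)) = norm_tail d (h 0)"
proof -
  interpret W: walk_grid "M d" h J \<eta> "Xs d" "a (n d)" L "blen L d" "steps d" by (rule walk_grid_at[OF assms])
  have "Measurable.pred borel (\<lambda>u :: ell2. h 0 < (norm u)\<^sup>2 / a (n d))" by measurable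
  from measure_Xs[OF assms(1) order_refl this] show ?thesis
    by (simp add: W.tail_prob_def W.sq_def norm_tail_def)
qed

lemma box_prob_eq:
  assumes "1 \<le> d" "0 < blen L d" and j: "0 < j" "j \<le> J"
  shows "walk_grid.box_prob (M d) h (Xs d) (a (n d)) j = norm_tail d (h (j - 1)) - norm_tail d (h j)"
proof -
  interpret W: walk_grid "M d" h J \<eta> "Xs d" "a (n d)" L "blen L d" "steps d" by (rule walk_grid_at[OF assms(1,2)])
  let ?R = "\<lambda>\<omega>. (norm (X d \<omega>))\<^sup>2 / a (n d)"
  have [measurable]: "X d \<in> borel_measurable (M d)" by (rule X_measurable[OF assms(1)])
  have "Measurable.pred borel (\<lambda>u :: ell2. h (j - 1) < (norm u)\<^sup>2 / a (n d) \<and> (norm u)\<^sup>2 / a (n d) \<le> h j)" by measurable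
  from measure_Xs[OF assms(1) order_refl this]
  have "W.box_prob j = measure (M d) {\<omega>\<in>space (M d). h (j - 1) < ?R \<omega> \<and> ?R \<omega> \<le> h j}"
    by (simp add: W.box_prob_def W.sq_def)
  also have "{\<omega>\<in>space (M d). h (j - 1) < ?R \<omega> \<and> ?R \<omega> \<le> h j}
      = {\<omega>\<in>space (M d). h (j - 1) < ?R \<omega>} - {\<omega>\<in>space (M d). h j < ?R \<omega>}" by auto
  also have "measure (M d) \<dots> = norm_tail d (h (j - 1)) - norm_tail d (h j)"
    unfolding norm_tail_def
  proof (rule W.finite_measure_Diff)
    have "h (j - 1) \<le> h j" using j by (intro h_mono) auto
    then show "{\<omega>\<in>space (M d). h j < ?R \<omega>} \<subseteq> {\<omega>\<in>space (M d). h (j - 1) < ?R \<omega>}" by auto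
  qed measurable
  finally show ?thesis .
qed

text \<open>A box probability is a difference of two tails at grid points, where
  \<open>\<nu>\<close> has no atom; each tail times the block length converges, and the remaining
  power has an exponential limit.\<close>

lemma block_prob_limit:
  assumes j: "j \<le> J"
  shows "(\<lambda>d. walk_grid.block_prob (M d) h (Xs d) (a (n d)) (blen L d) j) \<longlonglongrightarrow> cell_prob \<nu> h (T / real L) j"
proof -
  have ev: "\<forall>\<^sub>F d in sequentially. 1 \<le> d \<and> 0 < blen L d" using ev1 blen_large[OF L] by eventually_elim auto
  have good0: "measure \<nu> {ennreal (h 0)} = 0" by (rule good) simp
  show ?thesis
  proof (cases "j = 0")
    case True
    have "\<forall>\<^sub>F d in sequentially. walk_grid.block_prob (M d) h (Xs d) (a (n d)) (blen L d) j = (1 - norm_tail d (h 0)) ^ blen L d"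
      using ev
    proof eventually_elim
      case (elim d)
      interpret W: walk_grid "M d" h J \<eta> "Xs d" "a (n d)" L "blen L d" "steps d" by (rule walk_grid_at) (use elim in auto)
      show ?case using True tail_prob_eq[of d] elim by (simp add: W.block_prob_def)
    qed
    moreover have "(\<lambda>d. (1 - norm_tail d (h 0)) ^ blen L d) \<longlonglongrightarrow> cell_prob \<nu> h (T / real L) j"
      using no_large_limit(1)[OF L h0 good0] True by (simp add: cell_prob_def)
    ultimately show ?thesis by (simp add: tendsto_cong)
  next
    case False
    then have j0: "0 < j" by simp
    have jj: "j - 1 \<le> J" using j by linarith
    have "\<forall>\<^sub>F d in sequentially. walk_grid.block_prob (M d) h (Xs d) (a (n d)) (blen L d) j =
        (real (blen L d) * norm_tail d (h (j - 1)) - real (blen L d) * norm_tail d (h j)) * (1 - norm_tail d (h 0)) ^ (blen L d - 1)"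
      using ev
    proof eventually_elim
      case (elim d)
      interpret W: walk_grid "M d" h J \<eta> "Xs d" "a (n d)" L "blen L d" "steps d" by (rule walk_grid_at) (use elim in auto)
      show ?case using False tail_prob_eq[of d] box_prob_eq[of d j] j0 j elim
        by (simp add: W.block_prob_def right_diff_distrib)
    qed
    moreover have "(\<lambda>d. (real (blen L d) * norm_tail d (h (j - 1)) - real (blen L d) * norm_tail d (h j)) * (1 - norm_tail d (h 0)) ^ (blen L d - 1))
      \<longlonglongrightarrow> (T / real L * measure \<nu> {ennreal (h (j - 1))<..} - T / real L * measure \<nu> {ennreal (h j)<..})
        * exp (- (T / real L * measure \<nu> {ennreal (h 0)<..}))"
      by (intro tendsto_mult tendsto_diff blen_tail no_large_limit(2) L h_pos good j jj h0 good0)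
    moreover have "(T / real L * measure \<nu> {ennreal (h (j - 1))<..} - T / real L * measure \<nu> {ennreal (h j)<..})
        * exp (- (T / real L * measure \<nu> {ennreal (h 0)<..})) = cell_prob \<nu> h (T / real L) j"
      unfolding cell_prob_def box_measure[OF grid j0 j] right_diff_distrib using False by simp
    ultimately show ?thesis by (simp add: tendsto_cong)
  qed
qed

lemma walk_event_limit:
  assumes \<sigma>: "\<sigma> \<in> cell_codes L J"
  shows "(\<lambda>d. measure (M d) (walk_grid.walk_event (M d) h (Xs d) (a (n d)) L (blen L d) \<sigma>))
    \<longlonglongrightarrow> (\<Prod>l<L. cell_prob \<nu> h (T / real L) (\<sigma> l))"
proof -
  have "(\<lambda>d. \<Prod>l<L. walk_grid.block_prob (M d) h (Xs d) (a (n d)) (blen L d) (\<sigma> l))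
      \<longlonglongrightarrow> (\<Prod>l<L. cell_prob \<nu> h (T / real L) (\<sigma> l))"
    using \<sigma> by (intro tendsto_prod block_prob_limit) (auto simp: cell_codes_def PiE_iff)
  moreover have "\<forall>\<^sub>F d in sequentially. measure (M d) (walk_grid.walk_event (M d) h (Xs d) (a (n d)) L (blen L d) \<sigma>)
      = (\<Prod>l<L. walk_grid.block_prob (M d) h (Xs d) (a (n d)) (blen L d) (\<sigma> l))"
    using ev1 blen_large[OF L]
  proof eventually_elim
    case (elim d)
    interpret W: walk_grid "M d" h J \<eta> "Xs d" "a (n d)" L "blen L d" "steps d" by (rule walk_grid_at[OF elim])
    show ?case by (rule W.walk_event_prob(1)[OF \<sigma>])
  qed
  ultimately show ?thesis by (simp add: tendsto_cong)
qed

text \<open>There are at most \<open>n * T\<close> steps, which explains the constants: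
  \<open>\<delta> / T\<close> makes the accumulated mean at most \<open>\<delta>\<close> after
  scaling, and \<open>\<delta> ^ 3 / T\<close> makes the maximal inequality with its denominator
  \<open>\<delta>\<^sup>2\<close> give at most \<open>\<delta>\<close>.\<close>

lemma walk_cell_approx_eventually:
  assumes \<delta>: "0 < \<delta>" and mesh': "real L * \<eta> \<le> \<delta>"
    and \<epsilon>: "0 < \<epsilon>" "angle_tolerance L (sqrt (h J)) \<delta> \<epsilon>"
    and second: "\<forall>\<^sub>F d in sequentially. real (n d) / a (n d) *
      (LINT \<omega>|M d. (norm (X d \<omega>))\<^sup>2 * indicator {\<omega>. (norm (X d \<omega>))\<^sup>2 \<le> h 0 * a (n d)} \<omega>) < \<delta> ^ 3 / T"
    and first: "\<forall>\<^sub>F d in sequentially. real (n d) / sqrt (a (n d)) *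
      norm (LINT \<omega>|M d. indicator {\<omega>. (norm (X d \<omega>))\<^sup>2 \<le> h 0 * a (n d)} \<omega> *\<^sub>R X d \<omega>) < \<delta> / T"
  shows "\<forall>\<^sub>F d in sequentially. cell_approx (M d)
    (\<lambda>\<omega>. shape_of (walk_set (\<lambda>i. Xs d i \<omega>) (a (n d)) (steps d))) (cell_codes L J) (code_shape L h)
    (walk_grid.walk_event (M d) h (Xs d) (a (n d)) L (blen L d))
    (walk_grid.leftover_event (M d) h (Xs d) (a (n d)) L (blen L d) (steps d) \<union>
      walk_grid.angle_event (M d) h (Xs d) (a (n d)) (steps d) \<epsilon> \<union>
      walk_grid.fluctuation_event (M d) h (Xs d) (a (n d)) (steps d) \<delta>) (4 * \<delta>)"
proof -
  have good0: "measure \<nu> {ennreal (h 0)} = 0" by (rule good) simp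
  have "(\<lambda>d. real L * norm_tail d (h 0)) \<longlonglongrightarrow> real L * 0" by (intro tendsto_intros tail_vanishes h0 good0)
  then have e1: "\<forall>\<^sub>F d in sequentially. real L * norm_tail d (h 0) < \<delta>" using \<delta> by (intro order_tendstoD(2)) auto
  have e2: "\<forall>\<^sub>F d in sequentially. (real (steps d))\<^sup>2 * measure (M d) {\<omega>\<in>space (M d).
      \<epsilon> < \<bar>inner (Xs d 1 \<omega> /\<^sub>R norm (Xs d 1 \<omega>)) (Xs d 2 \<omega> /\<^sub>R norm (Xs d 2 \<omega>))\<bar> \<and>
      h 0 * a (n d) \<le> (norm (Xs d 1 \<omega>))\<^sup>2 \<and> h 0 * a (n d) \<le> (norm (Xs d 2 \<omega>))\<^sup>2} < \<delta>"
    by (rule order_tendstoD(2)[OF aligned_limit[OF h0 \<epsilon>(1)] \<delta>])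
  show ?thesis
    using ev1 blen_large[OF L] e1 e2 second first
  proof eventually_elim
    case (elim d)
    interpret W: walk_grid "M d" h J \<eta> "Xs d" "a (n d)" L "blen L d" "steps d" by (rule walk_grid_at[OF elim(1,2)])
    have a: "0 < a (n d)" by (rule an_pos[OF elim(1)])
    \<comment> \<open>Bridges the scaled truncation used for the grid and the indicator in the
      hypotheses, so that \<open>V\<close> and the drift are the very integrals bounded
      there.\<close>
    have sq_iff: "W.sq u \<le> h 0 \<longleftrightarrow> (norm u)\<^sup>2 \<le> h 0 * a (n d)" for u using a by (simp add: W.sq_def pos_divide_le_eq)
    define V where "V = (LINT \<omega>|M d. (norm (X d \<omega>))\<^sup>2 * indicator {\<omega>. (norm (X d \<omega>))\<^sup>2 \<le> h 0 * a (n d)} \<omega>)"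
    have tm: "(\<lambda>u. if W.sq u \<le> h 0 then u else 0) \<in> borel_measurable borel" by (rule W.truncate_measurable)
    then have "(\<lambda>u. (norm (if W.sq u \<le> h 0 then u else 0))\<^sup>2) \<in> borel_measurable borel" by measurable
    from integral_Xs[OF elim(1) order_refl this]
    have V: "W.expectation (\<lambda>\<omega>. (norm (W.small_part 1 \<omega>))\<^sup>2) = V"
      unfolding V_def W.small_part_def
      by (auto simp: sq_iff indicator_def intro!: Bochner_Integration.integral_cong elim!: trans)
    have D: "W.drift = (LINT \<omega>|M d. indicator {\<omega>. (norm (X d \<omega>))\<^sup>2 \<le> h 0 * a (n d)} \<omega> *\<^sub>R X d \<omega>)"
      using integral_Xs[OF elim(1) order_refl tm] unfolding W.drift_def W.small_part_def[abs_def]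
      by (auto simp: sq_iff indicator_def intro!: Bochner_Integration.integral_cong elim!: trans)
    show ?case
    proof (rule W.walk_cell_approx[OF \<delta> mesh' _ \<epsilon>])
      have "real (steps d) * norm W.drift \<le> (real (n d) * T) * norm W.drift"
        using steps_le[of d] by (intro mult_right_mono) auto
      also have "\<dots> = (real (n d) / sqrt (a (n d)) * norm W.drift) * T * sqrt (a (n d))" using a by simp
      also have "\<dots> \<le> (\<delta> / T) * T * sqrt (a (n d))"
        using elim(6) T_pos a unfolding D by (intro mult_right_mono) auto
      also have "\<dots> = \<delta> * sqrt (a (n d))" using T_pos by simp
      finally show "real (steps d) * norm W.drift \<le> \<delta> * sqrt (a (n d))" .
      have V0: "0 \<le> V" unfolding V_def by simp
      have "real (steps d) * V / (\<delta>\<^sup>2 * a (n d)) \<le> (real (n d) * T) * V / (\<delta>\<^sup>2 * a (n d))"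
        using steps_le[of d] V0 a by (intro divide_right_mono mult_right_mono) auto
      also have "\<dots> = (real (n d) / a (n d) * V) * (T / \<delta>\<^sup>2)" using a \<delta> by (simp add: field_simps)
      also have "\<dots> \<le> (\<delta> ^ 3 / T) * (T / \<delta>\<^sup>2)"
        using elim(5) T_pos unfolding V_def[symmetric] by (intro mult_right_mono) auto
      also have "\<dots> = \<delta>" using T_pos \<delta> by (simp add: power2_eq_square power3_eq_cube)
      finally have t3: "real (steps d) * V / (\<delta>\<^sup>2 * a (n d)) \<le> \<delta>" .
      have t1: "real L * W.tail_prob < \<delta>" using elim(3) tail_prob_eq[OF elim(1,2)] by simp
      have t2: "(real (steps d))\<^sup>2 * W.prob {\<omega>\<in>space (M d). W.aligned \<epsilon> (Xs d 1 \<omega>) (Xs d 2 \<omega>)} < \<delta>"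
        using elim(4) unfolding W.aligned_def .
      show "real L * W.tail_prob + (real (steps d))\<^sup>2 * W.prob {\<omega>\<in>space (M d). W.aligned \<epsilon> (Xs d 1 \<omega>) (Xs d 2 \<omega>)}
        + real (steps d) * W.expectation (\<lambda>\<omega>. (norm (W.small_part 1 \<omega>))\<^sup>2) / (\<delta>\<^sup>2 * a (n d)) \<le> 4 * \<delta>"
        unfolding V using t1 t2 t3 \<delta> by linarith
    qed
  qed
qed

end

text \<open>All constants depend on \<open>e\<close>, \<open>\<nu>\<close> and \<open>T\<close> and
  on the walk only through the thresholds of \<open>small_parts\<close>. Everything that depends on
  \<open>d\<close> is then handled by one eventual statement.\<close>

lemma approximation:
  assumes atoms: "crinkled_atoms \<nu> P x y" and e: "0 < e"
  shows "\<exists>(S :: (nat \<Rightarrow> nat) set) D E F A B. finite S \<and>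
      (\<forall>\<^sub>F d in sequentially. cell_approx (M d)
        (\<lambda>\<omega>. shape_of (walk_set (\<lambda>i. Xs d i \<omega>) (a (n d)) (steps d))) S D (E d) (A d) e) \<and>
      cell_approx P (\<lambda>\<omega>. shape_of (crinkled_range (\<lambda>k. x k \<omega>) (\<lambda>k. y k \<omega>) T)) S D F B e \<and>
      (\<forall>s\<in>S. (\<lambda>d. measure (M d) (E d s)) \<longlonglongrightarrow> measure P (F s)) \<and>
      1 - e \<le> (\<Sum>s\<in>S. measure P (F s))"
proof -
  \<comment> \<open>The walk estimate loses a factor 4, the crinkled one a factor 3.\<close>
  define \<delta> where "\<delta> = e / 4"
  have \<delta>: "0 < \<delta>" "4 * \<delta> = e" using e by (auto simp: \<delta>_def)
  define \<delta>' where "\<delta>' = min (\<delta> ^ 3 / T) (\<delta> / T)"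
  have \<delta>': "0 < \<delta>'" using \<delta> T_pos by (simp add: \<delta>'_def)
  have "0 < \<delta> ^ 3 / T" using \<delta> T_pos by simp
  from small_integral_tendsto_0[OF this] obtain s1 where s1: "0 < s1"
    "\<And>s. 0 < s \<Longrightarrow> s \<le> s1 \<Longrightarrow> (\<integral>\<^sup>+z\<in>{0<..ennreal s}. z \<partial>\<nu>) \<le> ennreal (\<delta> ^ 3 / T)" by blast
  obtain s2 where s2: "0 < s2" "\<forall>s. 0 < s \<and> s < s2 \<longrightarrow> (\<forall>\<^sub>F d in sequentially.
    real (n d) / a (n d) * (LINT \<omega>|M d. (norm (X d \<omega>))\<^sup>2 * indicator {\<omega>. (norm (X d \<omega>))\<^sup>2 \<le> s * a (n d)} \<omega>) < \<delta>' \<and>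
    real (n d) / sqrt (a (n d)) * norm (LINT \<omega>|M d. indicator {\<omega>. (norm (X d \<omega>))\<^sup>2 \<le> s * a (n d)} \<omega> *\<^sub>R X d \<omega>) < \<delta>')"
    using small_parts[OF \<delta>'] by (elim exE conjE)
  define s0 where "s0 = min s1 s2"
  have "0 < s0" using s1 s2 by (simp add: s0_def)
  then obtain s where s: "s0 / 2 < s" "s < s0" "measure \<nu> {ennreal s} = 0"
    using levy_continuity_point[of "s0 / 2" s0] by auto
  have s_pos: "0 < s" using s(1) \<open>0 < s0\<close> by linarith
  have "0 < \<delta> / T" using \<delta> T_pos by simp
  \<comment> \<open>Fixes a level above which jumps occur before time \<open>T\<close> with mean
    number less than \<open>\<delta>\<close>; the top \<open>H\<close> is then a continuity point
    beyond both this level and \<open>s\<close>.\<close>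
  from order_tendstoD(2)[OF levy_tail_tendsto_0 this]
  obtain k where k: "measure \<nu> {ennreal (real k + 1)<..} < \<delta> / T"
    unfolding eventually_sequentially by blast
  obtain H where H: "max (real k + 1) s < H" "measure \<nu> {ennreal H} = 0"
  proof -
    have "0 < max (real k + 1) s" using s_pos by simp
    from levy_continuity_point[OF this, of "max (real k + 1) s + 1"] show thesis using that by auto
  qed
  define q where "q = measure \<nu> {ennreal H<..}"
  have "q \<le> measure \<nu> {ennreal (real k + 1)<..}"
    unfolding q_def
  proof (rule measure_mono_fmeasurable)
    have "ennreal (real k + 1) \<le> ennreal H" using H(1) by (intro ennreal_leI) auto
    then show "{ennreal H<..} \<subseteq> {ennreal (real k + 1)<..}" by (rule greaterThan_subset_iff[THEN iffD2])
    show "{ennreal H<..} \<in> sets \<nu>" by (rule levy_tail_sets(1)) (use H(1) in linarith)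
    show "{ennreal (real k + 1)<..} \<in> fmeasurable \<nu>" by (rule levy_tail_fmeasurable) simp
  qed
  then have "q < \<delta> / T" using k by linarith
  then have Tq: "T * q \<le> \<delta>" using T_pos by (simp add: pos_less_divide_eq mult.commute)
  define r where "r = measure \<nu> {ennreal s<..}"
  \<comment> \<open>The number of cells depends only on the tails at \<open>s\<close> and
    \<open>H\<close>, so it can be fixed before the mesh, whose size has to be divided by
    it.\<close>
  obtain L where L: "0 < L" "exp (- (T * q)) - \<delta> \<le> ((1 + T / real L * (r - q)) * exp (- (T / real L * r))) ^ L"
    using many_cells[OF T_pos \<delta>(1), of q r] by blast
  define \<eta> where "\<eta> = \<delta> / real L"
  have \<eta>: "0 < \<eta>" "real L * \<eta> \<le> \<delta>" using \<delta> L by (auto simp: \<eta>_def)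
  have "s < H" using H(1) by simp
  from size_grid_exists[where good = "\<lambda>c. measure \<nu> {ennreal c} = 0", OF s_pos s(3) this H(2) \<eta>(1) levy_continuity_point]
  obtain h J where g: "size_grid h J \<eta>" "h 0 = s" "h J = H" and good: "\<And>j. j \<le> J \<Longrightarrow> measure \<nu> {ennreal (h j)} = 0" by blast
  have "0 \<le> sqrt (h J)" unfolding g(3) using s_pos \<open>s < H\<close> by simp
  \<comment> \<open>The angle tolerance comes last: it depends on the number of cells and on the top
    length \<open>sqrt (h J)\<close>.\<close>
  from angle_tolerance_exists[OF \<delta>(1) this, of L] obtain \<epsilon> where \<epsilon>: "0 < \<epsilon>" "angle_tolerance L (sqrt (h J)) \<delta> \<epsilon>" by blast
  interpret C: crinkled_grid \<nu> P x y h J \<eta> T L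
    by (intro crinkled_grid.intro crinkled_grid_axioms.intro atoms g(1) T_pos L(1))
  have ss: "0 < s \<and> s < s2" using s_pos s(2) by (simp add: s0_def)
  have small: "\<forall>\<^sub>F d in sequentially.
    real (n d) / a (n d) * (LINT \<omega>|M d. (norm (X d \<omega>))\<^sup>2 * indicator {\<omega>. (norm (X d \<omega>))\<^sup>2 \<le> h 0 * a (n d)} \<omega>) < \<delta>' \<and>
    real (n d) / sqrt (a (n d)) * norm (LINT \<omega>|M d. indicator {\<omega>. (norm (X d \<omega>))\<^sup>2 \<le> h 0 * a (n d)} \<omega> *\<^sub>R X d \<omega>) < \<delta>'"
    unfolding g(2) by (rule s2(2)[THEN spec, THEN mp, OF ss])
  have second: "\<forall>\<^sub>F d in sequentially. real (n d) / a (n d) *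
      (LINT \<omega>|M d. (norm (X d \<omega>))\<^sup>2 * indicator {\<omega>. (norm (X d \<omega>))\<^sup>2 \<le> h 0 * a (n d)} \<omega>) < \<delta> ^ 3 / T"
    using small by eventually_elim (simp add: \<delta>'_def)
  have first: "\<forall>\<^sub>F d in sequentially. real (n d) / sqrt (a (n d)) *
      norm (LINT \<omega>|M d. indicator {\<omega>. (norm (X d \<omega>))\<^sup>2 \<le> h 0 * a (n d)} \<omega> *\<^sub>R X d \<omega>) < \<delta> / T"
    using small by eventually_elim (simp add: \<delta>'_def)
  have walk: "\<forall>\<^sub>F d in sequentially. cell_approx (M d)
    (\<lambda>\<omega>. shape_of (walk_set (\<lambda>i. Xs d i \<omega>) (a (n d)) (steps d))) (cell_codes L J) (code_shape L h)
    (walk_grid.walk_event (M d) h (Xs d) (a (n d)) L (blen L d))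
    (walk_grid.leftover_event (M d) h (Xs d) (a (n d)) L (blen L d) (steps d) \<union>
      walk_grid.angle_event (M d) h (Xs d) (a (n d)) (steps d) \<epsilon> \<union>
      walk_grid.fluctuation_event (M d) h (Xs d) (a (n d)) (steps d) \<delta>) e"
    using walk_cell_approx_eventually[OF g(1) L(1) good \<delta>(1) \<eta>(2) \<epsilon> second first] unfolding \<delta>(2) .
  have "ennreal T * (\<integral>\<^sup>+z\<in>{0<..ennreal (h 0)}. z \<partial>\<nu>) \<le> ennreal T * ennreal (\<delta> ^ 3 / T)"
    unfolding g(2) using s(2) s_pos by (intro mult_left_mono s1(2)) (auto simp: s0_def)
  also have "\<dots> = ennreal (T * (\<delta> ^ 3 / T))" using T_pos \<delta> by (intro ennreal_mult[symmetric]) auto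
  also have "T * (\<delta> ^ 3 / T) = \<delta> ^ 3" using T_pos by simp
  finally have "cell_approx P (\<lambda>\<omega>. shape_of (crinkled_range (\<lambda>k. x k \<omega>) (\<lambda>k. y k \<omega>) T))
    (cell_codes L J) (code_shape L h) C.code_event (C.bad_event \<delta>) (3 * \<delta>)"
    by (rule C.crinkled_cell_approx[OF \<delta>(1) \<eta>(2)])
  then have crinkled: "cell_approx P (\<lambda>\<omega>. shape_of (crinkled_range (\<lambda>k. x k \<omega>) (\<lambda>k. y k \<omega>) T))
    (cell_codes L J) (code_shape L h) C.code_event (C.bad_event \<delta>) e"
    by (rule cell_approx_mono) (use \<delta> in linarith)
  have F: "measure P (C.code_event \<sigma>) = (\<Prod>l<L. cell_prob \<nu> h (T / real L) (\<sigma> l))" if "\<sigma> \<in> cell_codes L J" for \<sigma>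
    using C.code_event_prob(1)[OF that] unfolding C.dt_def .
  have lim: "\<forall>\<sigma>\<in>cell_codes L J. (\<lambda>d. measure (M d) (walk_grid.walk_event (M d) h (Xs d) (a (n d)) L (blen L d) \<sigma>))
    \<longlonglongrightarrow> measure P (C.code_event \<sigma>)"
    using walk_event_limit[OF g(1) L(1) good] F by simp
  \<comment> \<open>At most \<open>\<delta>\<close> of the code mass is lost to jumps above the top
    and at most \<open>\<delta>\<close> to the finite number of cells, well within
    \<open>e = 4 * \<delta>\<close>.\<close>
  have "1 - T * q \<le> exp (- (T * q))" using exp_ge_add_one_self[of "- (T * q)"] by simp
  then have "1 - e \<le> exp (- (T * q)) - \<delta>" using Tq \<delta> by linarith
  also have "\<dots> \<le> (\<Sum>\<sigma>\<in>cell_codes L J. \<Prod>l<L. cell_prob \<nu> h (T / real L) (\<sigma> l))"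
    unfolding sum_code_prob[OF g(1)] g(2,3) using L(2) unfolding q_def r_def .
  also have "\<dots> = (\<Sum>\<sigma>\<in>cell_codes L J. measure P (C.code_event \<sigma>))" using F by simp
  finally have total: "1 - e \<le> (\<Sum>\<sigma>\<in>cell_codes L J. measure P (C.code_event \<sigma>))" .
  have "finite (cell_codes L J)" unfolding cell_codes_def by (intro finite_PiE) auto
  then show ?thesis using walk crinkled lim total by (intro exI conjI)
qed

end

text \<open>The measurability claims ensure that the \<open>distr\<close> terms are the laws of the
  two random shapes; for the walk they concern \<open>1 \<le> d\<close>, and the limit is unaffected
  by \<open>d = 0\<close>.\<close>

theorem corollary2p10:
  fixes M :: "nat \<Rightarrow> 'w measure"
    and X :: "nat \<Rightarrow> 'w \<Rightarrow> ell2"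
    and Xs :: "nat \<Rightarrow> nat \<Rightarrow> 'w \<Rightarrow> ell2"
    and n :: "nat \<Rightarrow> nat"
    and a :: "nat \<Rightarrow> real"
    and \<nu> :: "ennreal measure"
    and T :: real
    and P :: "'v measure"
    and x :: "nat \<Rightarrow> 'v \<Rightarrow> real"
    and y :: "nat \<Rightarrow> 'v \<Rightarrow> ennreal"
  assumes prob: "\<And>d. 1 \<le> d \<Longrightarrow> prob_space (M d)"
    and X_measurable: "\<And>d. 1 \<le> d \<Longrightarrow> X d \<in> borel_measurable (M d)"
    and X_Rd: "\<And>d \<omega>. 1 \<le> d \<Longrightarrow> \<omega> \<in> space (M d) \<Longrightarrow> X d \<omega> \<in> span (ell2_basis ` {..<d})"
    and Xs_indep: "\<And>d. 1 \<le> d \<Longrightarrow> prob_space.indep_vars (M d) (\<lambda>_. borel) (Xs d) {1..}"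
    and Xs_distr: "\<And>d i. 1 \<le> d \<Longrightarrow> 1 \<le> i \<Longrightarrow> distr (M d) borel (Xs d i) = distr (M d) borel (X d)"
    and n_pos: "\<And>d. 1 \<le> d \<Longrightarrow> 1 \<le> n d"
    and n_lim: "filterlim n at_top sequentially"
    and a_pos: "\<And>k. 1 \<le> k \<Longrightarrow> 0 < a k"
    and \<nu>_sets: "sets \<nu> = sets (restrict_space borel {0<..})"
    and \<nu>_levy: "(\<integral>\<^sup>+z\<in>{0<..<\<infinity>}. min 1 z \<partial>\<nu>) < \<infinity>"
    and \<nu>_infty: "emeasure \<nu> {\<infinity>} = 0"
    and a_vague: "vague_conv
      (\<lambda>d. scale_measure (of_nat (n d))
        (distr (M d) borel (\<lambda>\<omega>. ennreal ((norm (X d \<omega>))\<^sup>2 / a (n d))))) \<nu>"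
    and a_trunc: "((\<lambda>s. limsup (\<lambda>d. ereal (real (n d) / a (n d) *
        (LINT \<omega>|M d. (norm (X d \<omega>))\<^sup>2 * indicator {\<omega>. (norm (X d \<omega>))\<^sup>2 \<le> s * a (n d)} \<omega>))))
      \<longlongrightarrow> 0) (at_right 0)"
    and b_angles: "\<And>s \<epsilon>. 0 < s \<Longrightarrow> 0 < \<epsilon> \<Longrightarrow>
      (\<lambda>d. cond_prob (M d)
        (\<lambda>\<omega>. \<epsilon> < \<bar>inner (Xs d 1 \<omega> /\<^sub>R norm (Xs d 1 \<omega>)) (Xs d 2 \<omega> /\<^sub>R norm (Xs d 2 \<omega>))\<bar>)
        (\<lambda>\<omega>. s * a (n d) \<le> (norm (Xs d 1 \<omega>))\<^sup>2 \<and> s * a (n d) \<le> (norm (Xs d 2 \<omega>))\<^sup>2))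
      \<longlonglongrightarrow> 0"
    and c_mean: "((\<lambda>s. limsup (\<lambda>d. ereal (real (n d) / sqrt (a (n d)) *
        norm (LINT \<omega>|M d. indicator {\<omega>. (norm (X d \<omega>))\<^sup>2 \<le> s * a (n d)} \<omega> *\<^sub>R X d \<omega>))))
      \<longlongrightarrow> 0) (at_right 0)"
    and T_pos: "0 < T"
    and P_prob: "prob_space P"
    and atoms: "poisson_atoms P \<nu> x y"
  shows "(\<forall>d\<ge>1. (\<lambda>\<omega>. shape_of (walk_set (\<lambda>i. Xs d i \<omega>) (a (n d)) (nat \<lfloor>real (n d) * T\<rfloor>)))
            \<in> borel_measurable (M d)) \<and>
    (\<lambda>\<omega>. shape_of (crinkled_range (\<lambda>k. x k \<omega>) (\<lambda>k. y k \<omega>) T)) \<in> borel_measurable P \<and>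
    weak_conv_measure
      (\<lambda>d. distr (M d) borel
        (\<lambda>\<omega>. shape_of (walk_set (\<lambda>i. Xs d i \<omega>) (a (n d)) (nat \<lfloor>real (n d) * T\<rfloor>))))
      (distr P borel (\<lambda>\<omega>. shape_of (crinkled_range (\<lambda>k. x k \<omega>) (\<lambda>k. y k \<omega>) T)))"
proof -
  have lm: "levy_measure \<nu>" by (rule levy_measure.intro[OF \<nu>_sets \<nu>_levy \<nu>_infty])
  interpret walk_limit \<nu> M X Xs n a T
    by (intro walk_limit.intro walk_limit_axioms.intro lm) (fact prob X_measurable Xs_indep Xs_distr n_pos n_lim a_pos a_vague a_trunc b_angles c_mean T_pos)+
  have atoms': "crinkled_atoms \<nu> P x y"
    by (intro crinkled_atoms.intro crinkled_atoms_axioms.intro lm P_prob atoms)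
  interpret A: crinkled_atoms \<nu> P x y by (rule atoms')
  have walk: "(\<lambda>\<omega>. shape_of (walk_set (\<lambda>i. Xs d i \<omega>) (a (n d)) (nat \<lfloor>real (n d) * T\<rfloor>))) \<in> borel_measurable (M d)"
    if "1 \<le> d" for d
    by (rule measurable_walk_set[OF Xs_measurable[OF that]])
  have range: "(\<lambda>\<omega>. shape_of (crinkled_range (\<lambda>k. x k \<omega>) (\<lambda>k. y k \<omega>) T)) \<in> borel_measurable P"
    by (rule measurable_crinkled_range[OF A.x_measurable A.x_nonneg A.y_measurable less_imp_le[OF T_pos]])
  show ?thesis
    using walk range weak_conv_of_cell_approx[OF prob P_prob walk range approximation[OF atoms', unfolded steps_def]]
    by blast
qed

end
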